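(* Let $\varphi=(\varphi_1,\varphi_2,\varphi_3,\varphi_4)\in L^2(\partial D'_\beta)$. Then $\varphi\in H^2(\partial D'_\beta)$ if and only if there exists a sequence of functions $\{\widehat{g_j}\}_{j\in\mathbb Z}$ on $\mathbb R$ (frequency-side functions, written $g_j$ below) such that $$\sum_{j\in\mathbb Z}\int_{\mathbb R}|g_j(\xi)|^2\cosh[\pi\xi]\cosh\big[(2\beta-\pi)(\xi-\tfrac j2)\big]\,d\xi<\infty$$ and \begin{align*} \varphi_1(x+i\beta,e^{\frac12(\beta-\frac\pi2)}e^{2\pi i\gamma})&=\sum_{j\in\mathbb Z}\varphi_{1,j}(x)\,e^{\frac j2(\beta-\frac\pi2)}e^{2\pi ij\gamma},\\ \varphi_2(x+i(\beta-\pi),e^{\frac12(\beta-\frac\pi2)}e^{2\pi i\gamma})&=\sum_{j\in\mathbb Z}\varphi_{2,j}(x)\,e^{\frac j2(\beta-\frac\pi2)}e^{2\pi ij\gamma},\\ \varphi_3(x-i\beta,e^{-\frac12(\beta-\frac\pi2)}e^{2\pi i\gamma})&=\sum_{j\in\mathbb Z}\varphi_{3,j}(x)\,e^{-\frac j2(\beta-\frac\pi2)}e^{2\pi ij\gamma},\\ \varphi_4(x-i(\beta-\pi),e^{-\frac12(\beta-\frac\pi2)}e^{2\pi i\gamma})&=\sum_{j\in\mathbb Z}\varphi_{4,j}(x)\,e^{-\frac j2(\beta-\frac\pi2)}e^{2\pi ij\gamma}, \end{align*} where, for every $j\in\mathbb Z$, $$\varphi_{1,j}=\mathcal F^{-1}_{\mathbb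 R}[e^{-\beta(\cdot)}g_j],\quad \varphi_{2,j}=\mathcal F^{-1}_{\mathbb R}[e^{-(\beta-\pi)(\cdot)}g_j],\quad \varphi_{3,j}=\mathcal F^{-1}_{\mathbb R}[e^{\beta(\cdot)}g_j],\quad \varphi_{4,j}=\mathcal F^{-1}_{\mathbb R}[e^{(\beta-\pi)(\cdot)}g_j].$$ Moreover, in this case, for $(u+iv,re^{2\pi i\gamma})\in D'_\beta$, $$S\varphi(u+iv,re^{2\pi i\gamma})=\sum_{j\in\mathbb Z}r^je^{2\pi ij\gamma}\,\mathcal F^{-1}_{\mathbb R}[e^{-v(\cdot)}g_j](u).$$
   Context: Fix $\beta>\frac{\pi}{2}$, and let $\mathbb T=\mathbb R/\mathbb Z$. Let $$D'_\beta=\{(z_1,z_2)\in\mathbb C^2: |\operatorname{Im}z_1-\log|z_2|^2|<\tfrac{\pi}{2},\ |\log|z_2|^2|<\beta-\tfrac{\pi}{2}\}.$$ Put $(\eta_1,\eta_2,\eta_3,\eta_4)=(\beta,\beta-\pi,-\beta,-(\beta-\pi))$ and $(\sigma_1,\sigma_2,\sigma_3,\sigma_4)=(1,1,-1,-1)$. The distinguished boundary is $\partial D'_\beta=\bigcup_{\ell=1}^4E_\ell$, $E_\ell=\{(x+i\eta_\ell,e^{\frac{\sigma_\ell}2(\beta-\frac\pi2)}e^{2\pi i\theta}):x\in\mathbb R,\theta\in\mathbb T\}$, each $E_\ell$ being identified with $\mathbb R\times\mathbb T$ with measure $dx\,d\theta$. A function on $\partial D'_\beta$ is a vector $\varphi=(\varphi_1,\dots,\varphi_4)$,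 $\varphi_\ell$ defined on $E_\ell$, and $\|\varphi\|^2_{L^2(\partial D'_\beta)}=\sum_\ell\|\varphi_\ell\|^2_{L^2(\mathbb R\times\mathbb T)}$. Equalities of boundary functions are in $L^2$ (series converging in $L^2(\mathbb R\times\mathbb T)$). For $F$ holomorphic on $D'_\beta$ and $(t,s)\in[0,\frac\pi2)\times[0,\beta-\frac\pi2)$, put $F_{t,s}=(F_{1,t,s},\dots,F_{4,t,s})$ with $F_{1,t,s}(x,\theta)=F(x+i(s+t),e^{s/2}e^{2\pi i\theta})$, $F_{2,t,s}(x,\theta)=F(x+i(s-t),e^{s/2}e^{2\pi i\theta})$, $F_{3,t,s}(x,\theta)=F(x-i(s+t),e^{-s/2}e^{2\pi i\theta})$, $F_{4,t,s}(x,\theta)=F(x-i(s-t),e^{-s/2}e^{2\pi i\theta})$. $H^2(D'_\beta)$ is the space of holomorphic $F$ with $\sup_{(t,s)}\|F_{t,s}\|^2_{L^2(\partial D'_\beta)}<\infty$. The boundary value $\widetilde F$ of $F\in H^2(D'_\beta)$ is the $L^2(\partial D'_\beta)$ limit of $F_{t,s}$ as $(t,s)\to(\frac\pi2,\beta-\frac\pi2)$, and $H^2(\partial D'_\beta)=\{\widetilde F:F\in H^2(D'_\beta)\}$. $\mathcal F_{\mathbb R}h(\xi)=\int_{\mathbb R}h(x)e^{-ix\xi}dx$ and $\mathcal F_{\mathbb R}^{-1}g(x)=\frac1{2\pi}\int_{\mathbb R}g(\xi)e^{ix\xi}d\xi$. The operator $S$ is $S\varphi(z)=\langle\varphi,K_{D'_\beta}[\cdot,z]\rangle_{L^2(\partial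 D'_\beta)}$ for $z\in D'_\beta$, where $$K_{D'_\beta}[(w_1,w_2),(z_1,z_2)]=\sum_{j\in\mathbb Z}\frac{w_2^j\,\overline{z_2}^{\,j}}{8\pi}\int_{\mathbb R}\frac{e^{i(w_1-\overline{z_1})\xi}}{\cosh[\pi\xi]\cosh[(2\beta-\pi)(\xi-\frac j2)]}\,d\xi .$$ *)

theory Defs
  imports "HOL-Analysis.Analysis"
begin

text \<open>The condition \<open>z\<^sub>2 \<noteq> 0\<close> is implicit on paper, where \<open>log \<bar>z\<^sub>2\<bar>\<^sup>2\<close> has to be finite; it is
  needed here because \<open>ln 0 = 0\<close>.\<close>

definition D' :: "real \<Rightarrow> (complex \<times> complex) set" where
  "D' \<beta> = {(z1, z2). z2 \<noteq> 0 \<and> \<bar>Im z1 - ln ((cmod z2)\<^sup>2)\<bar> < pi / 2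
                     \<and> \<bar>ln ((cmod z2)\<^sup>2)\<bar> < \<beta> - pi / 2}"

text \<open>Holomorphy in two variables: complex differentiability at each point of an open set, i.e. the
  Frechet derivative exists and is complex linear.\<close>

definition holomorphic2_on :: "(complex \<times> complex \<Rightarrow> complex) \<Rightarrow> (complex \<times> complex) set \<Rightarrow> bool" where
  "holomorphic2_on F D \<longleftrightarrow>
     (\<forall>z\<in>D. \<exists>a b. (F has_derivative (\<lambda>(h1, h2). a * h1 + b * h2)) (at z))"

definition L2_norm_sq :: "'a measure \<Rightarrow> ('a \<Rightarrow> complex) \<Rightarrow> ennreal" where
  "L2_norm_sq M f = (\<integral>\<^sup>+ x. ennreal ((cmod (f x))\<^sup>2) \<partial>M)"

definition L2 :: "'a measure \<Rightarrow> ('a \<Rightarrow> complex) set" where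
  "L2 M = {f \<in> borel_measurable M. L2_norm_sq M f < \<infinity>}"

text \<open>\<open>\<real> \<times> \<real>/\<int>\<close> with \<open>dx d\<theta>\<close>, the circle being represented by the fundamental domain \<open>[0,1)\<close>.\<close>

definition RT :: "(real \<times> real) measure" where
  "RT = lborel \<Otimes>\<^sub>M restrict_space lborel {0..<1}"

text \<open>A boundary function is a family \<open>\<phi> \<ell>\<close> of functions of the coordinates \<open>(x, \<theta>)\<close> of \<open>E\<^sub>\<ell>\<close>; only
  the indices \<open>\<ell> \<in> {1..4}\<close> are meaningful. Boundary functions are not quotiented by a.e. equality:
  all notions below are invariant under it.\<close>

type_synonym bdry_fun = "nat \<Rightarrow> real \<times> real \<Rightarrow> complex"

definition eta :: "real \<Rightarrow> nat \<Rightarrow> real" where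
  "eta \<beta> l = (if l = 1 then \<beta> else if l = 2 then \<beta> - pi else if l = 3 then - \<beta> else - (\<beta> - pi))"

definition sigma :: "nat \<Rightarrow> real" where
  "sigma l = (if l = 1 \<or> l = 2 then 1 else - 1)"

definition bdry_point :: "real \<Rightarrow> nat \<Rightarrow> real \<times> real \<Rightarrow> complex \<times> complex" where
  "bdry_point \<beta> l = (\<lambda>(x, \<theta>).
     (Complex x (eta \<beta> l), complex_of_real (exp (sigma l / 2 * (\<beta> - pi / 2))) * cis (2 * pi * \<theta>)))"

definition bdry_norm_sq :: "bdry_fun \<Rightarrow> ennreal" where
  "bdry_norm_sq \<phi> = (\<Sum>l = 1..4. L2_norm_sq RT (\<phi> l))"

definition L2_bdry :: "bdry_fun set" where
  "L2_bdry = {\<phi>. \<forall>l\<in>{1..4}. \<phi> l \<in> L2 RT}"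

text \<open>\<open>slice F t s l\<close> is \<open>F\<^bsub>l,t,s\<^esub>\<close>.\<close>

definition slice :: "(complex \<times> complex \<Rightarrow> complex) \<Rightarrow> real \<Rightarrow> real \<Rightarrow> bdry_fun" where
  "slice F t s l = (\<lambda>(x, \<theta>).
     if l = 1 then F (Complex x (s + t), complex_of_real (exp (s / 2)) * cis (2 * pi * \<theta>))
     else if l = 2 then F (Complex x (s - t), complex_of_real (exp (s / 2)) * cis (2 * pi * \<theta>))
     else if l = 3 then F (Complex x (- (s + t)), complex_of_real (exp (- s / 2)) * cis (2 * pi * \<theta>))
     else F (Complex x (- (s - t)), complex_of_real (exp (- s / 2)) * cis (2 * pi * \<theta>)))"

definition H2 :: "real \<Rightarrow> (complex \<times> complex \<Rightarrow> complex) set" where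
  "H2 \<beta> = {F. holomorphic2_on F (D' \<beta>) \<and>
     (SUP (t, s) \<in> {0..<pi / 2} \<times> {0..<\<beta> - pi / 2}. bdry_norm_sq (slice F t s)) < \<infinity>}"

definition is_bdry_value :: "real \<Rightarrow> (complex \<times> complex \<Rightarrow> complex) \<Rightarrow> bdry_fun \<Rightarrow> bool" where
  "is_bdry_value \<beta> F \<psi> \<longleftrightarrow> \<psi> \<in> L2_bdry \<and>
     ((\<lambda>(t, s). bdry_norm_sq (\<lambda>l p. slice F t s l p - \<psi> l p)) \<longlongrightarrow> 0)
       (at (pi / 2, \<beta> - pi / 2) within {0..<pi / 2} \<times> {0..<\<beta> - pi / 2})"

definition H2_bdry :: "real \<Rightarrow> bdry_fun set" where
  "H2_bdry \<beta> = {\<psi>. \<exists>F\<in>H2 \<beta>. is_bdry_value \<beta> F \<psi>}"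

definition inv_fourier :: "(real \<Rightarrow> complex) \<Rightarrow> real \<Rightarrow> complex" where
  "inv_fourier f x = 1 / (2 * complex_of_real pi) * (LBINT \<xi>. f \<xi> * cis (x * \<xi>))"

text \<open>The inverse Fourier transform on \<open>L\<^sup>2(\<real>)\<close>. The functions
  \<open>exp (- eta \<beta> l * \<xi>) * g j \<xi>\<close> below lie in \<open>L\<^sup>2\<close> but in general not in \<open>L\<^sup>1\<close>, so the transform is
  the usual (Plancherel) limit in the mean of the truncated integrals.\<close>

definition is_inv_fourier_L2 :: "(real \<Rightarrow> complex) \<Rightarrow> (real \<Rightarrow> complex) \<Rightarrow> bool" where
  "is_inv_fourier_L2 f h \<longleftrightarrow> f \<in> L2 lborel \<and> h \<in> L2 lborel \<and>
     ((\<lambda>R. L2_norm_sq lborel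
         (\<lambda>x. inv_fourier (\<lambda>\<xi>. indicator {- R..R} \<xi> * f \<xi>) x - h x)) \<longlongrightarrow> 0) at_top"

definition finite_energy :: "real \<Rightarrow> (int \<Rightarrow> real \<Rightarrow> complex) \<Rightarrow> bool" where
  "finite_energy \<beta> g \<longleftrightarrow> (\<forall>j. g j \<in> borel_measurable borel) \<and>
     (\<Sum>\<^sub>\<infinity>j. \<integral>\<^sup>+ \<xi>. ennreal ((cmod (g j \<xi>))\<^sup>2 * cosh (pi * \<xi>)
        * cosh ((2 * \<beta> - pi) * (\<xi> - of_int j / 2))) \<partial>lborel) < \<infinity>"

text \<open>\<open>bdry_series \<beta> g \<phi>\<close>: for each \<open>\<ell>\<close>, \<open>\<phi>\<^sub>\<ell>\<close> is the \<open>L\<^sup>2\<close>-sum (over the directed set of finite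
  \<open>J \<subseteq> \<int>\<close>) of the modes \<open>\<phi>\<^bsub>\<ell>,j\<^esub>(x) exp (\<sigma>\<^sub>\<ell> j/2 (\<beta> - \<pi>/2)) exp (2\<pi>ij\<gamma>)\<close>, where \<open>\<phi>\<^bsub>\<ell>,j\<^esub>\<close>
  is the inverse Fourier transform of \<open>exp (- \<eta>\<^sub>\<ell> \<xi>) g\<^sub>j(\<xi>)\<close>.\<close>

definition bdry_series :: "real \<Rightarrow> (int \<Rightarrow> real \<Rightarrow> complex) \<Rightarrow> bdry_fun \<Rightarrow> bool" where
  "bdry_series \<beta> g \<phi> \<longleftrightarrow> (\<exists>\<phi>j :: nat \<Rightarrow> int \<Rightarrow> real \<Rightarrow> complex. \<forall>l\<in>{1..4}.
     (\<forall>j. is_inv_fourier_L2 (\<lambda>\<xi>. complex_of_real (exp (- eta \<beta> l * \<xi>)) * g j \<xi>) (\<phi>j l j)) \<and>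
     ((\<lambda>J. L2_norm_sq RT (\<lambda>(x, \<gamma>). \<phi> l (x, \<gamma>) - (\<Sum>j\<in>J. \<phi>j l j x
          * complex_of_real (exp (sigma l * of_int j / 2 * (\<beta> - pi / 2)))
          * cis (2 * pi * of_int j * \<gamma>)))) \<longlongrightarrow> 0) (finite_subsets_at_top UNIV))"

definition K :: "real \<Rightarrow> complex \<times> complex \<Rightarrow> complex \<times> complex \<Rightarrow> complex" where
  "K \<beta> = (\<lambda>(w1, w2) (z1, z2). \<Sum>\<^sub>\<infinity>j::int.
     w2 powi j * cnj z2 powi j / (8 * complex_of_real pi) *
     (LBINT \<xi>. exp (\<i> * (w1 - cnj z1) * complex_of_real \<xi>)
        / complex_of_real (cosh (pi * \<xi>) * cosh ((2 * \<beta> - pi) * (\<xi> - of_int j / 2)))))"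

definition S :: "real \<Rightarrow> bdry_fun \<Rightarrow> complex \<times> complex \<Rightarrow> complex" where
  "S \<beta> \<phi> z = (\<Sum>l = 1..4. \<integral>p. \<phi> l p * cnj (K \<beta> (bdry_point \<beta> l p) z) \<partial>RT)"

end

theory Submission
  imports Defs "HOL-Probability.Probability" "HOL-Complex_Analysis.Complex_Analysis"
begin

text \<open>The condition on \<open>(z\<^sub>1, z\<^sub>2)\<close> that defines the domain concerns only \<open>(y, s) = (Im z\<^sub>1, log \<bar>z\<^sub>2\<bar>\<^sup>2)\<close>. So a
  holomorphic \<open>F\<close> can be analysed by Fourier series in the argument of \<open>z\<^sub>2\<close> and by Fourier transform in
  \<open>Re z\<^sub>1\<close>. The \<open>j\<close>-th Laurent coefficient \<open>F\<^sub>j(z\<^sub>1)\<close> in \<open>z\<^sub>2\<close> may be computed on any circle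
  \<open>\<bar>z\<^sub>2\<bar> = e\<^bsup>s/2\<^esup>\<close> that is admissible for \<open>z\<^sub>1\<close> and does not depend on it (\<open>coefficient_independent\<close>);
  therefore it is a holomorphic function on the whole strip \<open>\<bar>Im z\<^sub>1\<bar> < \<beta>\<close>, although no single circle is
  admissible for all of it. For \<open>F\<close> in the Hardy space, Bessel's inequality bounds \<open>F\<^sub>j\<close> in \<open>L\<^sup>2\<close> on the
  horizontal lines, and the Paley-Wiener theorem (\<open>paley_wiener_strip\<close>) provides \<open>g\<^sub>j\<close> such that
  \<open>F\<^sub>j(\<sqdot> + iy)\<close> is the inverse Fourier transform of \<open>e\<^bsup>-y\<xi>\<^esup> g\<^sub>j(\<xi>)\<close>. This relation between \<open>F\<close> and
  \<open>g\<close> is the predicate \<open>spectral\<close>; it is established in \<open>hardy_spectral\<close>.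

  For such a pair, Parseval's and Plancherel's theorems turn the squared norm of \<open>F\<close> on the set with parameters
  \<open>(y, s)\<close>, which is a copy of \<open>\<real> \<times> \<T>\<close>, into \<open>1/2\<pi>\<close> times the sum over \<open>j\<close> of the integrals of
  \<open>\<bar>g\<^sub>j(\<xi>)\<bar>\<^sup>2 e\<^bsup>sj-2y\<xi>\<^esup>\<close>. The four components of the distinguished boundary are the corners of the
  parallelogram of all \<open>(y, s)\<close>, and there the four weights add up to
  \<open>4 cosh(\<pi>\<xi>) cosh((2\<beta> - \<pi>)(\<xi> - j/2))\<close> (\<open>energy_weight_sum\<close>). Hence a bound for the slices gives a bound
  for the energy, by Fatou's lemma (\<open>spectral_finite_energy\<close>). Conversely each weight in the
  parallelogram is at most \<open>4\<close> times that product of hyperbolic cosines (\<open>mode_weight_le\<close>). So finite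
  energy bounds all slices (\<open>spectral_norm_bounded\<close>), and it bounds the tails of their expansions uniformly, which
  identifies boundary values with sums of the boundary series (\<open>is_bdry_value_iff_bdry_series\<close>).

  Given \<open>g\<close> of finite energy, \<open>F\<close> is recovered as an absolutely convergent sum of integrals (\<open>synthesis\<close>), because at
  an interior point of the parallelogram the weight is exponentially smaller than the bound
  (\<open>weight_margin\<close>).

  The kernel restricted to a boundary component is a series of the same kind. By Plancherel and the
  orthogonality of the angular modes, pairing it with \<open>\<phi>\<close> gives a sum over \<open>j\<close> of frequency
  integrals, in which the four boundary weights once more add up, this time to cancel the denominator of the
  kernel (\<open>S_has_sum\<close>).\<close>

section \<open>Square integrable functions\<close>

lemma L2_measurable [measurable_dest]: "f \<in> L2 M \<Longrightarrow> f \<in> borel_measurable M"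
  by (simp add: L2_def)

lemma borel_measurable_cnj [measurable (raw)]:
  "f \<in> borel_measurable M \<Longrightarrow> (\<lambda>x. cnj (f x)) \<in> borel_measurable M"
  by (rule measurable_compose[of f M borel cnj]) (auto intro!: borel_measurable_continuous_onI continuous_intros)

lemma L2_finite: "f \<in> L2 M \<Longrightarrow> L2_norm_sq M f < \<infinity>"
  by (simp add: L2_def)

lemma L2_norm_sq_cong: "(\<And>x. x \<in> space M \<Longrightarrow> cmod (f x) = cmod (g x)) \<Longrightarrow> L2_norm_sq M f = L2_norm_sq M g"
  unfolding L2_norm_sq_def by (intro nn_integral_cong) simp

lemma L2_norm_sq_cong_AE: "AE x in M. cmod (f x) = cmod (g x) \<Longrightarrow> L2_norm_sq M f = L2_norm_sq M g"
  unfolding L2_norm_sq_def by (intro nn_integral_cong_AE) auto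

lemma L2_norm_sq_mono: "(\<And>x. x \<in> space M \<Longrightarrow> cmod (f x) \<le> cmod (g x)) \<Longrightarrow> L2_norm_sq M f \<le> L2_norm_sq M g"
  unfolding L2_norm_sq_def by (intro nn_integral_mono) (simp add: power_mono)

lemma L2_norm_sq_diff_commute: "L2_norm_sq M (\<lambda>x. f x - g x) = L2_norm_sq M (\<lambda>x. g x - f x)"
  by (intro L2_norm_sq_cong norm_minus_commute)

lemma L2_norm_sq_cmult:
  assumes [measurable]: "f \<in> borel_measurable M"
  shows "L2_norm_sq M (\<lambda>x. c * f x) = ennreal ((cmod c)\<^sup>2) * L2_norm_sq M f"
  unfolding L2_norm_sq_def
  by (simp add: norm_mult power_mult_distrib ennreal_mult nn_integral_cmult)

lemma cmod_add_sq_le: "(cmod (a + b))\<^sup>2 \<le> 2 * (cmod a)\<^sup>2 + 2 * (cmod b)\<^sup>2"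
proof -
  have "(cmod (a+b))\<^sup>2 \<le> (cmod a + cmod b)\<^sup>2" by (intro power_mono norm_triangle_ineq) auto
  also have "\<dots> \<le> 2 * (cmod a)\<^sup>2 + 2 * (cmod b)\<^sup>2"
    using sum_squares_bound[of "cmod a" "cmod b"] by (simp add: power2_sum)
  finally show ?thesis .
qed

text \<open>The norm enters all limit arguments through its square, so the triangle inequality is used in
  this form; the loss of a factor is harmless there.\<close>

lemma L2_norm_sq_add_le:
  assumes [measurable]: "f \<in> borel_measurable M" "g \<in> borel_measurable M"
  shows "L2_norm_sq M (\<lambda>x. f x + g x) \<le> 2 * L2_norm_sq M f + 2 * L2_norm_sq M g"
proof -
  have "L2_norm_sq M (\<lambda>x. f x + g x) \<le> (\<integral>\<^sup>+x. 2 * ennreal ((cmod (f x))\<^sup>2) + 2 * ennreal ((cmod (g x))\<^sup>2) \<partial>M)"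
    unfolding L2_norm_sq_def
  proof (intro nn_integral_mono)
    fix x
    have "ennreal ((cmod (f x + g x))\<^sup>2) \<le> ennreal (2 * (cmod (f x))\<^sup>2 + 2 * (cmod (g x))\<^sup>2)"
      by (intro ennreal_leI cmod_add_sq_le)
    then show "ennreal ((cmod (f x + g x))\<^sup>2) \<le> 2 * ennreal ((cmod (f x))\<^sup>2) + 2 * ennreal ((cmod (g x))\<^sup>2)"
      by (simp add: ennreal_mult)
  qed
  also have "\<dots> = 2 * L2_norm_sq M f + 2 * L2_norm_sq M g"
    unfolding L2_norm_sq_def by (simp add: nn_integral_add nn_integral_cmult)
  finally show ?thesis .
qed

lemma L2_norm_sq_diff_triangle:
  assumes [measurable]: "f \<in> borel_measurable M" "g \<in> borel_measurable M" "h \<in> borel_measurable M"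
  shows "L2_norm_sq M (\<lambda>x. f x - h x) \<le> 2 * L2_norm_sq M (\<lambda>x. f x - g x) + 2 * L2_norm_sq M (\<lambda>x. g x - h x)"
  using L2_norm_sq_add_le[of "\<lambda>x. f x - g x" M "\<lambda>x. g x - h x"] by simp

lemma L2_add: "f \<in> L2 M \<Longrightarrow> g \<in> L2 M \<Longrightarrow> (\<lambda>x. f x + g x) \<in> L2 M"
  using L2_norm_sq_add_le[of f M g]
  by (auto simp: L2_def ennreal_mult_less_top intro: order.strict_trans1)

lemma L2_cmult: "f \<in> L2 M \<Longrightarrow> (\<lambda>x. c * f x) \<in> L2 M"
  by (auto simp: L2_def L2_norm_sq_cmult ennreal_mult_less_top)

lemma L2_diff: "f \<in> L2 M \<Longrightarrow> g \<in> L2 M \<Longrightarrow> (\<lambda>x. f x - g x) \<in> L2 M"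
  using L2_add[of f M "\<lambda>x. (-1) * g x"] L2_cmult[of g M "-1"] by simp

lemma L2_mono:
  assumes "g \<in> L2 M" "f \<in> borel_measurable M" "\<And>x. x \<in> space M \<Longrightarrow> cmod (f x) \<le> cmod (g x)"
  shows "f \<in> L2 M"
  using assms L2_norm_sq_mono[of M f g] by (auto simp: L2_def intro: order.strict_trans1)

lemma L2_sum: "finite J \<Longrightarrow> (\<And>j. j \<in> J \<Longrightarrow> f j \<in> L2 M) \<Longrightarrow> (\<lambda>x. \<Sum>j\<in>J. f j x) \<in> L2 M"
proof (induction J rule: finite_induct)
  case empty
  then show ?case by (simp add: L2_def L2_norm_sq_def)
next
  case (insert j J)
  then show ?case using L2_add[of "f j" M "\<lambda>x. \<Sum>j\<in>J. f j x"] by simp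
qed

lemma ennreal_tendsto_0_I:
  fixes f g :: "'a \<Rightarrow> ennreal"
  assumes "(g \<longlongrightarrow> 0) F" "\<forall>\<^sub>F x in F. f x \<le> g x"
  shows "(f \<longlongrightarrow> 0) F"
  by (rule tendsto_sandwich[OF _ assms(2) tendsto_const assms(1)]) simp

lemma ennreal_tendsto_0_mult:
  fixes f :: "'a \<Rightarrow> ennreal"
  assumes "(f \<longlongrightarrow> 0) F" "c < \<infinity>"
  shows "((\<lambda>x. c * f x) \<longlongrightarrow> 0) F"
  using ennreal_tendsto_cmult[of c f 0 F] assms by simp

lemma ennreal_tendsto_0_add:
  fixes f g :: "'a \<Rightarrow> ennreal"
  assumes "(f \<longlongrightarrow> 0) F" "(g \<longlongrightarrow> 0) F"
  shows "((\<lambda>x. f x + g x) \<longlongrightarrow> 0) F"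
  using tendsto_add[OF assms] by simp

text \<open>The factor \<open>2\<close> comes from \<open>L2_norm_sq_add_le\<close>. It is harmless where only the finiteness or the
  vanishing of the norm of the limit matters.\<close>

lemma L2_norm_sq_limit_le:
  assumes "((\<lambda>n. L2_norm_sq M (\<lambda>x. f n x - h x)) \<longlongrightarrow> 0) F" "F \<noteq> bot"
    "\<And>n. f n \<in> borel_measurable M" "h \<in> borel_measurable M" "\<forall>\<^sub>F n in F. L2_norm_sq M (f n) \<le> C"
  shows "L2_norm_sq M h \<le> 2 * C"
proof (rule tendsto_lowerbound[OF _ _ assms(2)])
  show "((\<lambda>n. 2 * L2_norm_sq M (\<lambda>x. f n x - h x) + 2 * C) \<longlongrightarrow> 2 * C) F"
    using tendsto_add[OF ennreal_tendsto_0_mult[OF assms(1), of 2] tendsto_const[of "2 * C"]] by simp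
  show "\<forall>\<^sub>F n in F. L2_norm_sq M h \<le> 2 * L2_norm_sq M (\<lambda>x. f n x - h x) + 2 * C"
    using assms(5)
  proof eventually_elim
    case (elim n)
    have "L2_norm_sq M h \<le> 2 * L2_norm_sq M (\<lambda>x. h x - f n x) + 2 * L2_norm_sq M (f n)"
      using L2_norm_sq_add_le[of "\<lambda>x. h x - f n x" M "f n"] assms(3,4) by simp
    also have "\<dots> \<le> 2 * L2_norm_sq M (\<lambda>x. f n x - h x) + 2 * C"
      using elim by (simp add: L2_norm_sq_diff_commute add_mono mult_left_mono)
    finally show ?case .
  qed
qed

lemma L2_dominated_tendsto_0:
  fixes w :: "'a \<Rightarrow> real"
  assumes [measurable]: "\<And>n. d n \<in> borel_measurable M" "w \<in> borel_measurable M"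
    and "\<And>n. AE x in M. cmod (d n x) \<le> w x" "(\<integral>\<^sup>+x. ennreal ((w x)\<^sup>2) \<partial>M) < \<infinity>"
    and "AE x in M. (\<lambda>n. d n x) \<longlonglongrightarrow> 0"
  shows "(\<lambda>n. L2_norm_sq M (d n)) \<longlonglongrightarrow> 0"
proof -
  have "(\<lambda>n. \<integral>\<^sup>+x. ennreal ((cmod (d n x))\<^sup>2) \<partial>M) \<longlonglongrightarrow> (\<integral>\<^sup>+x. 0 \<partial>M)"
  proof (rule nn_integral_dominated_convergence[where w = "\<lambda>x. ennreal ((w x)\<^sup>2)"])
    fix n show "AE x in M. ennreal ((cmod (d n x))\<^sup>2) \<le> ennreal ((w x)\<^sup>2)"
      using assms(3)[of n] by eventually_elim (auto intro!: ennreal_leI power_mono)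
  next
    show "AE x in M. (\<lambda>n. ennreal ((cmod (d n x))\<^sup>2)) \<longlonglongrightarrow> 0"
      using assms(5)
    proof eventually_elim
      case (elim x)
      then have "(\<lambda>n. (cmod (d n x))\<^sup>2) \<longlonglongrightarrow> 0" using tendsto_power[OF tendsto_norm_zero[OF elim], of 2] by simp
      then show ?case using tendsto_ennrealI by fastforce
    qed
  qed (use assms in auto)
  then show ?thesis by (simp add: L2_norm_sq_def)
qed

lemma L2_Cauchy_Schwarz:
  assumes f: "f \<in> L2 M" and g: "g \<in> L2 M"
  shows "integrable M (\<lambda>x. f x * cnj (g x))"
    and "(\<integral>\<^sup>+x. ennreal (cmod (f x * cnj (g x))) \<partial>M)\<^sup>2 \<le> L2_norm_sq M f * L2_norm_sq M g"
    and "ennreal ((cmod (\<integral>x. f x * cnj (g x) \<partial>M))\<^sup>2) \<le> L2_norm_sq M f * L2_norm_sq M g"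
proof -
  note [measurable] = L2_measurable[OF f] L2_measurable[OF g]
  show *: "(\<integral>\<^sup>+x. ennreal (cmod (f x * cnj (g x))) \<partial>M)\<^sup>2 \<le> L2_norm_sq M f * L2_norm_sq M g"
    using Cauchy_Schwarz_nn_integral[of "\<lambda>x. ennreal (cmod (f x))" M "\<lambda>x. ennreal (cmod (g x))"]
    by (simp add: L2_norm_sq_def norm_mult ennreal_mult ennreal_power)
  also have "\<dots> < \<infinity>" using L2_finite[OF f] L2_finite[OF g] by (simp add: ennreal_mult_less_top)
  finally have "(\<integral>\<^sup>+x. ennreal (cmod (f x * cnj (g x))) \<partial>M) < \<infinity>"
    by (auto simp: less_top[symmetric] power2_eq_square ennreal_mult_eq_top_iff)
  then show i: "integrable M (\<lambda>x. f x * cnj (g x))" by (intro integrableI_bounded) auto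
  have "ennreal (cmod (\<integral>x. f x * cnj (g x) \<partial>M)) \<le> (\<integral>\<^sup>+x. ennreal (cmod (f x * cnj (g x))) \<partial>M)"
    by (rule integral_norm_bound_ennreal[OF i])
  then have "(ennreal (cmod (\<integral>x. f x * cnj (g x) \<partial>M)))\<^sup>2 \<le> (\<integral>\<^sup>+x. ennreal (cmod (f x * cnj (g x))) \<partial>M)\<^sup>2"
    by (rule power_mono) simp
  then show "ennreal ((cmod (\<integral>x. f x * cnj (g x) \<partial>M))\<^sup>2) \<le> L2_norm_sq M f * L2_norm_sq M g"
    using * by (simp add: ennreal_power)
qed

text \<open>The inner product is continuous, by the Cauchy-Schwarz inequality.\<close>

lemma L2_inner_tendsto:
  assumes "((\<lambda>n. L2_norm_sq M (\<lambda>x. f n x - h x)) \<longlongrightarrow> 0) F"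
    "\<And>n. f n \<in> L2 M" "h \<in> L2 M" "g \<in> L2 M"
  shows "((\<lambda>n. \<integral>x. f n x * cnj (g x) \<partial>M) \<longlongrightarrow> (\<integral>x. h x * cnj (g x) \<partial>M)) F"
proof -
  have "((\<lambda>n. ennreal ((cmod ((\<integral>x. f n x * cnj (g x) \<partial>M) - (\<integral>x. h x * cnj (g x) \<partial>M)))\<^sup>2)) \<longlongrightarrow> 0) F"
  proof (rule ennreal_tendsto_0_I)
    show "((\<lambda>n. L2_norm_sq M g * L2_norm_sq M (\<lambda>x. f n x - h x)) \<longlongrightarrow> 0) F"
      by (intro ennreal_tendsto_0_mult assms L2_finite)
    have "ennreal ((cmod ((\<integral>x. f n x * cnj (g x) \<partial>M) - (\<integral>x. h x * cnj (g x) \<partial>M)))\<^sup>2)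
        \<le> L2_norm_sq M g * L2_norm_sq M (\<lambda>x. f n x - h x)" for n
      using L2_Cauchy_Schwarz(3)[OF L2_diff[OF assms(2)[of n] assms(3)] assms(4)]
        L2_Cauchy_Schwarz(1)[OF assms(2)[of n] assms(4)] L2_Cauchy_Schwarz(1)[OF assms(3,4)]
      by (simp add: left_diff_distrib mult.commute[of "L2_norm_sq M g"])
    then show "\<forall>\<^sub>F n in F. ennreal ((cmod ((\<integral>x. f n x * cnj (g x) \<partial>M) - (\<integral>x. h x * cnj (g x) \<partial>M)))\<^sup>2)
        \<le> L2_norm_sq M g * L2_norm_sq M (\<lambda>x. f n x - h x)" by simp
  qed
  then have "((\<lambda>n. (cmod ((\<integral>x. f n x * cnj (g x) \<partial>M) - (\<integral>x. h x * cnj (g x) \<partial>M)))\<^sup>2) \<longlongrightarrow> 0) F"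
    by (subst (asm) ennreal_0[symmetric], subst (asm) tendsto_ennreal_iff) auto
  then have "((\<lambda>n. sqrt ((cmod ((\<integral>x. f n x * cnj (g x) \<partial>M) - (\<integral>x. h x * cnj (g x) \<partial>M)))\<^sup>2)) \<longlongrightarrow> sqrt 0) F"
    by (rule tendsto_real_sqrt)
  then show ?thesis by (simp add: tendsto_norm_zero_iff LIM_zero_iff)
qed

section \<open>Continuity of translations\<close>

lemma nn_integral_translate:
  fixes f :: "real \<Rightarrow> ennreal"
  assumes "f \<in> borel_measurable borel"
  shows "(\<integral>\<^sup>+x. f (x - u) \<partial>lborel) = (\<integral>\<^sup>+x. f x \<partial>lborel)"
  using nn_integral_real_affine[OF assms, of 1 "-u"] by simp

definition L1_translation_continuous :: "(real \<Rightarrow> complex) \<Rightarrow> bool" where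
  "L1_translation_continuous f \<longleftrightarrow>
     (\<forall>u. u \<longlonglongrightarrow> 0 \<longrightarrow> (\<lambda>n. \<integral>\<^sup>+x. ennreal (cmod (f (x - u n) - f x)) \<partial>lborel) \<longlonglongrightarrow> 0)"

text \<open>Replacing \<open>f\<close> by \<open>g\<close> changes the distance between \<open>f\<close> and its translate by at most twice the distance
  of \<open>f\<close> and \<open>g\<close>, whatever the translation.\<close>

lemma L1_translation_continuousI:
  fixes f :: "real \<Rightarrow> complex"
  assumes [measurable]: "f \<in> borel_measurable borel"
    and approx: "\<And>e::real. e > 0 \<Longrightarrow> \<exists>g \<in> borel_measurable borel. L1_translation_continuous g \<and>
           (\<integral>\<^sup>+x. ennreal (cmod (f x - g x)) \<partial>lborel) \<le> ennreal e"
  shows "L1_translation_continuous f"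
  unfolding L1_translation_continuous_def
proof (intro allI impI)
  fix u :: "nat \<Rightarrow> real" assume u: "u \<longlonglongrightarrow> 0"
  show "(\<lambda>n. \<integral>\<^sup>+x. ennreal (cmod (f (x - u n) - f x)) \<partial>lborel) \<longlonglongrightarrow> 0"
  proof (rule tendsto_zero_ennreal)
    fix e :: real assume e: "e > 0"
    obtain g where [measurable]: "g \<in> borel_measurable borel" and g: "L1_translation_continuous g"
      and fg: "(\<integral>\<^sup>+x. ennreal (cmod (f x - g x)) \<partial>lborel) \<le> ennreal (e/4)"
      using approx[of "e/4"] e by auto
    have "(\<lambda>n. \<integral>\<^sup>+x. ennreal (cmod (g (x - u n) - g x)) \<partial>lborel) \<longlonglongrightarrow> 0"
      using g u by (simp add: L1_translation_continuous_def)
    then have "\<forall>\<^sub>F n in sequentially. (\<integral>\<^sup>+x. ennreal (cmod (g (x - u n) - g x)) \<partial>lborel) < ennreal (e/4)"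
      using e by (intro order_tendstoD(2)) auto
    then show "\<forall>\<^sub>F n in sequentially. (\<integral>\<^sup>+x. ennreal (cmod (f (x - u n) - f x)) \<partial>lborel) < ennreal e"
    proof eventually_elim
      case (elim n)
      have "(\<integral>\<^sup>+x. ennreal (cmod (f (x - u n) - f x)) \<partial>lborel) \<le>
          (\<integral>\<^sup>+x. ennreal (cmod (f (x - u n) - g (x - u n))) + ennreal (cmod (g (x - u n) - g x))
             + ennreal (cmod (f x - g x)) \<partial>lborel)"
      proof (intro nn_integral_mono)
        fix x
        have "cmod (f (x - u n) - f x) \<le> cmod (f (x - u n) - g (x - u n)) + cmod (g (x - u n) - g x) + cmod (f x - g x)"
          by norm
        then show "ennreal (cmod (f (x - u n) - f x)) \<le> ennreal (cmod (f (x - u n) - g (x - u n)))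
            + ennreal (cmod (g (x - u n) - g x)) + ennreal (cmod (f x - g x))"
          by (simp flip: ennreal_plus add: ennreal_leI)
      qed
      also have "\<dots> = (\<integral>\<^sup>+x. ennreal (cmod (f (x - u n) - g (x - u n))) \<partial>lborel)
          + (\<integral>\<^sup>+x. ennreal (cmod (g (x - u n) - g x)) \<partial>lborel) + (\<integral>\<^sup>+x. ennreal (cmod (f x - g x)) \<partial>lborel)"
        by (simp add: nn_integral_add)
      also have "(\<integral>\<^sup>+x. ennreal (cmod (f (x - u n) - g (x - u n))) \<partial>lborel) = (\<integral>\<^sup>+x. ennreal (cmod (f x - g x)) \<partial>lborel)"
        by (rule nn_integral_translate[of "\<lambda>x. ennreal (cmod (f x - g x))"]) simp
      also have "(\<integral>\<^sup>+x. ennreal (cmod (f x - g x)) \<partial>lborel) + (\<integral>\<^sup>+x. ennreal (cmod (g (x - u n) - g x)) \<partial>lborel)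
          + (\<integral>\<^sup>+x. ennreal (cmod (f x - g x)) \<partial>lborel) \<le> ennreal (e/4) + ennreal (e/4) + ennreal (e/4)"
        using fg elim by (intro add_mono) auto
      also have "\<dots> < ennreal e" using e by (simp flip: ennreal_plus add: ennreal_less_iff)
      finally show ?case .
    qed
  qed
qed

lemma L1_translation_continuous_add:
  assumes [measurable]: "f \<in> borel_measurable borel" "g \<in> borel_measurable borel"
    and "L1_translation_continuous f" "L1_translation_continuous g"
  shows "L1_translation_continuous (\<lambda>x. f x + g x)"
  unfolding L1_translation_continuous_def
proof (intro allI impI)
  fix u :: "nat \<Rightarrow> real" assume u: "u \<longlonglongrightarrow> 0"
  show "(\<lambda>n. \<integral>\<^sup>+x. ennreal (cmod (f (x - u n) + g (x - u n) - (f x + g x))) \<partial>lborel) \<longlonglongrightarrow> 0"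
  proof (rule ennreal_tendsto_0_I)
    show "(\<lambda>n. (\<integral>\<^sup>+x. ennreal (cmod (f (x - u n) - f x)) \<partial>lborel)
        + (\<integral>\<^sup>+x. ennreal (cmod (g (x - u n) - g x)) \<partial>lborel)) \<longlonglongrightarrow> 0"
      using assms u by (intro ennreal_tendsto_0_add) (auto simp: L1_translation_continuous_def)
    show "\<forall>\<^sub>F n in sequentially. (\<integral>\<^sup>+x. ennreal (cmod (f (x - u n) + g (x - u n) - (f x + g x))) \<partial>lborel) \<le>
       (\<integral>\<^sup>+x. ennreal (cmod (f (x - u n) - f x)) \<partial>lborel) + (\<integral>\<^sup>+x. ennreal (cmod (g (x - u n) - g x)) \<partial>lborel)"
    proof (intro always_eventually allI)
      fix n
      have "(\<integral>\<^sup>+x. ennreal (cmod (f (x - u n) + g (x - u n) - (f x + g x))) \<partial>lborel) \<le>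
         (\<integral>\<^sup>+x. ennreal (cmod (f (x - u n) - f x)) + ennreal (cmod (g (x - u n) - g x)) \<partial>lborel)"
        by (intro nn_integral_mono) (simp flip: ennreal_plus add: ennreal_leI add_diff_add norm_triangle_ineq)
      then show "(\<integral>\<^sup>+x. ennreal (cmod (f (x - u n) + g (x - u n) - (f x + g x))) \<partial>lborel) \<le>
       (\<integral>\<^sup>+x. ennreal (cmod (f (x - u n) - f x)) \<partial>lborel) + (\<integral>\<^sup>+x. ennreal (cmod (g (x - u n) - g x)) \<partial>lborel)"
        by (simp add: nn_integral_add)
    qed
  qed
qed

text \<open>For an open set \<open>U\<close> the translated indicators are eventually \<open>1\<close> at every point of \<open>U\<close>, so the
  part of \<open>U\<close> that a small translation uncovers has small measure; by symmetry so has the part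
  that it newly covers.\<close>

lemma L1_translation_continuous_open:
  assumes U: "open U" and fin: "emeasure lborel U < \<infinity>"
  shows "L1_translation_continuous (\<lambda>x. indicator U x)"
  unfolding L1_translation_continuous_def
proof (intro allI impI)
  fix u :: "nat \<Rightarrow> real" assume u: "u \<longlonglongrightarrow> 0"
  have [measurable]: "U \<in> sets borel" using U by simp
  have lim: "(\<lambda>n. \<integral>\<^sup>+x. indicator U x * indicator (-U) (x - v n) \<partial>lborel) \<longlonglongrightarrow> 0" if v: "v \<longlonglongrightarrow> 0" for v :: "nat \<Rightarrow> real"
  proof -
    have "(\<lambda>n. \<integral>\<^sup>+x. indicator U x * indicator (-U) (x - v n) \<partial>lborel) \<longlonglongrightarrow> (\<integral>\<^sup>+(x::real). 0 \<partial>lborel)"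
    proof (rule nn_integral_dominated_convergence[where w = "\<lambda>x. indicator U x"])
      have "(\<lambda>n. indicator U x * indicator (-U) (x - v n) :: ennreal) \<longlonglongrightarrow> 0" for x
      proof (cases "x \<in> U")
        case True
        have "(\<lambda>n. x - v n) \<longlonglongrightarrow> x - 0" by (intro tendsto_intros v)
        then have "\<forall>\<^sub>F n in sequentially. x - v n \<in> U" using U True by (auto intro: topological_tendstoD)
        then have "\<forall>\<^sub>F n in sequentially. indicator U x * indicator (-U) (x - v n) = (0::ennreal)"
          by eventually_elim simp
        then show ?thesis by (rule tendsto_eventually)
      qed simp
      then show "AE x in lborel. (\<lambda>n. indicator U x * indicator (-U) (x - v n) :: ennreal) \<longlonglongrightarrow> 0" by simp
    qed (use fin in \<open>auto split: split_indicator\<close>)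
    then show ?thesis by simp
  qed
  have "(\<integral>\<^sup>+x. ennreal (cmod (indicator U (x - u n) - indicator U x)) \<partial>lborel)
     = (\<integral>\<^sup>+x. indicator U x * indicator (-U) (x - (- u n)) \<partial>lborel) + (\<integral>\<^sup>+x. indicator U x * indicator (-U) (x - u n) \<partial>lborel)" for n
  proof -
    have "(\<integral>\<^sup>+x. ennreal (cmod (indicator U (x - u n) - indicator U x)) \<partial>lborel)
       = (\<integral>\<^sup>+x. indicator U (x - u n) * indicator (-U) (x - u n + u n) + indicator U x * indicator (-U) (x - u n) \<partial>lborel)"
      by (intro nn_integral_cong) (auto split: split_indicator)
    also have "\<dots> = (\<integral>\<^sup>+x. indicator U (x - u n) * indicator (-U) (x - u n + u n) \<partial>lborel)
        + (\<integral>\<^sup>+x. indicator U x * indicator (-U) (x - u n) \<partial>lborel)"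
      by (simp add: nn_integral_add)
    also have "(\<integral>\<^sup>+x. indicator U (x - u n) * indicator (-U) (x - u n + u n) \<partial>lborel)
        = (\<integral>\<^sup>+x. indicator U x * indicator (-U) (x - (- u n)) \<partial>lborel)"
      by (subst nn_integral_translate[of "\<lambda>x. indicator U x * indicator (-U) (x + u n)"]) auto
    finally show ?thesis .
  qed
  then show "(\<lambda>n. \<integral>\<^sup>+x. ennreal (cmod (indicator U (x - u n) - indicator U x)) \<partial>lborel) \<longlonglongrightarrow> 0"
    using ennreal_tendsto_0_add[OF lim[of "\<lambda>n. - u n"] lim[OF u]] tendsto_minus[OF u] by simp
qed

lemma L1_translation_continuous_cmult:
  assumes "L1_translation_continuous f" and [measurable]: "f \<in> borel_measurable borel"
  shows "L1_translation_continuous (\<lambda>x. f x * c)"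
  unfolding L1_translation_continuous_def
proof (intro allI impI)
  fix u :: "nat \<Rightarrow> real" assume u: "u \<longlonglongrightarrow> 0"
  have "(\<lambda>n. ennreal (cmod c) * (\<integral>\<^sup>+x. ennreal (cmod (f (x - u n) - f x)) \<partial>lborel)) \<longlonglongrightarrow> 0"
    using assms u by (intro ennreal_tendsto_0_mult) (auto simp: L1_translation_continuous_def)
  then show "(\<lambda>n. \<integral>\<^sup>+x. ennreal (cmod (f (x - u n) * c - f x * c)) \<partial>lborel) \<longlonglongrightarrow> 0"
    by (simp flip: left_diff_distrib add: norm_mult ennreal_mult nn_integral_cmult mult.commute[of _ "cmod c"])
qed

text \<open>By approximation: outer regularity reduces measurable sets to open ones.\<close>

lemma L1_translation_continuous_integrable:
  fixes f :: "real \<Rightarrow> complex"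
  assumes "integrable lborel f"
  shows "L1_translation_continuous f"
  using assms
proof (induction rule: integrable_induct)
  case (base A c)
  then have A[measurable]: "A \<in> sets borel" and finA: "emeasure lborel A < \<infinity>" by auto
  have "L1_translation_continuous (\<lambda>x. indicator A x)"
  proof (rule L1_translation_continuousI)
    fix e :: real assume e: "e > 0"
    obtain U where U: "open U" "A \<subseteq> U" "emeasure lborel (U - A) < e"
      using outer_regular_lborel[OF A e] by blast
    then have [measurable]: "U \<in> sets borel" by simp
    have "emeasure lborel U = emeasure lborel A + emeasure lborel (U - A)"
      using U by (subst plus_emeasure) (auto simp: Un_absorb1)
    also have "\<dots> < \<infinity>" using finA U by (auto simp: less_top[symmetric])
    finally have "L1_translation_continuous (\<lambda>x. indicator U x)"
      by (rule L1_translation_continuous_open[OF U(1)])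
    moreover have "(\<integral>\<^sup>+x. ennreal (cmod (indicator A x - indicator U x)) \<partial>lborel) = emeasure lborel (U - A)"
    proof -
      have "(\<integral>\<^sup>+x. ennreal (cmod (indicator A x - indicator U x)) \<partial>lborel) = (\<integral>\<^sup>+x. indicator (U - A) x \<partial>lborel)"
        using U(2) by (intro nn_integral_cong) (auto split: split_indicator)
      then show ?thesis by simp
    qed
    ultimately show "\<exists>g \<in> borel_measurable borel. L1_translation_continuous g \<and>
           (\<integral>\<^sup>+x. ennreal (cmod (indicator A x - g x)) \<partial>lborel) \<le> ennreal e"
      using U(3) by (intro bexI[of _ "\<lambda>x. indicator U x"]) auto
  qed simp
  from L1_translation_continuous_cmult[OF this, of c] show ?case
    by (simp add: scaleR_conv_of_real of_real_indicator)
next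
  case (add f g)
  then show ?case by (intro L1_translation_continuous_add) auto
next
  case (lim f s)
  note [measurable] = borel_measurable_integrable[OF lim(1)] borel_measurable_integrable[OF lim(4)]
  show ?case
  proof (rule L1_translation_continuousI)
    fix e :: real assume e: "e > 0"
    have "(\<lambda>i. \<integral>\<^sup>+x. norm (f x - s i x) \<partial>lborel) \<longlonglongrightarrow> 0"
      using lim
      by (intro nn_integral_dominated_convergence_norm[where w="\<lambda>x. 2 * norm (f x)"])
         (auto simp: integrable_iff_bounded ennreal_mult nn_integral_cmult ennreal_mult_less_top)
    then have "\<forall>\<^sub>F i in sequentially. (\<integral>\<^sup>+x. norm (f x - s i x) \<partial>lborel) < ennreal e"
      using e by (intro order_tendstoD(2)) auto
    then obtain i where "(\<integral>\<^sup>+x. norm (f x - s i x) \<partial>lborel) < ennreal e"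
      by (auto simp: eventually_sequentially)
    then show "\<exists>g \<in> borel_measurable borel. L1_translation_continuous g \<and>
           (\<integral>\<^sup>+x. ennreal (cmod (f x - g x)) \<partial>lborel) \<le> ennreal e"
      using lim(5)[of i] by (intro bexI[of _ "s i"]) auto
  qed simp
qed

section \<open>The Fourier transform on the line\<close>

lemma borel_measurable_cis [measurable (raw)]:
  "f \<in> borel_measurable M \<Longrightarrow> (\<lambda>x. cis (f x)) \<in> borel_measurable M"
  by (rule measurable_compose[of f M borel cis]) (auto intro!: borel_measurable_continuous_onI continuous_intros)

lemma integrable_mult_bounded_complex:
  fixes f b :: "'a \<Rightarrow> complex"
  assumes "integrable M f" "b \<in> borel_measurable M" "\<And>x. cmod (b x) \<le> C"
  shows "integrable M (\<lambda>x. f x * b x)"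
proof (rule Bochner_Integration.integrable_bound)
  show "integrable M (\<lambda>x. C * cmod (f x))" using assms by auto
  show "AE x in M. cmod (f x * b x) \<le> norm (C * cmod (f x))"
  proof (intro AE_I2)
    fix x
    have "0 \<le> C" using assms(3)[of x] norm_ge_zero order_trans by blast
    then show "cmod (f x * b x) \<le> norm (C * cmod (f x))"
      using mult_left_mono[OF assms(3)[of x], of "cmod (f x)"] by (simp add: norm_mult mult.commute)
  qed
qed (use assms in auto)

lemma integrable_tensor:
  fixes u v :: "real \<Rightarrow> complex" and b :: "real \<times> real \<Rightarrow> complex"
  assumes u: "integrable lborel u" and v: "integrable lborel v"
    and [measurable]: "b \<in> borel_measurable (lborel \<Otimes>\<^sub>M lborel)" and b: "\<And>p. cmod (b p) \<le> 1"
  shows "integrable (lborel \<Otimes>\<^sub>M lborel) (\<lambda>(x, y). u x * v y * b (x, y))"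
proof (rule lborel_pair.Fubini_integrable)
  note [measurable] = borel_measurable_integrable[OF u] borel_measurable_integrable[OF v]
  show meas: "(\<lambda>(x, y). u x * v y * b (x, y)) \<in> borel_measurable (lborel \<Otimes>\<^sub>M lborel)" by measurable
  have i: "integrable lborel (\<lambda>y. v y * b (x, y))" for x
    by (rule integrable_mult_bounded_complex[OF v _ b]) measurable
  then show "AE x in lborel. integrable lborel (\<lambda>y. case (x, y) of (x, y) \<Rightarrow> u x * v y * b (x, y))"
    by (simp add: mult.assoc)
  show "integrable lborel (\<lambda>x. \<integral>y. norm (case (x, y) of (x, y) \<Rightarrow> u x * v y * b (x, y)) \<partial>lborel)"
  proof (rule Bochner_Integration.integrable_bound)
    show "integrable lborel (\<lambda>x. cmod (u x) * (\<integral>y. cmod (v y) \<partial>lborel))" using u by auto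
    show "(\<lambda>x. \<integral>y. norm (case (x, y) of (x, y) \<Rightarrow> u x * v y * b (x, y)) \<partial>lborel) \<in> borel_measurable lborel"
      by measurable
    show "AE x in lborel. norm (\<integral>y. norm (case (x, y) of (x, y) \<Rightarrow> u x * v y * b (x, y)) \<partial>lborel)
        \<le> norm (cmod (u x) * (\<integral>y. cmod (v y) \<partial>lborel))"
    proof (intro AE_I2)
      fix x
      have "(\<integral>y. cmod (u x * v y * b (x, y)) \<partial>lborel) \<le> (\<integral>y. cmod (u x) * cmod (v y) \<partial>lborel)"
      proof (rule integral_mono)
        show "integrable lborel (\<lambda>y. cmod (u x * v y * b (x, y)))" using i[of x] by (auto simp: mult.assoc intro!: integrable_norm)
        show "integrable lborel (\<lambda>y. cmod (u x) * cmod (v y))" using v by auto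
        show "cmod (u x * v y * b (x, y)) \<le> cmod (u x) * cmod (v y)" for y
          using mult_left_mono[OF b[of "(x,y)"], of "cmod (u x * v y)"] by (simp add: norm_mult)
      qed
      then show "norm (\<integral>y. norm (case (x, y) of (x, y) \<Rightarrow> u x * v y * b (x, y)) \<partial>lborel)
          \<le> norm (cmod (u x) * (\<integral>y. cmod (v y) \<partial>lborel))"
        by (simp add: integral_nonneg_AE)
    qed
  qed
qed

lemma integrable_inv_fourier_integrand:
  "integrable lborel f \<Longrightarrow> integrable lborel (\<lambda>\<xi>. f \<xi> * cis (x * \<xi>))"
  by (rule integrable_mult_bounded_complex[where C = 1]) auto

lemma inv_fourier_bound:
  assumes f: "integrable lborel f"
  shows "cmod (inv_fourier f x) \<le> (LBINT \<xi>. cmod (f \<xi>)) / (2 * pi)"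
proof -
  have "cmod (LBINT \<xi>. f \<xi> * cis (x * \<xi>)) \<le> (LBINT \<xi>. cmod (f \<xi> * cis (x * \<xi>)))"
    by (rule integral_norm_bound)
  then show ?thesis
    by (simp add: inv_fourier_def norm_mult norm_divide divide_right_mono)
qed

lemma continuous_inv_fourier:
  assumes f: "integrable lborel f"
  shows "continuous_on UNIV (inv_fourier f)"
proof -
  note [measurable] = borel_measurable_integrable[OF f]
  have "continuous_on UNIV (\<lambda>x. LBINT \<xi>. f \<xi> * cis (x * \<xi>))"
    unfolding continuous_on_sequentially
  proof (intro allI ballI impI)
    fix X and a :: real assume X: "(\<forall>n. X n \<in> UNIV) \<and> X \<longlonglongrightarrow> a"
    show "((\<lambda>x. LBINT \<xi>. f \<xi> * cis (x * \<xi>)) \<circ> X) \<longlonglongrightarrow> (LBINT \<xi>. f \<xi> * cis (a * \<xi>))"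
      unfolding o_def
    proof (rule integral_dominated_convergence[where w = "\<lambda>\<xi>. cmod (f \<xi>)"])
      show "AE \<xi> in lborel. (\<lambda>n. f \<xi> * cis (X n * \<xi>)) \<longlonglongrightarrow> f \<xi> * cis (a * \<xi>)"
        unfolding cis_conv_exp using X by (auto intro!: AE_I2 tendsto_intros)
    qed (use f in \<open>auto simp: norm_mult\<close>)
  qed
  then show ?thesis unfolding inv_fourier_def by (intro continuous_intros)
qed

lemma measurable_inv_fourier [measurable]:
  "integrable lborel f \<Longrightarrow> inv_fourier f \<in> borel_measurable borel"
  by (rule borel_measurable_continuous_onI) (rule continuous_inv_fourier)

lemma inv_fourier_diff:
  assumes "integrable lborel f" "integrable lborel g"
  shows "inv_fourier (\<lambda>\<xi>. f \<xi> - g \<xi>) x = inv_fourier f x - inv_fourier g x"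
  using integrable_inv_fourier_integrand[OF assms(1), of x] integrable_inv_fourier_integrand[OF assms(2), of x]
  by (simp add: inv_fourier_def left_diff_distrib right_diff_distrib)

lemma inv_fourier_cmult: "inv_fourier (\<lambda>\<xi>. c * f \<xi>) x = c * inv_fourier f x"
  by (simp add: inv_fourier_def mult.assoc)

text \<open>A rescaling of the characteristic function of the standard normal distribution.\<close>

lemma gaussian_fourier:
  assumes \<delta>: "\<delta> > 0"
  shows "integrable lborel (\<lambda>x. complex_of_real (exp (- (\<delta> * x)\<^sup>2 / 2)))"
    and "(LBINT x. complex_of_real (exp (- (\<delta> * x)\<^sup>2 / 2)) * cis (t * x))
       = complex_of_real (sqrt (2 * pi) / \<delta> * exp (- (t / \<delta>)\<^sup>2 / 2))"
proof -
  have n: "integrable lborel (\<lambda>x. complex_of_real (std_normal_density x))"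
    by (intro integrable_of_real integrable_normal_density) simp
  have e: "complex_of_real (exp (- (\<delta> * x)\<^sup>2 / 2)) = sqrt (2 * pi) * complex_of_real (std_normal_density (\<delta> * x))" for x
    by (simp add: std_normal_density_def)
  show "integrable lborel (\<lambda>x. complex_of_real (exp (- (\<delta> * x)\<^sup>2 / 2)))"
    unfolding e using lborel_integrable_real_affine[OF n, of \<delta> 0] \<delta> by simp
  have "complex_of_real (exp (- (t / \<delta>)\<^sup>2 / 2)) = char std_normal_distribution (t / \<delta>)"
    by (simp add: char_std_normal_distribution)
  also have "\<dots> = (LBINT x. std_normal_density x *\<^sub>R cis (t / \<delta> * x))"
    unfolding char_def cis_conv_exp
    by (subst integral_density) (auto simp: normal_density_nonneg mult.commute)
  also have "\<dots> = \<delta> *\<^sub>R (LBINT x. std_normal_density (\<delta> * x) *\<^sub>R cis (t * x))"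
    using \<delta> by (subst lborel_integral_real_affine[where c=\<delta> and t=0]) auto
  also have "(LBINT x. std_normal_density (\<delta> * x) *\<^sub>R cis (t * x))
      = (LBINT x. complex_of_real (exp (- (\<delta> * x)\<^sup>2 / 2)) * cis (t * x)) / sqrt (2 * pi)"
    unfolding e by (simp add: scaleR_conv_of_real mult.assoc)
  finally show "(LBINT x. complex_of_real (exp (- (\<delta> * x)\<^sup>2 / 2)) * cis (t * x))
       = complex_of_real (sqrt (2 * pi) / \<delta> * exp (- (t / \<delta>)\<^sup>2 / 2))"
    using \<delta> by (simp add: scaleR_conv_of_real field_simps)
qed

lemma two_mult_ennreal: "0 \<le> a \<Longrightarrow> 2 * ennreal a = ennreal (2 * a)"
  by (simp add: ennreal_mult)

text \<open>Truncating \<open>f\<close> in size makes translation continuity in the mean imply the quadratic one.\<close>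

lemma L2_translation_continuous:
  fixes f :: "real \<Rightarrow> complex"
  assumes f: "integrable lborel f" "f \<in> L2 lborel" and u: "u \<longlonglongrightarrow> 0"
  shows "(\<lambda>n. L2_norm_sq lborel (\<lambda>x. f (x - u n) - f x)) \<longlonglongrightarrow> 0"
proof (rule tendsto_zero_ennreal)
  fix e :: real assume e: "e > 0"
  note [measurable] = borel_measurable_integrable[OF f(1)]
  define F where "F = (\<lambda>N::nat. \<lambda>x. if cmod (f x) \<le> real N then f x else 0)"
  have [measurable]: "F N \<in> borel_measurable borel" for N unfolding F_def by measurable
  have lim: "(\<lambda>N. L2_norm_sq lborel (\<lambda>x. f x - F N x)) \<longlonglongrightarrow> 0"
  proof (rule L2_dominated_tendsto_0[where w = "\<lambda>x. cmod (f x)"])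
    show "(\<integral>\<^sup>+ x. ennreal ((cmod (f x))\<^sup>2) \<partial>lborel) < \<infinity>"
      using L2_finite[OF f(2)] by (simp add: L2_norm_sq_def)
    show "AE x in lborel. (\<lambda>N. f x - F N x) \<longlonglongrightarrow> 0"
    proof (intro AE_I2 tendsto_eventually)
      fix x
      show "\<forall>\<^sub>F N in sequentially. f x - F N x = 0"
        using eventually_ge_at_top[of "nat \<lceil>cmod (f x)\<rceil>"]
        by eventually_elim (auto simp: F_def)
    qed
  qed (auto simp: F_def)
  then have "\<forall>\<^sub>F N in sequentially. L2_norm_sq lborel (\<lambda>x. f x - F N x) < ennreal (e/24)"
    using e by (intro order_tendstoD(2)) auto
  then obtain N where N: "L2_norm_sq lborel (\<lambda>x. f x - F N x) < ennreal (e/24)"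
    by (auto simp: eventually_sequentially)
  have iF: "integrable lborel (F N)"
    by (rule Bochner_Integration.integrable_bound[OF f(1)]) (auto simp: F_def)
  \<comment> \<open>The difference is bounded by \<open>2 N\<close>, so its square is at most \<open>2 N\<close> times its modulus.\<close>
  have le: "L2_norm_sq lborel (\<lambda>x. F N (x - a) - F N x) \<le> ennreal (2 * real N) * (\<integral>\<^sup>+x. ennreal (cmod (F N (x - a) - F N x)) \<partial>lborel)" for a
  proof -
    have "L2_norm_sq lborel (\<lambda>x. F N (x - a) - F N x) \<le> (\<integral>\<^sup>+x. ennreal (2 * real N) * ennreal (cmod (F N (x - a) - F N x)) \<partial>lborel)"
      unfolding L2_norm_sq_def
    proof (intro nn_integral_mono)
      fix x
      have "cmod (F N y) \<le> N" for y by (auto simp: F_def)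
      then have "cmod (F N (x - a) - F N x) \<le> 2 * real N"
        using norm_triangle_ineq4[of "F N (x - a)" "F N x"] by (smt (verit, best))
      then have "(cmod (F N (x - a) - F N x))\<^sup>2 \<le> 2 * real N * cmod (F N (x - a) - F N x)"
        by (simp add: power2_eq_square mult_right_mono)
      then show "ennreal ((cmod (F N (x - a) - F N x))\<^sup>2) \<le> ennreal (2 * real N) * ennreal (cmod (F N (x - a) - F N x))"
        by (simp flip: ennreal_mult add: ennreal_leI)
    qed
    then show ?thesis by (simp add: nn_integral_cmult)
  qed
  have "(\<lambda>n. ennreal (2 * real N) * (\<integral>\<^sup>+x. ennreal (cmod (F N (x - u n) - F N x)) \<partial>lborel)) \<longlonglongrightarrow> 0"
    using L1_translation_continuous_integrable[OF iF] u
    by (intro ennreal_tendsto_0_mult) (auto simp: L1_translation_continuous_def)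
  then have "\<forall>\<^sub>F n in sequentially. ennreal (2 * real N) * (\<integral>\<^sup>+x. ennreal (cmod (F N (x - u n) - F N x)) \<partial>lborel) < ennreal (e/16)"
    using e by (intro order_tendstoD(2)) auto
  then show "\<forall>\<^sub>F n in sequentially. L2_norm_sq lborel (\<lambda>x. f (x - u n) - f x) < ennreal e"
  proof eventually_elim
    case (elim n)
    have 1: "L2_norm_sq lborel (\<lambda>x. f (x - u n) - F N (x - u n)) = L2_norm_sq lborel (\<lambda>x. f x - F N x)"
      unfolding L2_norm_sq_def by (rule nn_integral_translate[of "\<lambda>x. ennreal ((cmod (f x - F N x))\<^sup>2)"]) simp
    have "L2_norm_sq lborel (\<lambda>x. f (x - u n) - f x)
       \<le> 2 * L2_norm_sq lborel (\<lambda>x. f (x - u n) - F N (x - u n)) + 2 * L2_norm_sq lborel (\<lambda>x. F N (x - u n) - f x)"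
      by (rule L2_norm_sq_diff_triangle) measurable
    also have "\<dots> \<le> 2 * L2_norm_sq lborel (\<lambda>x. f (x - u n) - F N (x - u n))
       + 2 * (2 * L2_norm_sq lborel (\<lambda>x. F N (x - u n) - F N x) + 2 * L2_norm_sq lborel (\<lambda>x. F N x - f x))"
      by (intro add_mono mult_left_mono L2_norm_sq_diff_triangle order_refl) measurable
    also have "\<dots> \<le> 2 * ennreal (e/24) + 2 * (2 * ennreal (e/16) + 2 * ennreal (e/24))"
      using N elim le[of "u n"] unfolding 1 L2_norm_sq_diff_commute[of _ "F N" f]
      by (intro add_mono mult_left_mono) auto
    \<comment> \<open>\<open>e/12 + e/4 + e/6 = e/2\<close>\<close>
    also have "\<dots> = ennreal (2 * (e/24) + 2 * (2 * (e/16) + 2 * (e/24)))"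
      using e by (simp add: two_mult_ennreal flip: ennreal_plus)
    also have "\<dots> < ennreal e" using e by (simp add: ennreal_less_iff)
    finally show ?case .
  qed
qed

subsection \<open>Plancherel's theorem\<close>

text \<open>Inserting a Gaussian factor makes the pairing of two transforms an absolutely convergent
  iterated integral, and the transform of the Gaussian is an explicit approximate identity.\<close>

lemma plancherel_gaussian:
  assumes f: "integrable lborel f" and k: "integrable lborel k" and \<delta>: "\<delta> > 0"
  shows "(LBINT x. inv_fourier f x * cnj (inv_fourier k x) * complex_of_real (exp (- (\<delta> * x)\<^sup>2 / 2)))
     = 1 / (2 * pi) * (LBINT \<eta>. cnj (k \<eta>) * (LBINT v. complex_of_real (std_normal_density v) * f (\<eta> + \<delta> * v)))"
proof -
  note [measurable] = borel_measurable_integrable[OF f] borel_measurable_integrable[OF k]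
  define G where "G = (\<lambda>x. complex_of_real (exp (- (\<delta> * x)\<^sup>2 / 2)))"
  have iG: "integrable lborel G" unfolding G_def by (rule gaussian_fourier[OF \<delta>])
  have [measurable]: "G \<in> borel_measurable borel" unfolding G_def by measurable
  have step1: "(LBINT x. inv_fourier f x * G x * cis (- \<eta> * x)) = (LBINT v. complex_of_real (std_normal_density v) * f (\<eta> + \<delta> * v))" for \<eta>
  proof -
    have int: "integrable (lborel \<Otimes>\<^sub>M lborel) (\<lambda>(x, \<xi>). G x * f \<xi> * cis (x * \<xi> - \<eta> * x))"
      using integrable_tensor[OF iG f, of "\<lambda>(x, \<xi>). cis (x * \<xi> - \<eta> * x)"] by (simp add: split_beta')
    have "(LBINT x. inv_fourier f x * G x * cis (- \<eta> * x))
        = 1 / (2 * pi) * (LBINT x. (LBINT \<xi>. G x * f \<xi> * cis (x * \<xi> - \<eta> * x)))"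
    proof -
      have "inv_fourier f x * G x * cis (- \<eta> * x) = 1 / (2 * pi) * (LBINT \<xi>. G x * f \<xi> * cis (x * \<xi> - \<eta> * x))" for x
      proof -
        have "(LBINT \<xi>. G x * f \<xi> * cis (x * \<xi> - \<eta> * x)) = (LBINT \<xi>. (G x * cis (- \<eta> * x)) * (f \<xi> * cis (x * \<xi>)))"
        proof (intro Bochner_Integration.integral_cong refl)
          fix \<xi>
          have "cis (x * \<xi> - \<eta> * x) = cis (- \<eta> * x) * cis (x * \<xi>)" by (simp add: cis_mult)
          then show "G x * f \<xi> * cis (x * \<xi> - \<eta> * x) = (G x * cis (- \<eta> * x)) * (f \<xi> * cis (x * \<xi>))" by simp
        qed
        also have "\<dots> = (G x * cis (- \<eta> * x)) * (LBINT \<xi>. f \<xi> * cis (x * \<xi>))"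
          by (rule integral_mult_right_zero)
        finally show ?thesis by (simp add: inv_fourier_def)
      qed
      then show ?thesis by simp
    qed
    also have "(LBINT x. (LBINT \<xi>. G x * f \<xi> * cis (x * \<xi> - \<eta> * x))) = (LBINT \<xi>. (LBINT x. G x * f \<xi> * cis (x * \<xi> - \<eta> * x)))"
      by (rule lborel_pair.Fubini_integral[symmetric, OF int])
    also have "\<dots> = (LBINT \<xi>. f \<xi> * (LBINT x. G x * cis ((\<xi> - \<eta>) * x)))"
    proof (intro Bochner_Integration.integral_cong refl)
      fix \<xi>
      have "(LBINT x. G x * f \<xi> * cis (x * \<xi> - \<eta> * x)) = (LBINT x. f \<xi> * (G x * cis ((\<xi> - \<eta>) * x)))"
        by (intro Bochner_Integration.integral_cong refl) (simp add: algebra_simps)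
      then show "(LBINT x. G x * f \<xi> * cis (x * \<xi> - \<eta> * x)) = f \<xi> * (LBINT x. G x * cis ((\<xi> - \<eta>) * x))"
        by simp
    qed
    also have "\<dots> = (LBINT \<xi>. f \<xi> * complex_of_real (sqrt (2 * pi) / \<delta> * exp (- ((\<xi> - \<eta>) / \<delta>)\<^sup>2 / 2)))"
      unfolding G_def gaussian_fourier(2)[OF \<delta>] ..
    also have "\<dots> = \<delta> *\<^sub>R (LBINT v. f (\<eta> + \<delta> * v) * complex_of_real (sqrt (2 * pi) / \<delta> * exp (- v\<^sup>2 / 2)))"
      using \<delta> by (subst lborel_integral_real_affine[where c=\<delta> and t=\<eta>]) auto
    also have "1 / (2 * pi) * (\<delta> *\<^sub>R (LBINT v. f (\<eta> + \<delta> * v) * complex_of_real (sqrt (2 * pi) / \<delta> * exp (- v\<^sup>2 / 2))))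
        = (LBINT v. complex_of_real (std_normal_density v) * f (\<eta> + \<delta> * v))"
    proof -
      have *: "complex_of_real (1 / (2 * pi)) * (complex_of_real \<delta> * (f (\<eta> + \<delta> * v) * complex_of_real (sqrt (2 * pi) / \<delta> * exp (- v\<^sup>2 / 2))))
        = complex_of_real (std_normal_density v) * f (\<eta> + \<delta> * v)" for v
      proof -
      have "1 / (2 * pi) * (\<delta> * (sqrt (2 * pi) / \<delta> * exp (- v\<^sup>2 / 2))) = std_normal_density v"
        using \<delta> real_sqrt_mult_self[of "2 * pi"] by (simp add: std_normal_density_def field_simps)
      then have "complex_of_real (1 / (2 * pi) * (\<delta> * (sqrt (2 * pi) / \<delta> * exp (- v\<^sup>2 / 2)))) = complex_of_real (std_normal_density v)" by simp
      moreover have "complex_of_real (1 / (2 * pi)) * (complex_of_real \<delta> * (f (\<eta> + \<delta> * v) * complex_of_real (sqrt (2 * pi) / \<delta> * exp (- v\<^sup>2 / 2))))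
        = complex_of_real (1 / (2 * pi) * (\<delta> * (sqrt (2 * pi) / \<delta> * exp (- v\<^sup>2 / 2)))) * f (\<eta> + \<delta> * v)"
        by (simp only: of_real_mult mult_ac)
      ultimately show ?thesis by simp
      qed
      show ?thesis
        unfolding *[symmetric] scaleR_conv_of_real integral_mult_right_zero ..
    qed
    finally show ?thesis by simp
  qed
  have iH: "integrable lborel (\<lambda>x. inv_fourier f x * G x)"
    using integrable_mult_bounded_complex[OF iG _ inv_fourier_bound[OF f]] measurable_inv_fourier[OF f]
    by (simp add: mult.commute)
  have int: "integrable (lborel \<Otimes>\<^sub>M lborel) (\<lambda>(x, \<eta>). (inv_fourier f x * G x) * cnj (k \<eta>) * cis (- \<eta> * x))"
    using integrable_tensor[OF iH, of "\<lambda>\<eta>. cnj (k \<eta>)" "\<lambda>(x, \<eta>). cis (- \<eta> * x)"] k by (simp add: split_beta')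
  have "(LBINT x. inv_fourier f x * cnj (inv_fourier k x) * G x)
     = 1 / (2 * pi) * (LBINT x. (LBINT \<eta>. (inv_fourier f x * G x) * cnj (k \<eta>) * cis (- \<eta> * x)))"
  proof -
    have *: "inv_fourier f x * cnj (inv_fourier k x) * G x
      = 1 / (2 * pi) * (LBINT \<eta>. (inv_fourier f x * G x) * cnj (k \<eta>) * cis (- \<eta> * x))" for x
    proof -
    have "cnj (inv_fourier k x) = 1 / (2 * pi) * (LBINT \<eta>. cnj (k \<eta>) * cis (- \<eta> * x))"
    proof -
      have "(LBINT \<eta>. cnj (k \<eta>) * cis (- \<eta> * x)) = (LBINT \<eta>. cnj (k \<eta> * cis (x * \<eta>)))"
        by (simp add: cis_cnj mult.commute)
      also have "\<dots> = cnj (LBINT \<eta>. k \<eta> * cis (x * \<eta>))" by (rule Bochner_Integration.integral_cnj)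
      finally show ?thesis by (simp add: inv_fourier_def)
    qed
    moreover have "(LBINT \<eta>. (inv_fourier f x * G x) * cnj (k \<eta>) * cis (- \<eta> * x))
      = (inv_fourier f x * G x) * (LBINT \<eta>. cnj (k \<eta>) * cis (- \<eta> * x))"
      unfolding integral_mult_right_zero[symmetric] by (simp only: mult.assoc)
    ultimately show ?thesis by simp
    qed
    show ?thesis unfolding * integral_mult_right_zero .. 
  qed
  also have "(LBINT x. (LBINT \<eta>. (inv_fourier f x * G x) * cnj (k \<eta>) * cis (- \<eta> * x)))
     = (LBINT \<eta>. (LBINT x. (inv_fourier f x * G x) * cnj (k \<eta>) * cis (- \<eta> * x)))"
    by (rule lborel_pair.Fubini_integral[symmetric, OF int])
  also have "\<dots> = (LBINT \<eta>. cnj (k \<eta>) * (LBINT x. inv_fourier f x * G x * cis (- \<eta> * x)))"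
  proof (intro Bochner_Integration.integral_cong refl)
    fix \<eta>
    have "(LBINT x. (inv_fourier f x * G x) * cnj (k \<eta>) * cis (- \<eta> * x)) = (LBINT x. cnj (k \<eta>) * (inv_fourier f x * G x * cis (- \<eta> * x)))"
      by (intro Bochner_Integration.integral_cong refl) simp
    then show "(LBINT x. (inv_fourier f x * G x) * cnj (k \<eta>) * cis (- \<eta> * x)) = cnj (k \<eta>) * (LBINT x. inv_fourier f x * G x * cis (- \<eta> * x))"
      by simp
  qed
  finally show ?thesis unfolding step1 unfolding G_def .
qed

lemma ennreal_power2_le_imp_le:
  fixes a b :: ennreal
  assumes "a\<^sup>2 \<le> b\<^sup>2"
  shows "a \<le> b"
proof (cases "b = top")
  case False
  then have "b * b < top" using False by (simp add: ennreal_mult_less_top less_top)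
  then have "a \<noteq> top" using assms by (auto simp: power2_eq_square top_unique)
  then obtain x where x: "0 \<le> x" "a = ennreal x" by (cases a) auto
  obtain y where y: "0 \<le> y" "b = ennreal y" using False by (cases b) auto
  have "ennreal (x\<^sup>2) \<le> ennreal (y\<^sup>2)" using assms x y by (simp add: ennreal_power)
  then have "x\<^sup>2 \<le> y\<^sup>2" by (simp add: ennreal_le_iff)
  then have "x \<le> y" using y(1) by (rule power2_le_imp_le)
  then show ?thesis using x y by (simp add: ennreal_leI)
qed simp

text \<open>The inner product \<open>A u\<close> of \<open>k\<close> with the translate of \<open>f\<close> by \<open>u\<close> is a continuous function of \<open>u\<close>, because
  translations are continuous in the mean; so its average over a shrinking Gaussian tends to \<open>A 0\<close>.\<close>

lemma plancherel_gaussian_tendsto: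
  assumes f: "integrable lborel f" "f \<in> L2 lborel" and k: "integrable lborel k" "k \<in> L2 lborel"
    and \<delta>: "\<And>n. \<delta> n > 0" "\<delta> \<longlonglongrightarrow> 0"
  shows "(\<lambda>n. LBINT x. inv_fourier f x * cnj (inv_fourier k x) * complex_of_real (exp (- (\<delta> n * x)\<^sup>2 / 2)))
     \<longlonglongrightarrow> 1 / (2 * pi) * (LBINT \<eta>. f \<eta> * cnj (k \<eta>))"
proof -
  note [measurable] = borel_measurable_integrable[OF f(1)] borel_measurable_integrable[OF k(1)]
  define A where "A = (\<lambda>u. LBINT \<eta>. f (\<eta> - u) * cnj (k \<eta>))"
  have fu: "(\<lambda>\<eta>. f (\<eta> - u)) \<in> L2 lborel" for u
    using f(2) nn_integral_translate[of "\<lambda>x. ennreal ((cmod (f x))\<^sup>2)" u]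
    by (auto simp: L2_def L2_norm_sq_def)
  have nfu: "L2_norm_sq lborel (\<lambda>\<eta>. f (\<eta> - u)) = L2_norm_sq lborel f" for u
    unfolding L2_norm_sq_def by (rule nn_integral_translate[of "\<lambda>x. ennreal ((cmod (f x))\<^sup>2)"]) simp
  define C where "C = sqrt (enn2real (L2_norm_sq lborel f * L2_norm_sq lborel k))"
  have fin: "L2_norm_sq lborel f * L2_norm_sq lborel k < \<infinity>"
    using L2_finite[OF f(2)] L2_finite[OF k(2)] by (simp add: ennreal_mult_less_top)
  have C2: "L2_norm_sq lborel f * L2_norm_sq lborel k = (ennreal C)\<^sup>2"
    using fin by (simp add: C_def ennreal_power less_top)
  have nn: "(\<integral>\<^sup>+\<eta>. ennreal (cmod (f (\<eta> - u) * cnj (k \<eta>))) \<partial>lborel) \<le> ennreal C" for u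
  proof -
    have "(\<integral>\<^sup>+\<eta>. ennreal (cmod (f (\<eta> - u) * cnj (k \<eta>))) \<partial>lborel)\<^sup>2 \<le> (ennreal C)\<^sup>2"
      using L2_Cauchy_Schwarz(2)[OF fu[of u] k(2)] unfolding nfu C2 .
    then show ?thesis by (rule ennreal_power2_le_imp_le)
  qed
  have Abound: "cmod (A u) \<le> C" for u
  proof -
    have "ennreal (cmod (A u)) \<le> ennreal C"
      unfolding A_def using integral_norm_bound_ennreal[OF L2_Cauchy_Schwarz(1)[OF fu[of u] k(2)]] nn[of u] by (rule order_trans)
    then show ?thesis by (simp add: C_def)
  qed
  have Alim: "(\<lambda>n. A (u n)) \<longlonglongrightarrow> A 0" if u: "u \<longlonglongrightarrow> 0" for u
    using L2_inner_tendsto[OF L2_translation_continuous[OF f u] fu f(2) k(2)] by (simp add: A_def)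
  have [measurable]: "A \<in> borel_measurable borel" unfolding A_def by measurable
  have n: "integrable lborel (\<lambda>x. complex_of_real (std_normal_density x))" "(LBINT x. std_normal_density x) = 1"
    by (auto intro!: integrable_of_real integrable_normal_density integral_normal_density)
  have eq: "(LBINT x. inv_fourier f x * cnj (inv_fourier k x) * complex_of_real (exp (- (\<delta> n * x)\<^sup>2 / 2)))
     = 1 / (2 * pi) * (LBINT v. complex_of_real (std_normal_density v) * A (- (\<delta> n * v)))" for n
  proof -
    have int: "integrable (lborel \<Otimes>\<^sub>M lborel) (\<lambda>(v, \<eta>). complex_of_real (std_normal_density v) * (f (\<eta> + \<delta> n * v) * cnj (k \<eta>)))"
    proof (rule integrableI_bounded)
      have "(\<integral>\<^sup>+p. ennreal (cmod (case p of (v, \<eta>) \<Rightarrow> complex_of_real (std_normal_density v) * (f (\<eta> + \<delta> n * v) * cnj (k \<eta>)))) \<partial>(lborel \<Otimes>\<^sub>M lborel))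
        = (\<integral>\<^sup>+v. \<integral>\<^sup>+\<eta>. ennreal (cmod (complex_of_real (std_normal_density v) * (f (\<eta> + \<delta> n * v) * cnj (k \<eta>)))) \<partial>lborel \<partial>lborel)"
        by (subst lborel.nn_integral_fst[symmetric]) auto
      also have "\<dots> = (\<integral>\<^sup>+v. ennreal (std_normal_density v) * (\<integral>\<^sup>+\<eta>. ennreal (cmod (f (\<eta> - (- (\<delta> n * v))) * cnj (k \<eta>))) \<partial>lborel) \<partial>lborel)"
        by (intro nn_integral_cong) (simp add: norm_mult ennreal_mult normal_density_nonneg nn_integral_cmult)
      also have "\<dots> \<le> (\<integral>\<^sup>+v. ennreal (std_normal_density v) * ennreal C \<partial>lborel)"
        by (intro nn_integral_mono mult_left_mono nn) simp
      also have "\<dots> = (\<integral>\<^sup>+v. ennreal (std_normal_density v) \<partial>lborel) * ennreal C"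
        by (rule nn_integral_multc) simp
      also have "(\<integral>\<^sup>+v. ennreal (std_normal_density v) \<partial>lborel) = 1"
        using n by (subst nn_integral_eq_integral) (auto intro: integrable_normal_density)
      also have "1 * ennreal C < \<infinity>" by simp
      finally show "(\<integral>\<^sup>+p. ennreal (cmod (case p of (v, \<eta>) \<Rightarrow> complex_of_real (std_normal_density v) * (f (\<eta> + \<delta> n * v) * cnj (k \<eta>)))) \<partial>(lborel \<Otimes>\<^sub>M lborel)) < \<infinity>" .
    qed measurable
    have "(LBINT \<eta>. cnj (k \<eta>) * (LBINT v. complex_of_real (std_normal_density v) * f (\<eta> + \<delta> n * v)))
       = (LBINT \<eta>. (LBINT v. complex_of_real (std_normal_density v) * (f (\<eta> + \<delta> n * v) * cnj (k \<eta>))))"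
    proof (intro Bochner_Integration.integral_cong refl)
      fix \<eta>
      have "(LBINT v. complex_of_real (std_normal_density v) * (f (\<eta> + \<delta> n * v) * cnj (k \<eta>)))
        = (LBINT v. cnj (k \<eta>) * (complex_of_real (std_normal_density v) * f (\<eta> + \<delta> n * v)))"
        by (intro Bochner_Integration.integral_cong refl) simp
      then show "cnj (k \<eta>) * (LBINT v. complex_of_real (std_normal_density v) * f (\<eta> + \<delta> n * v))
        = (LBINT v. complex_of_real (std_normal_density v) * (f (\<eta> + \<delta> n * v) * cnj (k \<eta>)))" by simp
    qed
    also have "\<dots> = (LBINT v. (LBINT \<eta>. complex_of_real (std_normal_density v) * (f (\<eta> + \<delta> n * v) * cnj (k \<eta>))))"
      by (rule lborel_pair.Fubini_integral[OF int])
    also have "\<dots> = (LBINT v. complex_of_real (std_normal_density v) * A (- (\<delta> n * v)))"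
      by (simp add: A_def)
    finally show ?thesis unfolding plancherel_gaussian[OF f(1) k(1) \<delta>(1)] by simp
  qed
  have "(\<lambda>n. LBINT v. complex_of_real (std_normal_density v) * A (- (\<delta> n * v))) \<longlonglongrightarrow> (LBINT v. complex_of_real (std_normal_density v) * A 0)"
  proof (rule integral_dominated_convergence[where w = "\<lambda>v. std_normal_density v * C"])
    show "integrable lborel (\<lambda>v. std_normal_density v * C)" by (auto intro: integrable_normal_density)
    show "AE v in lborel. (\<lambda>n. complex_of_real (std_normal_density v) * A (- (\<delta> n * v))) \<longlonglongrightarrow> complex_of_real (std_normal_density v) * A 0"
    proof (intro AE_I2 tendsto_intros Alim)
      fix v :: real
      show "(\<lambda>n. - (\<delta> n * v)) \<longlonglongrightarrow> 0" using tendsto_minus[OF tendsto_mult_right[OF \<delta>(2), of v]] by simp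
    qed
    show "AE v in lborel. norm (complex_of_real (std_normal_density v) * A (- (\<delta> n * v))) \<le> std_normal_density v * C" for n
      by (intro AE_I2) (auto simp: norm_mult normal_density_nonneg intro!: mult_left_mono Abound)
  qed measurable
  also have "(LBINT v. complex_of_real (std_normal_density v) * A 0) = A 0"
    using n by simp
  finally have "(\<lambda>n. LBINT v. complex_of_real (std_normal_density v) * A (- (\<delta> n * v))) \<longlonglongrightarrow> A 0" .
  then show ?thesis unfolding eq by (intro tendsto_intros) (simp add: A_def)
qed

text \<open>Fatou's lemma, applied to the Gaussian means of \<open>\<bar>inv_fourier f\<bar>\<^sup>2\<close>, which converge by
  \<open>plancherel_gaussian_tendsto\<close>.\<close>

lemma inv_fourier_L2:
  assumes f: "integrable lborel f" "f \<in> L2 lborel"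
  shows "inv_fourier f \<in> L2 lborel"
proof -
  note [measurable] = measurable_inv_fourier[OF f(1)]
  define \<delta> where "\<delta> = (\<lambda>n. 1 / real (Suc n))"
  have \<delta>: "\<And>n. \<delta> n > 0" "\<delta> \<longlonglongrightarrow> 0"
    using LIMSEQ_inverse_real_of_nat by (auto simp: \<delta>_def inverse_eq_divide)
  define I where "I = (\<lambda>n. LBINT x. inv_fourier f x * cnj (inv_fourier f x) * complex_of_real (exp (- (\<delta> n * x)\<^sup>2 / 2)))"
  have lim: "I \<longlonglongrightarrow> 1 / (2 * pi) * (LBINT \<eta>. f \<eta> * cnj (f \<eta>))"
    unfolding I_def by (rule plancherel_gaussian_tendsto[OF f f \<delta>])
  have "(\<integral>\<^sup>+x. ennreal ((cmod (inv_fourier f x))\<^sup>2 * exp (- (\<delta> n * x)\<^sup>2 / 2)) \<partial>lborel) = ennreal (cmod (I n))" for n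
  proof -
    have "integrable lborel (\<lambda>x. complex_of_real (exp (- (\<delta> n * x)\<^sup>2 / 2)) * (inv_fourier f x * cnj (inv_fourier f x)))"
    proof (rule integrable_mult_bounded_complex[OF gaussian_fourier(1)[OF \<delta>(1)]])
      show "cmod (inv_fourier f x * cnj (inv_fourier f x)) \<le> ((LBINT \<xi>. cmod (f \<xi>)) / (2 * pi)) * ((LBINT \<xi>. cmod (f \<xi>)) / (2 * pi))" for x
        unfolding norm_mult complex_mod_cnj by (intro mult_mono inv_fourier_bound[OF f(1)]) (auto intro!: divide_nonneg_pos integral_nonneg_AE)
    qed measurable
    also have "(\<lambda>x. complex_of_real (exp (- (\<delta> n * x)\<^sup>2 / 2)) * (inv_fourier f x * cnj (inv_fourier f x)))
        = (\<lambda>x. complex_of_real ((cmod (inv_fourier f x))\<^sup>2 * exp (- (\<delta> n * x)\<^sup>2 / 2)))"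
      by (simp add: complex_norm_square mult.commute del: of_real_power)
    finally have int: "integrable lborel (\<lambda>x. (cmod (inv_fourier f x))\<^sup>2 * exp (- (\<delta> n * x)\<^sup>2 / 2))"
      by (simp only: complex_of_real_integrable_eq)
    have "I n = (LBINT x. complex_of_real ((cmod (inv_fourier f x))\<^sup>2 * exp (- (\<delta> n * x)\<^sup>2 / 2)))"
      unfolding I_def by (simp add: complex_norm_square del: of_real_power)
    also have "\<dots> = complex_of_real (LBINT x. ((cmod (inv_fourier f x))\<^sup>2 * exp (- (\<delta> n * x)\<^sup>2 / 2)))"
      by (rule integral_complex_of_real)
    finally have "cmod (I n) = (LBINT x. ((cmod (inv_fourier f x))\<^sup>2 * exp (- (\<delta> n * x)\<^sup>2 / 2)))"
      by (simp add: integral_nonneg_AE)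
    then show ?thesis by (subst nn_integral_eq_integral[OF int]) auto
  qed
  moreover have "liminf (\<lambda>n. ennreal (cmod (I n))) = ennreal (cmod (1 / (2 * pi) * (LBINT \<eta>. f \<eta> * cnj (f \<eta>))))"
    by (intro lim_imp_Liminf tendsto_ennrealI tendsto_norm lim) simp
  ultimately have "liminf (\<lambda>n. \<integral>\<^sup>+x. ennreal ((cmod (inv_fourier f x))\<^sup>2 * exp (- (\<delta> n * x)\<^sup>2 / 2)) \<partial>lborel) < \<infinity>"
    by simp
  moreover have "L2_norm_sq lborel (inv_fourier f) = (\<integral>\<^sup>+x. liminf (\<lambda>n. ennreal ((cmod (inv_fourier f x))\<^sup>2 * exp (- (\<delta> n * x)\<^sup>2 / 2))) \<partial>lborel)"
    unfolding L2_norm_sq_def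
  proof (intro nn_integral_cong)
    fix x
    have "(\<lambda>n. ennreal ((cmod (inv_fourier f x))\<^sup>2 * exp (- (\<delta> n * x)\<^sup>2 / 2))) \<longlonglongrightarrow> ennreal ((cmod (inv_fourier f x))\<^sup>2 * exp (- (0 * x)\<^sup>2 / 2))"
      by (intro tendsto_ennrealI tendsto_intros \<delta>; simp)
    from lim_imp_Liminf[OF sequentially_bot this] show "ennreal ((cmod (inv_fourier f x))\<^sup>2) = liminf (\<lambda>n. ennreal ((cmod (inv_fourier f x))\<^sup>2 * exp (- (\<delta> n * x)\<^sup>2 / 2)))"
      by simp
  qed
  ultimately show ?thesis
    using nn_integral_liminf[of "\<lambda>n x. ennreal ((cmod (inv_fourier f x))\<^sup>2 * exp (- (\<delta> n * x)\<^sup>2 / 2))" lborel]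
    by (auto simp: L2_def intro: order.strict_trans1)
qed

theorem plancherel_inner:
  assumes f: "integrable lborel f" "f \<in> L2 lborel" and k: "integrable lborel k" "k \<in> L2 lborel"
  shows "(LBINT x. inv_fourier f x * cnj (inv_fourier k x)) = 1 / (2 * pi) * (LBINT \<eta>. f \<eta> * cnj (k \<eta>))"
proof -
  note [measurable] = measurable_inv_fourier[OF f(1)] measurable_inv_fourier[OF k(1)]
  define \<delta> where "\<delta> = (\<lambda>n. 1 / real (Suc n))"
  have \<delta>: "\<And>n. \<delta> n > 0" "\<delta> \<longlonglongrightarrow> 0"
    using LIMSEQ_inverse_real_of_nat by (auto simp: \<delta>_def inverse_eq_divide)
  have int: "integrable lborel (\<lambda>x. inv_fourier f x * cnj (inv_fourier k x))"
    by (intro L2_Cauchy_Schwarz inv_fourier_L2 f k)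
  have "(\<lambda>n. LBINT x. inv_fourier f x * cnj (inv_fourier k x) * complex_of_real (exp (- (\<delta> n * x)\<^sup>2 / 2)))
     \<longlonglongrightarrow> (LBINT x. inv_fourier f x * cnj (inv_fourier k x))"
  proof (rule integral_dominated_convergence[where w = "\<lambda>x. cmod (inv_fourier f x * cnj (inv_fourier k x))"])
    show "AE x in lborel. (\<lambda>n. inv_fourier f x * cnj (inv_fourier k x) * complex_of_real (exp (- (\<delta> n * x)\<^sup>2 / 2)))
       \<longlonglongrightarrow> inv_fourier f x * cnj (inv_fourier k x)"
    proof (intro AE_I2)
      fix x
      have "(\<lambda>n. inv_fourier f x * cnj (inv_fourier k x) * complex_of_real (exp (- (\<delta> n * x)\<^sup>2 / 2)))
       \<longlonglongrightarrow> inv_fourier f x * cnj (inv_fourier k x) * complex_of_real (exp (- (0 * x)\<^sup>2 / 2))"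
        by (intro tendsto_intros \<delta>; simp)
      then show "(\<lambda>n. inv_fourier f x * cnj (inv_fourier k x) * complex_of_real (exp (- (\<delta> n * x)\<^sup>2 / 2)))
       \<longlonglongrightarrow> inv_fourier f x * cnj (inv_fourier k x)" by simp
    qed
  qed (use integrable_norm[OF int] int in \<open>auto simp: norm_mult intro!: mult_left_le\<close>)
  with plancherel_gaussian_tendsto[OF f k \<delta>] show ?thesis by (rule LIMSEQ_unique[rotated])
qed

lemma L2_norm_sq_eq_inner:
  assumes "f \<in> L2 M"
  shows "L2_norm_sq M f = ennreal (Re (\<integral>x. f x * cnj (f x) \<partial>M))"
proof -
  have e: "(\<lambda>x. f x * cnj (f x)) = (\<lambda>x. complex_of_real ((cmod (f x))\<^sup>2))"
    by (simp add: complex_norm_square del: of_real_power)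
  have "integrable M (\<lambda>x. (cmod (f x))\<^sup>2)"
    using L2_Cauchy_Schwarz(1)[OF assms assms] unfolding e complex_of_real_integrable_eq .
  then show ?thesis
    unfolding e L2_norm_sq_def integral_complex_of_real by (simp add: nn_integral_eq_integral)
qed

theorem plancherel:
  assumes f: "integrable lborel f" "f \<in> L2 lborel"
  shows "L2_norm_sq lborel (inv_fourier f) = ennreal (1 / (2 * pi)) * L2_norm_sq lborel f"
  unfolding L2_norm_sq_eq_inner[OF f(2)] L2_norm_sq_eq_inner[OF inv_fourier_L2[OF f]] plancherel_inner[OF f f]
  by (subst ennreal_mult'[symmetric]) auto

subsection \<open>The transform of square integrable functions\<close>

definition truncate :: "real \<Rightarrow> (real \<Rightarrow> complex) \<Rightarrow> real \<Rightarrow> complex" where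
  "truncate R f = (\<lambda>\<xi>. indicator {- R..R} \<xi> * f \<xi>)"

lemma truncate_measurable [measurable (raw)]:
  "f \<in> borel_measurable borel \<Longrightarrow> truncate R f \<in> borel_measurable borel"
  unfolding truncate_def by measurable

lemma truncate_L2: "f \<in> L2 lborel \<Longrightarrow> truncate R f \<in> L2 lborel"
  using L2_measurable[of f lborel]
  by - (rule L2_mono[of f], auto simp: truncate_def split: split_indicator)

lemma L2_mult_integrable:
  assumes "f \<in> L2 M" "g \<in> L2 M"
  shows "integrable M (\<lambda>x. f x * g x)"
  using L2_Cauchy_Schwarz(1)[OF assms(1), of "\<lambda>x. cnj (g x)"] assms(2)
  by (simp add: L2_def L2_norm_sq_def)

lemma truncate_integrable:
  assumes "f \<in> L2 lborel"
  shows "integrable lborel (truncate R f)"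
proof -
  have "L2_norm_sq lborel (indicator {- R..R}) = (\<integral>\<^sup>+x. indicator {-R..R} x \<partial>lborel)"
    unfolding L2_norm_sq_def by (intro nn_integral_cong) (auto split: split_indicator)
  also have "\<dots> < \<infinity>" by (simp add: emeasure_lborel_Icc_eq)
  finally have "(indicator {- R..R} :: real \<Rightarrow> complex) \<in> L2 lborel" by (simp add: L2_def)
  from L2_mult_integrable[OF this assms] show ?thesis by (simp add: truncate_def)
qed

lemma truncate_tendsto:
  assumes f: "f \<in> L2 lborel"
  shows "((\<lambda>R. L2_norm_sq lborel (\<lambda>\<xi>. truncate R f \<xi> - f \<xi>)) \<longlongrightarrow> 0) at_top"
proof (rule tendsto_at_topI_sequentially)
  fix R :: "nat \<Rightarrow> real" assume R: "filterlim R at_top sequentially"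
  note [measurable] = L2_measurable[OF f]
  show "(\<lambda>n. L2_norm_sq lborel (\<lambda>\<xi>. truncate (R n) f \<xi> - f \<xi>)) \<longlonglongrightarrow> 0"
  proof (rule L2_dominated_tendsto_0[where w = "\<lambda>\<xi>. cmod (f \<xi>)"])
    show "(\<integral>\<^sup>+ x. ennreal ((cmod (f x))\<^sup>2) \<partial>lborel) < \<infinity>"
      using L2_finite[OF f] by (simp add: L2_norm_sq_def)
    show "AE x in lborel. (\<lambda>n. truncate (R n) f x - f x) \<longlonglongrightarrow> 0"
    proof (intro AE_I2 tendsto_eventually)
      fix x
      show "\<forall>\<^sub>F n in sequentially. truncate (R n) f x - f x = 0"
        using filterlim_at_top[THEN iffD1, OF R, rule_format, of "\<bar>x\<bar>"]
        by eventually_elim (auto simp: truncate_def abs_le_iff split: split_indicator)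
    qed
  qed (auto simp: truncate_def split: split_indicator)
qed

lemma plancherel_diff:
  assumes "integrable lborel f" "f \<in> L2 lborel" "integrable lborel k" "k \<in> L2 lborel"
  shows "L2_norm_sq lborel (\<lambda>x. inv_fourier f x - inv_fourier k x)
    = ennreal (1 / (2 * pi)) * L2_norm_sq lborel (\<lambda>\<xi>. f \<xi> - k \<xi>)"
proof -
  have "inv_fourier (\<lambda>\<xi>. f \<xi> - k \<xi>) = (\<lambda>x. inv_fourier f x - inv_fourier k x)"
    by (intro ext inv_fourier_diff assms)
  then show ?thesis using plancherel[of "\<lambda>\<xi>. f \<xi> - k \<xi>"] assms by (simp add: L2_diff)
qed

lemma plancherel_diff_le:
  assumes "integrable lborel f" "f \<in> L2 lborel" "integrable lborel k" "k \<in> L2 lborel"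
  shows "L2_norm_sq lborel (\<lambda>x. inv_fourier f x - inv_fourier k x) \<le> L2_norm_sq lborel (\<lambda>\<xi>. f \<xi> - k \<xi>)"
proof -
  have "ennreal (1 / (2 * pi)) \<le> 1" using pi_gt3 by simp
  from mult_right_mono[OF this, of "L2_norm_sq lborel (\<lambda>\<xi>. f \<xi> - k \<xi>)"]
  show ?thesis unfolding plancherel_diff[OF assms] by simp
qed

lemma is_inv_fourier_L2_alt:
  "is_inv_fourier_L2 f h \<longleftrightarrow> f \<in> L2 lborel \<and> h \<in> L2 lborel \<and>
     ((\<lambda>R. L2_norm_sq lborel (\<lambda>x. inv_fourier (truncate R f) x - h x)) \<longlongrightarrow> 0) at_top"
  unfolding is_inv_fourier_L2_def truncate_def ..

text \<open>On \<open>L\<^sup>1 \<inter> L\<^sup>2\<close> the transform contracts, which extends to limits in the mean; the constant \<open>4\<close> accounts for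
  two squared triangle inequalities.\<close>

lemma is_inv_fourier_L2_diff_le:
  assumes fh: "is_inv_fourier_L2 f h" and k: "integrable lborel k" "k \<in> L2 lborel"
  shows "L2_norm_sq lborel (\<lambda>x. inv_fourier k x - h x) \<le> 4 * L2_norm_sq lborel (\<lambda>\<xi>. k \<xi> - f \<xi>)"
proof -
  have f: "f \<in> L2 lborel" and h: "h \<in> L2 lborel"
    and lim: "((\<lambda>R. L2_norm_sq lborel (\<lambda>x. inv_fourier (truncate R f) x - h x)) \<longlongrightarrow> 0) at_top"
    using fh by (auto simp: is_inv_fourier_L2_alt)
  note T = truncate_integrable[OF f] truncate_L2[OF f]
  note [measurable] = L2_measurable[OF f] L2_measurable[OF h] borel_measurable_integrable[OF k(1)]
    measurable_inv_fourier[OF k(1)] measurable_inv_fourier[OF T(1)]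
  show ?thesis
  proof (rule tendsto_lowerbound[where F = "at_top :: real filter"])
    have "((\<lambda>R. 2 * L2_norm_sq lborel (\<lambda>x. inv_fourier (truncate R f) x - h x) + 4 * L2_norm_sq lborel (\<lambda>\<xi>. truncate R f \<xi> - f \<xi>)
       + 4 * L2_norm_sq lborel (\<lambda>\<xi>. k \<xi> - f \<xi>)) \<longlongrightarrow> 0 + 0 + 4 * L2_norm_sq lborel (\<lambda>\<xi>. k \<xi> - f \<xi>)) at_top"
      by (intro tendsto_add tendsto_const ennreal_tendsto_0_mult lim truncate_tendsto f) auto
    then show "((\<lambda>R. 2 * L2_norm_sq lborel (\<lambda>x. inv_fourier (truncate R f) x - h x) + 4 * L2_norm_sq lborel (\<lambda>\<xi>. truncate R f \<xi> - f \<xi>)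
       + 4 * L2_norm_sq lborel (\<lambda>\<xi>. k \<xi> - f \<xi>)) \<longlongrightarrow> 4 * L2_norm_sq lborel (\<lambda>\<xi>. k \<xi> - f \<xi>)) at_top" by simp
    show "\<forall>\<^sub>F R in at_top. L2_norm_sq lborel (\<lambda>x. inv_fourier k x - h x)
       \<le> 2 * L2_norm_sq lborel (\<lambda>x. inv_fourier (truncate R f) x - h x) + 4 * L2_norm_sq lborel (\<lambda>\<xi>. truncate R f \<xi> - f \<xi>)
       + 4 * L2_norm_sq lborel (\<lambda>\<xi>. k \<xi> - f \<xi>)"
    proof (intro always_eventually allI)
      fix R
      have "L2_norm_sq lborel (\<lambda>x. inv_fourier k x - h x) \<le> 2 * L2_norm_sq lborel (\<lambda>x. inv_fourier k x - inv_fourier (truncate R f) x)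
         + 2 * L2_norm_sq lborel (\<lambda>x. inv_fourier (truncate R f) x - h x)"
        by (rule L2_norm_sq_diff_triangle) measurable
      also have "\<dots> \<le> 2 * L2_norm_sq lborel (\<lambda>\<xi>. k \<xi> - truncate R f \<xi>) + 2 * L2_norm_sq lborel (\<lambda>x. inv_fourier (truncate R f) x - h x)"
        by (intro add_mono mult_left_mono plancherel_diff_le k T) auto
      also have "\<dots> \<le> 2 * (2 * L2_norm_sq lborel (\<lambda>\<xi>. k \<xi> - f \<xi>) + 2 * L2_norm_sq lborel (\<lambda>\<xi>. f \<xi> - truncate R f \<xi>))
         + 2 * L2_norm_sq lborel (\<lambda>x. inv_fourier (truncate R f) x - h x)"
        by (intro add_mono mult_left_mono L2_norm_sq_diff_triangle order_refl) auto
      finally show "L2_norm_sq lborel (\<lambda>x. inv_fourier k x - h x)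
       \<le> 2 * L2_norm_sq lborel (\<lambda>x. inv_fourier (truncate R f) x - h x) + 4 * L2_norm_sq lborel (\<lambda>\<xi>. truncate R f \<xi> - f \<xi>)
       + 4 * L2_norm_sq lborel (\<lambda>\<xi>. k \<xi> - f \<xi>)"
        by (simp add: distrib_left mult.assoc[symmetric] L2_norm_sq_diff_commute[of _ f "truncate R f"] add_ac)
    qed
  qed auto
qed

lemma is_inv_fourier_L2_inner:
  assumes fh: "is_inv_fourier_L2 f h" and k: "integrable lborel k" "k \<in> L2 lborel"
  shows "(LBINT x. h x * cnj (inv_fourier k x)) = 1 / (2 * pi) * (LBINT \<xi>. f \<xi> * cnj (k \<xi>))"
proof (rule tendsto_unique[where F = "at_top :: real filter"])
  have f: "f \<in> L2 lborel" and h: "h \<in> L2 lborel"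
    and lim: "((\<lambda>R. L2_norm_sq lborel (\<lambda>x. inv_fourier (truncate R f) x - h x)) \<longlongrightarrow> 0) at_top"
    using fh by (auto simp: is_inv_fourier_L2_alt)
  note T = truncate_integrable[OF f] truncate_L2[OF f]
  show "((\<lambda>R. LBINT x. inv_fourier (truncate R f) x * cnj (inv_fourier k x)) \<longlongrightarrow> (LBINT x. h x * cnj (inv_fourier k x))) at_top"
    by (intro L2_inner_tendsto lim inv_fourier_L2 T h k)
  show "((\<lambda>R. LBINT x. inv_fourier (truncate R f) x * cnj (inv_fourier k x)) \<longlongrightarrow> 1 / (2 * pi) * (LBINT \<xi>. f \<xi> * cnj (k \<xi>))) at_top"
    unfolding plancherel_inner[OF T k]
    by (intro tendsto_mult tendsto_const L2_inner_tendsto truncate_tendsto T f k)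
qed simp

text \<open>The truncations in the definition may be replaced by any approximation whose transforms are
  known to converge.\<close>

lemma is_inv_fourier_L2I:
  assumes f: "f \<in> L2 lborel" and h: "h \<in> L2 lborel" and F: "F \<noteq> bot"
    and k: "\<forall>\<^sub>F n in F. integrable lborel (k n) \<and> k n \<in> L2 lborel"
    and kf: "((\<lambda>n. L2_norm_sq lborel (\<lambda>\<xi>. k n \<xi> - f \<xi>)) \<longlongrightarrow> 0) F"
    and kh: "((\<lambda>n. L2_norm_sq lborel (\<lambda>x. inv_fourier (k n) x - h x)) \<longlongrightarrow> 0) F"
  shows "is_inv_fourier_L2 f h"
  unfolding is_inv_fourier_L2_alt
proof (intro conjI f h)
  note T = truncate_integrable[OF f] truncate_L2[OF f]
  note [measurable] = L2_measurable[OF f] L2_measurable[OF h] measurable_inv_fourier[OF T(1)]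
  have "L2_norm_sq lborel (\<lambda>x. inv_fourier (truncate R f) x - h x) \<le> 4 * L2_norm_sq lborel (\<lambda>\<xi>. truncate R f \<xi> - f \<xi>)" for R
  proof (rule tendsto_lowerbound[OF _ _ F])
    have "((\<lambda>n. 2 * L2_norm_sq lborel (\<lambda>x. inv_fourier (k n) x - h x) + 4 * L2_norm_sq lborel (\<lambda>\<xi>. k n \<xi> - f \<xi>)
       + 4 * L2_norm_sq lborel (\<lambda>\<xi>. truncate R f \<xi> - f \<xi>)) \<longlongrightarrow> 0 + 0 + 4 * L2_norm_sq lborel (\<lambda>\<xi>. truncate R f \<xi> - f \<xi>)) F"
      by (intro tendsto_add tendsto_const ennreal_tendsto_0_mult kh kf) auto
    then show "((\<lambda>n. 2 * L2_norm_sq lborel (\<lambda>x. inv_fourier (k n) x - h x) + 4 * L2_norm_sq lborel (\<lambda>\<xi>. k n \<xi> - f \<xi>)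
       + 4 * L2_norm_sq lborel (\<lambda>\<xi>. truncate R f \<xi> - f \<xi>)) \<longlongrightarrow> 4 * L2_norm_sq lborel (\<lambda>\<xi>. truncate R f \<xi> - f \<xi>)) F" by simp
    show "\<forall>\<^sub>F n in F. L2_norm_sq lborel (\<lambda>x. inv_fourier (truncate R f) x - h x)
       \<le> 2 * L2_norm_sq lborel (\<lambda>x. inv_fourier (k n) x - h x) + 4 * L2_norm_sq lborel (\<lambda>\<xi>. k n \<xi> - f \<xi>)
       + 4 * L2_norm_sq lborel (\<lambda>\<xi>. truncate R f \<xi> - f \<xi>)"
      using k
    proof eventually_elim
      case (elim n)
      then have kn: "integrable lborel (k n)" "k n \<in> L2 lborel" by auto
      note [measurable] = borel_measurable_integrable[OF kn(1)] measurable_inv_fourier[OF kn(1)]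
      have "L2_norm_sq lborel (\<lambda>x. inv_fourier (truncate R f) x - h x)
         \<le> 2 * L2_norm_sq lborel (\<lambda>x. inv_fourier (truncate R f) x - inv_fourier (k n) x)
         + 2 * L2_norm_sq lborel (\<lambda>x. inv_fourier (k n) x - h x)"
        by (rule L2_norm_sq_diff_triangle) measurable
      also have "\<dots> \<le> 2 * L2_norm_sq lborel (\<lambda>\<xi>. truncate R f \<xi> - k n \<xi>) + 2 * L2_norm_sq lborel (\<lambda>x. inv_fourier (k n) x - h x)"
        by (intro add_mono mult_left_mono plancherel_diff_le kn T) auto
      also have "\<dots> \<le> 2 * (2 * L2_norm_sq lborel (\<lambda>\<xi>. truncate R f \<xi> - f \<xi>) + 2 * L2_norm_sq lborel (\<lambda>\<xi>. f \<xi> - k n \<xi>))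
         + 2 * L2_norm_sq lborel (\<lambda>x. inv_fourier (k n) x - h x)"
        by (intro add_mono mult_left_mono L2_norm_sq_diff_triangle order_refl) auto
      finally show "L2_norm_sq lborel (\<lambda>x. inv_fourier (truncate R f) x - h x)
       \<le> 2 * L2_norm_sq lborel (\<lambda>x. inv_fourier (k n) x - h x) + 4 * L2_norm_sq lborel (\<lambda>\<xi>. k n \<xi> - f \<xi>)
       + 4 * L2_norm_sq lborel (\<lambda>\<xi>. truncate R f \<xi> - f \<xi>)"
        by (simp add: distrib_left mult.assoc[symmetric] L2_norm_sq_diff_commute[of _ f "k n"] add_ac)
    qed
  qed
  then show "((\<lambda>R. L2_norm_sq lborel (\<lambda>x. inv_fourier (truncate R f) x - h x)) \<longlongrightarrow> 0) at_top"
    by (intro ennreal_tendsto_0_I[OF ennreal_tendsto_0_mult[OF truncate_tendsto[OF f], of 4]] always_eventually) auto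
qed

text \<open>Inversion by duality: both sides have the same inner product with every \<open>p\<close> in
  \<open>L\<^sup>1 \<inter> L\<^sup>2\<close>, in particular with the truncations of their difference.\<close>

lemma fourier_inversion_AE:
  assumes q: "integrable lborel q" "q \<in> L2 lborel"
    and Q: "integrable lborel (\<lambda>\<xi>. inv_fourier q (- \<xi>))"
  shows "AE x in lborel. 2 * pi * inv_fourier (\<lambda>\<xi>. inv_fourier q (- \<xi>)) x = q x"
proof -
  define k where "k = (\<lambda>\<xi>. inv_fourier q (- \<xi>))"
  have refl_int: "(LBINT \<xi>. F (- \<xi>)) = (LBINT \<xi>. F \<xi>)" for F :: "real \<Rightarrow> complex"
    using lborel_integral_real_affine[of "-1" F 0] by simp
  have reflnn: "(\<integral>\<^sup>+\<xi>. F (- \<xi>) \<partial>lborel) = (\<integral>\<^sup>+\<xi>. F \<xi> \<partial>lborel)" if "F \<in> borel_measurable borel" for F :: "real \<Rightarrow> ennreal"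
    using nn_integral_real_affine[of F "-1" 0] that by simp
  have iQ: "integrable lborel k" using Q by (simp add: k_def)
  have k2: "k \<in> L2 lborel"
  proof -
    note [measurable] = measurable_inv_fourier[OF q(1)]
    have "L2_norm_sq lborel k = L2_norm_sq lborel (inv_fourier q)"
      unfolding L2_norm_sq_def k_def by (rule reflnn[of "\<lambda>x. ennreal ((cmod (inv_fourier q x))\<^sup>2)"]) simp
    then show ?thesis using inv_fourier_L2[OF q] iQ by (simp add: L2_def)
  qed
  define d where "d = (\<lambda>x. 2 * pi * inv_fourier k x - q x)"
  have d2: "d \<in> L2 lborel" unfolding d_def by (intro L2_diff L2_cmult inv_fourier_L2 iQ k2 q)
  have dual: "(LBINT x. d x * cnj (p x)) = 0" if p: "integrable lborel p" "p \<in> L2 lborel" for p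
  proof -
    note [measurable] = borel_measurable_integrable[OF p(1)]
    have int: "integrable (lborel \<Otimes>\<^sub>M lborel) (\<lambda>(\<xi>, x). k \<xi> * cnj (p x) * cis (x * \<xi>))"
      using integrable_tensor[OF iQ, of "\<lambda>x. cnj (p x)" "\<lambda>(\<xi>, x). cis (x * \<xi>)"] p by (simp add: split_beta')
    have "(LBINT x. inv_fourier k x * cnj (p x)) = 1 / (2 * pi) * (LBINT x. LBINT \<xi>. k \<xi> * cnj (p x) * cis (x * \<xi>))"
    proof -
      have *: "inv_fourier k x * cnj (p x) = 1 / (2 * pi) * (LBINT \<xi>. k \<xi> * cnj (p x) * cis (x * \<xi>))" for x
      proof -
        have "(LBINT \<xi>. k \<xi> * cnj (p x) * cis (x * \<xi>)) = (LBINT \<xi>. cnj (p x) * (k \<xi> * cis (x * \<xi>)))"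
          by (rule Bochner_Integration.integral_cong) (simp_all add: mult_ac)
        then show ?thesis by (simp add: inv_fourier_def)
      qed
      show ?thesis unfolding * integral_mult_right_zero ..
    qed
    also have "(LBINT x. LBINT \<xi>. k \<xi> * cnj (p x) * cis (x * \<xi>)) = (LBINT \<xi>. LBINT x. k \<xi> * cnj (p x) * cis (x * \<xi>))"
      by (rule lborel_pair.Fubini_integral[OF int])
    also have "\<dots> = (LBINT \<xi>. k \<xi> * (2 * pi * cnj (inv_fourier p (- \<xi>))))"
    proof (intro Bochner_Integration.integral_cong refl)
      fix \<xi>
      have "(LBINT x. k \<xi> * cnj (p x) * cis (x * \<xi>)) = (LBINT x. k \<xi> * cnj (p x * cis (- \<xi> * x)))"
        by (rule Bochner_Integration.integral_cong) (simp_all add: cis_cnj mult.commute mult.left_commute)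
      also have "\<dots> = k \<xi> * cnj (LBINT x. p x * cis (- \<xi> * x))"
        by (simp only: integral_mult_right_zero Bochner_Integration.integral_cnj)
      finally show "(LBINT x. k \<xi> * cnj (p x) * cis (x * \<xi>)) = k \<xi> * (2 * pi * cnj (inv_fourier p (- \<xi>)))"
        by (simp add: inv_fourier_def)
    qed
    also have "\<dots> = 2 * pi * (LBINT \<xi>. inv_fourier q (- \<xi>) * cnj (inv_fourier p (- \<xi>)))"
      unfolding k_def integral_mult_right_zero[symmetric] by (intro Bochner_Integration.integral_cong refl) simp
    also have "(LBINT \<xi>. inv_fourier q (- \<xi>) * cnj (inv_fourier p (- \<xi>))) = 1 / (2 * pi) * (LBINT \<eta>. q \<eta> * cnj (p \<eta>))"
      unfolding refl_int[of "\<lambda>\<xi>. inv_fourier q \<xi> * cnj (inv_fourier p \<xi>)"] by (rule plancherel_inner[OF q p])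
    finally have eq: "2 * pi * (LBINT x. inv_fourier k x * cnj (p x)) = (LBINT \<eta>. q \<eta> * cnj (p \<eta>))" by simp
    have "(LBINT x. d x * cnj (p x)) = (LBINT x. 2 * pi * (inv_fourier k x * cnj (p x)) - q x * cnj (p x))"
      by (intro Bochner_Integration.integral_cong refl) (simp add: d_def algebra_simps)
    also have "\<dots> = 2 * pi * (LBINT x. inv_fourier k x * cnj (p x)) - (LBINT \<eta>. q \<eta> * cnj (p \<eta>))"
      by (subst Bochner_Integration.integral_diff)
         (auto intro!: L2_Cauchy_Schwarz(1) inv_fourier_L2 iQ k2 q p integrable_mult_right)
    finally show ?thesis using eq by simp
  qed
  have 0: "L2_norm_sq lborel (truncate R d) = 0" for R
  proof -
    have "(LBINT x. truncate R d x * cnj (truncate R d x)) = (LBINT x. d x * cnj (truncate R d x))"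
      by (intro Bochner_Integration.integral_cong refl) (auto simp: truncate_def split: split_indicator)
    also have "\<dots> = 0" by (rule dual[OF truncate_integrable[OF d2] truncate_L2[OF d2]])
    finally show ?thesis using L2_norm_sq_eq_inner[OF truncate_L2[OF d2, of R]] by simp
  qed
  have [measurable]: "d \<in> borel_measurable borel" using d2 by (auto simp: L2_def)
  have "L2_norm_sq lborel d \<le> 2 * 0"
    by (rule L2_norm_sq_limit_le[OF truncate_tendsto[OF d2]]) (auto simp: 0)
  then have "AE x in lborel. ennreal ((cmod (d x))\<^sup>2) = 0"
    by (simp add: L2_norm_sq_def nn_integral_0_iff_AE)
  then show ?thesis by eventually_elim (simp add: d_def k_def)
qed

section \<open>Almost everywhere convergent subsequences\<close>

text \<open>Almost everywhere the distances of consecutive terms are eventually dominated by a geometric series, because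
  the sum of their squares with weights \<open>4\<^sup>n\<close> is integrable.\<close>

lemma L2_Cauchy_fast_AE_convergent:
  assumes [measurable]: "\<And>n. f n \<in> borel_measurable M"
    and d: "\<And>n. L2_norm_sq M (\<lambda>x. f (Suc n) x - f n x) \<le> ennreal ((1/8) ^ n)"
  shows "AE x in M. convergent (\<lambda>n. f n x)"
proof -
  have "(\<integral>\<^sup>+x. (\<Sum>n. ennreal (4 ^ n * (cmod (f (Suc n) x - f n x))\<^sup>2)) \<partial>M) = (\<Sum>n. \<integral>\<^sup>+x. ennreal (4 ^ n * (cmod (f (Suc n) x - f n x))\<^sup>2) \<partial>M)"
    by (rule nn_integral_suminf) measurable
  also have "\<dots> = (\<Sum>n. ennreal (4 ^ n) * L2_norm_sq M (\<lambda>x. f (Suc n) x - f n x))"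
    unfolding L2_norm_sq_def by (simp add: ennreal_mult nn_integral_cmult)
  also have "\<dots> \<le> (\<Sum>n. ennreal (4 ^ n) * ennreal ((1/8) ^ n))"
    by (intro suminf_le mult_left_mono d) auto
  also have "\<dots> = (\<Sum>n. ennreal ((1/2) ^ n))"
    by (simp flip: ennreal_mult power_mult_distrib)
  also have "\<dots> = ennreal (\<Sum>n. (1/2) ^ n)"
    by (rule suminf_ennreal2) (auto intro!: summable_geometric)
  also have "\<dots> < \<infinity>" by simp
  finally have "AE x in M. (\<Sum>n. ennreal (4 ^ n * (cmod (f (Suc n) x - f n x))\<^sup>2)) \<noteq> \<infinity>"
    by (intro nn_integral_PInf_AE) auto
  then show ?thesis
  proof eventually_elim
    case (elim x)
    have s: "summable (\<lambda>n. 4 ^ n * (cmod (f (Suc n) x - f n x))\<^sup>2)"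
      by (rule summable_suminf_not_top) (use elim in auto)
    have "(\<lambda>n. 4 ^ n * (cmod (f (Suc n) x - f n x))\<^sup>2) \<longlonglongrightarrow> 0" by (rule summable_LIMSEQ_zero[OF s])
    then have "\<forall>\<^sub>F n in sequentially. 4 ^ n * (cmod (f (Suc n) x - f n x))\<^sup>2 < 1"
      by (rule order_tendstoD) simp
    \<comment> \<open>\<open>4\<^sup>n \<bar>d\<^sub>n\<bar>\<^sup>2 < 1\<close> means \<open>\<bar>d\<^sub>n\<bar> < 2\<^bsup>-n\<^esup>\<close>.\<close>
    then have "\<forall>\<^sub>F n in sequentially. norm (f (Suc n) x - f n x) \<le> (1/2) ^ n"
    proof eventually_elim
      case (elim n)
      have "(2 ^ n * cmod (f (Suc n) x - f n x))\<^sup>2 = 4 ^ n * (cmod (f (Suc n) x - f n x))\<^sup>2"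
        by (simp add: power_mult_distrib power2_eq_square flip: power_mult_distrib)
      with elim have "(2 ^ n * cmod (f (Suc n) x - f n x))\<^sup>2 < 1\<^sup>2" by simp
      then have "2 ^ n * cmod (f (Suc n) x - f n x) < 1" by (rule power2_less_imp_less) simp
      then show ?case by (simp add: power_one_over field_simps)
    qed
    then have "summable (\<lambda>n. f (Suc n) x - f n x)"
      by (rule summable_comparison_test_ev) (auto intro!: summable_geometric)
    then have "convergent (\<lambda>n. \<Sum>i<n. f (Suc i) x - f i x)"
      by (simp add: summable_iff_convergent)
    then have "convergent (\<lambda>n. f n x - f 0 x)" by (simp add: sum_lessThan_telescope[of "\<lambda>n. f n x"])
    then show ?case using convergent_add_const_right_iff[of "\<lambda>n. f n x" "- f 0 x"] by simp
  qed
qed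

lemma L2_Cauchy_AE_subseq:
  assumes [measurable]: "\<And>n. f n \<in> borel_measurable M"
    and C: "\<And>e::real. e > 0 \<Longrightarrow> \<exists>N. \<forall>m\<ge>N. \<forall>n\<ge>N. L2_norm_sq M (\<lambda>x. f m x - f n x) \<le> ennreal e"
  obtains r :: "nat \<Rightarrow> nat" and g where "strict_mono r" "g \<in> borel_measurable M" "AE x in M. (\<lambda>n. f (r n) x) \<longlonglongrightarrow> g x"
proof -
  have "\<forall>k. \<exists>N. \<forall>m\<ge>N. \<forall>n\<ge>N. L2_norm_sq M (\<lambda>x. f m x - f n x) \<le> ennreal ((1/8)^k)"
    by (intro allI C) simp
  from choice[OF this] obtain N where
    N: "\<And>k m n. m \<ge> N k \<Longrightarrow> n \<ge> N k \<Longrightarrow> L2_norm_sq M (\<lambda>x. f m x - f n x) \<le> ennreal ((1/8)^k)"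
    by blast
  define r where "r = rec_nat (N 0) (\<lambda>k x. max (Suc x) (N (Suc k)))"
  have r: "r 0 = N 0" "r (Suc k) = max (Suc (r k)) (N (Suc k))" for k by (auto simp: r_def)
  have sm: "strict_mono r" by (rule strict_monoI_Suc) (simp add: r)
  have rN: "r k \<ge> N k" for k by (cases k) (auto simp: r)
  have "AE x in M. convergent (\<lambda>n. f (r n) x)"
  proof (rule L2_Cauchy_fast_AE_convergent)
    fix n
    have "r (Suc n) \<ge> N n" using rN[of n] by (simp add: r)
    then show "L2_norm_sq M (\<lambda>x. f (r (Suc n)) x - f (r n) x) \<le> ennreal ((1/8) ^ n)"
      using N rN by blast
  qed simp
  then have "AE x in M. (\<lambda>n. f (r n) x) \<longlonglongrightarrow> lim (\<lambda>n. f (r n) x)"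
    by eventually_elim (simp add: convergent_LIMSEQ_iff)
  with sm that[of r "\<lambda>x. lim (\<lambda>n. f (r n) x)"] show ?thesis by simp
qed

text \<open>Fatou's lemma.\<close>

lemma L2_norm_sq_AE_limit_le:
  assumes [measurable]: "\<And>n. f n \<in> borel_measurable M" "g \<in> borel_measurable M"
    and "AE x in M. (\<lambda>n. f n x) \<longlonglongrightarrow> g x" and le: "\<forall>\<^sub>F n in sequentially. L2_norm_sq M (f n) \<le> C"
  shows "L2_norm_sq M g \<le> C"
proof -
  have "L2_norm_sq M g = (\<integral>\<^sup>+x. liminf (\<lambda>n. ennreal ((cmod (f n x))\<^sup>2)) \<partial>M)"
    unfolding L2_norm_sq_def
  proof (intro nn_integral_cong_AE)
    show "AE x in M. ennreal ((cmod (g x))\<^sup>2) = liminf (\<lambda>n. ennreal ((cmod (f n x))\<^sup>2))"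
      using assms(3)
    proof eventually_elim
      case (elim x)
      then have "(\<lambda>n. ennreal ((cmod (f n x))\<^sup>2)) \<longlonglongrightarrow> ennreal ((cmod (g x))\<^sup>2)"
        by (intro tendsto_ennrealI tendsto_power tendsto_norm)
      from lim_imp_Liminf[OF sequentially_bot this] show ?case by simp
    qed
  qed
  also have "\<dots> \<le> liminf (\<lambda>n. L2_norm_sq M (f n))"
    unfolding L2_norm_sq_def by (rule nn_integral_liminf) measurable
  also have "\<dots> \<le> C"
    using le by (intro Liminf_le) auto
  finally show ?thesis .
qed

section \<open>Holomorphic functions in a strip\<close>

lemma exp_neg_abs_integrable:
  assumes c: "c > 0"
  shows "(\<integral>\<^sup>+x. ennreal (exp (- c * \<bar>x\<bar>)) \<partial>lborel) < \<infinity>"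
proof -
  have e: "(\<integral>\<^sup>+x. ennreal (exponential_density c x) \<partial>lborel) = 1"
    using prob_space.emeasure_space_1[OF prob_space_exponential_density[OF c]]
    by (simp add: emeasure_density)
  have "(\<integral>\<^sup>+x. ennreal (exp (- c * \<bar>x\<bar>)) \<partial>lborel)
     \<le> (\<integral>\<^sup>+x. ennreal (1/c) * (ennreal (exponential_density c x) + ennreal (exponential_density c (- x))) \<partial>lborel)"
  proof (intro nn_integral_mono)
    fix x :: real
    have "exp (- c * \<bar>x\<bar>) \<le> 1/c * (exponential_density c x + exponential_density c (- x))"
      using c by (cases "x < 0"; cases "x = 0") (auto simp: exponential_density_def field_simps)
    moreover have "exponential_density c y \<ge> 0" for y using c by (simp add: exponential_density_def)
    ultimately show "ennreal (exp (- c * \<bar>x\<bar>)) \<le> ennreal (1/c) * (ennreal (exponential_density c x) + ennreal (exponential_density c (- x)))"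
      using c by (simp flip: ennreal_plus ennreal_mult add: ennreal_leI)
  qed
  also have "\<dots> = ennreal (1/c) * (1 + (\<integral>\<^sup>+x. ennreal (exponential_density c (- x)) \<partial>lborel))"
    by (simp add: nn_integral_cmult nn_integral_add e)
  also have "(\<integral>\<^sup>+x. ennreal (exponential_density c (- x)) \<partial>lborel) = 1"
    using nn_integral_real_affine[of "\<lambda>x. ennreal (exponential_density c x)" "-1" 0] e by simp
  also have "ennreal (1/c) * (1 + 1) < \<infinity>" by (simp add: ennreal_mult_less_top)
  finally show ?thesis .
qed

lemma exp_neg_abs_L2:
  assumes c: "c > 0"
  shows "(\<lambda>x. complex_of_real (exp (- c * \<bar>x\<bar>))) \<in> L2 lborel"
proof -
  have "L2_norm_sq lborel (\<lambda>x. complex_of_real (exp (- c * \<bar>x\<bar>))) = (\<integral>\<^sup>+x. ennreal (exp (- (2 * c) * \<bar>x\<bar>)) \<partial>lborel)"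
    unfolding L2_norm_sq_def by (intro nn_integral_cong) (simp add: power2_eq_square flip: exp_add)
  with exp_neg_abs_integrable[of "2 * c"] c show ?thesis by (simp add: L2_def)
qed

text \<open>Square integrability with slightly larger weights leaves an exponentially decaying factor to spare.\<close>

lemma exp_weight_integrable:
  assumes w: "\<And>y. \<bar>y\<bar> < B \<Longrightarrow> (\<lambda>\<xi>. complex_of_real (exp (- y * \<xi>)) * g \<xi>) \<in> L2 lborel" and y: "\<bar>y\<bar> < B"
  shows "integrable lborel (\<lambda>\<xi>. complex_of_real (exp (- y * \<xi>)) * g \<xi>)"
proof -
  define d where "d = (B - \<bar>y\<bar>) / 2"
  have d: "d > 0" "\<bar>y + d\<bar> < B" "\<bar>y - d\<bar> < B" using y by (auto simp: d_def abs_if field_simps split: if_splits)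
  \<comment> \<open>\<open>\<bar>G \<xi>\<bar>\<close> is \<open>e\<^bsup>-y\<xi>\<^esup> \<bar>g \<xi>\<bar>\<close> times a factor of at least \<open>e\<^bsup>d\<bar>\<xi>\<bar>\<^esup>\<close>, and \<open>e\<^bsup>-d\<bar>\<xi>\<bar>\<^esup>\<close> is square integrable.\<close>
  define G where "G = (\<lambda>\<xi>. complex_of_real (exp (- (y + d) * \<xi>)) * g \<xi> + complex_of_real (exp (- (y - d) * \<xi>)) * g \<xi>)"
  have G: "G \<in> L2 lborel" unfolding G_def by (intro L2_add w d)
  note [measurable] = L2_measurable[OF w[OF y]] L2_measurable[OF G]
  show ?thesis
  proof (rule Bochner_Integration.integrable_bound)
    show "integrable lborel (\<lambda>\<xi>. complex_of_real (exp (- d * \<bar>\<xi>\<bar>)) * G \<xi>)"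
      by (rule L2_mult_integrable[OF exp_neg_abs_L2[OF d(1)] G])
    show "AE \<xi> in lborel. norm (complex_of_real (exp (- y * \<xi>)) * g \<xi>) \<le> norm (complex_of_real (exp (- d * \<bar>\<xi>\<bar>)) * G \<xi>)"
    proof (intro AE_I2)
      fix \<xi>
      have "G \<xi> = complex_of_real (exp (- (y + d) * \<xi>) + exp (- (y - d) * \<xi>)) * g \<xi>"
        by (simp add: G_def algebra_simps)
      then have G_eq: "norm (complex_of_real (exp (- d * \<bar>\<xi>\<bar>)) * G \<xi>) = exp (- d * \<bar>\<xi>\<bar>) * (exp (- (y + d) * \<xi>) + exp (- (y - d) * \<xi>)) * norm (g \<xi>)"
        by (simp add: norm_mult add_pos_pos flip: of_real_add)
      have "exp (- y * \<xi>) = exp (- d * \<bar>\<xi>\<bar>) * exp (- y * \<xi> + d * \<bar>\<xi>\<bar>)" by (simp flip: exp_add)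
      also have "exp (- y * \<xi> + d * \<bar>\<xi>\<bar>) \<le> exp (- (y + d) * \<xi>) + exp (- (y - d) * \<xi>)"
      proof (cases "\<xi> \<ge> 0")
        case True
        then have "exp (- y * \<xi> + d * \<bar>\<xi>\<bar>) = exp (- (y - d) * \<xi>)" by (simp add: algebra_simps)
        then show ?thesis by simp
      next
        case False
        then have "exp (- y * \<xi> + d * \<bar>\<xi>\<bar>) = exp (- (y + d) * \<xi>)" by (simp add: algebra_simps)
        then show ?thesis by simp
      qed
      finally have "exp (- y * \<xi>) \<le> exp (- d * \<bar>\<xi>\<bar>) * (exp (- (y + d) * \<xi>) + exp (- (y - d) * \<xi>))" by simp
      then show "norm (complex_of_real (exp (- y * \<xi>)) * g \<xi>) \<le> norm (complex_of_real (exp (- d * \<bar>\<xi>\<bar>)) * G \<xi>)"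
        unfolding G_eq by (simp add: norm_mult mult_right_mono)
    qed
  qed measurable
qed

lemma continuous_AE_eq:
  fixes f g :: "real \<Rightarrow> complex"
  assumes f: "continuous_on UNIV f" and g: "continuous_on UNIV g" and ae: "AE x in lborel. f x = g x"
  shows "f x = g x"
proof -
  have o: "open {x. f x \<noteq> g x}" by (rule open_Collect_neq[OF f g])
  have "emeasure lborel {x. f x \<noteq> g x} = 0"
    using ae o by (subst (asm) AE_iff_measurable[OF _ refl]) auto
  then have "{x. f x \<noteq> g x} \<in> null_sets lborel" using o by auto
  then have "negligible {x. f x \<noteq> g x}"
    by (simp add: negligible_iff_null_sets null_sets_completionI)
  then have "{x. f x \<noteq> g x} = {}" using open_not_negligible[OF o] by blast
  then show ?thesis by blast
qed

lemma emeasure_lborel_Ici: "emeasure lborel {a::real..} = \<infinity>"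
proof (rule ccontr)
  assume "emeasure lborel {a..} \<noteq> \<infinity>"
  then obtain n :: nat where n: "emeasure lborel {a..} < of_nat n"
    using ennreal_Ex_less_of_nat[of "emeasure lborel {a..}"] by (auto simp: less_top)
  have "emeasure lborel {a..a + real n} \<le> emeasure lborel {a..}" by (rule emeasure_mono) auto
  with n show False by (simp add: ennreal_of_nat_eq_real_of_nat)
qed

definition strip :: "real \<Rightarrow> complex set" where
  "strip B = {z. \<bar>Im z\<bar> < B}"

lemma open_strip: "open (strip B)"
  unfolding strip_def by (intro open_Collect_less continuous_intros)

lemma convex_strip: "convex (strip B)"
proof -
  have "strip B = {z. Im z < B} \<inter> {z. Im z > - B}" by (auto simp: strip_def abs_less_iff)
  then show ?thesis by (simp add: convex_Int convex_halfspace_Im_lt convex_halfspace_Im_gt)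
qed

text \<open>The vertical sides of a rectangle of half-width \<open>R\<close> contribute at most \<open>b R\<close> and \<open>b (- R)\<close>, and \<open>b\<close> is
  integrable; so the difference of the two horizontal integrals, which tends to a limit, tends to \<open>0\<close>.\<close>

lemma strip_integral_shift:
  assumes holo: "H holomorphic_on strip B" and y: "\<bar>y0\<bar> < B" "\<bar>y1\<bar> < B" "y0 \<le> y1"
    and int: "integrable lborel (\<lambda>x. H (Complex x y0))" "integrable lborel (\<lambda>x. H (Complex x y1))"
    and area: "(\<integral>\<^sup>+y. indicator {y0..y1} y * (\<integral>\<^sup>+x. ennreal (cmod (H (Complex x y))) \<partial>lborel) \<partial>lborel) < \<infinity>"
  shows "(LBINT x. H (Complex x y0)) = (LBINT x. H (Complex x y1))"
proof -
  obtain P where P: "\<And>z. z \<in> strip B \<Longrightarrow> (P has_field_derivative H z) (at z within strip B)"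
    using holomorphic_convex_primitive'[OF convex_strip open_strip holo] by blast
  have P': "(P has_field_derivative H (Complex x y)) (at (Complex x y))" if "\<bar>y\<bar> < B" for x y
    using P[of "Complex x y"] that open_strip at_within_open[of "Complex x y" "strip B"] by (auto simp: strip_def)
  have cH: "continuous_on (strip B) H" by (rule holomorphic_on_imp_continuous_on[OF holo])
  have hor: "(LBINT x. indicator {-R..R} x *\<^sub>R H (Complex x y)) = P (Complex R y) - P (Complex (-R) y)"
    if "\<bar>y\<bar> < B" "R \<ge> 0" for R y
  proof (rule integral_FTC_atLeastAtMost)
    fix x :: real
    have "((\<lambda>x. Complex x y) has_vector_derivative 1) (at x)"
      unfolding Complex_eq by (auto intro!: derivative_eq_intros)
    from field_vector_diff_chain_at[OF this P'[OF that(1)]]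
    show "((\<lambda>x. P (Complex x y)) has_vector_derivative H (Complex x y)) (at x within {- R..R})"
      by (simp add: o_def has_vector_derivative_at_within)
    show "continuous_on {- R..R} (\<lambda>x. H (Complex x y))"
      by (intro continuous_on_compose2[OF cH] continuous_intros) (use that in \<open>auto simp: strip_def\<close>)
  qed (use that in auto)
  define b where "b = (\<lambda>R. \<integral>\<^sup>+y. indicator {y0..y1} y * ennreal (cmod (H (Complex R y))) \<partial>lborel)"
  have ver: "ennreal (cmod (P (Complex R y1) - P (Complex R y0))) \<le> b R" for R
  proof -
    have cont: "continuous_on {y0..y1} (\<lambda>y. \<i> * H (Complex R y))"
      by (intro continuous_on_compose2[OF cH] continuous_intros) (use y in \<open>auto simp: strip_def\<close>)
    have "(LBINT y. indicator {y0..y1} y *\<^sub>R (\<i> * H (Complex R y))) = P (Complex R y1) - P (Complex R y0)"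
    proof (rule integral_FTC_atLeastAtMost)
      fix t :: real assume t: "y0 \<le> t" "t \<le> y1"
      have "((\<lambda>y. Complex R y) has_vector_derivative \<i>) (at t)"
        unfolding Complex_eq by (auto intro!: derivative_eq_intros)
      from field_vector_diff_chain_at[OF this P'[of t R]] t y
      show "((\<lambda>y. P (Complex R y)) has_vector_derivative \<i> * H (Complex R t)) (at t within {y0..y1})"
        by (simp add: o_def has_vector_derivative_at_within)
    qed (use y cont in auto)
    moreover have "integrable lborel (\<lambda>y. indicator {y0..y1} y *\<^sub>R (\<i> * H (Complex R y)))"
      using borel_integrable_compact[OF compact_Icc cont] by simp
    ultimately have "ennreal (cmod (P (Complex R y1) - P (Complex R y0)))
        \<le> (\<integral>\<^sup>+y. ennreal (cmod (indicator {y0..y1} y *\<^sub>R (\<i> * H (Complex R y)))) \<partial>lborel)"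
      using integral_norm_bound_ennreal by metis
    also have "\<dots> = b R" unfolding b_def by (intro nn_integral_cong) (auto simp: norm_mult split: split_indicator)
    finally show ?thesis .
  qed
  have bm: "(\<lambda>(R, y). indicator {y0..y1} y * ennreal (cmod (H (Complex R y)))) \<in> borel_measurable (lborel \<Otimes>\<^sub>M lborel)"
  proof -
    have "(\<lambda>p. indicator (UNIV \<times> {y0..y1}) p *\<^sub>R H (Complex (fst p) (snd p))) \<in> borel_measurable borel"
      by (intro borel_measurable_continuous_on_indicator closed_Times borel_closed continuous_on_compose2[OF cH] continuous_intros)
         (use y in \<open>auto simp: strip_def\<close>)
    then have "(\<lambda>p. indicator (UNIV \<times> {y0..y1}) p *\<^sub>R H (Complex (fst p) (snd p))) \<in> borel_measurable (lborel \<Otimes>\<^sub>M lborel)"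
      by (simp add: lborel_prod)
    then have "(\<lambda>p. ennreal (cmod (indicator (UNIV \<times> {y0..y1}) p *\<^sub>R H (Complex (fst p) (snd p))))) \<in> borel_measurable (lborel \<Otimes>\<^sub>M lborel)"
      by measurable
    then show ?thesis
      by (rule measurable_cong[THEN iffD1, rotated]) (auto split: split_indicator simp: split_beta')
  qed
  have [measurable]: "b \<in> borel_measurable borel"
    unfolding b_def using lborel.borel_measurable_nn_integral_fst[OF bm] by simp
  have b_int: "(\<integral>\<^sup>+R. b R \<partial>lborel) < \<infinity>"
  proof -
    have "(\<integral>\<^sup>+R. b R \<partial>lborel) = (\<integral>\<^sup>+y. \<integral>\<^sup>+R. indicator {y0..y1} y * ennreal (cmod (H (Complex R y))) \<partial>lborel \<partial>lborel)"
      unfolding b_def using lborel_pair.Fubini[OF bm] by simp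
    also have "\<dots> = (\<integral>\<^sup>+y. indicator {y0..y1} y * (\<integral>\<^sup>+x. ennreal (cmod (H (Complex x y))) \<partial>lborel) \<partial>lborel)"
    proof (intro nn_integral_cong)
      fix y :: real
      show "(\<integral>\<^sup>+R. indicator {y0..y1} y * ennreal (cmod (H (Complex R y))) \<partial>lborel)
         = indicator {y0..y1} y * (\<integral>\<^sup>+x. ennreal (cmod (H (Complex x y))) \<partial>lborel)"
        by (cases "y \<in> {y0..y1}") auto
    qed
    finally show ?thesis using area by simp
  qed
  define L where "L = (LBINT x. H (Complex x y0)) - (LBINT x. H (Complex x y1))"
  define D where "D = (\<lambda>R. (LBINT x. indicator {-R..R} x *\<^sub>R H (Complex x y0)) - (LBINT x. indicator {-R..R} x *\<^sub>R H (Complex x y1)))"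
  have lim: "((\<lambda>R. LBINT x. indicator {-R..R} x *\<^sub>R h x) \<longlongrightarrow> (LBINT x. h x)) at_top" if h: "integrable lborel h" for h :: "real \<Rightarrow> complex"
  proof (rule integral_dominated_convergence_at_top[where w = "\<lambda>x. cmod (h x)"])
    show "AE x in lborel. ((\<lambda>R. indicator {-R..R} x *\<^sub>R h x) \<longlongrightarrow> h x) at_top"
    proof (intro AE_I2 tendsto_eventually)
      fix x :: real
      show "\<forall>\<^sub>F R in at_top. indicator {-R..R} x *\<^sub>R h x = h x"
        using eventually_ge_at_top[of "\<bar>x\<bar>"] by eventually_elim (auto simp: abs_le_iff split: split_indicator)
    qed
  qed (use h in \<open>auto split: split_indicator\<close>)
  have "((\<lambda>R. D R) \<longlongrightarrow> L) at_top" unfolding D_def L_def by (intro tendsto_diff lim int)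
  then have Dlim: "((\<lambda>R. cmod (D R)) \<longlongrightarrow> cmod L) at_top" by (rule tendsto_norm)
  have Db: "ennreal (cmod (D R)) \<le> b R + b (- R)" if "R \<ge> 0" for R
  proof -
    have "D R = (P (Complex (-R) y1) - P (Complex (-R) y0)) - (P (Complex R y1) - P (Complex R y0))"
      unfolding D_def using hor[OF y(1) that] hor[OF y(2) that] by simp
    then have "cmod (D R) \<le> cmod (P (Complex R y1) - P (Complex R y0)) + cmod (P (Complex (-R) y1) - P (Complex (-R) y0))"
      using norm_triangle_ineq4[of "P (Complex (-R) y1) - P (Complex (-R) y0)" "P (Complex R y1) - P (Complex R y0)"]
      by (simp add: add.commute)
    then have "ennreal (cmod (D R)) \<le> ennreal (cmod (P (Complex R y1) - P (Complex R y0))) + ennreal (cmod (P (Complex (-R) y1) - P (Complex (-R) y0)))"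
      by (simp flip: ennreal_plus add: ennreal_leI)
    also have "\<dots> \<le> b R + b (- R)" by (intro add_mono ver)
    finally show ?thesis .
  qed
  \<comment> \<open>Otherwise \<open>b R + b (- R)\<close> would be at least \<open>\<bar>L\<bar>/2\<close> for all large \<open>R\<close>, hence not integrable.\<close>
  have "L = 0"
  proof (rule ccontr)
    assume "L \<noteq> 0"
    then have "\<forall>\<^sub>F R in at_top. cmod (D R) > cmod L / 2"
      using order_tendstoD(1)[OF Dlim, of "cmod L / 2"] by simp
    then obtain R0 where R0: "\<And>R. R \<ge> R0 \<Longrightarrow> cmod (D R) > cmod L / 2"
      by (auto simp: eventually_at_top_linorder)
    have "(\<integral>\<^sup>+R. ennreal (cmod L / 2) * indicator {max 0 R0..} R \<partial>lborel) \<le> (\<integral>\<^sup>+R. b R + b (- R) \<partial>lborel)"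
    proof (intro nn_integral_mono)
      fix R :: real
      show "ennreal (cmod L / 2) * indicator {max 0 R0..} R \<le> b R + b (- R)"
      proof (cases "R \<ge> max 0 R0")
        case True
        then have "ennreal (cmod L / 2) \<le> ennreal (cmod (D R))" using R0[of R] by (intro ennreal_leI) auto
        also have "\<dots> \<le> b R + b (- R)" using True by (intro Db) auto
        finally show ?thesis using True by simp
      qed simp
    qed
    also have "\<dots> = (\<integral>\<^sup>+R. b R \<partial>lborel) + (\<integral>\<^sup>+R. b (- R) \<partial>lborel)" by (simp add: nn_integral_add)
    also have "(\<integral>\<^sup>+R. b (- R) \<partial>lborel) = (\<integral>\<^sup>+R. b R \<partial>lborel)"
      using nn_integral_real_affine[of b "-1" 0] by simp
    also have "(\<integral>\<^sup>+R. b R \<partial>lborel) + (\<integral>\<^sup>+R. b R \<partial>lborel) < \<infinity>" using b_int by simp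
    finally have "(\<integral>\<^sup>+R. ennreal (cmod L / 2) * indicator {max 0 R0..} R \<partial>lborel) < \<infinity>" .
    moreover have "(\<integral>\<^sup>+R. ennreal (cmod L / 2) * indicator {max 0 R0..} R \<partial>lborel) = \<infinity>"
      using \<open>L \<noteq> 0\<close> by (simp add: nn_integral_cmult_indicator ennreal_mult_eq_top_iff emeasure_lborel_Ici)
    ultimately show False by simp
  qed
  then show ?thesis by (simp add: L_def)
qed

text \<open>Multiplication by \<open>exp (- z\<^sup>2/(n + 1))\<close> makes \<open>f\<close> integrable on every line without losing holomorphy. The
  transforms on the different lines then differ by exponential factors only, because the line of
  integration may be moved; the limit \<open>n \<rightarrow> \<infinity>\<close> exists in the mean on each line, with one common
  almost everywhere limit of a subsequence.\<close>

theorem paley_wiener_strip: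
  assumes B: "B > 0" and holo: "f holomorphic_on strip B"
    and bound: "\<And>y. \<bar>y\<bar> < B \<Longrightarrow> L2_norm_sq lborel (\<lambda>x. f (Complex x y)) \<le> C" and C: "C < \<infinity>"
  obtains g where "g \<in> borel_measurable borel"
    "\<And>y. \<bar>y\<bar> < B \<Longrightarrow> (\<lambda>\<xi>. complex_of_real (exp (- y * \<xi>)) * g \<xi>) \<in> L2 lborel"
    "\<And>x y. \<bar>y\<bar> < B \<Longrightarrow> f (Complex x y) = inv_fourier (\<lambda>\<xi>. complex_of_real (exp (- y * \<xi>)) * g \<xi>) x"
proof -
  define e where "e = (\<lambda>n z. exp (- (z::complex)\<^sup>2 / complex_of_real (real (Suc n))))"
  define F where "F = (\<lambda>y x. f (Complex x y))"
  define q where "q = (\<lambda>n y x. F y x * e n (Complex x y))"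
  have cont_F: "continuous_on UNIV (F y)" if "\<bar>y\<bar> < B" for y
    unfolding F_def
    by (intro continuous_on_compose2[OF holomorphic_on_imp_continuous_on[OF holo]] continuous_intros)
       (use that in \<open>auto simp: strip_def\<close>)
  have F2: "F y \<in> L2 lborel" if "\<bar>y\<bar> < B" for y
    using borel_measurable_continuous_onI[OF cont_F[OF that]] order.strict_trans1[OF bound[OF that] C]
    by (simp add: L2_def F_def)
  have cmod_e: "cmod (e n (Complex x y)) = exp (- x\<^sup>2 / real (Suc n)) * exp (y\<^sup>2 / real (Suc n))" for n x y
  proof -
    have "Re (- (Complex x y)\<^sup>2 / complex_of_real (real (Suc n))) = (y\<^sup>2 - x\<^sup>2) / real (Suc n)"
      by (simp only: Re_divide_of_real) (simp add: power2_eq_square)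
    then show ?thesis unfolding e_def norm_exp_eq_Re by (simp add: diff_divide_distrib flip: exp_add)
  qed
  have cmod_e_le: "cmod (e n (Complex x y)) \<le> exp (y\<^sup>2)" for n x y
  proof -
    have "y\<^sup>2 / real (Suc n) \<le> y\<^sup>2" by (simp add: divide_le_eq mult_le_cancel_left1 not_less)
    then have "exp (- x\<^sup>2 / real (Suc n)) * exp (y\<^sup>2 / real (Suc n)) \<le> 1 * exp (y\<^sup>2)"
      by (intro mult_mono) auto
    then show ?thesis by (simp add: cmod_e)
  qed
  have cont_e: "continuous_on UNIV (\<lambda>x. e n (Complex x y))" for n y
    unfolding e_def by (intro continuous_intros) (auto simp del: of_nat_Suc)
  have [measurable]: "(\<lambda>x. e n (Complex x y)) \<in> borel_measurable borel" for n y
    by (rule borel_measurable_continuous_onI[OF cont_e])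
  define E where "E = (\<lambda>n. \<integral>\<^sup>+x. ennreal (exp (2 * B\<^sup>2) * exp (- (2 / sqrt (real (Suc n)) * x)\<^sup>2 / 2)) \<partial>lborel)"
  have E: "E n < \<infinity>" for n
  proof -
    have "integrable lborel (\<lambda>x. complex_of_real (exp (- (2 / sqrt (real (Suc n)) * x)\<^sup>2 / 2)))"
      by (rule gaussian_fourier(1)) simp
    then have "integrable lborel (\<lambda>x. exp (2 * B\<^sup>2) * exp (- (2 / sqrt (real (Suc n)) * x)\<^sup>2 / 2))"
      unfolding complex_of_real_integrable_eq by (rule integrable_mult_right)
    then show ?thesis unfolding E_def by (subst nn_integral_eq_integral) auto
  qed
  have e_L2: "(\<lambda>x. e n (Complex x y)) \<in> L2 lborel" "L2_norm_sq lborel (\<lambda>x. e n (Complex x y)) \<le> E n" if "\<bar>y\<bar> < B" for n y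
  proof -
    have "(cmod (e n (Complex x y)))\<^sup>2 \<le> exp (2 * B\<^sup>2) * exp (- (2 / sqrt (real (Suc n)) * x)\<^sup>2 / 2)" for x
    proof -
      have "y\<^sup>2 \<le> B\<^sup>2" using that by (intro power2_le_iff_abs_le[THEN iffD2]) auto
      moreover have "y\<^sup>2 / real (Suc n) \<le> y\<^sup>2" by (simp add: divide_le_eq mult_le_cancel_left1 not_less)
      ultimately have i: "exp (2 * (y\<^sup>2 / real (Suc n))) \<le> exp (2 * B\<^sup>2)" by simp
      have ii: "- (2 / sqrt (real (Suc n)) * x)\<^sup>2 / 2 = - (2 * (x\<^sup>2 / real (Suc n)))"
        by (simp add: power_mult_distrib power_divide del: of_nat_Suc)
      have iii: "(cmod (e n (Complex x y)))\<^sup>2 = exp (- (2 * (x\<^sup>2 / real (Suc n)))) * exp (2 * (y\<^sup>2 / real (Suc n)))"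
        unfolding cmod_e by (simp add: power2_eq_square flip: exp_add) 
      show ?thesis unfolding ii iii using mult_right_mono[OF i, of "exp (- (2 * (x\<^sup>2 / real (Suc n))))"]
        by (simp only: mult.commute exp_ge_zero)
    qed
    then show le: "L2_norm_sq lborel (\<lambda>x. e n (Complex x y)) \<le> E n"
      unfolding L2_norm_sq_def E_def by (intro nn_integral_mono ennreal_leI)
    then show "(\<lambda>x. e n (Complex x y)) \<in> L2 lborel"
      using E[of n] by (auto simp: L2_def intro: order.strict_trans1)
  qed
  have q_int: "integrable lborel (q n y)" if "\<bar>y\<bar> < B" for n y
    unfolding q_def by (rule L2_mult_integrable[OF F2[OF that] e_L2(1)[OF that]])
  have q_L2: "q n y \<in> L2 lborel" if "\<bar>y\<bar> < B" for n y
  proof (rule L2_mono[OF L2_cmult[OF F2[OF that], of "complex_of_real (exp (y\<^sup>2))"]])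
    show "q n y \<in> borel_measurable lborel" using q_int[OF that] by auto
    show "cmod (q n y x) \<le> cmod (complex_of_real (exp (y\<^sup>2)) * F y x)" for x
      using mult_left_mono[OF cmod_e_le[of n x y], of "cmod (F y x)"] by (simp add: q_def norm_mult mult.commute)
  qed
  \<comment> \<open>The estimate \<open>X \<le> 1 + X\<^sup>2\<close> avoids a square root; any bound that is uniform in \<open>y\<close> will do.\<close>
  have q_L1: "(\<integral>\<^sup>+x. ennreal (cmod (q n y x)) \<partial>lborel) \<le> 1 + C * E n" if "\<bar>y\<bar> < B" for n y
  proof -
    define X where "X = (\<integral>\<^sup>+x. ennreal (cmod (q n y x)) \<partial>lborel)"
    have "X\<^sup>2 \<le> L2_norm_sq lborel (F y) * L2_norm_sq lborel (\<lambda>x. e n (Complex x y))"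
    proof -
      have "(\<lambda>x. cnj (e n (Complex x y))) \<in> L2 lborel"
        using e_L2(1)[OF that] by (auto simp: L2_def L2_norm_sq_def)
      from L2_Cauchy_Schwarz(2)[OF F2[OF that] this] show ?thesis
        by (simp add: X_def q_def L2_norm_sq_def)
    qed
    also have "\<dots> \<le> C * E n"
      using bound[OF that] e_L2(2)[OF that] by (intro mult_mono) (auto simp: F_def)
    finally have X: "X\<^sup>2 \<le> C * E n" .
    have "X \<le> 1 + X\<^sup>2"
    proof (cases X)
      case (real x)
      have "x \<le> 1 + x\<^sup>2" using sum_squares_bound[of x 1] real by (simp add: power2_eq_square) 
      then show ?thesis using real by (simp add: ennreal_power flip: ennreal_1 ennreal_plus del: ennreal_1)
    qed (simp add: power2_eq_square)
    also have "\<dots> \<le> 1 + C * E n" using X by (intro add_mono) auto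
    finally show ?thesis by (simp add: X_def)
  qed
  \<comment> \<open>\<open>G n\<close> is the Fourier transform of \<open>q n 0\<close>, written with the inverse transform.\<close>
  define G where "G = (\<lambda>n \<xi>. 2 * pi * inv_fourier (q n 0) (- \<xi>))"
  have shift: "2 * pi * inv_fourier (q n y) (- \<xi>) = complex_of_real (exp (- y * \<xi>)) * G n \<xi>" if y: "\<bar>y\<bar> < B" for n y \<xi>
  proof -
    define H where "H = (\<lambda>z. f z * e n z * exp (- \<i> * z * complex_of_real \<xi>))"
    have H: "H (Complex x t) = complex_of_real (exp (t * \<xi>)) * (q n t x * cis (- \<xi> * x))" for x t
    proof -
      have "exp (- \<i> * Complex x t * complex_of_real \<xi>) = exp (complex_of_real (t * \<xi>) + \<i> * complex_of_real (- \<xi> * x))"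
        by (rule arg_cong[of _ _ exp]) (simp add: complex_eq_iff)
      also have "\<dots> = complex_of_real (exp (t * \<xi>)) * cis (- \<xi> * x)"
        by (simp only: exp_add exp_of_real cis_conv_exp)
      finally show ?thesis unfolding H_def q_def F_def by (simp only: mult_ac)
    qed
    have hH: "H holomorphic_on strip B"
      unfolding H_def e_def by (intro holomorphic_intros holo) (auto simp del: of_nat_Suc)
    have iH: "integrable lborel (\<lambda>x. H (Complex x t))" if "\<bar>t\<bar> < B" for t
      unfolding H by (intro integrable_mult_right integrable_inv_fourier_integrand q_int that)
    have vH: "(LBINT x. H (Complex x t)) = complex_of_real (exp (t * \<xi>)) * (2 * pi * inv_fourier (q n t) (- \<xi>))" for t
      unfolding H by (simp add: inv_fourier_def)
    have sh: "(LBINT x. H (Complex x a)) = (LBINT x. H (Complex x b))" if ab: "\<bar>a\<bar> < B" "\<bar>b\<bar> < B" "a \<le> b" for a b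
    proof (rule strip_integral_shift[OF hH ab iH[OF ab(1)] iH[OF ab(2)]])
      have "(\<integral>\<^sup>+y. indicator {a..b} y * (\<integral>\<^sup>+x. ennreal (cmod (H (Complex x y))) \<partial>lborel) \<partial>lborel)
         \<le> (\<integral>\<^sup>+y. (ennreal (exp (B * \<bar>\<xi>\<bar>)) * (1 + C * E n)) * indicator {a..b} y \<partial>lborel)"
      proof (intro nn_integral_mono)
        fix t :: real
        show "indicator {a..b} t * (\<integral>\<^sup>+x. ennreal (cmod (H (Complex x t))) \<partial>lborel)
          \<le> (ennreal (exp (B * \<bar>\<xi>\<bar>)) * (1 + C * E n)) * indicator {a..b} t"
        proof (cases "t \<in> {a..b}")
          case True
          then have t: "\<bar>t\<bar> < B" using ab by auto
          have [measurable]: "q n t \<in> borel_measurable borel" using q_int[OF t] by auto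
          have "t * \<xi> \<le> \<bar>t\<bar> * \<bar>\<xi>\<bar>" by (metis abs_ge_self abs_mult)
          also have "\<dots> \<le> B * \<bar>\<xi>\<bar>" using t by (intro mult_right_mono) auto
          finally have "t * \<xi> \<le> B * \<bar>\<xi>\<bar>" .
          have "(\<integral>\<^sup>+x. ennreal (cmod (H (Complex x t))) \<partial>lborel) = (\<integral>\<^sup>+x. ennreal (exp (t * \<xi>)) * ennreal (cmod (q n t x)) \<partial>lborel)"
            unfolding H by (simp add: norm_mult ennreal_mult)
          also have "\<dots> = ennreal (exp (t * \<xi>)) * (\<integral>\<^sup>+x. ennreal (cmod (q n t x)) \<partial>lborel)"
            by (rule nn_integral_cmult) measurable
          also have "\<dots> \<le> ennreal (exp (B * \<bar>\<xi>\<bar>)) * (1 + C * E n)"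
            using \<open>t * \<xi> \<le> B * \<bar>\<xi>\<bar>\<close> by (intro mult_mono q_L1 t ennreal_leI) auto
          finally show ?thesis using True by simp
        qed simp
      qed
      also have "\<dots> = (ennreal (exp (B * \<bar>\<xi>\<bar>)) * (1 + C * E n)) * emeasure lborel {a..b}"
        by (rule nn_integral_cmult_indicator) simp
      also have "\<dots> < \<infinity>" using C E[of n] ab by (simp add: ennreal_mult_less_top)
      finally show "(\<integral>\<^sup>+y. indicator {a..b} y * (\<integral>\<^sup>+x. ennreal (cmod (H (Complex x y))) \<partial>lborel) \<partial>lborel) < \<infinity>" .
    qed
    have "(LBINT x. H (Complex x y)) = (LBINT x. H (Complex x 0))"
      using sh[of y 0] sh[of 0 y] y B by (cases "y \<le> 0") auto
    then have "complex_of_real (exp (y * \<xi>)) * (2 * pi * inv_fourier (q n y) (- \<xi>)) = G n \<xi>"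
      unfolding vH by (simp add: G_def)
    moreover have "complex_of_real (exp (- y * \<xi>)) * complex_of_real (exp (y * \<xi>)) = 1"
      by (simp flip: of_real_mult exp_add)
    ultimately show ?thesis by (metis mult.assoc mult.left_neutral)
  qed
  define w where "w = (\<lambda>y g \<xi>. complex_of_real (exp (- y * \<xi>)) * (g \<xi> :: complex))"
  have reflect: "L2_norm_sq lborel (\<lambda>\<xi>. h (- \<xi>)) = L2_norm_sq lborel h" if [measurable]: "h \<in> borel_measurable borel" for h :: "real \<Rightarrow> complex"
    unfolding L2_norm_sq_def using nn_integral_real_affine[of "\<lambda>x. ennreal ((cmod (h x))\<^sup>2)" "-1" 0] by simp
  have wG: "w y (G n) = (\<lambda>\<xi>. 2 * pi * inv_fourier (q n y) (- \<xi>))" if "\<bar>y\<bar> < B" for n y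
    unfolding w_def using shift[OF that] by simp
  have m_inv [measurable]: "inv_fourier (q n y) \<in> borel_measurable borel" if "\<bar>y\<bar> < B" for n y
    by (rule measurable_inv_fourier[OF q_int[OF that]])
  have wG_meas: "w y (G n) \<in> borel_measurable borel" if "\<bar>y\<bar> < B" for n y
    unfolding wG[OF that] using m_inv[OF that, of n] by measurable
  have wG_L2: "w y (G n) \<in> L2 lborel" if "\<bar>y\<bar> < B" for n y
  proof -
    have "(\<lambda>\<xi>. inv_fourier (q n y) (- \<xi>)) \<in> L2 lborel"
    proof -
      note [measurable] = m_inv[OF that]
      have "(\<lambda>\<xi>. inv_fourier (q n y) (- \<xi>)) \<in> borel_measurable borel" by measurable
      then show ?thesis
        using L2_finite[OF inv_fourier_L2[OF q_int[OF that, of n] q_L2[OF that, of n]]] reflect[OF m_inv[OF that, of n]]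
        by (simp add: L2_def)
    qed
    then show ?thesis unfolding wG[OF that] by (rule L2_cmult)
  qed
  have wG_int: "integrable lborel (w y (G n))" if "\<bar>y\<bar> < B" for n y
    unfolding w_def by (rule exp_weight_integrable[OF _ that]) (use wG_L2 in \<open>simp add: w_def\<close>)
  have inversion: "AE x in lborel. inv_fourier (w y (G n)) x = q n y x" if "\<bar>y\<bar> < B" for n y
  proof -
    have "integrable lborel (\<lambda>\<xi>. inv_fourier (q n y) (- \<xi>))"
      using integrable_mult_right[OF wG_int[OF that, of n], of "1 / (2 * complex_of_real pi)"]
      unfolding wG[OF that] by simp
    from fourier_inversion_AE[OF q_int[OF that] q_L2[OF that] this]
    show ?thesis unfolding wG[OF that] inv_fourier_cmult .
  qed
  have G_diff: "L2_norm_sq lborel (\<lambda>\<xi>. w y (G m) \<xi> - w y (G n) \<xi>) = ennreal (2 * pi) * L2_norm_sq lborel (\<lambda>x. q m y x - q n y x)"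
    if "\<bar>y\<bar> < B" for y m n
  proof -
    note [measurable] = m_inv[OF that]
    have "L2_norm_sq lborel (\<lambda>\<xi>. w y (G m) \<xi> - w y (G n) \<xi>)
       = L2_norm_sq lborel (\<lambda>\<xi>. 2 * pi * (inv_fourier (q m y) (- \<xi>) - inv_fourier (q n y) (- \<xi>)))"
      unfolding wG[OF that] by (simp add: right_diff_distrib)
    also have "\<dots> = ennreal ((cmod (2 * pi))\<^sup>2) * L2_norm_sq lborel (\<lambda>\<xi>. inv_fourier (q m y) (- \<xi>) - inv_fourier (q n y) (- \<xi>))"
      by (rule L2_norm_sq_cmult) measurable
    also have "L2_norm_sq lborel (\<lambda>\<xi>. inv_fourier (q m y) (- \<xi>) - inv_fourier (q n y) (- \<xi>)) = L2_norm_sq lborel (\<lambda>\<xi>. inv_fourier (q m y) \<xi> - inv_fourier (q n y) \<xi>)"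
      by (rule reflect[of "\<lambda>\<xi>. inv_fourier (q m y) \<xi> - inv_fourier (q n y) \<xi>"]) measurable
    also have "\<dots> = ennreal (1 / (2 * pi)) * L2_norm_sq lborel (\<lambda>x. q m y x - q n y x)"
      by (intro plancherel_diff q_int q_L2 that)
    also have "ennreal ((cmod (2 * pi))\<^sup>2) * (ennreal (1 / (2 * pi)) * L2_norm_sq lborel (\<lambda>x. q m y x - q n y x))
       = ennreal ((2 * pi)\<^sup>2 * (1 / (2 * pi))) * L2_norm_sq lborel (\<lambda>x. q m y x - q n y x)"
      by (subst ennreal_mult) (auto simp: mult.assoc norm_mult)
    also have "(2 * pi)\<^sup>2 * (1 / (2 * pi)) = 2 * pi" by (simp add: power2_eq_square)
    finally show ?thesis .
  qed
  have q_lim: "(\<lambda>n. L2_norm_sq lborel (\<lambda>x. q n y x - F y x)) \<longlonglongrightarrow> 0" if "\<bar>y\<bar> < B" for y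
  proof (rule L2_dominated_tendsto_0[where w = "\<lambda>x. (exp (y\<^sup>2) + 1) * cmod (F y x)"])
    note [measurable] = L2_measurable[OF F2[OF that]] borel_measurable_integrable[OF q_int[OF that]]
    show "(\<lambda>x. q n y x - F y x) \<in> borel_measurable lborel" for n by measurable
    show "(\<lambda>x. (exp (y\<^sup>2) + 1) * cmod (F y x)) \<in> borel_measurable lborel" by measurable
    show "AE x in lborel. cmod (q n y x - F y x) \<le> (exp (y\<^sup>2) + 1) * cmod (F y x)" for n
    proof (intro AE_I2)
      fix x
      have "cmod (q n y x - F y x) \<le> cmod (q n y x) + cmod (F y x)" by (rule norm_triangle_ineq4)
      also have "cmod (q n y x) \<le> exp (y\<^sup>2) * cmod (F y x)"
        using mult_left_mono[OF cmod_e_le[of n x y], of "cmod (F y x)"] by (simp add: q_def norm_mult mult.commute)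
      finally show "cmod (q n y x - F y x) \<le> (exp (y\<^sup>2) + 1) * cmod (F y x)" by (simp add: algebra_simps)
    qed
    have "(\<integral>\<^sup>+ x. ennreal (((exp (y\<^sup>2) + 1) * cmod (F y x))\<^sup>2) \<partial>lborel) = L2_norm_sq lborel (\<lambda>x. complex_of_real (exp (y\<^sup>2) + 1) * F y x)"
      unfolding L2_norm_sq_def
      by (intro nn_integral_cong) (simp add: norm_mult add_pos_pos del: of_real_add)
    also have "\<dots> < \<infinity>" by (intro L2_finite L2_cmult F2 that)
    finally show "(\<integral>\<^sup>+ x. ennreal (((exp (y\<^sup>2) + 1) * cmod (F y x))\<^sup>2) \<partial>lborel) < \<infinity>" .
    show "AE x in lborel. (\<lambda>n. q n y x - F y x) \<longlonglongrightarrow> 0"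
    proof (intro AE_I2)
      fix x
      have "(\<lambda>n. - (Complex x y)\<^sup>2 * complex_of_real (inverse (real (Suc n)))) \<longlonglongrightarrow> - (Complex x y)\<^sup>2 * complex_of_real 0"
        by (intro tendsto_intros LIMSEQ_inverse_real_of_nat)
      then have "(\<lambda>n. exp (- (Complex x y)\<^sup>2 * complex_of_real (inverse (real (Suc n))))) \<longlonglongrightarrow> exp 0"
        by (intro tendsto_exp) simp
      then have "(\<lambda>n. e n (Complex x y)) \<longlonglongrightarrow> 1" by (simp add: e_def divide_inverse)
      then have "(\<lambda>n. F y x * e n (Complex x y) - F y x) \<longlonglongrightarrow> F y x * 1 - F y x" by (intro tendsto_intros)
      then show "(\<lambda>n. q n y x - F y x) \<longlonglongrightarrow> 0" by (simp add: q_def)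
    qed
  qed
  have Cauchy: "\<exists>N. \<forall>m\<ge>N. \<forall>n\<ge>N. L2_norm_sq lborel (\<lambda>\<xi>. w y (G m) \<xi> - w y (G n) \<xi>) \<le> ennreal d"
    if y: "\<bar>y\<bar> < B" and d: "d > 0" for y d
  proof -
    note [measurable] = L2_measurable[OF F2[OF y]] borel_measurable_integrable[OF q_int[OF y]]
    have "\<forall>\<^sub>F n in sequentially. L2_norm_sq lborel (\<lambda>x. q n y x - F y x) < ennreal (d / (8 * pi))"
      using d by (intro order_tendstoD(2)[OF q_lim[OF y]]) auto
    then obtain N where N: "\<And>n. n \<ge> N \<Longrightarrow> L2_norm_sq lborel (\<lambda>x. q n y x - F y x) < ennreal (d / (8 * pi))"
      by (auto simp: eventually_sequentially)
    show ?thesis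
    proof (intro exI[of _ N] allI impI)
      fix m n assume mn: "N \<le> m" "N \<le> n"
      have "L2_norm_sq lborel (\<lambda>x. q m y x - q n y x) \<le> 2 * L2_norm_sq lborel (\<lambda>x. q m y x - F y x) + 2 * L2_norm_sq lborel (\<lambda>x. F y x - q n y x)"
        by (rule L2_norm_sq_diff_triangle) measurable
      also have "\<dots> \<le> 2 * ennreal (d / (8 * pi)) + 2 * ennreal (d / (8 * pi))"
        using N[OF mn(1)] N[OF mn(2)] unfolding L2_norm_sq_diff_commute[of _ "F y" "q n y"]
        by (intro add_mono mult_left_mono) auto
      also have "\<dots> = ennreal (d / (2 * pi))" using d by (simp add: two_mult_ennreal flip: ennreal_plus)
      finally have "ennreal (2 * pi) * L2_norm_sq lborel (\<lambda>x. q m y x - q n y x) \<le> ennreal (2 * pi) * ennreal (d / (2 * pi))"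
        by (intro mult_left_mono) auto
      also have "\<dots> = ennreal d" using d by (subst ennreal_mult[symmetric]) auto
      finally show "L2_norm_sq lborel (\<lambda>\<xi>. w y (G m) \<xi> - w y (G n) \<xi>) \<le> ennreal d" unfolding G_diff[OF y] .
    qed
  qed
  have G0: "w 0 (G n) = G n" for n by (simp add: w_def)
  have G_meas [measurable]: "G n \<in> borel_measurable borel" for n using wG_meas[of 0 n] B by (simp add: G0)
  obtain r :: "nat \<Rightarrow> nat" and g where r: "strict_mono r" and [measurable]: "g \<in> borel_measurable lborel"
    and g: "AE \<xi> in lborel. (\<lambda>k. G (r k) \<xi>) \<longlonglongrightarrow> g \<xi>"
    using L2_Cauchy_AE_subseq[of G lborel] Cauchy[of 0] B unfolding G0 by auto
  have w_meas [measurable]: "w y h \<in> borel_measurable borel" if "h \<in> borel_measurable borel" for y h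
    unfolding w_def using that by measurable
  have lim: "(\<lambda>n. L2_norm_sq lborel (\<lambda>\<xi>. w y (G n) \<xi> - w y g \<xi>)) \<longlonglongrightarrow> 0" if y: "\<bar>y\<bar> < B" for y
  proof (rule tendsto_zero_ennreal)
    fix d :: real assume d: "d > 0"
    obtain N where N: "\<And>m n. m \<ge> N \<Longrightarrow> n \<ge> N \<Longrightarrow> L2_norm_sq lborel (\<lambda>\<xi>. w y (G m) \<xi> - w y (G n) \<xi>) \<le> ennreal (d/2)"
      using Cauchy[OF y, of "d/2"] d by auto
    have "L2_norm_sq lborel (\<lambda>\<xi>. w y (G n) \<xi> - w y g \<xi>) \<le> ennreal (d/2)" if n: "n \<ge> N" for n
    proof (rule L2_norm_sq_AE_limit_le[where f = "\<lambda>k \<xi>. w y (G n) \<xi> - w y (G (r k)) \<xi>"])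
      show "AE \<xi> in lborel. (\<lambda>k. w y (G n) \<xi> - w y (G (r k)) \<xi>) \<longlonglongrightarrow> w y (G n) \<xi> - w y g \<xi>"
        using g by eventually_elim (auto simp: w_def intro!: tendsto_intros)
      show "\<forall>\<^sub>F k in sequentially. L2_norm_sq lborel (\<lambda>\<xi>. w y (G n) \<xi> - w y (G (r k)) \<xi>) \<le> ennreal (d/2)"
        using eventually_ge_at_top[of N]
      proof eventually_elim
        case (elim k)
        then have "r k \<ge> N" using strict_mono_imp_increasing[OF r, of k] by simp
        then show ?case by (rule N[OF n])
      qed
    qed measurable
    moreover have "ennreal (d/2) < ennreal d" using d by (simp add: ennreal_less_iff)
    ultimately show "\<forall>\<^sub>F n in sequentially. L2_norm_sq lborel (\<lambda>\<xi>. w y (G n) \<xi> - w y g \<xi>) < ennreal d"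
      unfolding eventually_sequentially by (meson order.strict_trans1)
  qed
  have wg_L2: "w y g \<in> L2 lborel" if y: "\<bar>y\<bar> < B" for y
  proof -
    have "\<forall>\<^sub>F n in sequentially. L2_norm_sq lborel (\<lambda>\<xi>. w y (G n) \<xi> - w y g \<xi>) < 1"
      by (rule order_tendstoD(2)[OF lim[OF y]]) simp
    then obtain n where n: "L2_norm_sq lborel (\<lambda>\<xi>. w y (G n) \<xi> - w y g \<xi>) < 1" by (auto simp: eventually_sequentially)
    then have "(\<lambda>\<xi>. w y (G n) \<xi> - w y g \<xi>) \<in> L2 lborel"
      by (auto simp: L2_def intro: order.strict_trans)
    from L2_diff[OF wG_L2[OF y, of n] this] show ?thesis by simp
  qed
  have wg_int: "integrable lborel (w y g)" if "\<bar>y\<bar> < B" for y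
    unfolding w_def by (rule exp_weight_integrable[OF _ that]) (use wg_L2 in \<open>simp add: w_def\<close>)
  have eq: "F y x = inv_fourier (w y g) x" if y: "\<bar>y\<bar> < B" for x y
  proof (rule continuous_AE_eq[OF cont_F[OF y] continuous_inv_fourier[OF wg_int[OF y]]])
    note [measurable] = L2_measurable[OF F2[OF y]] measurable_inv_fourier[OF wg_int[OF y]]
      measurable_inv_fourier[OF wG_int[OF y]] borel_measurable_integrable[OF q_int[OF y]]
    have le: "L2_norm_sq lborel (\<lambda>x. F y x - inv_fourier (w y g) x)
       \<le> 2 * L2_norm_sq lborel (\<lambda>x. q n y x - F y x) + 2 * L2_norm_sq lborel (\<lambda>\<xi>. w y (G n) \<xi> - w y g \<xi>)" for n
    proof -
      have "L2_norm_sq lborel (\<lambda>x. q n y x - inv_fourier (w y g) x) = L2_norm_sq lborel (\<lambda>x. inv_fourier (w y (G n)) x - inv_fourier (w y g) x)"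
        by (rule L2_norm_sq_cong_AE) (use inversion[OF y, of n] in eventually_elim, simp)
      also have "\<dots> \<le> L2_norm_sq lborel (\<lambda>\<xi>. w y (G n) \<xi> - w y g \<xi>)"
        by (intro plancherel_diff_le wG_int wG_L2 wg_int wg_L2 y)
      finally have 1: "L2_norm_sq lborel (\<lambda>x. q n y x - inv_fourier (w y g) x) \<le> L2_norm_sq lborel (\<lambda>\<xi>. w y (G n) \<xi> - w y g \<xi>)" .
      have "L2_norm_sq lborel (\<lambda>x. F y x - inv_fourier (w y g) x)
        \<le> 2 * L2_norm_sq lborel (\<lambda>x. F y x - q n y x) + 2 * L2_norm_sq lborel (\<lambda>x. q n y x - inv_fourier (w y g) x)"
        by (rule L2_norm_sq_diff_triangle) measurable
      also have "\<dots> \<le> 2 * L2_norm_sq lborel (\<lambda>x. q n y x - F y x) + 2 * L2_norm_sq lborel (\<lambda>\<xi>. w y (G n) \<xi> - w y g \<xi>)"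
        unfolding L2_norm_sq_diff_commute[of _ "F y" "q n y"] by (intro add_mono mult_left_mono 1) auto
      finally show ?thesis .
    qed
    have "(\<lambda>n. 2 * L2_norm_sq lborel (\<lambda>x. q n y x - F y x) + 2 * L2_norm_sq lborel (\<lambda>\<xi>. w y (G n) \<xi> - w y g \<xi>)) \<longlonglongrightarrow> 0"
      by (intro ennreal_tendsto_0_add ennreal_tendsto_0_mult q_lim lim y) auto
    then have "L2_norm_sq lborel (\<lambda>x. F y x - inv_fourier (w y g) x) \<le> 0"
      by (rule tendsto_lowerbound) (auto simp: le)
    then show "AE x in lborel. F y x = inv_fourier (w y g) x"
      by (simp add: L2_norm_sq_def nn_integral_0_iff_AE)
  qed
  show ?thesis
    by (rule that[of g]) (use wg_L2 eq in \<open>auto simp: w_def F_def\<close>)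
qed

section \<open>Sums of nonnegative terms\<close>

text \<open>This makes monotone convergence and Tonelli's theorem available for unordered sums.\<close>

lemma infsum_ennreal_eq_nn_integral:
  fixes f :: "'a \<Rightarrow> ennreal"
  assumes A: "countable A"
  shows "infsum f A = (\<integral>\<^sup>+x. f x \<partial>count_space A)"
proof (rule antisym)
  have "sum f F \<le> (\<integral>\<^sup>+x. f x \<partial>count_space A)" if "finite F" "F \<subseteq> A" for F
  proof -
    have "sum f F = (\<integral>\<^sup>+x. f x \<partial>count_space F)" using that by (simp add: nn_integral_count_space_finite)
    also have "\<dots> = (\<integral>\<^sup>+x. f x * indicator F x \<partial>count_space A)"
      using that by (simp add: nn_integral_count_space_indicator[of F] nn_integral_count_space_indicator[of A])
        (intro nn_integral_cong, auto split: split_indicator)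
    also have "\<dots> \<le> (\<integral>\<^sup>+x. f x \<partial>count_space A)" by (intro nn_integral_mono) (auto split: split_indicator)
    finally show ?thesis .
  qed
  then show "infsum f A \<le> (\<integral>\<^sup>+x. f x \<partial>count_space A)"
    by (subst nonneg_infsum_complete) (auto intro!: SUP_least)
  show "(\<integral>\<^sup>+x. f x \<partial>count_space A) \<le> infsum f A"
  proof (cases "finite A")
    case True
    then show ?thesis by (simp add: nn_integral_count_space_finite)
  next
    case False
    have bij: "bij_betw (from_nat_into A) UNIV A" using False A by (rule bij_betw_from_nat_into[rotated])
    have "(\<integral>\<^sup>+x. f x \<partial>count_space A) = (\<integral>\<^sup>+n. f (from_nat_into A n) \<partial>count_space UNIV)"
      by (rule nn_integral_bij_count_space[OF bij, symmetric])
    also have "\<dots> = (SUP n. \<Sum>i<n. f (from_nat_into A i))"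
      by (simp add: nn_integral_count_space_nat suminf_eq_SUP)
    also have "\<dots> \<le> infsum f A"
    proof (rule SUP_least)
      fix n
      have inj: "inj_on (from_nat_into A) {..<n}" using bij by (meson bij_betw_imp_inj_on inj_on_subset subset_UNIV)
      have "(\<Sum>i<n. f (from_nat_into A i)) = sum f (from_nat_into A ` {..<n})"
        by (simp add: sum.reindex[OF inj])
      also have "\<dots> \<le> infsum f A"
        using bij by (subst nonneg_infsum_complete) (auto intro!: SUP_upper simp: bij_betw_def)
      finally show "(\<Sum>i<n. f (from_nat_into A i)) \<le> infsum f A" .
    qed
    finally show ?thesis .
  qed
qed

lemma nn_integral_infsum:
  fixes f :: "'i :: countable \<Rightarrow> 'a \<Rightarrow> ennreal"
  assumes "\<And>i. f i \<in> borel_measurable M"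
  shows "(\<integral>\<^sup>+x. (\<Sum>\<^sub>\<infinity>i\<in>A. f i x) \<partial>M) = (\<Sum>\<^sub>\<infinity>i\<in>A. \<integral>\<^sup>+x. f i x \<partial>M)"
  unfolding infsum_ennreal_eq_nn_integral[OF countableI_type]
  by (rule nn_integral_count_space_nn_integral) (auto simp: assms)

lemma infsum_ennreal_cmult:
  fixes f :: "'i :: countable \<Rightarrow> ennreal"
  shows "(\<Sum>\<^sub>\<infinity>i\<in>A. c * f i) = c * (\<Sum>\<^sub>\<infinity>i\<in>A. f i)"
  unfolding infsum_ennreal_eq_nn_integral[OF countableI_type] by (rule nn_integral_cmult) simp

lemma infsum_ennreal_mono:
  fixes f g :: "'i \<Rightarrow> ennreal"
  assumes "\<And>i. i \<in> A \<Longrightarrow> f i \<le> g i"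
  shows "infsum f A \<le> infsum g A"
  by (intro infsum_mono nonneg_summable_on_complete assms) auto

lemma infsum_ennreal_mono_set:
  fixes f :: "'i \<Rightarrow> ennreal"
  assumes "A \<subseteq> B"
  shows "infsum f A \<le> infsum f B"
  by (rule infsum_mono_neutral) (use assms in \<open>auto intro!: nonneg_summable_on_complete\<close>)

lemma infsum_ennreal_tail_tendsto_0:
  fixes f :: "'i \<Rightarrow> ennreal"
  assumes fin: "infsum f UNIV < \<infinity>"
  shows "((\<lambda>J. infsum f (- J)) \<longlongrightarrow> 0) (finite_subsets_at_top UNIV)"
proof -
  have eq: "infsum f (- J) = infsum f UNIV - sum f J" if "finite J" for J
  proof -
    have "infsum f UNIV = infsum f (J \<union> - J)" by simp
    also have "\<dots> = infsum f J + infsum f (- J)" by (rule infsum_Un_disjoint) (auto intro!: nonneg_summable_on_complete)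
    also have "infsum f J = sum f J" using that by simp
    finally have *: "infsum f UNIV = sum f J + infsum f (- J)" .
    then have "sum f J < \<infinity>" using fin by auto
    then show ?thesis unfolding * by (subst add.commute) (simp add: ennreal_add_diff_cancel_right less_top)
  qed
  have "((\<lambda>J. infsum f UNIV - sum f J) \<longlongrightarrow> infsum f UNIV - infsum f UNIV) (finite_subsets_at_top UNIV)"
  proof (intro tendsto_diff_ennreal tendsto_const)
    show "(sum f \<longlongrightarrow> infsum f UNIV) (finite_subsets_at_top UNIV)"
      using has_sum_infsum[OF nonneg_summable_on_complete, of UNIV f] by (simp add: has_sum_def)
  qed (use fin in auto)
  then have "((\<lambda>J. infsum f UNIV - sum f J) \<longlongrightarrow> 0) (finite_subsets_at_top UNIV)" using fin by simp
  then show ?thesis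
    by (rule Lim_transform_eventually)
       (use eq in \<open>auto simp: eventually_finite_subsets_at_top intro!: exI[of _ "{}"]\<close>)
qed

lemma infsum_ennreal_has_sum:
  fixes f :: "'i \<Rightarrow> real"
  assumes "(f has_sum s) A" "\<And>i. i \<in> A \<Longrightarrow> f i \<ge> 0"
  shows "infsum (\<lambda>i. ennreal (f i)) A = ennreal s"
proof (rule infsumI)
  have "((\<lambda>F. ennreal (sum f F)) \<longlongrightarrow> ennreal s) (finite_subsets_at_top A)"
    using assms(1) unfolding has_sum_def by (rule tendsto_ennrealI)
  then show "((\<lambda>i. ennreal (f i)) has_sum ennreal s) A"
    unfolding has_sum_def
    by (rule Lim_transform_eventually)
       (use assms(2) in \<open>auto simp: eventually_finite_subsets_at_top subset_iff intro!: exI[of _ "{}"]\<close>)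
qed

section \<open>Fourier series of continuous functions\<close>

abbreviation circle_measure :: "real measure" where
  "circle_measure \<equiv> restrict_space lborel {0..<1}"

definition circ :: "int \<Rightarrow> real \<Rightarrow> complex" where
  "circ j \<theta> = cis (2 * pi * of_int j * \<theta>)"

lemma norm_circ [simp]: "cmod (circ j \<theta>) = 1" by (simp add: circ_def)

lemma circ_add: "circ (j + k) \<theta> = circ j \<theta> * circ k \<theta>"
  by (simp add: circ_def cis_mult algebra_simps)

lemma circ_cnj: "cnj (circ j \<theta>) = circ (- j) \<theta>"
  by (simp add: circ_def cis_cnj)

lemma circ_0 [simp]: "circ 0 \<theta> = 1" by (simp add: circ_def)

lemma circ_powi: "cis (2 * pi * \<theta>) powi j = circ j \<theta>"
  by (simp add: cis_power_int circ_def mult_ac)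

lemma circ_measurable [measurable]: "circ j \<in> borel_measurable borel"
  unfolding circ_def by measurable

lemma continuous_on_circ [continuous_intros]: "continuous_on A f \<Longrightarrow> continuous_on A (\<lambda>x. circ j (f x))"
  unfolding circ_def by (intro continuous_intros)

lemma prob_space_circle: "prob_space circle_measure"
  by (rule prob_spaceI) (simp add: emeasure_restrict_space space_restrict_space)

lemma measurable_circle [measurable (raw)]:
  "f \<in> borel_measurable borel \<Longrightarrow> f \<in> borel_measurable circle_measure"
  by (rule measurable_restrict_space1) simp

lemma integrable_circle_bounded:
  fixes f :: "real \<Rightarrow> complex"
  assumes "f \<in> borel_measurable circle_measure" "\<And>\<theta>. cmod (f \<theta>) \<le> C"
  shows "integrable circle_measure f"
  using finite_measure.integrable_const_bound[OF prob_space.finite_measure[OF prob_space_circle], of f C] assms by simp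

text \<open>The circle is represented by \<open>[0, 1)\<close>; the missing end point is negligible.\<close>

lemma integral_circle_Icc:
  fixes f :: "real \<Rightarrow> complex"
  assumes f: "continuous_on UNIV f"
  shows "(\<integral>\<theta>. f \<theta> \<partial>circle_measure) = (LBINT \<theta>. indicator {0..1} \<theta> *\<^sub>R f \<theta>)"
proof -
  have [measurable]: "f \<in> borel_measurable borel" by (rule borel_measurable_continuous_onI[OF f])
  have "(\<integral>\<theta>. f \<theta> \<partial>circle_measure) = (LBINT \<theta>. indicator {0..<1} \<theta> *\<^sub>R f \<theta>)"
    by (rule integral_restrict_space) simp
  also have "\<dots> = (LBINT \<theta>. indicator {0..1} \<theta> *\<^sub>R f \<theta>)"
  proof (rule integral_cong_AE)
    show "AE \<theta> in lborel. indicator {0..<1} \<theta> *\<^sub>R f \<theta> = indicator {0..1} \<theta> *\<^sub>R f \<theta>"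
      using AE_lborel_singleton[of "1::real"] by eventually_elim (auto split: split_indicator)
  qed measurable
  finally show ?thesis .
qed

lemma integral_circle_FTC:
  fixes f G :: "real \<Rightarrow> complex"
  assumes G: "\<And>x. 0 \<le> x \<Longrightarrow> x \<le> 1 \<Longrightarrow> (G has_vector_derivative f x) (at x within {0..1})"
    and f: "continuous_on UNIV f"
  shows "(\<integral>\<theta>. f \<theta> \<partial>circle_measure) = G 1 - G 0"
  unfolding integral_circle_Icc[OF f]
  by (rule integral_FTC_atLeastAtMost) (use G f in \<open>auto intro: continuous_on_subset\<close>)

lemma integral_circ: "(\<integral>\<theta>. circ j \<theta> \<partial>circle_measure) = (if j = 0 then 1 else 0)"
proof (cases "j = 0")
  case True
  then show ?thesis using prob_space.prob_space[OF prob_space_circle] by simp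
next
  case False
  define c where "c = 2 * pi * real_of_int j"
  have c: "c \<noteq> 0" using False by (simp add: c_def)
  have "(\<integral>\<theta>. circ j \<theta> \<partial>circle_measure) = cis (c * 1) / (\<i> * c) - cis (c * 0) / (\<i> * c)"
  proof (rule integral_circle_FTC)
    fix x :: real
    have "((\<lambda>z. exp (\<i> * c * z) / (\<i> * c)) has_field_derivative exp (\<i> * c * of_real x)) (at (of_real x))"
      using c by (auto intro!: derivative_eq_intros)
    from has_vector_derivative_real_field[OF this]
    show "((\<lambda>\<theta>. cis (c * \<theta>) / (\<i> * c)) has_vector_derivative circ j x) (at x within {0..1})"
      by (simp add: circ_def cis_conv_exp c_def mult.assoc)
  qed (auto intro!: continuous_intros)
  also have "\<dots> = 0"
  proof -
    have "cis (c * 1) = 1" unfolding c_def by (simp add: cis_multiple_2pi)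
    then show ?thesis by simp
  qed
  finally show ?thesis using False by simp
qed

lemma circ_orthonormal: "(\<integral>\<theta>. circ j \<theta> * cnj (circ k \<theta>) \<partial>circle_measure) = (if j = k then 1 else 0)"
  using integral_circ[of "j - k"] circ_add[of j "- k"] by (simp add: circ_cnj)

definition trig_poly :: "(real \<Rightarrow> complex) \<Rightarrow> bool" where
  "trig_poly p \<longleftrightarrow> (\<exists>J a. finite J \<and> p = (\<lambda>\<theta>. \<Sum>j\<in>J. a j * circ j \<theta>))"

lemma trig_poly_add:
  assumes "trig_poly p" "trig_poly q"
  shows "trig_poly (\<lambda>\<theta>. p \<theta> + q \<theta>)"
proof -
  obtain J a K b where J: "finite J" "p = (\<lambda>\<theta>. \<Sum>j\<in>J. a j * circ j \<theta>)" and K: "finite K" "q = (\<lambda>\<theta>. \<Sum>j\<in>K. b j * circ j \<theta>)"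
    using assms unfolding trig_poly_def by blast
  define d where "d = (\<lambda>j. (if j \<in> J then a j else 0) + (if j \<in> K then b j else 0))"
  have "p \<theta> + q \<theta> = (\<Sum>j\<in>J \<union> K. d j * circ j \<theta>)" for \<theta>
  proof -
    have "p \<theta> = (\<Sum>j\<in>J \<union> K. (if j \<in> J then a j else 0) * circ j \<theta>)"
      unfolding J(2) using J(1) K(1) by (intro sum.mono_neutral_cong_left) auto
    moreover have "q \<theta> = (\<Sum>j\<in>J \<union> K. (if j \<in> K then b j else 0) * circ j \<theta>)"
      unfolding K(2) using J(1) K(1) by (intro sum.mono_neutral_cong_left) auto
    ultimately show ?thesis by (simp add: d_def distrib_right sum.distrib)
  qed
  then show ?thesis unfolding trig_poly_def using J(1) K(1) by (intro exI[of _ "J \<union> K"] exI[of _ d]) auto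
qed

lemma trig_poly_mult_monomial:
  assumes "trig_poly p"
  shows "trig_poly (\<lambda>\<theta>. c * circ k \<theta> * p \<theta>)"
proof -
  obtain J a where J: "finite J" "p = (\<lambda>\<theta>. \<Sum>j\<in>J. a j * circ j \<theta>)" using assms unfolding trig_poly_def by blast
  have "c * circ k \<theta> * p \<theta> = (\<Sum>j\<in>(+) k ` J. (c * a (j - k)) * circ j \<theta>)" for \<theta>
    unfolding J(2) by (subst sum.reindex) (auto simp: sum_distrib_left circ_add mult_ac)
  then show ?thesis unfolding trig_poly_def using J(1)
    by (intro exI[of _ "(+) k ` J"] exI[of _ "\<lambda>j. c * a (j - k)"]) auto
qed

lemma trig_poly_const: "trig_poly (\<lambda>\<theta>. c)"
  unfolding trig_poly_def by (intro exI[of _ "{0}"] exI[of _ "\<lambda>_. c"]) auto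

lemma trig_poly_sum:
  assumes "finite I" "\<And>i. i \<in> I \<Longrightarrow> trig_poly (p i)"
  shows "trig_poly (\<lambda>\<theta>. \<Sum>i\<in>I. p i \<theta>)"
  using assms by (induction I rule: finite_induct) (auto intro: trig_poly_const trig_poly_add)

lemma trig_poly_mult:
  assumes "trig_poly p" "trig_poly q"
  shows "trig_poly (\<lambda>\<theta>. p \<theta> * q \<theta>)"
proof -
  obtain J a where J: "finite J" "p = (\<lambda>\<theta>. \<Sum>j\<in>J. a j * circ j \<theta>)" using assms unfolding trig_poly_def by blast
  show ?thesis unfolding J(2) sum_distrib_right
    by (intro trig_poly_sum J trig_poly_mult_monomial assms)
qed

text \<open>By induction on polynomials it is enough that a real linear functional on \<open>\<complex>\<close> is a combination of \<open>z\<close> and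
  \<open>cnj z\<close>.\<close>

lemma trig_poly_real_polynomial:
  assumes "real_polynomial_function p"
  shows "trig_poly (\<lambda>\<theta>. complex_of_real (p (cis (2 * pi * \<theta>))))"
  using assms
proof induction
  case (linear L)
  interpret bounded_linear L by fact
  have "complex_of_real (L (cis (2 * pi * \<theta>))) = (L 1 - \<i> * L \<i>) / 2 * circ 1 \<theta> * 1 + (L 1 + \<i> * L \<i>) / 2 * circ (- 1) \<theta> * 1" for \<theta>
  proof -
    have "cis (2 * pi * \<theta>) = cos (2 * pi * \<theta>) *\<^sub>R 1 + sin (2 * pi * \<theta>) *\<^sub>R \<i>"
      by (simp add: complex_eq_iff)
    then have "L (cis (2 * pi * \<theta>)) = cos (2 * pi * \<theta>) * L 1 + sin (2 * pi * \<theta>) * L \<i>"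
      by (simp only: add scaleR) simp
    then show ?thesis by (simp add: circ_def complex_eq_iff field_simps)
  qed
  then show ?case by (simp only:) (intro trig_poly_add trig_poly_mult_monomial trig_poly_const)
next
  case (const c)
  show ?case by (rule trig_poly_const)
next
  case (add f g)
  then show ?case by (simp add: trig_poly_add)
next
  case (mult f g)
  then show ?case by (simp add: trig_poly_mult)
qed

text \<open>By the Stone-Weierstrass theorem, since polynomials restrict to trigonometric polynomials on the circle.\<close>

lemma trig_poly_dense:
  assumes h: "continuous_on (sphere 0 1) h" and e: "e > 0"
  obtains p where "trig_poly p" "\<And>\<theta>. cmod (h (cis (2 * pi * \<theta>)) - p \<theta>) < e"
proof -
  obtain g :: "complex \<Rightarrow> complex" where g: "polynomial_function g" "\<And>z. z \<in> sphere 0 1 \<Longrightarrow> cmod (h z - g z) < e"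
    using Stone_Weierstrass_polynomial_function[OF compact_sphere h e] by blast
  have "real_polynomial_function (Re \<circ> g)" "real_polynomial_function (Im \<circ> g)"
    using g(1) bounded_linear_Re bounded_linear_Im unfolding polynomial_function_def by blast+
  note t = this[THEN trig_poly_real_polynomial]
  show ?thesis
  proof (rule that)
    show "trig_poly (\<lambda>\<theta>. complex_of_real ((Re \<circ> g) (cis (2 * pi * \<theta>))) + \<i> * complex_of_real ((Im \<circ> g) (cis (2 * pi * \<theta>))))"
      by (intro trig_poly_add trig_poly_mult trig_poly_const t)
    show "cmod (h (cis (2 * pi * \<theta>)) - (complex_of_real ((Re \<circ> g) (cis (2 * pi * \<theta>))) + \<i> * complex_of_real ((Im \<circ> g) (cis (2 * pi * \<theta>))))) < e" for \<theta>
      using g(2)[of "cis (2 * pi * \<theta>)"] by (simp flip: complex_eq)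
  qed
qed

text \<open>Completing the square: among all trigonometric polynomials with frequencies in \<open>J\<close> the distance is
  least for the Fourier coefficients.\<close>

lemma L2_circle_distance:
  fixes f :: "real \<Rightarrow> complex"
  assumes [measurable]: "f \<in> borel_measurable borel" and b: "\<And>\<theta>. cmod (f \<theta>) \<le> C" and J: "finite J"
  defines "c \<equiv> \<lambda>j. \<integral>\<theta>. f \<theta> * cnj (circ j \<theta>) \<partial>circle_measure"
  shows "L2_norm_sq circle_measure (\<lambda>\<theta>. f \<theta> - (\<Sum>j\<in>J. a j * circ j \<theta>))
     = ennreal ((\<integral>\<theta>. (cmod (f \<theta>))\<^sup>2 \<partial>circle_measure) - (\<Sum>j\<in>J. (cmod (c j))\<^sup>2) + (\<Sum>j\<in>J. (cmod (a j - c j))\<^sup>2))" (is ?eq)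
    and "0 \<le> (\<integral>\<theta>. (cmod (f \<theta>))\<^sup>2 \<partial>circle_measure) - (\<Sum>j\<in>J. (cmod (c j))\<^sup>2) + (\<Sum>j\<in>J. (cmod (a j - c j))\<^sup>2)" (is ?nonneg)
proof -
  define p where "p = (\<lambda>\<theta>. \<Sum>j\<in>J. a j * circ j \<theta>)"
  have [measurable]: "p \<in> borel_measurable borel" unfolding p_def by measurable
  have pb: "cmod (p \<theta>) \<le> (\<Sum>j\<in>J. cmod (a j))" for \<theta>
    unfolding p_def using norm_sum[of "\<lambda>j. a j * circ j \<theta>" J] by (simp add: norm_mult)
  have bound2: "integrable circle_measure (\<lambda>\<theta>. u \<theta> * cnj (v \<theta>))"
    if [measurable]: "u \<in> borel_measurable borel" "v \<in> borel_measurable borel" and "\<And>\<theta>. cmod (u \<theta>) \<le> A" "\<And>\<theta>. cmod (v \<theta>) \<le> B"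
    for u v :: "real \<Rightarrow> complex" and A B
  proof (rule integrable_circle_bounded)
    show "cmod (u \<theta> * cnj (v \<theta>)) \<le> A * B" for \<theta>
      unfolding norm_mult complex_mod_cnj using that(3)[of \<theta>] that(4)[of \<theta>]
      by (intro mult_mono) (auto intro: order_trans[OF norm_ge_zero])
  qed measurable
  note ib = bound2[OF _ _ b b] bound2[OF _ _ b pb] bound2[OF _ _ pb b] bound2[OF _ _ pb pb]
  have fc: "(\<integral>\<theta>. f \<theta> * cnj (p \<theta>) \<partial>circle_measure) = (\<Sum>j\<in>J. cnj (a j) * c j)"
  proof -
    have "(\<integral>\<theta>. f \<theta> * cnj (p \<theta>) \<partial>circle_measure) = (\<integral>\<theta>. (\<Sum>j\<in>J. cnj (a j) * (f \<theta> * cnj (circ j \<theta>))) \<partial>circle_measure)"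
      unfolding p_def by (intro Bochner_Integration.integral_cong refl) (simp add: sum_distrib_left mult_ac)
    also have "\<dots> = (\<Sum>j\<in>J. cnj (a j) * c j)"
      unfolding c_def using bound2[OF _ _ b, where v = "circ j" and B = 1 for j]
      by (subst Bochner_Integration.integral_sum) auto
    finally show ?thesis .
  qed
  have pc: "(\<integral>\<theta>. p \<theta> * cnj (p \<theta>) \<partial>circle_measure) = (\<Sum>j\<in>J. cnj (a j) * a j)"
  proof -
    have "(\<integral>\<theta>. p \<theta> * cnj (circ j \<theta>) \<partial>circle_measure) = a j" if "j \<in> J" for j
    proof -
      have "(\<integral>\<theta>. p \<theta> * cnj (circ j \<theta>) \<partial>circle_measure) = (\<integral>\<theta>. (\<Sum>k\<in>J. a k * (circ k \<theta> * cnj (circ j \<theta>))) \<partial>circle_measure)"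
        unfolding p_def by (intro Bochner_Integration.integral_cong refl) (simp add: sum_distrib_right mult.assoc)
      also have "\<dots> = (\<Sum>k\<in>J. a k * (if k = j then 1 else 0))"
        using bound2[where u = "circ k" and v = "circ j" and A = 1 and B = 1 for k]
        by (subst Bochner_Integration.integral_sum) (auto simp: circ_orthonormal)
      finally show ?thesis using that J by (simp add: if_distrib cong: if_cong)
    qed
    moreover have "(\<integral>\<theta>. p \<theta> * cnj (p \<theta>) \<partial>circle_measure) = (\<integral>\<theta>. (\<Sum>j\<in>J. cnj (a j) * (p \<theta> * cnj (circ j \<theta>))) \<partial>circle_measure)"
      by (intro Bochner_Integration.integral_cong refl) (simp add: p_def sum_distrib_left mult_ac)
    moreover have "\<dots> = (\<Sum>j\<in>J. cnj (a j) * (\<integral>\<theta>. p \<theta> * cnj (circ j \<theta>) \<partial>circle_measure))"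
      using bound2[OF _ _ pb, where v = "circ j" and B = 1 for j] by (subst Bochner_Integration.integral_sum) auto
    ultimately show ?thesis by simp
  qed
  have sq: "complex_of_real ((cmod z)\<^sup>2) = z * cnj z" for z by (rule complex_norm_square)
  have fp2: "(\<lambda>\<theta>. f \<theta> - p \<theta>) \<in> L2 circle_measure"
  proof -
    have "L2_norm_sq circle_measure (\<lambda>\<theta>. f \<theta> - p \<theta>) \<le> (\<integral>\<^sup>+\<theta>. ennreal ((C + (\<Sum>j\<in>J. cmod (a j)))\<^sup>2) \<partial>circle_measure)"
      unfolding L2_norm_sq_def
    proof (intro nn_integral_mono ennreal_leI power_mono)
      show "cmod (f \<theta> - p \<theta>) \<le> C + (\<Sum>j\<in>J. cmod (a j))" for \<theta>
        using norm_triangle_ineq4[of "f \<theta>" "p \<theta>"] b[of \<theta>] pb[of \<theta>] by simp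
    qed simp
    also have "\<dots> < \<infinity>" using prob_space.emeasure_space_1[OF prob_space_circle] by simp
    finally show ?thesis by (simp add: L2_def)
  qed
  have "(\<integral>\<theta>. (f \<theta> - p \<theta>) * cnj (f \<theta> - p \<theta>) \<partial>circle_measure)
     = (\<integral>\<theta>. f \<theta> * cnj (f \<theta>) \<partial>circle_measure) - (\<integral>\<theta>. f \<theta> * cnj (p \<theta>) \<partial>circle_measure)
       - (\<integral>\<theta>. p \<theta> * cnj (f \<theta>) \<partial>circle_measure) + (\<integral>\<theta>. p \<theta> * cnj (p \<theta>) \<partial>circle_measure)"
  proof -
    have "(\<integral>\<theta>. (f \<theta> - p \<theta>) * cnj (f \<theta> - p \<theta>) \<partial>circle_measure)
     = (\<integral>\<theta>. f \<theta> * cnj (f \<theta>) - f \<theta> * cnj (p \<theta>) - p \<theta> * cnj (f \<theta>) + p \<theta> * cnj (p \<theta>) \<partial>circle_measure)"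
      by (intro Bochner_Integration.integral_cong refl) (simp add: algebra_simps)
    then show ?thesis using ib by simp
  qed
  also have "(\<integral>\<theta>. p \<theta> * cnj (f \<theta>) \<partial>circle_measure) = cnj (\<integral>\<theta>. f \<theta> * cnj (p \<theta>) \<partial>circle_measure)"
    unfolding Bochner_Integration.integral_cnj[symmetric] by (simp add: mult.commute)
  also have "(\<integral>\<theta>. f \<theta> * cnj (f \<theta>) \<partial>circle_measure) = complex_of_real (\<integral>\<theta>. (cmod (f \<theta>))\<^sup>2 \<partial>circle_measure)"
    unfolding sq[symmetric] by (rule integral_complex_of_real)
  finally have "Re (\<integral>\<theta>. (f \<theta> - p \<theta>) * cnj (f \<theta> - p \<theta>) \<partial>circle_measure)
     = (\<integral>\<theta>. (cmod (f \<theta>))\<^sup>2 \<partial>circle_measure) - 2 * Re (\<Sum>j\<in>J. cnj (a j) * c j) + Re (\<Sum>j\<in>J. cnj (a j) * a j)"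
    unfolding fc pc by simp
  also have "\<dots> = (\<integral>\<theta>. (cmod (f \<theta>))\<^sup>2 \<partial>circle_measure) - (\<Sum>j\<in>J. (cmod (c j))\<^sup>2) + (\<Sum>j\<in>J. (cmod (a j - c j))\<^sup>2)"
  proof -
    have "- 2 * Re (cnj (a j) * c j) + Re (cnj (a j) * a j) = - (cmod (c j))\<^sup>2 + (cmod (a j - c j))\<^sup>2" for j
      unfolding cmod_power2 by (simp add: power2_eq_square algebra_simps)
    then have "(\<Sum>j\<in>J. - 2 * Re (cnj (a j) * c j) + Re (cnj (a j) * a j)) = (\<Sum>j\<in>J. - (cmod (c j))\<^sup>2 + (cmod (a j - c j))\<^sup>2)" by simp
    then show ?thesis by (simp add: sum.distrib sum_negf sum_distrib_left sum_subtractf algebra_simps)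
  qed
  finally have eq: "Re (\<integral>\<theta>. (f \<theta> - p \<theta>) * cnj (f \<theta> - p \<theta>) \<partial>circle_measure)
     = (\<integral>\<theta>. (cmod (f \<theta>))\<^sup>2 \<partial>circle_measure) - (\<Sum>j\<in>J. (cmod (c j))\<^sup>2) + (\<Sum>j\<in>J. (cmod (a j - c j))\<^sup>2)" .
  then show ?eq using L2_norm_sq_eq_inner[OF fp2] by (simp add: p_def)
  have "Re (\<integral>\<theta>. (f \<theta> - p \<theta>) * cnj (f \<theta> - p \<theta>) \<partial>circle_measure) = (\<integral>\<theta>. (cmod (f \<theta> - p \<theta>))\<^sup>2 \<partial>circle_measure)"
    unfolding sq[symmetric] integral_complex_of_real by simp
  also have "\<dots> \<ge> 0" by (intro integral_nonneg_AE) auto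
  finally show ?nonneg unfolding eq .
qed

text \<open>Bessel's inequality, together with the density of trigonometric polynomials and the minimality of the
  Fourier coefficients.\<close>

theorem parseval_circle:
  assumes h: "continuous_on (sphere 0 1) h" and J: "finite J"
  defines "f \<equiv> \<lambda>\<theta>. h (cis (2 * pi * \<theta>))"
  defines "c \<equiv> \<lambda>j. \<integral>\<theta>. f \<theta> * cnj (circ j \<theta>) \<partial>circle_measure"
  shows "L2_norm_sq circle_measure (\<lambda>\<theta>. f \<theta> - (\<Sum>j\<in>J. c j * circ j \<theta>)) = (\<Sum>\<^sub>\<infinity>j\<in>-J. ennreal ((cmod (c j))\<^sup>2))"
proof -
  have cf: "continuous_on UNIV f"
    unfolding f_def by (intro continuous_on_compose2[OF h] continuous_intros) auto
  then have [measurable]: "f \<in> borel_measurable borel" by (rule borel_measurable_continuous_onI)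
  have "bounded (h ` sphere 0 1)" by (intro compact_imp_bounded compact_continuous_image h) simp
  then obtain C where "\<forall>z\<in>sphere 0 1. cmod (h z) \<le> C" by (auto simp: bounded_iff)
  then have C: "cmod (f \<theta>) \<le> C" for \<theta> by (simp add: f_def)
  define N where "N = (\<integral>\<theta>. (cmod (f \<theta>))\<^sup>2 \<partial>circle_measure)"
  have dist: "L2_norm_sq circle_measure (\<lambda>\<theta>. f \<theta> - (\<Sum>j\<in>J. a j * circ j \<theta>))
     = ennreal (N - (\<Sum>j\<in>J. (cmod (c j))\<^sup>2) + (\<Sum>j\<in>J. (cmod (a j - c j))\<^sup>2))" if "finite J" for J a
    unfolding N_def c_def by (rule L2_circle_distance(1)[OF _ C that]) simp
  have approx: "\<exists>J0. finite J0 \<and> (\<forall>J. finite J \<and> J0 \<subseteq> J \<longrightarrow> N - (\<Sum>j\<in>J. (cmod (c j))\<^sup>2) \<le> e)" if e: "e > 0" for e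
  proof -
    obtain p where p: "trig_poly p" "\<And>\<theta>. cmod (f \<theta> - p \<theta>) < sqrt e"
      using trig_poly_dense[OF h, of "sqrt e"] e unfolding f_def by auto
    obtain J0 a where J0: "finite J0" "p = (\<lambda>\<theta>. \<Sum>j\<in>J0. a j * circ j \<theta>)" using p(1) unfolding trig_poly_def by blast
    have "N - (\<Sum>j\<in>J. (cmod (c j))\<^sup>2) \<le> e" if J: "finite J" "J0 \<subseteq> J" for J
    proof -
      define b where "b = (\<lambda>j. if j \<in> J0 then a j else 0)"
      have pb: "p \<theta> = (\<Sum>j\<in>J. b j * circ j \<theta>)" for \<theta>
        unfolding J0(2) b_def using J by (intro sum.mono_neutral_cong_left) auto
      have "ennreal (N - (\<Sum>j\<in>J. (cmod (c j))\<^sup>2) + (\<Sum>j\<in>J. (cmod (b j - c j))\<^sup>2)) = L2_norm_sq circle_measure (\<lambda>\<theta>. f \<theta> - p \<theta>)"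
        unfolding pb dist[OF J(1)] ..
      also have "\<dots> \<le> (\<integral>\<^sup>+\<theta>. ennreal e \<partial>circle_measure)"
        unfolding L2_norm_sq_def
      proof (intro nn_integral_mono ennreal_leI)
        fix \<theta>
        have "(cmod (f \<theta> - p \<theta>))\<^sup>2 \<le> (sqrt e)\<^sup>2" using p(2)[of \<theta>] by (intro power_mono) auto
        then show "(cmod (f \<theta> - p \<theta>))\<^sup>2 \<le> e" using e by simp
      qed
      also have "\<dots> = ennreal e" using prob_space.emeasure_space_1[OF prob_space_circle] by simp
      finally have "N - (\<Sum>j\<in>J. (cmod (c j))\<^sup>2) + (\<Sum>j\<in>J. (cmod (b j - c j))\<^sup>2) \<le> e"
        using e by (simp add: ennreal_le_iff)
      moreover have "0 \<le> (\<Sum>j\<in>J. (cmod (b j - c j))\<^sup>2)" by (intro sum_nonneg) auto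
      ultimately show ?thesis by linarith
    qed
    then show ?thesis using J0(1) by blast
  qed
  have bessel: "(\<Sum>j\<in>J. (cmod (c j))\<^sup>2) \<le> N" if J: "finite J" for J
    using L2_circle_distance(2)[of f C J c] C J unfolding N_def c_def by simp
  have "((\<lambda>j. (cmod (c j))\<^sup>2) has_sum N) UNIV"
    unfolding has_sum_def
  proof (rule tendstoI)
    fix e :: real assume e: "e > 0"
    obtain J0 where J0: "finite J0" "\<And>J. finite J \<Longrightarrow> J0 \<subseteq> J \<Longrightarrow> N - (\<Sum>j\<in>J. (cmod (c j))\<^sup>2) \<le> e/2"
      using approx[of "e/2"] e by auto
    have "dist (\<Sum>j\<in>J. (cmod (c j))\<^sup>2) N < e" if "finite J" "J0 \<subseteq> J" for J
      using J0(2)[OF that] bessel[OF that(1)] e by (simp add: dist_real_def)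
    then show "\<forall>\<^sub>F J in finite_subsets_at_top UNIV. dist (\<Sum>j\<in>J. (cmod (c j))\<^sup>2) N < e"
      using J0(1) by (auto simp: eventually_finite_subsets_at_top)
  qed
  from has_sum_Diff[OF this has_sum_finite[OF J]]
  have "((\<lambda>j. (cmod (c j))\<^sup>2) has_sum (N - (\<Sum>j\<in>J. (cmod (c j))\<^sup>2))) (- J)" by (simp add: Compl_eq_Diff_UNIV)
  from infsum_ennreal_has_sum[OF this]
  show ?thesis unfolding dist[OF J] by simp
qed

section \<open>Square integrable functions on the boundary components\<close>

interpretation circle: prob_space circle_measure by (rule prob_space_circle)

interpretation RT: pair_sigma_finite lborel circle_measure ..

lemma emeasure_circle [simp]: "emeasure circle_measure {0..<1} = 1"
  by (simp add: emeasure_restrict_space)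

lemma measurable_snd_restrict [measurable]: "snd \<in> borel_measurable (M \<Otimes>\<^sub>M restrict_space borel A)"
  by (rule measurable_compose[OF measurable_snd]) (auto intro: measurable_restrict_space1)

lemma measurable_snd_circle [measurable]: "snd \<in> borel_measurable (M \<Otimes>\<^sub>M circle_measure)"
  by (rule measurable_compose[OF measurable_snd]) (auto intro: measurable_restrict_space1)

lemma borel_measurable_cosh [measurable (raw)]:
  "f \<in> borel_measurable M \<Longrightarrow> (\<lambda>x. cosh (f x :: real)) \<in> borel_measurable M"
  by (rule measurable_compose[of f M borel cosh]) (auto intro!: borel_measurable_continuous_onI continuous_intros)

lemma RT_measurableI:
  "f \<in> borel_measurable borel \<Longrightarrow> f \<in> borel_measurable RT"
proof -
  assume f: "f \<in> borel_measurable borel"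
  have "(\<lambda>p. (fst p, snd p)) \<in> measurable RT (borel \<Otimes>\<^sub>M borel)"
    unfolding RT_def by (intro measurable_Pair measurable_snd_circle) simp
  then have "(\<lambda>p. f (fst p, snd p)) \<in> borel_measurable RT"
    by (rule measurable_compose) (simp add: borel_prod f)
  then show ?thesis by simp
qed

lemma L2_norm_sq_RT:
  assumes [measurable]: "f \<in> borel_measurable RT"
  shows "L2_norm_sq RT f = (\<integral>\<^sup>+x. L2_norm_sq circle_measure (\<lambda>\<theta>. f (x, \<theta>)) \<partial>lborel)"
  using assms unfolding L2_norm_sq_def RT_def
  by (subst circle.nn_integral_fst[symmetric]) auto

lemma measurable_RT_mode [measurable]:
  assumes [measurable]: "u \<in> borel_measurable borel"
  shows "(\<lambda>(x, \<theta>). u x * circ j \<theta>) \<in> borel_measurable RT"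
  unfolding RT_def split_beta' by measurable

lemma L2_norm_sq_RT_mode:
  assumes [measurable]: "u \<in> borel_measurable borel"
  shows "L2_norm_sq RT (\<lambda>(x, \<theta>). u x * circ j \<theta>) = L2_norm_sq lborel u"
  by (subst L2_norm_sq_RT) (auto simp: L2_norm_sq_def norm_mult circle.emeasure_space_1)

text \<open>Parseval's theorem on each circle, integrated over the line.\<close>

lemma L2_norm_sq_RT_expansion:
  assumes \<Phi>: "\<Phi> \<in> borel_measurable RT" and J: "finite J"
    and u [measurable]: "\<And>j. u j \<in> borel_measurable borel"
    and c: "\<And>x. \<exists>h. continuous_on (sphere 0 1) h \<and> (\<forall>\<theta>. \<Phi> (x, \<theta>) = h (cis (2 * pi * \<theta>)))"
    and coef: "\<And>x j. (\<integral>\<theta>. \<Phi> (x, \<theta>) * cnj (circ j \<theta>) \<partial>circle_measure) = u j x"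
  shows "L2_norm_sq RT (\<lambda>(x, \<theta>). \<Phi> (x, \<theta>) - (\<Sum>j\<in>J. u j x * circ j \<theta>)) = (\<Sum>\<^sub>\<infinity>j\<in>-J. L2_norm_sq lborel (u j))"
proof -
  have [measurable]: "\<Phi> \<in> borel_measurable (lborel \<Otimes>\<^sub>M circle_measure)" using \<Phi> by (simp add: RT_def)
  have "(\<lambda>(x, \<theta>). \<Phi> (x, \<theta>) - (\<Sum>j\<in>J. u j x * circ j \<theta>)) \<in> borel_measurable RT" unfolding RT_def split_beta' by measurable
  then have "L2_norm_sq RT (\<lambda>(x, \<theta>). \<Phi> (x, \<theta>) - (\<Sum>j\<in>J. u j x * circ j \<theta>))
     = (\<integral>\<^sup>+x. L2_norm_sq circle_measure (\<lambda>\<theta>. \<Phi> (x, \<theta>) - (\<Sum>j\<in>J. u j x * circ j \<theta>)) \<partial>lborel)"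
    by (subst L2_norm_sq_RT) auto
  also have "\<dots> = (\<integral>\<^sup>+x. (\<Sum>\<^sub>\<infinity>j\<in>-J. ennreal ((cmod (u j x))\<^sup>2)) \<partial>lborel)"
  proof (intro nn_integral_cong)
    fix x
    obtain h where h: "continuous_on (sphere 0 1) h" "\<And>\<theta>. \<Phi> (x, \<theta>) = h (cis (2 * pi * \<theta>))" using c[of x] by blast
    show "L2_norm_sq circle_measure (\<lambda>\<theta>. \<Phi> (x, \<theta>) - (\<Sum>j\<in>J. u j x * circ j \<theta>)) = (\<Sum>\<^sub>\<infinity>j\<in>-J. ennreal ((cmod (u j x))\<^sup>2))"
      using parseval_circle[OF h(1) J] coef[of x] unfolding h(2) by simp
  qed
  also have "\<dots> = (\<Sum>\<^sub>\<infinity>j\<in>-J. L2_norm_sq lborel (u j))"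
    unfolding L2_norm_sq_def by (rule nn_integral_infsum) measurable
  finally show ?thesis .
qed

text \<open>Bessel's inequality for a single coefficient, on almost every circle.\<close>

lemma L2_norm_sq_RT_coefficient_le:
  assumes \<Phi>: "\<Phi> \<in> L2 RT" and \<Psi>: "\<Psi> \<in> L2 RT"
  shows "L2_norm_sq lborel (\<lambda>x. (\<integral>\<theta>. \<Phi> (x, \<theta>) * cnj (circ j \<theta>) \<partial>circle_measure) - (\<integral>\<theta>. \<Psi> (x, \<theta>) * cnj (circ j \<theta>) \<partial>circle_measure))
    \<le> L2_norm_sq RT (\<lambda>p. \<Phi> p - \<Psi> p)"
proof -
  have m: "\<Phi> \<in> borel_measurable RT" "\<Psi> \<in> borel_measurable RT" using \<Phi> \<Psi> by (auto simp: L2_def)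
  then have [measurable]: "\<Phi> \<in> borel_measurable (lborel \<Otimes>\<^sub>M circle_measure)" "\<Psi> \<in> borel_measurable (lborel \<Otimes>\<^sub>M circle_measure)"
    by (simp_all add: RT_def)
  have ae: "AE x in lborel. (\<lambda>\<theta>. X (x, \<theta>)) \<in> L2 circle_measure" if X: "X \<in> L2 RT" for X
  proof -
    have [measurable]: "X \<in> borel_measurable (lborel \<Otimes>\<^sub>M circle_measure)" using X by (simp add: L2_def RT_def)
    have "(\<integral>\<^sup>+x. L2_norm_sq circle_measure (\<lambda>\<theta>. X (x, \<theta>)) \<partial>lborel) \<noteq> \<infinity>"
      using L2_norm_sq_RT[of X] X by (auto simp: L2_def)
    then have "AE x in lborel. L2_norm_sq circle_measure (\<lambda>\<theta>. X (x, \<theta>)) \<noteq> \<infinity>"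
      unfolding L2_norm_sq_def by (intro nn_integral_PInf_AE) auto
    then show ?thesis by eventually_elim (auto simp: L2_def less_top)
  qed
  have c2: "circ j \<in> L2 circle_measure"
    by (simp add: L2_def L2_norm_sq_def circle.emeasure_space_1)
  have c1: "L2_norm_sq circle_measure (circ j) = 1"
    by (simp add: L2_norm_sq_def circle.emeasure_space_1)
  have "L2_norm_sq lborel (\<lambda>x. (\<integral>\<theta>. \<Phi> (x, \<theta>) * cnj (circ j \<theta>) \<partial>circle_measure) - (\<integral>\<theta>. \<Psi> (x, \<theta>) * cnj (circ j \<theta>) \<partial>circle_measure))
     \<le> (\<integral>\<^sup>+x. L2_norm_sq circle_measure (\<lambda>\<theta>. \<Phi> (x, \<theta>) - \<Psi> (x, \<theta>)) \<partial>lborel)"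
    unfolding L2_norm_sq_def[of lborel]
  proof (intro nn_integral_mono_AE)
    show "AE x in lborel. ennreal ((cmod ((\<integral>\<theta>. \<Phi> (x, \<theta>) * cnj (circ j \<theta>) \<partial>circle_measure) - (\<integral>\<theta>. \<Psi> (x, \<theta>) * cnj (circ j \<theta>) \<partial>circle_measure)))\<^sup>2)
      \<le> L2_norm_sq circle_measure (\<lambda>\<theta>. \<Phi> (x, \<theta>) - \<Psi> (x, \<theta>))"
      using ae[OF \<Phi>] ae[OF \<Psi>]
    proof eventually_elim
      case (elim x)
      from L2_Cauchy_Schwarz(3)[OF L2_diff[OF elim] c2] L2_Cauchy_Schwarz(1)[OF elim(1) c2] L2_Cauchy_Schwarz(1)[OF elim(2) c2]
      show ?case by (simp add: c1 left_diff_distrib)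
    qed
  qed
  also have "\<dots> = L2_norm_sq RT (\<lambda>p. \<Phi> p - \<Psi> p)"
    using m by (subst L2_norm_sq_RT) auto
  finally show ?thesis .
qed

lemma RT_coefficient_L2:
  assumes \<Phi>: "\<Phi> \<in> L2 RT"
  shows "(\<lambda>x. \<integral>\<theta>. \<Phi> (x, \<theta>) * cnj (circ j \<theta>) \<partial>circle_measure) \<in> L2 lborel"
proof -
  have [measurable]: "\<Phi> \<in> borel_measurable (lborel \<Otimes>\<^sub>M circle_measure)" using \<Phi> by (simp add: L2_def RT_def)
  have z: "(\<lambda>p. 0) \<in> L2 RT" by (simp add: L2_def L2_norm_sq_def)
  have "L2_norm_sq lborel (\<lambda>x. \<integral>\<theta>. \<Phi> (x, \<theta>) * cnj (circ j \<theta>) \<partial>circle_measure) \<le> L2_norm_sq RT \<Phi>"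
    using L2_norm_sq_RT_coefficient_le[OF \<Phi> z, of j] by simp
  also have "\<dots> < \<infinity>" by (rule L2_finite[OF \<Phi>])
  finally show ?thesis by (simp add: L2_def)
qed

section \<open>The energy and the modes\<close>

text \<open>The signs with \<open>\<eta>\<^sub>l = \<sigma>\<^sub>l (\<beta> - \<pi>/2) + \<tau>\<^sub>l \<pi>/2\<close>. The slice with parameters \<open>(t, s)\<close> lies over
  \<open>(\<sigma>\<^sub>l s + \<tau>\<^sub>l t, \<sigma>\<^sub>l s)\<close>.\<close>

definition tau :: "nat \<Rightarrow> real" where
  "tau l = (if l = 1 \<or> l = 4 then 1 else - 1)"

lemma eta_eq: "l \<in> {1..4} \<Longrightarrow> eta \<beta> l = sigma l * (\<beta> - pi / 2) + tau l * (pi / 2)"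
  by (auto simp: eta_def sigma_def tau_def)

lemma slice_eq:
  "l \<in> {1..4} \<Longrightarrow> slice F t s l = (\<lambda>(x, \<theta>). F (Complex x (sigma l * s + tau l * t), complex_of_real (exp (sigma l * s / 2)) * cis (2 * pi * \<theta>)))"
  by (auto simp: slice_def sigma_def tau_def fun_eq_iff)

text \<open>The pairs \<open>(Im z\<^sub>1, log \<bar>z\<^sub>2\<bar>\<^sup>2)\<close> for \<open>(z\<^sub>1, z\<^sub>2)\<close> in the domain.\<close>

definition tube :: "real \<Rightarrow> (real \<times> real) set" where
  "tube \<beta> = {(y, s). \<bar>y - s\<bar> < pi / 2 \<and> \<bar>s\<bar> < \<beta> - pi / 2}"

definition closed_tube :: "real \<Rightarrow> (real \<times> real) set" where
  "closed_tube \<beta> = {(y, s). \<bar>y - s\<bar> \<le> pi / 2 \<and> \<bar>s\<bar> \<le> \<beta> - pi / 2}"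

lemma tube_subset: "tube \<beta> \<subseteq> closed_tube \<beta>"
  by (auto simp: tube_def closed_tube_def)

lemma tube_D': "(y, s) \<in> tube \<beta> \<Longrightarrow> cmod z = 1 \<Longrightarrow> (Complex x y, complex_of_real (exp (s / 2)) * z) \<in> D' \<beta>"
  by (cases "z = 0") (auto simp: tube_def D'_def norm_mult power2_eq_square simp flip: exp_add)

lemma tube_abs: "(y, s) \<in> tube \<beta> \<Longrightarrow> \<bar>y\<bar> < \<beta>"
  by (auto simp: tube_def abs_if field_simps split: if_splits)

text \<open>Between the corner \<open>(\<beta>, \<beta> - \<pi>/2)\<close> and its opposite the diagonal runs inside the tube, so every line of the
  strip \<open>\<bar>Im z\<^sub>1\<bar> < \<beta>\<close> meets the domain.\<close>

lemma tube_section: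
  assumes "\<bar>y\<bar> < \<beta>" "\<beta> > pi / 2"
  shows "(y, y * ((\<beta> - pi / 2) / \<beta>)) \<in> tube \<beta>"
proof -
  have b: "\<beta> > 0" using assms pi_gt_zero by linarith
  have "y - y * ((\<beta> - pi / 2) / \<beta>) = y / \<beta> * (pi / 2)" using b by (simp add: field_simps)
  moreover have "\<bar>y / \<beta>\<bar> < 1" using assms b by simp
  moreover have "y * ((\<beta> - pi / 2) / \<beta>) = y / \<beta> * (\<beta> - pi / 2)" by simp
  moreover have "\<bar>y / \<beta> * c\<bar> < c" if "c > 0" for c
    using mult_strict_right_mono[OF \<open>\<bar>y / \<beta>\<bar> < 1\<close> that] that by (simp only: abs_mult; simp)
  ultimately show ?thesis using assms by (simp add: tube_def)
qed

lemma slice_tube: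
  assumes "t \<in> {0..<pi / 2}" "s \<in> {0..<\<beta> - pi / 2}"
  shows "(sigma l * s + tau l * t, sigma l * s) \<in> tube \<beta>"
  using assms by (auto simp: tube_def sigma_def tau_def)

lemma eta_closed_tube:
  assumes "\<beta> > pi / 2" "l \<in> {1..4}"
  shows "(eta \<beta> l, sigma l * (\<beta> - pi / 2)) \<in> closed_tube \<beta>"
  using assms unfolding eta_eq[OF assms(2)] by (auto simp: closed_tube_def sigma_def tau_def)

definition energy :: "real \<Rightarrow> (int \<Rightarrow> real \<Rightarrow> complex) \<Rightarrow> int \<Rightarrow> ennreal" where
  "energy \<beta> g j = (\<integral>\<^sup>+\<xi>. ennreal ((cmod (g j \<xi>))\<^sup>2 * cosh (pi * \<xi>) * cosh ((2 * \<beta> - pi) * (\<xi> - of_int j / 2))) \<partial>lborel)"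

lemma finite_energy_alt: "finite_energy \<beta> g \<longleftrightarrow> (\<forall>j. g j \<in> borel_measurable borel) \<and> infsum (energy \<beta> g) UNIV < \<infinity>"
  unfolding finite_energy_def energy_def ..

lemma finite_energyD:
  assumes "finite_energy \<beta> g"
  shows "g j \<in> borel_measurable borel" "energy \<beta> g j < \<infinity>" "infsum (energy \<beta> g) UNIV < \<infinity>"
proof -
  show "g j \<in> borel_measurable borel" and *: "infsum (energy \<beta> g) UNIV < \<infinity>"
    using assms by (auto simp: finite_energy_alt)
  have "energy \<beta> g j = infsum (energy \<beta> g) {j}" by simp
  also have "\<dots> \<le> infsum (energy \<beta> g) UNIV" by (rule infsum_ennreal_mono_set) simp
  finally show "energy \<beta> g j < \<infinity>" using * by (rule order.strict_trans1)
qed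

text \<open>The Fourier transform in \<open>Re z\<^sub>1\<close> of the \<open>j\<close>-th angular coefficient over \<open>(y, s)\<close>.\<close>

definition mode :: "(int \<Rightarrow> real \<Rightarrow> complex) \<Rightarrow> real \<Rightarrow> real \<Rightarrow> int \<Rightarrow> real \<Rightarrow> complex" where
  "mode g y s j \<xi> = complex_of_real (exp (s * of_int j / 2 - y * \<xi>)) * g j \<xi>"

lemma mode_measurable: "g j \<in> borel_measurable borel \<Longrightarrow> mode g y s j \<in> borel_measurable borel"
  unfolding mode_def by measurable

lemma mode_eq: "mode g y s j \<xi> = complex_of_real (exp (s * of_int j / 2)) * (complex_of_real (exp (- y * \<xi>)) * g j \<xi>)"
proof -
  have "exp (s * of_int j / 2 - y * \<xi>) = exp (s * of_int j / 2) * exp (- y * \<xi>)" by (simp flip: exp_add)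
  then show ?thesis by (simp add: mode_def)
qed

lemma exp_le_2_cosh: "\<bar>x\<bar> \<le> y \<Longrightarrow> exp x \<le> 2 * cosh (y::real)"
proof -
  assume "\<bar>x\<bar> \<le> y"
  then have "exp x \<le> exp y" by simp
  also have "\<dots> \<le> 2 * cosh y" by (simp add: cosh_def)
  finally show ?thesis .
qed

text \<open>The exponent is \<open>-2(y - s)\<xi> - 2s(\<xi> - j/2)\<close>, and the two conditions of the tube bound its two terms.\<close>

lemma mode_weight_le:
  assumes "(y, s) \<in> closed_tube \<beta>"
  shows "(exp (s * of_int j / 2 - y * \<xi>))\<^sup>2 \<le> 4 * (cosh (pi * \<xi>) * cosh ((2 * \<beta> - pi) * (\<xi> - of_int j / 2)))"
proof -
  have "(exp (s * of_int j / 2 - y * \<xi>))\<^sup>2 = exp (- 2 * (y - s) * \<xi>) * exp (- 2 * s * (\<xi> - of_int j / 2))"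
    by (simp add: power2_eq_square field_simps flip: exp_add)
  also have "\<dots> \<le> (2 * cosh \<bar>pi * \<xi>\<bar>) * (2 * cosh \<bar>(2 * \<beta> - pi) * (\<xi> - of_int j / 2)\<bar>)"
  proof (intro mult_mono exp_le_2_cosh)
    have "\<bar>- 2 * (y - s) * \<xi>\<bar> = 2 * \<bar>y - s\<bar> * \<bar>\<xi>\<bar>" by (simp only: abs_mult; simp)
    also have "\<dots> \<le> pi * \<bar>\<xi>\<bar>" using assms by (intro mult_right_mono) (auto simp: closed_tube_def)
    finally show "\<bar>- 2 * (y - s) * \<xi>\<bar> \<le> \<bar>pi * \<xi>\<bar>" by (simp add: abs_mult)
    have "\<bar>- 2 * s * (\<xi> - of_int j / 2)\<bar> = 2 * \<bar>s\<bar> * \<bar>\<xi> - of_int j / 2\<bar>" by (simp only: abs_mult; simp)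
    also have "\<dots> \<le> \<bar>2 * \<beta> - pi\<bar> * \<bar>\<xi> - of_int j / 2\<bar>" using assms by (intro mult_right_mono) (auto simp: closed_tube_def)
    finally show "\<bar>- 2 * s * (\<xi> - of_int j / 2)\<bar> \<le> \<bar>(2 * \<beta> - pi) * (\<xi> - of_int j / 2)\<bar>" by (simp add: abs_mult)
  qed auto
  also have "\<dots> = 4 * (cosh (pi * \<xi>) * cosh ((2 * \<beta> - pi) * (\<xi> - of_int j / 2)))"
    by simp
  finally show ?thesis .
qed

lemma mode_norm_le:
  assumes "(y, s) \<in> closed_tube \<beta>"
  shows "(cmod (mode g y s j \<xi>))\<^sup>2 \<le> 4 * ((cmod (g j \<xi>))\<^sup>2 * cosh (pi * \<xi>) * cosh ((2 * \<beta> - pi) * (\<xi> - of_int j / 2)))"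
  using mult_right_mono[OF mode_weight_le[OF assms, of j \<xi>], of "(cmod (g j \<xi>))\<^sup>2"]
  by (simp add: mode_def norm_mult power_mult_distrib mult_ac)

lemma L2_norm_sq_mode_le:
  assumes [measurable]: "g j \<in> borel_measurable borel" and "(y, s) \<in> closed_tube \<beta>"
  shows "L2_norm_sq lborel (mode g y s j) \<le> 4 * energy \<beta> g j"
proof -
  have "L2_norm_sq lborel (mode g y s j) \<le> (\<integral>\<^sup>+\<xi>. 4 * ennreal ((cmod (g j \<xi>))\<^sup>2 * cosh (pi * \<xi>) * cosh ((2 * \<beta> - pi) * (\<xi> - of_int j / 2))) \<partial>lborel)"
    unfolding L2_norm_sq_def
    using mode_norm_le[OF assms(2), of g j]
    by (intro nn_integral_mono) (metis (no_types, lifting) ennreal_leI ennreal_mult' ennreal_numeral zero_le_numeral)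
  then show ?thesis by (simp add: nn_integral_cmult energy_def)
qed

lemma mode_L2:
  assumes "g j \<in> borel_measurable borel" "energy \<beta> g j < \<infinity>" "(y, s) \<in> closed_tube \<beta>"
  shows "mode g y s j \<in> L2 lborel"
proof -
  have "L2_norm_sq lborel (mode g y s j) \<le> 4 * energy \<beta> g j" by (rule L2_norm_sq_mode_le[where j = j and g = g, OF assms(1,3)])
  also have "\<dots> < \<infinity>" using assms(2) by (simp add: ennreal_mult_less_top)
  finally show ?thesis using assms(1) by (simp add: L2_def mode_measurable)
qed

lemma exp_weight_L2:
  assumes "g j \<in> borel_measurable borel" "energy \<beta> g j < \<infinity>" "\<bar>y\<bar> < \<beta>" "\<beta> > pi / 2"
  shows "(\<lambda>\<xi>. complex_of_real (exp (- y * \<xi>)) * g j \<xi>) \<in> L2 lborel"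
proof -
  define s where "s = y * ((\<beta> - pi / 2) / \<beta>)"
  have "(y, s) \<in> closed_tube \<beta>" using tube_section[OF assms(3,4)] tube_subset by (auto simp: s_def)
  from L2_cmult[OF mode_L2[where g = g and j = j, OF assms(1,2) this], of "complex_of_real (exp (- (s * of_int j / 2)))"]
  show ?thesis unfolding mode_eq mult.assoc[symmetric] of_real_mult[symmetric] exp_add[symmetric] by simp
qed

lemma mode_integrable:
  assumes w: "\<And>y. \<bar>y\<bar> < \<beta> \<Longrightarrow> (\<lambda>\<xi>. complex_of_real (exp (- y * \<xi>)) * g j \<xi>) \<in> L2 lborel" and y: "\<bar>y\<bar> < \<beta>"
  shows "integrable lborel (mode g y s j)" "mode g y s j \<in> L2 lborel"
  unfolding mode_eq
  by (intro integrable_mult_right exp_weight_integrable[OF w y], assumption)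
     (intro L2_cmult w y)

lemma inv_fourier_mode: "inv_fourier (mode g y s j) x = complex_of_real (exp (s * of_int j / 2)) * inv_fourier (\<lambda>\<xi>. complex_of_real (exp (- y * \<xi>)) * g j \<xi>) x"
  unfolding mode_eq by (rule inv_fourier_cmult)

text \<open>Dominated convergence: \<open>mode_norm_le\<close> bounds all modes by one square integrable function.\<close>

lemma mode_continuous:
  assumes [measurable]: "g j \<in> borel_measurable borel" and e: "energy \<beta> g j < \<infinity>"
    and Y: "\<And>n. (Y n, X n) \<in> closed_tube \<beta>" "(y, s) \<in> closed_tube \<beta>" and lim: "Y \<longlonglongrightarrow> y" "X \<longlonglongrightarrow> s"
  shows "(\<lambda>n. L2_norm_sq lborel (\<lambda>\<xi>. mode g (Y n) (X n) j \<xi> - mode g y s j \<xi>)) \<longlonglongrightarrow> 0"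
proof (rule L2_dominated_tendsto_0[where w = "\<lambda>\<xi>. 4 * sqrt ((cmod (g j \<xi>))\<^sup>2 * cosh (pi * \<xi>) * cosh ((2 * \<beta> - pi) * (\<xi> - of_int j / 2)))"])
  show "(\<lambda>\<xi>. 4 * sqrt ((cmod (g j \<xi>))\<^sup>2 * cosh (pi * \<xi>) * cosh ((2 * \<beta> - pi) * (\<xi> - of_int j / 2)))) \<in> borel_measurable lborel"
    by measurable
  have nn: "0 \<le> (cmod (g j \<xi>))\<^sup>2 * cosh (pi * \<xi>) * cosh ((2 * \<beta> - pi) * (\<xi> - of_int j / 2))" for \<xi> by simp
  have le: "cmod (mode g y' s' j \<xi>) \<le> 2 * sqrt ((cmod (g j \<xi>))\<^sup>2 * cosh (pi * \<xi>) * cosh ((2 * \<beta> - pi) * (\<xi> - of_int j / 2)))"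
    if "(y', s') \<in> closed_tube \<beta>" for y' s' \<xi>
  proof -
    have "cmod (mode g y' s' j \<xi>) = sqrt ((cmod (mode g y' s' j \<xi>))\<^sup>2)" by simp
    also have "\<dots> \<le> sqrt (4 * ((cmod (g j \<xi>))\<^sup>2 * cosh (pi * \<xi>) * cosh ((2 * \<beta> - pi) * (\<xi> - of_int j / 2))))"
      by (rule real_sqrt_le_mono[OF mode_norm_le[OF that]])
    finally show ?thesis by (simp only: real_sqrt_mult[of 4]) simp
  qed
  show "AE \<xi> in lborel. cmod (mode g (Y n) (X n) j \<xi> - mode g y s j \<xi>)
      \<le> 4 * sqrt ((cmod (g j \<xi>))\<^sup>2 * cosh (pi * \<xi>) * cosh ((2 * \<beta> - pi) * (\<xi> - of_int j / 2)))" for n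
  proof (intro AE_I2)
    fix \<xi>
    show "cmod (mode g (Y n) (X n) j \<xi> - mode g y s j \<xi>)
      \<le> 4 * sqrt ((cmod (g j \<xi>))\<^sup>2 * cosh (pi * \<xi>) * cosh ((2 * \<beta> - pi) * (\<xi> - of_int j / 2)))"
      using norm_triangle_ineq4[of "mode g (Y n) (X n) j \<xi>" "mode g y s j \<xi>"] le[OF Y(1)[of n], of \<xi>] le[OF Y(2), of \<xi>] by linarith
  qed
  have "(\<integral>\<^sup>+ \<xi>. ennreal ((4 * sqrt ((cmod (g j \<xi>))\<^sup>2 * cosh (pi * \<xi>) * cosh ((2 * \<beta> - pi) * (\<xi> - of_int j / 2))))\<^sup>2) \<partial>lborel)
      = (\<integral>\<^sup>+ \<xi>. 16 * ennreal ((cmod (g j \<xi>))\<^sup>2 * cosh (pi * \<xi>) * cosh ((2 * \<beta> - pi) * (\<xi> - of_int j / 2))) \<partial>lborel)"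
  proof (intro nn_integral_cong)
    fix \<xi>
    have "(4 * sqrt ((cmod (g j \<xi>))\<^sup>2 * cosh (pi * \<xi>) * cosh ((2 * \<beta> - pi) * (\<xi> - of_int j / 2))))\<^sup>2
      = 16 * ((cmod (g j \<xi>))\<^sup>2 * cosh (pi * \<xi>) * cosh ((2 * \<beta> - pi) * (\<xi> - of_int j / 2)))"
      unfolding power_mult_distrib real_sqrt_pow2[OF nn] by simp
    then show "ennreal ((4 * sqrt ((cmod (g j \<xi>))\<^sup>2 * cosh (pi * \<xi>) * cosh ((2 * \<beta> - pi) * (\<xi> - of_int j / 2))))\<^sup>2)
      = 16 * ennreal ((cmod (g j \<xi>))\<^sup>2 * cosh (pi * \<xi>) * cosh ((2 * \<beta> - pi) * (\<xi> - of_int j / 2)))"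
      by (metis ennreal_mult' ennreal_numeral zero_le_numeral)
  qed
  also have "\<dots> < \<infinity>" using e by (simp add: nn_integral_cmult energy_def ennreal_mult_less_top)
  finally show "(\<integral>\<^sup>+ \<xi>. ennreal ((4 * sqrt ((cmod (g j \<xi>))\<^sup>2 * cosh (pi * \<xi>) * cosh ((2 * \<beta> - pi) * (\<xi> - of_int j / 2))))\<^sup>2) \<partial>lborel) < \<infinity>" .
  show "AE \<xi> in lborel. (\<lambda>n. mode g (Y n) (X n) j \<xi> - mode g y s j \<xi>) \<longlonglongrightarrow> 0"
  proof (intro AE_I2)
    fix \<xi>
    have "(\<lambda>n. complex_of_real (exp (X n * of_int j / 2 - Y n * \<xi>)) * g j \<xi> - mode g y s j \<xi>)
       \<longlonglongrightarrow> complex_of_real (exp (s * of_int j / 2 - y * \<xi>)) * g j \<xi> - mode g y s j \<xi>"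
      by (intro tendsto_intros lim) auto
    then show "(\<lambda>n. mode g (Y n) (X n) j \<xi> - mode g y s j \<xi>) \<longlonglongrightarrow> 0" by (simp add: mode_def)
  qed
  show "(\<lambda>\<xi>. mode g (Y n) (X n) j \<xi> - mode g y s j \<xi>) \<in> borel_measurable lborel" for n
    unfolding mode_def by measurable
qed

abbreviation bdry_filter :: "real \<Rightarrow> (real \<times> real) filter" where
  "bdry_filter \<beta> \<equiv> at (pi / 2, \<beta> - pi / 2) within {0..<pi / 2} \<times> {0..<\<beta> - pi / 2}"

lemma bdry_filter_neq_bot:
  assumes "\<beta> > pi / 2"
  shows "bdry_filter \<beta> \<noteq> bot"
proof -
  have "(pi / 2, \<beta> - pi / 2) islimpt ({0..<pi / 2} \<times> {0..<\<beta> - pi / 2})"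
    unfolding islimpt_sequential
  proof (intro exI conjI allI)
    define X where "X = (\<lambda>n. (pi / 2 * (1 - 1 / real (Suc n)), (\<beta> - pi / 2) * (1 - 1 / real (Suc n))))"
    have "0 \<le> 1 - 1 / real (Suc n)" "1 - 1 / real (Suc n) < 1" for n by auto
    then show "X n \<in> ({0..<pi / 2} \<times> {0..<\<beta> - pi / 2}) - {(pi / 2, \<beta> - pi / 2)}" for n
      using assms pi_gt_zero by (auto simp: X_def intro!: mult_nonneg_nonneg simp del: of_nat_Suc)
    have "(\<lambda>n. 1 / real (Suc n)) \<longlonglongrightarrow> 0" using LIMSEQ_inverse_real_of_nat by (simp add: inverse_eq_divide)
    then have "X \<longlonglongrightarrow> (pi / 2 * (1 - 0), (\<beta> - pi / 2) * (1 - 0))"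
      unfolding X_def by (intro tendsto_intros)
    then show "X \<longlonglongrightarrow> (pi / 2, \<beta> - pi / 2)" by simp
  qed
  then show ?thesis by (simp add: trivial_limit_within)
qed

lemma slice_mode_tendsto:
  assumes b: "\<beta> > pi / 2" and g: "g j \<in> borel_measurable borel" "energy \<beta> g j < \<infinity>" and l: "l \<in> {1..4}"
  shows "((\<lambda>(t, s). L2_norm_sq lborel (\<lambda>\<xi>. mode g (sigma l * s + tau l * t) (sigma l * s) j \<xi>
      - mode g (eta \<beta> l) (sigma l * (\<beta> - pi / 2)) j \<xi>)) \<longlongrightarrow> 0) (bdry_filter \<beta>)"
  unfolding tendsto_at_iff_sequentially
proof (intro allI impI)
  fix X :: "nat \<Rightarrow> real \<times> real"
  assume X: "\<forall>i. X i \<in> {0..<pi / 2} \<times> {0..<\<beta> - pi / 2} - {(pi / 2, \<beta> - pi / 2)}" and lim: "X \<longlonglongrightarrow> (pi / 2, \<beta> - pi / 2)"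
  have 1: "(\<lambda>n. fst (X n)) \<longlonglongrightarrow> pi / 2" "(\<lambda>n. snd (X n)) \<longlonglongrightarrow> \<beta> - pi / 2"
    using tendsto_fst[OF lim] tendsto_snd[OF lim] by auto
  have "(\<lambda>n. L2_norm_sq lborel (\<lambda>\<xi>. mode g (sigma l * snd (X n) + tau l * fst (X n)) (sigma l * snd (X n)) j \<xi>
      - mode g (eta \<beta> l) (sigma l * (\<beta> - pi / 2)) j \<xi>)) \<longlonglongrightarrow> 0"
  proof (rule mode_continuous[where g = g and j = j, OF g])
    show "(sigma l * snd (X n) + tau l * fst (X n), sigma l * snd (X n)) \<in> closed_tube \<beta>" for n
      by (rule subsetD[OF tube_subset slice_tube]) (use X[rule_format, of n] in auto)
    show "(eta \<beta> l, sigma l * (\<beta> - pi / 2)) \<in> closed_tube \<beta>" by (rule eta_closed_tube[OF b l])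
    show "(\<lambda>n. sigma l * snd (X n) + tau l * fst (X n)) \<longlonglongrightarrow> eta \<beta> l"
      unfolding eta_eq[OF l] by (intro tendsto_intros 1)
    show "(\<lambda>n. sigma l * snd (X n)) \<longlonglongrightarrow> sigma l * (\<beta> - pi / 2)" by (intro tendsto_intros 1)
  qed
  then show "((\<lambda>(t, s). L2_norm_sq lborel (\<lambda>\<xi>. mode g (sigma l * s + tau l * t) (sigma l * s) j \<xi>
      - mode g (eta \<beta> l) (sigma l * (\<beta> - pi / 2)) j \<xi>)) \<circ> X) \<longlonglongrightarrow> 0"
    by (simp add: o_def split_beta')
qed

section \<open>Functions with given frequency-side coefficients\<close>

text \<open>The restriction to the part of the domain over \<open>(y, s)\<close>; each component of a slice is one.\<close>

definition fiber :: "(complex \<times> complex \<Rightarrow> complex) \<Rightarrow> real \<Rightarrow> real \<Rightarrow> real \<times> real \<Rightarrow> complex" where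
  "fiber F y s = (\<lambda>(x, \<theta>). F (Complex x y, complex_of_real (exp (s / 2)) * cis (2 * pi * \<theta>)))"

text \<open>\<open>spectral \<beta> F g\<close> expresses that \<open>F(z\<^sub>1, z\<^sub>2) = \<Sum>\<^sub>j z\<^sub>2\<^sup>j F\<^sub>j(z\<^sub>1)\<close> where \<open>F\<^sub>j(\<sqdot> + iy)\<close> is the inverse transform of
  \<open>e\<^bsup>-y\<xi>\<^esup> g\<^sub>j(\<xi>)\<close>. Both halves of the characterisation reduce to it.\<close>

definition spectral :: "real \<Rightarrow> (complex \<times> complex \<Rightarrow> complex) \<Rightarrow> (int \<Rightarrow> real \<Rightarrow> complex) \<Rightarrow> bool" where
  "spectral \<beta> F g \<longleftrightarrow> continuous_on (D' \<beta>) F \<and> (\<forall>j. g j \<in> borel_measurable borel) \<and>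
     (\<forall>j y. \<bar>y\<bar> < \<beta> \<longrightarrow> (\<lambda>\<xi>. complex_of_real (exp (- y * \<xi>)) * g j \<xi>) \<in> L2 lborel) \<and>
     (\<forall>y s x j. (y, s) \<in> tube \<beta> \<longrightarrow>
        (\<integral>\<theta>. fiber F y s (x, \<theta>) * cnj (circ j \<theta>) \<partial>circle_measure) = inv_fourier (mode g y s j) x)"

lemma slice_fiber:
  "l \<in> {1..4} \<Longrightarrow> slice F t s l = fiber F (sigma l * s + tau l * t) (sigma l * s)"
  by (simp add: slice_eq fiber_def)

lemma fiber_continuous:
  assumes F: "continuous_on (D' \<beta>) F" and ys: "(y, s) \<in> tube \<beta>"
  shows "continuous_on UNIV (fiber F y s)"
    and "continuous_on (sphere 0 1) (\<lambda>z. F (Complex x y, complex_of_real (exp (s / 2)) * z))"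
  unfolding fiber_def split_beta'
  by (intro continuous_on_compose2[OF F] continuous_intros; use tube_D'[OF ys] in auto)+

context
  fixes \<beta> F g
  assumes sp: "spectral \<beta> F g"
begin

lemma spectral_measurable: "g j \<in> borel_measurable borel"
  using sp by (simp add: spectral_def)

lemma spectral_mode:
  assumes "(y, s) \<in> tube \<beta>"
  shows "integrable lborel (mode g y s j)" "mode g y s j \<in> L2 lborel"
  using mode_integrable[of \<beta> g j y s] sp tube_abs[OF assms] by (auto simp: spectral_def)

lemma fiber_measurable: "(y, s) \<in> tube \<beta> \<Longrightarrow> fiber F y s \<in> borel_measurable RT"
  using sp by (intro RT_measurableI borel_measurable_continuous_onI fiber_continuous(1)) (auto simp: spectral_def)

text \<open>Parseval in the angle and Plancherel on the line.\<close>

lemma fiber_expansion: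
  assumes ys: "(y, s) \<in> tube \<beta>" and J: "finite J"
  shows "L2_norm_sq RT (\<lambda>(x, \<theta>). fiber F y s (x, \<theta>) - (\<Sum>j\<in>J. inv_fourier (mode g y s j) x * circ j \<theta>))
    = ennreal (1 / (2 * pi)) * (\<Sum>\<^sub>\<infinity>j\<in>-J. L2_norm_sq lborel (mode g y s j))"
proof -
  have "L2_norm_sq RT (\<lambda>(x, \<theta>). fiber F y s (x, \<theta>) - (\<Sum>j\<in>J. inv_fourier (mode g y s j) x * circ j \<theta>))
     = (\<Sum>\<^sub>\<infinity>j\<in>-J. L2_norm_sq lborel (inv_fourier (mode g y s j)))"
  proof (rule L2_norm_sq_RT_expansion[OF fiber_measurable[OF ys] J])
    show "inv_fourier (mode g y s j) \<in> borel_measurable borel" for j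
      by (rule measurable_inv_fourier[OF spectral_mode(1)[OF ys]])
    show "\<exists>h. continuous_on (sphere 0 1) h \<and> (\<forall>\<theta>. fiber F y s (x, \<theta>) = h (cis (2 * pi * \<theta>)))" for x
      using fiber_continuous(2)[OF _ ys, of F x] sp
      by (intro exI[of _ "\<lambda>z. F (Complex x y, complex_of_real (exp (s / 2)) * z)"]) (auto simp: fiber_def spectral_def)
    show "(\<integral>\<theta>. fiber F y s (x, \<theta>) * cnj (circ j \<theta>) \<partial>circle_measure) = inv_fourier (mode g y s j) x" for x j
      using sp ys by (simp add: spectral_def)
  qed
  also have "\<dots> = (\<Sum>\<^sub>\<infinity>j\<in>-J. ennreal (1 / (2 * pi)) * L2_norm_sq lborel (mode g y s j))"
    using plancherel[OF spectral_mode[OF ys]] by simp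
  also have "\<dots> = ennreal (1 / (2 * pi)) * (\<Sum>\<^sub>\<infinity>j\<in>-J. L2_norm_sq lborel (mode g y s j))"
    by (rule infsum_ennreal_cmult)
  finally show ?thesis .
qed

text \<open>The bound no longer depends on \<open>(y, s)\<close>.\<close>

lemma fiber_expansion_le:
  assumes ys: "(y, s) \<in> tube \<beta>" and J: "finite J"
  shows "L2_norm_sq RT (\<lambda>(x, \<theta>). fiber F y s (x, \<theta>) - (\<Sum>j\<in>J. inv_fourier (mode g y s j) x * circ j \<theta>))
    \<le> 4 * infsum (energy \<beta> g) (- J)"
proof -
  have "ennreal (1 / (2 * pi)) \<le> 1" using pi_gt3 by simp
  moreover have "(\<Sum>\<^sub>\<infinity>j\<in>-J. L2_norm_sq lborel (mode g y s j)) \<le> (\<Sum>\<^sub>\<infinity>j\<in>-J. 4 * energy \<beta> g j)"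
    by (intro infsum_ennreal_mono L2_norm_sq_mode_le spectral_measurable subsetD[OF tube_subset ys])
  ultimately have "ennreal (1 / (2 * pi)) * (\<Sum>\<^sub>\<infinity>j\<in>-J. L2_norm_sq lborel (mode g y s j)) \<le> 1 * (\<Sum>\<^sub>\<infinity>j\<in>-J. 4 * energy \<beta> g j)"
    by (intro mult_mono) auto
  then show ?thesis unfolding fiber_expansion[OF assms] by (simp add: infsum_ennreal_cmult)
qed

lemma fiber_norm_le: "(y, s) \<in> tube \<beta> \<Longrightarrow> L2_norm_sq RT (fiber F y s) \<le> 4 * infsum (energy \<beta> g) UNIV"
  using fiber_expansion_le[of y s "{}"] by (simp add: fiber_def)

lemma fiber_L2:
  assumes "(y, s) \<in> tube \<beta>" "infsum (energy \<beta> g) UNIV < \<infinity>"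
  shows "fiber F y s \<in> L2 RT"
proof -
  have "4 * infsum (energy \<beta> g) UNIV < \<infinity>" using assms(2) by (simp add: ennreal_mult_less_top)
  with fiber_norm_le[OF assms(1)] fiber_measurable[OF assms(1)] show ?thesis
    by (auto simp: L2_def intro: order.strict_trans1)
qed

lemma spectral_norm_bounded:
  assumes e: "infsum (energy \<beta> g) UNIV < \<infinity>"
  shows "(SUP (t, s) \<in> {0..<pi / 2} \<times> {0..<\<beta> - pi / 2}. bdry_norm_sq (slice F t s)) < \<infinity>"
proof -
  have "(SUP (t, s) \<in> {0..<pi / 2} \<times> {0..<\<beta> - pi / 2}. bdry_norm_sq (slice F t s)) \<le> (\<Sum>l = 1..4::nat. 4 * infsum (energy \<beta> g) UNIV)"
  proof (rule SUP_least)
    fix ts assume "ts \<in> {0..<pi / 2} \<times> {0..<\<beta> - pi / 2}"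
    then obtain t s where ts: "ts = (t, s)" "t \<in> {0..<pi / 2}" "s \<in> {0..<\<beta> - pi / 2}" by auto
    have "bdry_norm_sq (slice F t s) \<le> (\<Sum>l = 1..4::nat. 4 * infsum (energy \<beta> g) UNIV)"
      unfolding bdry_norm_sq_def
    proof (intro sum_mono)
      fix l :: nat assume l: "l \<in> {1..4}"
      show "L2_norm_sq RT (slice F t s l) \<le> 4 * infsum (energy \<beta> g) UNIV"
        unfolding slice_fiber[OF l] by (rule fiber_norm_le[OF slice_tube[OF ts(2,3)]])
    qed
    then show "(case ts of (t, s) \<Rightarrow> bdry_norm_sq (slice F t s)) \<le> (\<Sum>l = 1..4::nat. 4 * infsum (energy \<beta> g) UNIV)"
      by (simp add: ts)
  qed
  also have "\<dots> < \<infinity>" using e by (auto simp: ennreal_mult_less_top)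
  finally show ?thesis .
qed

end

lemma eventually_bdry_filter: "\<forall>\<^sub>F (t, s) in bdry_filter \<beta>. t \<in> {0..<pi / 2} \<and> s \<in> {0..<\<beta> - pi / 2}"
  unfolding eventually_at_filter by (rule always_eventually) auto

lemma L2_norm_sq_sum_tendsto_0:
  assumes "finite J"
    and "\<And>j. j \<in> J \<Longrightarrow> ((\<lambda>n. L2_norm_sq M (d j n)) \<longlongrightarrow> 0) F"
    and "\<forall>\<^sub>F n in F. \<forall>j\<in>J. d j n \<in> borel_measurable M"
  shows "((\<lambda>n. L2_norm_sq M (\<lambda>p. \<Sum>j\<in>J. d j n p)) \<longlongrightarrow> 0) F"
  using assms
proof (induction J rule: finite_induct)
  case empty
  then show ?case by (simp add: L2_norm_sq_def)
next
  case (insert j J)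
  have IH: "((\<lambda>n. L2_norm_sq M (\<lambda>p. \<Sum>j\<in>J. d j n p)) \<longlongrightarrow> 0) F"
    by (rule insert.IH) (use insert.prems in \<open>auto elim: eventually_mono\<close>)
  show ?case
  proof (rule ennreal_tendsto_0_I)
    show "((\<lambda>n. 2 * L2_norm_sq M (d j n) + 2 * L2_norm_sq M (\<lambda>p. \<Sum>j\<in>J. d j n p)) \<longlongrightarrow> 0) F"
      by (intro ennreal_tendsto_0_add ennreal_tendsto_0_mult insert.prems IH) auto
    show "\<forall>\<^sub>F n in F. L2_norm_sq M (\<lambda>p. \<Sum>j\<in>insert j J. d j n p) \<le> 2 * L2_norm_sq M (d j n) + 2 * L2_norm_sq M (\<lambda>p. \<Sum>j\<in>J. d j n p)"
      using insert.prems(2)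
    proof eventually_elim
      case (elim n)
      then have "L2_norm_sq M (\<lambda>p. d j n p + (\<Sum>j\<in>J. d j n p)) \<le> 2 * L2_norm_sq M (d j n) + 2 * L2_norm_sq M (\<lambda>p. \<Sum>j\<in>J. d j n p)"
        by (intro L2_norm_sq_add_le borel_measurable_sum) auto
      then show ?case using insert.hyps by simp
    qed
  qed
qed

lemma is_inv_fourier_L2_cmult:
  assumes "is_inv_fourier_L2 f h"
  shows "is_inv_fourier_L2 (\<lambda>\<xi>. c * f \<xi>) (\<lambda>x. c * h x)"
proof -
  have f: "f \<in> L2 lborel" and h: "h \<in> L2 lborel"
    and lim: "((\<lambda>R. L2_norm_sq lborel (\<lambda>x. inv_fourier (truncate R f) x - h x)) \<longlongrightarrow> 0) at_top"
    using assms by (auto simp: is_inv_fourier_L2_alt)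
  have "L2_norm_sq lborel (\<lambda>x. inv_fourier (truncate R (\<lambda>\<xi>. c * f \<xi>)) x - c * h x)
     = ennreal ((cmod c)\<^sup>2) * L2_norm_sq lborel (\<lambda>x. inv_fourier (truncate R f) x - h x)" for R
  proof -
    have "truncate R (\<lambda>\<xi>. c * f \<xi>) = (\<lambda>\<xi>. c * truncate R f \<xi>)" by (simp add: truncate_def mult_ac)
    then have "(\<lambda>x. inv_fourier (truncate R (\<lambda>\<xi>. c * f \<xi>)) x - c * h x) = (\<lambda>x. c * (inv_fourier (truncate R f) x - h x))"
      by (simp add: inv_fourier_cmult right_diff_distrib)
    moreover have "(\<lambda>x. inv_fourier (truncate R f) x - h x) \<in> borel_measurable lborel"
      using L2_measurable[OF h] measurable_inv_fourier[OF truncate_integrable[OF f]] by measurable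
    ultimately show ?thesis by (simp add: L2_norm_sq_cmult)
  qed
  then show ?thesis unfolding is_inv_fourier_L2_alt
    using ennreal_tendsto_0_mult[OF lim, of "ennreal ((cmod c)\<^sup>2)"] f h by (auto intro: L2_cmult)
qed

text \<open>The transforms of the modes on the boundary, with the weights \<open>e\<^bsup>\<sigma>j(\<beta>-\<pi>/2)/2\<^esup>\<close> absorbed.\<close>

definition is_bdry_mode :: "real \<Rightarrow> (int \<Rightarrow> real \<Rightarrow> complex) \<Rightarrow> nat \<Rightarrow> int \<Rightarrow> (real \<Rightarrow> complex) \<Rightarrow> bool" where
  "is_bdry_mode \<beta> g l j h \<longleftrightarrow> is_inv_fourier_L2 (mode g (eta \<beta> l) (sigma l * (\<beta> - pi / 2)) j) h"

lemma bdry_series_iff: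
  "bdry_series \<beta> g \<phi> \<longleftrightarrow> (\<exists>h. \<forall>l\<in>{1..4}. (\<forall>j. is_bdry_mode \<beta> g l j (h l j)) \<and>
     ((\<lambda>J. L2_norm_sq RT (\<lambda>(x, \<theta>). \<phi> l (x, \<theta>) - (\<Sum>j\<in>J. h l j x * circ j \<theta>))) \<longlongrightarrow> 0) (finite_subsets_at_top UNIV))"
  (is "?L \<longleftrightarrow> ?R")
proof -
  define w where "w = (\<lambda>l j. complex_of_real (exp (sigma l * of_int j / 2 * (\<beta> - pi / 2))))"
  have w_app: "complex_of_real (exp (sigma l * of_int j / 2 * (\<beta> - pi / 2))) = w l j" for l j by (simp add: w_def)
  have w0: "w l j \<noteq> 0" for l j by (simp add: w_def)
  have m: "mode g (eta \<beta> l) (sigma l * (\<beta> - pi / 2)) j = (\<lambda>\<xi>. w l j * (complex_of_real (exp (- eta \<beta> l * \<xi>)) * g j \<xi>))" for l j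
    unfolding mode_eq w_def by (simp add: mult_ac)
  have ?R if ?L
  proof -
    from that obtain \<phi>j where \<phi>j: "\<And>l j. l \<in> {1..4} \<Longrightarrow> is_inv_fourier_L2 (\<lambda>\<xi>. complex_of_real (exp (- eta \<beta> l * \<xi>)) * g j \<xi>) (\<phi>j l j)"
      "\<And>l. l \<in> {1..4} \<Longrightarrow> ((\<lambda>J. L2_norm_sq RT (\<lambda>(x, \<gamma>). \<phi> l (x, \<gamma>) - (\<Sum>j\<in>J. \<phi>j l j x * w l j * cis (2 * pi * of_int j * \<gamma>)))) \<longlongrightarrow> 0) (finite_subsets_at_top UNIV)"
      unfolding bdry_series_def w_def by blast
    show ?R
    proof (intro exI[of _ "\<lambda>l j x. w l j * \<phi>j l j x"] ballI conjI allI)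
      fix l :: nat and j assume l: "l \<in> {1..4}"
      show "is_bdry_mode \<beta> g l j (\<lambda>x. w l j * \<phi>j l j x)"
        unfolding is_bdry_mode_def m by (rule is_inv_fourier_L2_cmult[OF \<phi>j(1)[OF l]])
      show "((\<lambda>J. L2_norm_sq RT (\<lambda>(x, \<theta>). \<phi> l (x, \<theta>) - (\<Sum>j\<in>J. w l j * \<phi>j l j x * circ j \<theta>))) \<longlongrightarrow> 0) (finite_subsets_at_top UNIV)"
        using \<phi>j(2)[OF l] by (simp add: circ_def mult.commute[of "w _ _"])
    qed
  qed
  moreover have ?L if ?R
  proof -
    from that obtain h where h: "\<And>l j. l \<in> {1..4} \<Longrightarrow> is_bdry_mode \<beta> g l j (h l j)"
      "\<And>l. l \<in> {1..4} \<Longrightarrow> ((\<lambda>J. L2_norm_sq RT (\<lambda>(x, \<theta>). \<phi> l (x, \<theta>) - (\<Sum>j\<in>J. h l j x * circ j \<theta>))) \<longlongrightarrow> 0) (finite_subsets_at_top UNIV)"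
      by blast
    show ?L unfolding bdry_series_def w_app
    proof (intro exI[of _ "\<lambda>l j x. inverse (w l j) * h l j x"] ballI conjI allI)
      fix l :: nat and j assume l: "l \<in> {1..4}"
      show "is_inv_fourier_L2 (\<lambda>\<xi>. complex_of_real (exp (- eta \<beta> l * \<xi>)) * g j \<xi>) (\<lambda>x. inverse (w l j) * h l j x)"
        using is_inv_fourier_L2_cmult[OF h(1)[OF l, of j, unfolded is_bdry_mode_def m], of "inverse (w l j)"] w0[of l j] 
        by (simp add: mult.assoc[symmetric])
      show "((\<lambda>J. L2_norm_sq RT (\<lambda>(x, \<gamma>). \<phi> l (x, \<gamma>) - (\<Sum>j\<in>J. inverse (w l j) * h l j x * w l j * cis (2 * pi * of_int j * \<gamma>)))) \<longlongrightarrow> 0) (finite_subsets_at_top UNIV)"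
        using h(2)[OF l] w0 by (simp add: circ_def mult.commute[of "inverse (w _ _)"] mult.assoc)
    qed
  qed
  ultimately show ?thesis by blast
qed

lemma bdry_mode_tendsto:
  assumes sp: "spectral \<beta> F g" and fe: "finite_energy \<beta> g" and b: "\<beta> > pi / 2" and l: "l \<in> {1..4}"
    and h: "\<And>j. is_bdry_mode \<beta> g l j (h j)" and J: "finite J"
  shows "((\<lambda>(t, s). L2_norm_sq RT (\<lambda>(x, \<theta>). (\<Sum>j\<in>J. inv_fourier (mode g (sigma l * s + tau l * t) (sigma l * s) j) x * circ j \<theta>)
      - (\<Sum>j\<in>J. h j x * circ j \<theta>))) \<longlongrightarrow> 0) (bdry_filter \<beta>)"
proof -
  define k where "k = (\<lambda>ts::real \<times> real. \<lambda>j. mode g (sigma l * snd ts + tau l * fst ts) (sigma l * snd ts) j)"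
  define d where "d = (\<lambda>j ts (x, \<theta>). (inv_fourier (k ts j) x - h j x) * circ j \<theta>)"
  have hm [measurable]: "h j \<in> borel_measurable borel" for j
    using h[of j] by (auto simp: is_bdry_mode_def is_inv_fourier_L2_def L2_def)
  have ev: "\<forall>\<^sub>F ts in bdry_filter \<beta>. \<forall>j. integrable lborel (k ts j) \<and> k ts j \<in> L2 lborel"
    using eventually_bdry_filter
  proof eventually_elim
    case (elim ts)
    then show ?case
      using spectral_mode[OF sp slice_tube[of "fst ts" "snd ts" \<beta> l]] by (auto simp: k_def split: prod.splits)
  qed
  have "((\<lambda>ts. L2_norm_sq RT (\<lambda>p. \<Sum>j\<in>J. d j ts p)) \<longlongrightarrow> 0) (bdry_filter \<beta>)"
  proof (rule L2_norm_sq_sum_tendsto_0[OF J])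
    show "\<forall>\<^sub>F ts in bdry_filter \<beta>. \<forall>j\<in>J. d j ts \<in> borel_measurable RT"
      using ev
    proof eventually_elim
      case (elim ts)
      then have "(\<lambda>x. inv_fourier (k ts j) x - h j x) \<in> borel_measurable borel" for j
        using hm[of j] by (intro borel_measurable_diff measurable_inv_fourier) auto
      then show ?case unfolding d_def by (auto intro: measurable_RT_mode)
    qed
    fix j assume "j \<in> J"
    show "((\<lambda>ts. L2_norm_sq RT (d j ts)) \<longlongrightarrow> 0) (bdry_filter \<beta>)"
    proof (rule ennreal_tendsto_0_I)
      show "((\<lambda>ts. 4 * L2_norm_sq lborel (\<lambda>\<xi>. k ts j \<xi> - mode g (eta \<beta> l) (sigma l * (\<beta> - pi / 2)) j \<xi>)) \<longlongrightarrow> 0) (bdry_filter \<beta>)"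
        using slice_mode_tendsto[where g = g and j = j, OF b finite_energyD(1)[OF fe] finite_energyD(2)[OF fe] l]
        by (intro ennreal_tendsto_0_mult) (auto simp: k_def split_beta')
      show "\<forall>\<^sub>F ts in bdry_filter \<beta>. L2_norm_sq RT (d j ts) \<le> 4 * L2_norm_sq lborel (\<lambda>\<xi>. k ts j \<xi> - mode g (eta \<beta> l) (sigma l * (\<beta> - pi / 2)) j \<xi>)"
        using ev
      proof eventually_elim
        case (elim ts)
        then have i: "integrable lborel (k ts j)" "k ts j \<in> L2 lborel" by auto
        note [measurable] = measurable_inv_fourier[OF i(1)]
        have "L2_norm_sq RT (d j ts) = L2_norm_sq lborel (\<lambda>x. inv_fourier (k ts j) x - h j x)"
          unfolding d_def by (rule L2_norm_sq_RT_mode) measurable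
        also have "\<dots> \<le> 4 * L2_norm_sq lborel (\<lambda>\<xi>. k ts j \<xi> - mode g (eta \<beta> l) (sigma l * (\<beta> - pi / 2)) j \<xi>)"
          by (rule is_inv_fourier_L2_diff_le[OF h[of j, unfolded is_bdry_mode_def] i])
        finally show ?case .
      qed
    qed
  qed
  then show ?thesis
    by (simp add: d_def k_def split_beta' left_diff_distrib sum_subtractf)
qed

text \<open>Summing the expansions of the slices and letting the slices approach the boundary, with the
  tails controlled by the energy uniformly in the slice.\<close>

theorem is_bdry_value_iff_bdry_series:
  assumes sp: "spectral \<beta> F g" and fe: "finite_energy \<beta> g" and b: "\<beta> > pi / 2" and \<phi>: "\<phi> \<in> L2_bdry"
  shows "is_bdry_value \<beta> F \<phi> \<longleftrightarrow> bdry_series \<beta> g \<phi>"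
proof -
  define fib where "fib = (\<lambda>l (ts :: real \<times> real). fiber F (sigma l * snd ts + tau l * fst ts) (sigma l * snd ts))"
  define k where "k = (\<lambda>l (ts :: real \<times> real) j. mode g (sigma l * snd ts + tau l * fst ts) (sigma l * snd ts) j)"
  define T where "T = (\<lambda>J. infsum (energy \<beta> g) (- J))"
  have T: "(T \<longlongrightarrow> 0) (finite_subsets_at_top UNIV)"
    unfolding T_def by (rule infsum_ennreal_tail_tendsto_0[OF finite_energyD(3)[OF fe]])
  have \<phi>2: "\<phi> l \<in> L2 RT" if "l \<in> {1..4}" for l using \<phi> that by (auto simp: L2_bdry_def)
  have ev: "\<forall>\<^sub>F ts in bdry_filter \<beta>. \<forall>l. (sigma l * snd ts + tau l * fst ts, sigma l * snd ts) \<in> tube \<beta>"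
    using eventually_bdry_filter by eventually_elim (auto intro: slice_tube)
  have bv: "is_bdry_value \<beta> F \<phi> \<longleftrightarrow> (\<forall>l\<in>{1..4}. ((\<lambda>ts. L2_norm_sq RT (\<lambda>p. fib l ts p - \<phi> l p)) \<longlongrightarrow> 0) (bdry_filter \<beta>))"
  proof -
    have eq: "(\<lambda>(t, s). bdry_norm_sq (\<lambda>l p. slice F t s l p - \<phi> l p)) = (\<lambda>ts. \<Sum>l=1..4. L2_norm_sq RT (\<lambda>p. fib l ts p - \<phi> l p))"
      by (auto simp: fun_eq_iff bdry_norm_sq_def fib_def slice_fiber)
    show ?thesis
    proof
      assume L: "is_bdry_value \<beta> F \<phi>"
      show "\<forall>l\<in>{1..4}. ((\<lambda>ts. L2_norm_sq RT (\<lambda>p. fib l ts p - \<phi> l p)) \<longlongrightarrow> 0) (bdry_filter \<beta>)"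
      proof
        fix l :: nat assume l: "l \<in> {1..4}"
        have "L2_norm_sq RT (\<lambda>p. fib l ts p - \<phi> l p) \<le> (\<Sum>l=1..4. L2_norm_sq RT (\<lambda>p. fib l ts p - \<phi> l p))" for ts
          by (rule member_le_sum[OF l]) auto
        then have "\<forall>\<^sub>F ts in bdry_filter \<beta>. L2_norm_sq RT (\<lambda>p. fib l ts p - \<phi> l p) \<le> (\<Sum>l=1..4. L2_norm_sq RT (\<lambda>p. fib l ts p - \<phi> l p))"
          by (intro always_eventually allI)
        then show "((\<lambda>ts. L2_norm_sq RT (\<lambda>p. fib l ts p - \<phi> l p)) \<longlongrightarrow> 0) (bdry_filter \<beta>)"
          by (rule ennreal_tendsto_0_I[OF conjunct2[OF L[unfolded is_bdry_value_def eq]]])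
      qed
    next
      assume R: "\<forall>l\<in>{1..4}. ((\<lambda>ts. L2_norm_sq RT (\<lambda>p. fib l ts p - \<phi> l p)) \<longlongrightarrow> 0) (bdry_filter \<beta>)"
      have "((\<lambda>ts. \<Sum>l=1..4. L2_norm_sq RT (\<lambda>p. fib l ts p - \<phi> l p)) \<longlongrightarrow> (\<Sum>l=(1::nat)..4. 0)) (bdry_filter \<beta>)"
        by (rule tendsto_sum) (use R in auto)
      then show "is_bdry_value \<beta> F \<phi>" unfolding is_bdry_value_def eq using \<phi> by simp
    qed
  qed
  have meas_fib: "fib l ts \<in> borel_measurable RT" if "(sigma l * snd ts + tau l * fst ts, sigma l * snd ts) \<in> tube \<beta>" for l ts
    unfolding fib_def by (rule fiber_measurable[OF sp that])
  have meas_k: "(\<lambda>(x, \<theta>). \<Sum>j\<in>J. inv_fourier (k l ts j) x * circ j \<theta>) \<in> borel_measurable RT"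
    if "(sigma l * snd ts + tau l * fst ts, sigma l * snd ts) \<in> tube \<beta>" for l ts J
    unfolding split_beta'
    by (intro borel_measurable_sum measurable_RT_mode[unfolded split_beta'] measurable_inv_fourier)
       (unfold k_def, rule spectral_mode(1)[OF sp that])
  have meas_h: "(\<lambda>(x, \<theta>). \<Sum>j\<in>J. h j x * circ j \<theta>) \<in> borel_measurable RT" if "\<And>j. is_bdry_mode \<beta> g l j (h j)" for h l J
    unfolding split_beta'
    by (intro borel_measurable_sum measurable_RT_mode[unfolded split_beta'])
       (use that in \<open>auto simp: is_bdry_mode_def is_inv_fourier_L2_def L2_def\<close>)
  \<comment> \<open>Uniform in \<open>ts\<close>: this permits passing to the boundary before the series is summed.\<close>
  have tail: "L2_norm_sq RT (\<lambda>p. fib l ts p - (case p of (x, \<theta>) \<Rightarrow> \<Sum>j\<in>J. inv_fourier (k l ts j) x * circ j \<theta>)) \<le> 4 * T J"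
    if "(sigma l * snd ts + tau l * fst ts, sigma l * snd ts) \<in> tube \<beta>" "finite J" for l ts J
    using fiber_expansion_le[OF sp that] unfolding fib_def k_def T_def by (simp add: split_beta')
  show ?thesis
  proof
    assume "bdry_series \<beta> g \<phi>"
    then obtain h where h: "\<And>l j. l \<in> {1..4} \<Longrightarrow> is_bdry_mode \<beta> g l j (h l j)"
      "\<And>l. l \<in> {1..4} \<Longrightarrow> ((\<lambda>J. L2_norm_sq RT (\<lambda>(x, \<theta>). \<phi> l (x, \<theta>) - (\<Sum>j\<in>J. h l j x * circ j \<theta>))) \<longlongrightarrow> 0) (finite_subsets_at_top UNIV)"
      unfolding bdry_series_iff by blast
    show "is_bdry_value \<beta> F \<phi>" unfolding bv
    proof (intro ballI tendsto_zero_ennreal)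
      fix l :: nat and e :: real assume l: "l \<in> {1..4}" and e: "e > 0"
      note [measurable] = L2_measurable[OF \<phi>2[OF l]]
      have "((\<lambda>J. 8 * T J + 4 * L2_norm_sq RT (\<lambda>(x, \<theta>). \<phi> l (x, \<theta>) - (\<Sum>j\<in>J. h l j x * circ j \<theta>))) \<longlongrightarrow> 0) (finite_subsets_at_top UNIV)"
        by (intro ennreal_tendsto_0_add ennreal_tendsto_0_mult T h(2) l) auto
      then have "\<forall>\<^sub>F J in finite_subsets_at_top UNIV. 8 * T J + 4 * L2_norm_sq RT (\<lambda>(x, \<theta>). \<phi> l (x, \<theta>) - (\<Sum>j\<in>J. h l j x * circ j \<theta>)) < ennreal (e/2)"
        using e by (intro order_tendstoD(2)) auto
      then obtain J where J: "finite J" and Je: "8 * T J + 4 * L2_norm_sq RT (\<lambda>(x, \<theta>). \<phi> l (x, \<theta>) - (\<Sum>j\<in>J. h l j x * circ j \<theta>)) < ennreal (e/2)"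
        unfolding eventually_finite_subsets_at_top by blast
      define A where "A = (\<lambda>ts (x, \<theta>). \<Sum>j\<in>J. inv_fourier (k l ts j) x * circ j \<theta>)"
      define H where "H = (\<lambda>(x, \<theta>). \<Sum>j\<in>J. h l j x * circ j \<theta>)"
      have Hm [measurable]: "H \<in> borel_measurable RT" unfolding H_def by (rule meas_h[OF h(1)[OF l]])
      have "((\<lambda>ts. L2_norm_sq RT (\<lambda>p. A ts p - H p)) \<longlongrightarrow> 0) (bdry_filter \<beta>)"
        using bdry_mode_tendsto[OF sp fe b l h(1)[OF l] J] by (simp add: A_def H_def k_def split_beta')
      then have "((\<lambda>ts. 4 * L2_norm_sq RT (\<lambda>p. A ts p - H p)) \<longlongrightarrow> 0) (bdry_filter \<beta>)"
        by (rule ennreal_tendsto_0_mult) simp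
      then have "\<forall>\<^sub>F ts in bdry_filter \<beta>. 4 * L2_norm_sq RT (\<lambda>p. A ts p - H p) < ennreal (e/2)"
        using e by (intro order_tendstoD(2)) auto
      then show "\<forall>\<^sub>F ts in bdry_filter \<beta>. L2_norm_sq RT (\<lambda>p. fib l ts p - \<phi> l p) < ennreal e"
        using ev
      proof eventually_elim
        case (elim ts)
        have t: "(sigma l * snd ts + tau l * fst ts, sigma l * snd ts) \<in> tube \<beta>" using elim(2) by blast
        have [measurable]: "fib l ts \<in> borel_measurable RT" by (rule meas_fib[OF t])
        have [measurable]: "A ts \<in> borel_measurable RT" unfolding A_def by (rule meas_k[OF t])
        have tailA: "L2_norm_sq RT (\<lambda>p. fib l ts p - A ts p) \<le> 4 * T J"
          using tail[OF t J] by (simp add: A_def)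
        have "L2_norm_sq RT (\<lambda>p. fib l ts p - \<phi> l p) \<le> 2 * L2_norm_sq RT (\<lambda>p. fib l ts p - A ts p) + 2 * L2_norm_sq RT (\<lambda>p. A ts p - \<phi> l p)"
          by (rule L2_norm_sq_diff_triangle) measurable
        also have "\<dots> \<le> 2 * (4 * T J) + 2 * (2 * L2_norm_sq RT (\<lambda>p. A ts p - H p) + 2 * L2_norm_sq RT (\<lambda>p. H p - \<phi> l p))"
          using tailA by (intro add_mono mult_left_mono L2_norm_sq_diff_triangle) auto
        also have "\<dots> = (8 * T J + 4 * L2_norm_sq RT (\<lambda>(x, \<theta>). \<phi> l (x, \<theta>) - (\<Sum>j\<in>J. h l j x * circ j \<theta>))) + 4 * L2_norm_sq RT (\<lambda>p. A ts p - H p)"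
          unfolding L2_norm_sq_diff_commute[of RT H "\<phi> l"] by (simp add: H_def split_beta' distrib_left mult.assoc[symmetric] add_ac)
        also have "\<dots> < ennreal (e/2) + ennreal (e/2)" by (rule add_strict_mono[OF Je elim(1)])
        also have "\<dots> = ennreal e" using e by (simp flip: ennreal_plus)
        finally show ?case .
      qed
    qed
  next
    assume "is_bdry_value \<beta> F \<phi>"
    then have lim: "((\<lambda>ts. L2_norm_sq RT (\<lambda>p. fib l ts p - \<phi> l p)) \<longlongrightarrow> 0) (bdry_filter \<beta>)" if "l \<in> {1..4}" for l
      using that bv by blast
    \<comment> \<open>The only candidates are the angular coefficients of \<open>\<phi>\<close>, and they are limits of those of the slices.\<close>
    define h where "h = (\<lambda>l j x. \<integral>\<theta>. \<phi> l (x, \<theta>) * cnj (circ j \<theta>) \<partial>circle_measure)"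
    have h: "is_bdry_mode \<beta> g l j (h l j)" if l: "l \<in> {1..4}" for l j
      unfolding is_bdry_mode_def
    proof (rule is_inv_fourier_L2I[OF _ _ bdry_filter_neq_bot[OF b]])
      show "mode g (eta \<beta> l) (sigma l * (\<beta> - pi / 2)) j \<in> L2 lborel"
        by (rule mode_L2[where g = g and j = j, OF finite_energyD(1)[OF fe] finite_energyD(2)[OF fe] eta_closed_tube[OF b l]])
      show "h l j \<in> L2 lborel" unfolding h_def by (rule RT_coefficient_L2[OF \<phi>2[OF l]])
      show "\<forall>\<^sub>F ts in bdry_filter \<beta>. integrable lborel (k l ts j) \<and> k l ts j \<in> L2 lborel"
        using ev by eventually_elim (use spectral_mode[OF sp] in \<open>auto simp: k_def\<close>)
      show "((\<lambda>ts. L2_norm_sq lborel (\<lambda>\<xi>. k l ts j \<xi> - mode g (eta \<beta> l) (sigma l * (\<beta> - pi / 2)) j \<xi>)) \<longlongrightarrow> 0) (bdry_filter \<beta>)"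
        using slice_mode_tendsto[where g = g and j = j, OF b finite_energyD(1)[OF fe] finite_energyD(2)[OF fe] l]
        by (auto simp: k_def split_beta')
      show "((\<lambda>ts. L2_norm_sq lborel (\<lambda>x. inv_fourier (k l ts j) x - h l j x)) \<longlongrightarrow> 0) (bdry_filter \<beta>)"
      proof (rule ennreal_tendsto_0_I[OF lim[OF l]])
        show "\<forall>\<^sub>F ts in bdry_filter \<beta>. L2_norm_sq lborel (\<lambda>x. inv_fourier (k l ts j) x - h l j x) \<le> L2_norm_sq RT (\<lambda>p. fib l ts p - \<phi> l p)"
          using ev
        proof eventually_elim
          case (elim ts)
          have t: "(sigma l * snd ts + tau l * fst ts, sigma l * snd ts) \<in> tube \<beta>" using elim by blast
          have "inv_fourier (k l ts j) x = (\<integral>\<theta>. fib l ts (x, \<theta>) * cnj (circ j \<theta>) \<partial>circle_measure)" for x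
            using sp t unfolding spectral_def k_def fib_def by simp
          then show ?case
            using L2_norm_sq_RT_coefficient_le[OF fiber_L2[OF sp t finite_energyD(3)[OF fe]] \<phi>2[OF l], of j]
            by (simp add: h_def fib_def)
        qed
      qed
    qed
    have "((\<lambda>J. L2_norm_sq RT (\<lambda>(x, \<theta>). \<phi> l (x, \<theta>) - (\<Sum>j\<in>J. h l j x * circ j \<theta>))) \<longlongrightarrow> 0) (finite_subsets_at_top UNIV)" if l: "l \<in> {1..4}" for l
    proof (rule ennreal_tendsto_0_I)
      note [measurable] = L2_measurable[OF \<phi>2[OF l]]
      show "((\<lambda>J. 16 * T J) \<longlongrightarrow> 0) (finite_subsets_at_top UNIV)" by (rule ennreal_tendsto_0_mult[OF T]) simp
      show "\<forall>\<^sub>F J in finite_subsets_at_top UNIV. L2_norm_sq RT (\<lambda>(x, \<theta>). \<phi> l (x, \<theta>) - (\<Sum>j\<in>J. h l j x * circ j \<theta>)) \<le> 16 * T J"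
        unfolding eventually_finite_subsets_at_top
      proof (intro exI[of _ "{}"] conjI allI impI; (elim conjE)?)
        fix J :: "int set" assume J: "finite J"
        define A where "A = (\<lambda>ts (x, \<theta>). \<Sum>j\<in>J. inv_fourier (k l ts j) x * circ j \<theta>)"
        define H where "H = (\<lambda>(x, \<theta>). \<Sum>j\<in>J. h l j x * circ j \<theta>)"
        have Hm [measurable]: "H \<in> borel_measurable RT" unfolding H_def by (rule meas_h[OF h[OF l]])
        have A: "((\<lambda>ts. L2_norm_sq RT (\<lambda>p. A ts p - H p)) \<longlongrightarrow> 0) (bdry_filter \<beta>)"
          using bdry_mode_tendsto[OF sp fe b l h[OF l] J] by (simp add: A_def H_def k_def split_beta')
        have "L2_norm_sq RT (\<lambda>p. \<phi> l p - H p) \<le> 16 * T J"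
        proof (rule tendsto_lowerbound[OF _ _ bdry_filter_neq_bot[OF b]])
          have "((\<lambda>ts. 2 * L2_norm_sq RT (\<lambda>p. fib l ts p - \<phi> l p) + 4 * L2_norm_sq RT (\<lambda>p. A ts p - H p) + 16 * T J) \<longlongrightarrow> 0 + 0 + 16 * T J) (bdry_filter \<beta>)"
            by (intro tendsto_add tendsto_const ennreal_tendsto_0_mult lim[OF l] A) auto
          then show "((\<lambda>ts. 2 * L2_norm_sq RT (\<lambda>p. fib l ts p - \<phi> l p) + 4 * L2_norm_sq RT (\<lambda>p. A ts p - H p) + 16 * T J) \<longlongrightarrow> 16 * T J) (bdry_filter \<beta>)" by simp
          show "\<forall>\<^sub>F ts in bdry_filter \<beta>. L2_norm_sq RT (\<lambda>p. \<phi> l p - H p)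
             \<le> 2 * L2_norm_sq RT (\<lambda>p. fib l ts p - \<phi> l p) + 4 * L2_norm_sq RT (\<lambda>p. A ts p - H p) + 16 * T J"
            using ev
          proof eventually_elim
            case (elim ts)
            have t: "(sigma l * snd ts + tau l * fst ts, sigma l * snd ts) \<in> tube \<beta>" using elim by blast
            have [measurable]: "fib l ts \<in> borel_measurable RT" by (rule meas_fib[OF t])
            have [measurable]: "A ts \<in> borel_measurable RT" unfolding A_def by (rule meas_k[OF t])
            have "L2_norm_sq RT (\<lambda>p. \<phi> l p - H p) \<le> 2 * L2_norm_sq RT (\<lambda>p. \<phi> l p - fib l ts p) + 2 * L2_norm_sq RT (\<lambda>p. fib l ts p - H p)"
              by (rule L2_norm_sq_diff_triangle) measurable
            also have "\<dots> \<le> 2 * L2_norm_sq RT (\<lambda>p. \<phi> l p - fib l ts p) + 2 * (2 * L2_norm_sq RT (\<lambda>p. fib l ts p - A ts p) + 2 * L2_norm_sq RT (\<lambda>p. A ts p - H p))"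
              by (intro add_mono mult_left_mono L2_norm_sq_diff_triangle order_refl) auto
            also have "\<dots> \<le> 2 * L2_norm_sq RT (\<lambda>p. \<phi> l p - fib l ts p) + 2 * (2 * (4 * T J) + 2 * L2_norm_sq RT (\<lambda>p. A ts p - H p))"
              using tail[OF t J] by (intro add_mono mult_left_mono) (auto simp: A_def)
            finally show ?case
              unfolding L2_norm_sq_diff_commute[of RT "\<phi> l" "fib l ts"] by (simp add: distrib_left mult.assoc[symmetric] add_ac)
          qed
        qed
        then show "L2_norm_sq RT (\<lambda>(x, \<theta>). \<phi> l (x, \<theta>) - (\<Sum>j\<in>J. h l j x * circ j \<theta>)) \<le> 16 * T J"
          by (simp add: H_def split_beta')
      qed auto
    qed
    with h show "bdry_series \<beta> g \<phi>" unfolding bdry_series_iff by blast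
  qed
qed

section \<open>Laurent coefficients\<close>

lemma holomorphic2_partial:
  assumes "holomorphic2_on F D" "(z1, z2) \<in> D"
  shows "\<exists>a. ((\<lambda>z. F (z, z2)) has_field_derivative a) (at z1)"
    and "\<exists>b. ((\<lambda>z. F (z1, z)) has_field_derivative b) (at z2)"
proof -
  obtain a b where F: "(F has_derivative (\<lambda>(h1, h2). a * h1 + b * h2)) (at (z1, z2))"
    using assms by (auto simp: holomorphic2_on_def)
  have "((\<lambda>z. (z, z2)) has_derivative (\<lambda>h. (h, 0))) (at z1)" by (auto intro!: derivative_eq_intros)
  from has_derivative_compose[OF this F] show "\<exists>a. ((\<lambda>z. F (z, z2)) has_field_derivative a) (at z1)"
    by (auto simp: has_field_derivative_def)
  have "((\<lambda>z. (z1, z)) has_derivative (\<lambda>h. (0, h))) (at z2)" by (auto intro!: derivative_eq_intros)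
  from has_derivative_compose[OF this F] show "\<exists>b. ((\<lambda>z. F (z1, z)) has_field_derivative b) (at z2)"
    by (auto simp: has_field_derivative_def)
qed

lemma holomorphic2_continuous: "holomorphic2_on F D \<Longrightarrow> continuous_on D F"
  unfolding holomorphic2_on_def
  by (intro continuous_at_imp_continuous_on ballI) (blast intro: has_derivative_continuous)

lemma tube_iff:
  "(y, s) \<in> tube \<beta> \<longleftrightarrow> y < s + pi / 2 \<and> s - pi / 2 < y \<and> s < \<beta> - pi / 2 \<and> - (\<beta> - pi / 2) < s"
  by (simp only: tube_def mem_Collect_eq prod.case abs_less_iff; rule iffI; elim conjE; intro conjI; linarith)

lemma open_tube_section: "open {z. (Im z, s) \<in> tube \<beta>}"
proof -
  have "{z. (Im z, s) \<in> tube \<beta>} = (if \<bar>s\<bar> < \<beta> - pi / 2 then {z. Im z < s + pi / 2} \<inter> {z. Im z > s - pi / 2} else {})"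
    by (auto simp: tube_iff abs_less_iff)
  then show ?thesis by (simp add: open_Int open_halfspace_Im_lt open_halfspace_Im_gt)
qed

definition coefficient :: "(complex \<times> complex \<Rightarrow> complex) \<Rightarrow> int \<Rightarrow> real \<Rightarrow> complex \<Rightarrow> complex" where
  "coefficient F j s z = complex_of_real (exp (- s * of_int j / 2)) *
     (\<integral>\<theta>. F (z, complex_of_real (exp (s / 2)) * cis (2 * pi * \<theta>)) * cnj (circ j \<theta>) \<partial>circle_measure)"

text \<open>In the logarithmic coordinate \<open>w\<close>, with \<open>z\<^sub>2 = e\<^sup>w\<close>, the coefficient is the increment over a period of a
  primitive of the \<open>2\<pi>i\<close>-periodic function \<open>F(z\<^sub>1, e\<^sup>w) e\<^bsup>-jw\<^esup>\<close>. That increment is constant.\<close>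

lemma coefficient_independent:
  assumes F: "holomorphic2_on F (D' \<beta>)" and s: "(Im z, s) \<in> tube \<beta>" "(Im z, s') \<in> tube \<beta>"
  shows "coefficient F j s z = coefficient F j s' z"
proof -
  define V where "V = {w. (Im z, 2 * Re w) \<in> tube \<beta>}"
  have V_eq: "V = {w. Re w < (Im z + pi / 2) / 2} \<inter> {w. Re w > (Im z - pi / 2) / 2} \<inter> {w. Re w < (\<beta> - pi / 2) / 2} \<inter> {w. Re w > - (\<beta> - pi / 2) / 2}"
    by (auto simp: V_def tube_iff field_simps)
  have V: "open V" "convex V"
    unfolding V_eq by (intro open_Int open_halfspace_Re_lt open_halfspace_Re_gt)
      (intro convex_Int convex_halfspace_Re_lt convex_halfspace_Re_gt)
  have VD: "(z, exp w) \<in> D' \<beta>" if "w \<in> V" for w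
  proof -
    have "exp w = complex_of_real (exp (2 * Re w / 2)) * cis (Im w)" by (simp add: exp_eq_polar)
    then show ?thesis using tube_D'[of "Im z" "2 * Re w" \<beta> "cis (Im w)" "Re z"] that by (simp add: V_def)
  qed
  define h where "h = (\<lambda>w. F (z, exp w) * exp (- of_int j * w))"
  have "h holomorphic_on V"
  proof -
    have "(\<lambda>w. F (z, exp w)) holomorphic_on V"
      unfolding holomorphic_on_open[OF V(1)]
    proof (intro ballI)
      fix w assume "w \<in> V"
      from holomorphic2_partial(2)[OF F VD[OF this]] obtain b where
        b: "((\<lambda>z2. F (z, z2)) has_field_derivative b) (at (exp w))" by blast
      show "\<exists>f'. ((\<lambda>w. F (z, exp w)) has_field_derivative f') (at w)"
        using DERIV_chain2[OF b DERIV_exp] by blast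
    qed
    then show ?thesis unfolding h_def by (intro holomorphic_intros)
  qed
  then have ch: "continuous_on V h" by (rule holomorphic_on_imp_continuous_on)
  obtain P where P: "\<And>w. w \<in> V \<Longrightarrow> (P has_field_derivative h w) (at w within V)"
    using holomorphic_convex_primitive'[OF V(2,1) \<open>h holomorphic_on V\<close>] by blast
  have P': "(P has_field_derivative h w) (at w)" if "w \<in> V" for w
    using P[OF that] at_within_open[OF that V(1)] by simp
  have shiftV: "w + 2 * pi * \<i> \<in> V \<longleftrightarrow> w \<in> V" for w by (simp add: V_def)
  have per: "h (w + 2 * pi * \<i>) = h w" for w
  proof -
    have "exp (- of_int j * (w + 2 * pi * \<i>)) = exp (- of_int j * w) * exp (2 * of_int (- j) * pi * \<i>)"
      by (simp add: algebra_simps flip: exp_add)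
    also have "exp (2 * of_int (- j) * pi * \<i>) = cis (2 * pi * of_int (- j))" by (simp add: cis_conv_exp mult_ac)
    also have "\<dots> = 1" by (rule cis_multiple_2pi) (rule Ints_of_int)
    finally show ?thesis by (simp add: h_def exp_add)
  qed
  have "\<exists>c. \<forall>w\<in>V. P (w + 2 * pi * \<i>) - P w = c"
  proof (rule has_field_derivative_zero_constant[OF V(2)])
    fix w assume w: "w \<in> V"
    have "((\<lambda>w. P (w + 2 * pi * \<i>)) has_field_derivative h (w + 2 * pi * \<i>) * 1) (at w)"
      by (rule DERIV_chain2[of P]) (use P' shiftV w in \<open>auto intro!: derivative_eq_intros\<close>)
    then have "((\<lambda>w. P (w + 2 * pi * \<i>) - P w) has_field_derivative h w * 1 - h w) (at w)"
      unfolding per by (intro DERIV_diff P' w)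
    then show "((\<lambda>w. P (w + 2 * pi * \<i>) - P w) has_field_derivative 0) (at w within V)"
      by (simp add: has_field_derivative_at_within)
  qed
  then obtain c where c: "\<And>w. w \<in> V \<Longrightarrow> P (w + 2 * pi * \<i>) - P w = c" by blast
  have "coefficient F j s z = c / (2 * pi * \<i>)" if s: "(Im z, s) \<in> tube \<beta>" for s
  proof -
    define \<gamma> where "\<gamma> = (\<lambda>\<theta>. complex_of_real (s / 2) + 2 * pi * \<i> * complex_of_real \<theta>)"
    have \<gamma>V: "\<gamma> \<theta> \<in> V" for \<theta> using s by (simp add: \<gamma>_def V_def)
    have d\<gamma>: "(\<gamma> has_vector_derivative 2 * pi * \<i>) (at \<theta>)" for \<theta>
      unfolding \<gamma>_def by (auto intro!: derivative_eq_intros)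
    have "complex_of_real (exp (- s * of_int j / 2)) * (F (z, complex_of_real (exp (s / 2)) * cis (2 * pi * \<theta>)) * cnj (circ j \<theta>)) = h (\<gamma> \<theta>)" for \<theta>
    proof -
      have "exp (\<gamma> \<theta>) = complex_of_real (exp (s / 2)) * cis (2 * pi * \<theta>)"
      proof -
        have "\<gamma> \<theta> = complex_of_real (s / 2) + \<i> * complex_of_real (2 * pi * \<theta>)" by (simp add: \<gamma>_def mult_ac)
        then show ?thesis by (simp only: exp_add exp_of_real cis_conv_exp)
      qed
      moreover have "exp (- of_int j * \<gamma> \<theta>) = complex_of_real (exp (- s * of_int j / 2)) * cnj (circ j \<theta>)"
      proof -
        have "- of_int j * \<gamma> \<theta> = complex_of_real (- s * of_int j / 2) + \<i> * complex_of_real (2 * pi * of_int (- j) * \<theta>)"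
          by (simp add: \<gamma>_def complex_eq_iff field_simps)
        then show ?thesis unfolding circ_cnj unfolding circ_def cis_conv_exp by (simp only: exp_add exp_of_real)
      qed
      ultimately show ?thesis by (simp add: h_def)
    qed
    then have "coefficient F j s z = (\<integral>\<theta>. h (\<gamma> \<theta>) \<partial>circle_measure)"
      unfolding coefficient_def by (simp flip: integral_mult_right_zero)
    also have "\<dots> = P (\<gamma> 1) / (2 * pi * \<i>) - P (\<gamma> 0) / (2 * pi * \<i>)"
    proof (rule integral_circle_FTC)
      fix x :: real
      have "((P \<circ> \<gamma>) has_vector_derivative (2 * pi * \<i>) * h (\<gamma> x)) (at x)"
        by (rule field_vector_diff_chain_at[OF d\<gamma> P'[OF \<gamma>V]])
      from has_vector_derivative_divide[OF this, of "2 * pi * \<i>"]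
      show "((\<lambda>x. P (\<gamma> x) / (2 * pi * \<i>)) has_vector_derivative h (\<gamma> x)) (at x within {0..1})"
        by (simp add: o_def has_vector_derivative_at_within)
      show "continuous_on UNIV (\<lambda>x. h (\<gamma> x))"
        by (intro continuous_on_compose2[OF ch]) (use \<gamma>V[unfolded \<gamma>_def] in \<open>auto simp: \<gamma>_def intro!: continuous_intros\<close>)
    qed
    also have "\<dots> = (P (\<gamma> 0 + 2 * pi * \<i>) - P (\<gamma> 0)) / (2 * pi * \<i>)"
      by (simp add: \<gamma>_def diff_divide_distrib)
    finally show ?thesis unfolding c[OF \<gamma>V] .
  qed
  with s show ?thesis by simp
qed

text \<open>The circle integral as a contour integral, to which \<open>contour_integral_swap\<close> applies.\<close>

lemma integral_circle_linepath:
  fixes k :: "real \<Rightarrow> complex"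
  assumes k: "continuous_on UNIV k" and k': "\<And>x. k' (complex_of_real x) = k x"
  shows "(\<integral>\<theta>. k \<theta> \<partial>circle_measure) = contour_integral (linepath 0 1) k'"
proof -
  have "set_integrable lborel {0..1} k"
    unfolding set_integrable_def using borel_integrable_compact[of "{0..1}" k] k continuous_on_subset by auto
  from set_borel_integral_eq_integral(2)[OF this]
  have "(LBINT \<theta>. indicator {0..1} \<theta> *\<^sub>R k \<theta>) = integral {0..1} k" by (simp add: set_lebesgue_integral_def)
  also have "\<dots> = contour_integral (linepath 0 1) k'"
    by (simp add: contour_integral_integral linepath_def k' scaleR_conv_of_real)
  finally show ?thesis unfolding integral_circle_Icc[OF k] .
qed

text \<open>Morera's theorem: the integral over a triangle may be taken inside the integral over the circle.\<close>

lemma coefficient_holomorphic: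
  assumes F: "holomorphic2_on F (D' \<beta>)"
  shows "coefficient F j s holomorphic_on {z. (Im z, s) \<in> tube \<beta>}"
proof -
  define U where "U = {z. (Im z, s) \<in> tube \<beta>}"
  have U: "open U" unfolding U_def by (rule open_tube_section)
  define f where "f = (\<lambda>z \<zeta>. F (z, complex_of_real (exp (s / 2)) * exp (2 * pi * \<i> * \<zeta>)) * exp (- (2 * pi * of_int j * \<i> * \<zeta>)))"
  have f_eq: "f z (complex_of_real \<theta>) = F (z, complex_of_real (exp (s / 2)) * cis (2 * pi * \<theta>)) * cnj (circ j \<theta>)" for z \<theta>
  proof -
    have "exp (2 * pi * \<i> * complex_of_real \<theta>) = cis (2 * pi * \<theta>)" by (simp add: cis_conv_exp mult_ac)
    moreover have "exp (- (2 * pi * of_int j * \<i> * complex_of_real \<theta>)) = cnj (circ j \<theta>)"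
      unfolding circ_cnj unfolding circ_def cis_conv_exp by (simp add: mult_ac)
    ultimately show ?thesis by (simp add: f_def)
  qed
  have D: "(z, complex_of_real (exp (s / 2)) * exp (2 * pi * \<i> * \<zeta>)) \<in> D' \<beta>" if "z \<in> U" "\<zeta> \<in> \<real>" for z \<zeta>
  proof -
    have "cmod (exp (2 * pi * \<i> * \<zeta>)) = 1" using that(2) by (auto elim!: Reals_cases)
    then show ?thesis using tube_D'[of "Im z" s \<beta> "exp (2 * pi * \<i> * \<zeta>)" "Re z"] that(1) by (simp add: U_def)
  qed
  have cF: "continuous_on (D' \<beta>) F" by (rule holomorphic2_continuous[OF F])
  have cf: "continuous_on (U \<times> \<real>) (\<lambda>(z, \<zeta>). f z \<zeta>)"
    unfolding f_def split_beta' by (intro continuous_intros continuous_on_compose2[OF cF]) (use D in auto)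
  have real_seg: "closed_segment 0 (1::complex) \<subseteq> \<real>"
    by (auto simp: closed_segment_def scaleR_conv_of_real)
  define C where "C = (\<lambda>z. contour_integral (linepath 0 1) (f z))"
  have coef: "coefficient F j s z = complex_of_real (exp (- s * of_int j / 2)) * C z" if z: "z \<in> U" for z
  proof -
    have "continuous_on UNIV (\<lambda>\<theta>. f z (complex_of_real \<theta>))"
      by (intro continuous_on_compose2[OF cf, of _ "\<lambda>\<theta>. (z, complex_of_real \<theta>)", simplified] continuous_intros) (use z in auto)
    then show ?thesis unfolding coefficient_def C_def f_eq[symmetric]
      by (subst integral_circle_linepath[of "\<lambda>\<theta>. f z (complex_of_real \<theta>)" "f z"]) auto
  qed
  have fz: "(\<lambda>z. f z \<zeta>) holomorphic_on U" if "\<zeta> \<in> \<real>" for \<zeta>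
  proof -
    have "(\<lambda>z. F (z, complex_of_real (exp (s / 2)) * exp (2 * pi * \<i> * \<zeta>))) holomorphic_on U"
      unfolding holomorphic_on_open[OF U] using holomorphic2_partial(1)[OF F D[OF _ that]] by blast
    then show ?thesis unfolding f_def by (intro holomorphic_intros)
  qed
  have swap: "contour_integral (linepath a b) C = contour_integral (linepath 0 1) (\<lambda>\<zeta>. contour_integral (linepath a b) (\<lambda>z. f z \<zeta>))"
    if "closed_segment a b \<subseteq> U" for a b
    unfolding C_def
  proof (rule contour_integral_swap)
    show "continuous_on (path_image (linepath a b) \<times> path_image (linepath 0 1)) (\<lambda>(y1, y2). f y1 y2)"
      by (rule continuous_on_subset[OF cf]) (use that real_seg in auto)
  qed (auto intro!: continuous_intros)
  have cC: "continuous_on U C"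
  proof -
    have "C = (\<lambda>z. integral (cbox 0 1) (\<lambda>t. f z (complex_of_real t)))"
      by (simp add: C_def contour_integral_integral linepath_def scaleR_conv_of_real)
    moreover have "continuous_on (U \<times> cbox (0::real) 1) (\<lambda>(z, t). f z (complex_of_real t))"
      unfolding split_beta'
      by (intro continuous_on_compose2[OF cf, of _ "\<lambda>p. (fst p, complex_of_real (snd p))", simplified] continuous_intros) auto
    ultimately show ?thesis by (simp only: integral_continuous_on_param)
  qed
  have "C analytic_on U"
  proof (rule Morera_triangle[OF cC U]; intro impI)
    fix a b c assume abc: "convex hull {a, b, c} \<subseteq> U"
    have seg: "closed_segment a b \<subseteq> U" "closed_segment b c \<subseteq> U" "closed_segment c a \<subseteq> U"
      using abc hull_mono[of "{a, b}" "{a, b, c}" convex] hull_mono[of "{b, c}" "{a, b, c}" convex]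
        hull_mono[of "{c, a}" "{a, b, c}" convex] by (auto simp: segment_convex_hull)
    have ci: "(\<lambda>\<zeta>. contour_integral (linepath p q) (\<lambda>z. f z \<zeta>)) contour_integrable_on (linepath 0 1)"
      if "closed_segment p q \<subseteq> U" for p q
    proof (rule contour_integrable_continuous_linepath)
      have lp: "(1 - t) *\<^sub>R p + t *\<^sub>R q \<in> U" if "0 \<le> t" "t \<le> 1" for t
        using linepath_in_path[of t p q] \<open>closed_segment p q \<subseteq> U\<close> that by (auto simp: linepath_def)
      have "(\<lambda>\<zeta>. contour_integral (linepath p q) (\<lambda>z. f z \<zeta>)) = (\<lambda>\<zeta>. integral (cbox 0 1) (\<lambda>t. f (linepath p q t) \<zeta> * (q - p)))"
        by (simp add: contour_integral_integral)
      moreover have "continuous_on (\<real> \<times> cbox (0::real) 1) (\<lambda>(\<zeta>, t). f (linepath p q t) \<zeta> * (q - p))"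
        unfolding split_beta' linepath_def
        by (intro continuous_intros continuous_on_compose2[OF cf, of _ "\<lambda>x. ((1 - snd x) *\<^sub>R p + snd x *\<^sub>R q, fst x)", simplified])
           (use lp in \<open>auto intro!: continuous_intros\<close>)
      ultimately have "continuous_on \<real> (\<lambda>\<zeta>. contour_integral (linepath p q) (\<lambda>z. f z \<zeta>))"
        by (simp only: integral_continuous_on_param)
      then show "continuous_on (closed_segment 0 1) (\<lambda>\<zeta>. contour_integral (linepath p q) (\<lambda>z. f z \<zeta>))"
        by (rule continuous_on_subset[OF _ real_seg])
    qed
    have "contour_integral (linepath a b) C + contour_integral (linepath b c) C + contour_integral (linepath c a) C
      = contour_integral (linepath 0 1) (\<lambda>\<zeta>. contour_integral (linepath a b) (\<lambda>z. f z \<zeta>) + contour_integral (linepath b c) (\<lambda>z. f z \<zeta>)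
          + contour_integral (linepath c a) (\<lambda>z. f z \<zeta>))"
      unfolding swap[OF seg(1)] swap[OF seg(2)] swap[OF seg(3)]
      using ci[OF seg(1)] ci[OF seg(2)] ci[OF seg(3)] by (simp add: contour_integral_add contour_integrable_add)
    also have "\<dots> = contour_integral (linepath 0 1) (\<lambda>\<zeta>. 0)"
    proof (rule contour_integral_eq)
      fix \<zeta> assume "\<zeta> \<in> path_image (linepath 0 (1::complex))"
      then have "\<zeta> \<in> \<real>" using real_seg by auto
      from Cauchy_theorem_triangle[OF holomorphic_on_subset[OF fz[OF this] abc]]
      show "contour_integral (linepath a b) (\<lambda>z. f z \<zeta>) + contour_integral (linepath b c) (\<lambda>z. f z \<zeta>)
          + contour_integral (linepath c a) (\<lambda>z. f z \<zeta>) = 0"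
        by (rule has_chain_integral_chain_integral3)
    qed
    finally show "contour_integral (linepath a b) C + contour_integral (linepath b c) C + contour_integral (linepath c a) C = 0" by simp
  qed
  then have "(\<lambda>z. complex_of_real (exp (- s * of_int j / 2)) * C z) holomorphic_on U"
    by (intro holomorphic_intros analytic_imp_holomorphic)
  then show ?thesis using coef unfolding U_def[symmetric] by (simp cong: holomorphic_cong)
qed

section \<open>From the Hardy space to the coefficients\<close>

text \<open>Every point of the tube is reached by one component of the slice with \<open>t = \<bar>y - s\<bar>\<close> and \<open>s' = \<bar>s\<bar>\<close>.\<close>

lemma fiber_slice:
  assumes "(y, s) \<in> tube \<beta>"
  obtains t s' l where "t \<in> {0..<pi / 2}" "s' \<in> {0..<\<beta> - pi / 2}" "l \<in> {1..4::nat}" "fiber F y s = slice F t s' l"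
proof -
  define l :: nat where "l = (if s \<ge> 0 then if y \<ge> s then 1 else 2 else if y \<le> s then 3 else 4)"
  have l: "l \<in> {1..4}" by (simp add: l_def)
  have "sigma l * \<bar>s\<bar> = s" "tau l * \<bar>y - s\<bar> = y - s" by (auto simp: l_def sigma_def tau_def)
  then have "fiber F y s = slice F \<bar>y - s\<bar> \<bar>s\<bar> l" by (simp add: slice_fiber[OF l])
  moreover have "\<bar>y - s\<bar> \<in> {0..<pi / 2}" "\<bar>s\<bar> \<in> {0..<\<beta> - pi / 2}" using assms by (auto simp: tube_def)
  ultimately show ?thesis using that l by blast
qed

definition hardy_norm_sq :: "real \<Rightarrow> (complex \<times> complex \<Rightarrow> complex) \<Rightarrow> ennreal" where
  "hardy_norm_sq \<beta> F = (SUP (t, s) \<in> {0..<pi / 2} \<times> {0..<\<beta> - pi / 2}. bdry_norm_sq (slice F t s))"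

lemma bdry_norm_sq_le_hardy:
  "t \<in> {0..<pi / 2} \<Longrightarrow> s \<in> {0..<\<beta> - pi / 2} \<Longrightarrow> bdry_norm_sq (slice F t s) \<le> hardy_norm_sq \<beta> F"
  unfolding hardy_norm_sq_def by (rule SUP_upper2[of "(t, s)"]) auto

lemma fiber_norm_le_hardy:
  assumes "(y, s) \<in> tube \<beta>"
  shows "L2_norm_sq RT (fiber F y s) \<le> hardy_norm_sq \<beta> F"
proof -
  obtain t s' l where ts: "t \<in> {0..<pi / 2}" "s' \<in> {0..<\<beta> - pi / 2}" and l: "l \<in> {1..4::nat}" and eq: "fiber F y s = slice F t s' l"
    using fiber_slice[OF assms] by blast
  have "L2_norm_sq RT (slice F t s' l) \<le> bdry_norm_sq (slice F t s')"
    unfolding bdry_norm_sq_def by (rule member_le_sum[OF l]) auto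
  also have "\<dots> \<le> hardy_norm_sq \<beta> F" by (rule bdry_norm_sq_le_hardy[OF ts])
  finally show ?thesis by (simp add: eq)
qed

text \<open>Each Laurent coefficient is holomorphic in the whole strip and satisfies there the hypotheses of the
  Paley-Wiener theorem.\<close>

theorem hardy_spectral:
  assumes b: "\<beta> > pi / 2" and F: "holomorphic2_on F (D' \<beta>)" and fin: "hardy_norm_sq \<beta> F < \<infinity>"
  obtains g where "spectral \<beta> F g"
proof -
  have b0: "\<beta> > 0" using b pi_gt_zero by linarith
  define s0 where "s0 = (\<lambda>y. y * ((\<beta> - pi / 2) / \<beta>))"
  have s0: "(y, s0 y) \<in> tube \<beta>" if "\<bar>y\<bar> < \<beta>" for y unfolding s0_def by (rule tube_section[OF that b])
  \<comment> \<open>Some radius has to be chosen for each \<open>z\<close>; locally it may be taken constant, whence holomorphy.\<close>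
  define f where "f = (\<lambda>j z. coefficient F j (s0 (Im z)) z)"
  have f_eq: "f j z = coefficient F j s z" if "(Im z, s) \<in> tube \<beta>" for j z s
    unfolding f_def by (rule coefficient_independent[OF F s0[OF tube_abs[OF that]] that])
  have cF: "continuous_on (D' \<beta>) F" by (rule holomorphic2_continuous[OF F])
  have meas: "fiber F y s \<in> borel_measurable RT" if "(y, s) \<in> tube \<beta>" for y s
    by (intro RT_measurableI borel_measurable_continuous_onI fiber_continuous(1)[OF cF that])
  have fib2: "fiber F y s \<in> L2 RT" if "(y, s) \<in> tube \<beta>" for y s
    using meas[OF that] order.strict_trans1[OF fiber_norm_le_hardy[OF that] fin] by (simp add: L2_def)
  have holo: "f j holomorphic_on strip \<beta>" for j
    unfolding holomorphic_on_open[OF open_strip]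
  proof
    fix z assume z: "z \<in> strip \<beta>"
    define s where "s = s0 (Im z)"
    define U where "U = {z. (Im z, s) \<in> tube \<beta>}"
    have zU: "z \<in> U" using s0 z by (simp add: U_def s_def strip_def)
    have U: "open U" unfolding U_def by (rule open_tube_section)
    have "coefficient F j s holomorphic_on U" unfolding U_def by (rule coefficient_holomorphic[OF F])
    then obtain d where "(coefficient F j s has_field_derivative d) (at z)"
      using zU holomorphic_on_open[OF U] by blast
    then have "(f j has_field_derivative d) (at z)"
      by (rule has_field_derivative_transform_within_open[OF _ U zU]) (use f_eq in \<open>auto simp: U_def\<close>)
    then show "\<exists>d. (f j has_field_derivative d) (at z)" by blast
  qed
  have coef: "(\<integral>\<theta>. fiber F y s (x, \<theta>) * cnj (circ j \<theta>) \<partial>circle_measure) = complex_of_real (exp (s * of_int j / 2)) * f j (Complex x y)"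
    if "(y, s) \<in> tube \<beta>" for y s x j
  proof -
    have "complex_of_real (exp (s * of_int j / 2)) * complex_of_real (exp (- s * of_int j / 2)) = 1"
      by (simp flip: of_real_mult exp_add)
    then show ?thesis
      using f_eq[of "Complex x y" s j] that by (simp add: coefficient_def fiber_def mult.assoc[symmetric])
  qed
  have bound: "L2_norm_sq lborel (\<lambda>x. f j (Complex x y)) \<le> ennreal (exp (\<beta> * \<bar>of_int j\<bar>)) * hardy_norm_sq \<beta> F" if y: "\<bar>y\<bar> < \<beta>" for j y
  proof -
    define s where "s = s0 y"
    have t: "(y, s) \<in> tube \<beta>" unfolding s_def by (rule s0[OF y])
    define c where "c = (\<lambda>x. \<integral>\<theta>. fiber F y s (x, \<theta>) * cnj (circ j \<theta>) \<partial>circle_measure)"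
    have c2: "c \<in> L2 lborel" unfolding c_def by (rule RT_coefficient_L2[OF fib2[OF t]])
    have z: "(\<lambda>p. 0) \<in> L2 RT" by (simp add: L2_def L2_norm_sq_def)
    have cn: "L2_norm_sq lborel c \<le> hardy_norm_sq \<beta> F"
      using L2_norm_sq_RT_coefficient_le[OF fib2[OF t] z, of j] fiber_norm_le_hardy[OF t, of F] by (simp add: c_def)
    have "f j (Complex x y) = complex_of_real (exp (- (s * of_int j / 2))) * c x" for x
      unfolding c_def coef[OF t] mult.assoc[symmetric] of_real_mult[symmetric] exp_add[symmetric] by simp
    then have "L2_norm_sq lborel (\<lambda>x. f j (Complex x y)) = ennreal ((cmod (complex_of_real (exp (- (s * of_int j / 2)))))\<^sup>2) * L2_norm_sq lborel c"
      using L2_norm_sq_cmult[OF L2_measurable[OF c2]] by simp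
    also have "(cmod (complex_of_real (exp (- (s * of_int j / 2)))))\<^sup>2 = exp (- (s * of_int j))"
      by (simp add: power2_eq_square flip: exp_add)
    also have "ennreal (exp (- (s * of_int j))) * L2_norm_sq lborel c \<le> ennreal (exp (\<beta> * \<bar>of_int j\<bar>)) * hardy_norm_sq \<beta> F"
    proof (intro mult_mono cn ennreal_leI)
      have "\<bar>s\<bar> < \<beta> - pi / 2" using t by (simp add: tube_def)
      then have "\<bar>s\<bar> \<le> \<beta>" using pi_gt_zero by linarith
      then have "- (s * of_int j) \<le> \<beta> * \<bar>of_int j\<bar>"
        using mult_right_mono[of "\<bar>s\<bar>" \<beta> "\<bar>of_int j\<bar>"] abs_ge_minus_self[of "s * of_int j"] by (simp add: abs_mult)
      then show "exp (- (s * of_int j)) \<le> exp (\<beta> * \<bar>of_int j\<bar>)" by simp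
    qed auto
    finally show ?thesis .
  qed
  have "\<exists>g. g \<in> borel_measurable borel \<and> (\<forall>y. \<bar>y\<bar> < \<beta> \<longrightarrow> (\<lambda>\<xi>. complex_of_real (exp (- y * \<xi>)) * g \<xi>) \<in> L2 lborel) \<and>
     (\<forall>x y. \<bar>y\<bar> < \<beta> \<longrightarrow> f j (Complex x y) = inv_fourier (\<lambda>\<xi>. complex_of_real (exp (- y * \<xi>)) * g \<xi>) x)" for j
  proof -
    have "ennreal (exp (\<beta> * \<bar>of_int j\<bar>)) * hardy_norm_sq \<beta> F < \<infinity>" using fin by (simp add: ennreal_mult_less_top)
    from paley_wiener_strip[OF b0 holo bound this] obtain g where
      "g \<in> borel_measurable borel" "\<And>y. \<bar>y\<bar> < \<beta> \<Longrightarrow> (\<lambda>\<xi>. complex_of_real (exp (- y * \<xi>)) * g \<xi>) \<in> L2 lborel"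
      "\<And>x y. \<bar>y\<bar> < \<beta> \<Longrightarrow> f j (Complex x y) = inv_fourier (\<lambda>\<xi>. complex_of_real (exp (- y * \<xi>)) * g \<xi>) x"
      by blast
    then show ?thesis by blast
  qed
  then have "\<forall>j. \<exists>g. g \<in> borel_measurable borel \<and> (\<forall>y. \<bar>y\<bar> < \<beta> \<longrightarrow> (\<lambda>\<xi>. complex_of_real (exp (- y * \<xi>)) * g \<xi>) \<in> L2 lborel) \<and>
     (\<forall>x y. \<bar>y\<bar> < \<beta> \<longrightarrow> f j (Complex x y) = inv_fourier (\<lambda>\<xi>. complex_of_real (exp (- y * \<xi>)) * g \<xi>) x)"
    by (rule allI)
  from choice[OF this] obtain g where g: "\<And>j. g j \<in> borel_measurable borel"
     "\<And>j y. \<bar>y\<bar> < \<beta> \<Longrightarrow> (\<lambda>\<xi>. complex_of_real (exp (- y * \<xi>)) * g j \<xi>) \<in> L2 lborel"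
     "\<And>j x y. \<bar>y\<bar> < \<beta> \<Longrightarrow> f j (Complex x y) = inv_fourier (\<lambda>\<xi>. complex_of_real (exp (- y * \<xi>)) * g j \<xi>) x"
    by blast
  have "spectral \<beta> F g"
    unfolding spectral_def
  proof (intro conjI allI impI g cF)
    fix y s x j assume t: "(y, s) \<in> tube \<beta>"
    show "(\<integral>\<theta>. fiber F y s (x, \<theta>) * cnj (circ j \<theta>) \<partial>circle_measure) = inv_fourier (mode g y s j) x"
      unfolding coef[OF t] g(3)[OF tube_abs[OF t]] inv_fourier_mode ..
  qed
  then show ?thesis by (rule that)
qed

text \<open>The exponents are \<open>\<plusminus>A \<plusminus> B\<close> with \<open>A = \<pi>\<xi>\<close> and \<open>B = (2\<beta> - \<pi>)(\<xi> - j/2)\<close>, each combination of signs occurring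
  once. This is why the squared norm on the distinguished boundary is a multiple of the energy.\<close>

lemma energy_weight_sum:
  "(\<Sum>l=1..4. (exp (sigma l * (\<beta> - pi / 2) * of_int j / 2 - eta \<beta> l * \<xi>))\<^sup>2)
     = 4 * (cosh (pi * \<xi>) * cosh ((2 * \<beta> - pi) * (\<xi> - of_int j / 2)))"
proof -
  define A B where "A = pi * \<xi>" and "B = (2 * \<beta> - pi) * (\<xi> - of_int j / 2)"
  have "(exp (sigma l * (\<beta> - pi / 2) * of_int j / 2 - eta \<beta> l * \<xi>))\<^sup>2 = exp (- (sigma l * B) - tau l * A)" if "l \<in> {1..4}" for l
  proof -
    have "2 * (sigma l * (\<beta> - pi / 2) * of_int j / 2 - eta \<beta> l * \<xi>) = - (sigma l * B) - tau l * A"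
      unfolding eta_eq[OF that] A_def B_def by (simp add: field_simps)
    then show ?thesis by (simp only: exp_double[symmetric])
  qed
  then have "(\<Sum>l=1..4. (exp (sigma l * (\<beta> - pi / 2) * of_int j / 2 - eta \<beta> l * \<xi>))\<^sup>2) = (\<Sum>l=1..4. exp (- (sigma l * B) - tau l * A))"
    by (intro sum.cong refl)
  also have "\<dots> = exp (- B - A) + exp (- B + A) + exp (B + A) + exp (B - A)"
  proof -
    have "{1..4::nat} = {1, 2, 3, 4}" by auto
    then show ?thesis by (simp add: sigma_def tau_def)
  qed
  also have "\<dots> = 2 * cosh (A + B) + 2 * cosh (A - B)"
    by (simp add: cosh_def algebra_simps)
  also have "\<dots> = 4 * (cosh A * cosh B)" by (simp add: cosh_add cosh_diff)
  finally show ?thesis by (simp add: A_def B_def)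
qed

text \<open>Fatou's lemma along slices that approach the boundary, for finitely many modes at a time.\<close>

lemma spectral_finite_energy:
  assumes b: "\<beta> > pi / 2" and sp: "spectral \<beta> F g" and fin: "hardy_norm_sq \<beta> F < \<infinity>"
  shows "finite_energy \<beta> g"
proof -
  have g [measurable]: "g j \<in> borel_measurable borel" for j by (rule spectral_measurable[OF sp])
  define q where "q = (\<lambda>n. 1 - 1 / real (Suc n))"
  have q: "0 \<le> q n" "q n < 1" for n by (auto simp: q_def)
  have qlim: "q \<longlonglongrightarrow> 1"
  proof -
    have "(\<lambda>n. 1 / real (Suc n)) \<longlonglongrightarrow> 0" using LIMSEQ_inverse_real_of_nat by (simp add: inverse_eq_divide)
    then have "q \<longlonglongrightarrow> 1 - 0" unfolding q_def by (intro tendsto_intros)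
    then show ?thesis by simp
  qed
  define t s where "t = (\<lambda>n. pi / 2 * q n)" and "s = (\<lambda>n. (\<beta> - pi / 2) * q n)"
  have ts: "t n \<in> {0..<pi / 2}" "s n \<in> {0..<\<beta> - pi / 2}" for n
    using q[of n] b by (auto simp: t_def s_def intro!: mult_nonneg_nonneg)
  define m where "m = (\<lambda>n l j. mode g (sigma l * s n + tau l * t n) (sigma l * s n) j)"
  define M where "M = (\<lambda>l j. mode g (eta \<beta> l) (sigma l * (\<beta> - pi / 2)) j)"
  have lim: "(\<lambda>n. m n l j \<xi>) \<longlonglongrightarrow> M l j \<xi>" if l: "l \<in> {1..4}" for l j \<xi>
  proof -
    have "(\<lambda>n. m n l j \<xi>) \<longlonglongrightarrow> complex_of_real (exp (sigma l * ((\<beta> - pi / 2) * 1) * of_int j / 2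
      - (sigma l * ((\<beta> - pi / 2) * 1) + tau l * (pi / 2 * 1)) * \<xi>)) * g j \<xi>"
      unfolding m_def mode_def t_def s_def by (intro tendsto_intros qlim) auto
    then show ?thesis unfolding M_def mode_def eta_eq[OF l] by simp
  qed
  have mm [measurable]: "m n l j \<in> borel_measurable borel" for n l j
    unfolding m_def by (rule mode_measurable[OF g])
  have slice_sum: "(\<Sum>l=1..4. \<Sum>j\<in>J. L2_norm_sq lborel (m n l j)) \<le> ennreal (2 * pi) * hardy_norm_sq \<beta> F" if J: "finite J" for J n
  proof -
    have "(\<Sum>j\<in>J. L2_norm_sq lborel (m n l j)) \<le> ennreal (2 * pi) * L2_norm_sq RT (slice F (t n) (s n) l)" if l: "l \<in> {1..4}" for l
    proof -
      have tu: "(sigma l * s n + tau l * t n, sigma l * s n) \<in> tube \<beta>" by (rule slice_tube[OF ts])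
      have "(\<Sum>j\<in>J. L2_norm_sq lborel (m n l j)) = infsum (\<lambda>j. L2_norm_sq lborel (m n l j)) J" using J by simp
      also have "\<dots> \<le> infsum (\<lambda>j. L2_norm_sq lborel (m n l j)) UNIV" by (rule infsum_ennreal_mono_set) simp
      also have "\<dots> = ennreal (2 * pi) * (ennreal (1 / (2 * pi)) * infsum (\<lambda>j. L2_norm_sq lborel (m n l j)) UNIV)"
      proof -
        have "ennreal (2 * pi) * ennreal (1 / (2 * pi)) = 1" by (subst ennreal_mult[symmetric]) auto
        then show ?thesis by (simp only: mult.assoc[symmetric] mult_1)
      qed
      also have "ennreal (1 / (2 * pi)) * infsum (\<lambda>j. L2_norm_sq lborel (m n l j)) UNIV = L2_norm_sq RT (slice F (t n) (s n) l)"
        using fiber_expansion[OF sp tu, of "{}"] unfolding slice_fiber[OF l] m_def by (simp add: fiber_def)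
      finally show ?thesis .
    qed
    then have "(\<Sum>l=1..4. \<Sum>j\<in>J. L2_norm_sq lborel (m n l j)) \<le> (\<Sum>l=1..4. ennreal (2 * pi) * L2_norm_sq RT (slice F (t n) (s n) l))"
      by (rule sum_mono)
    also have "\<dots> = ennreal (2 * pi) * bdry_norm_sq (slice F (t n) (s n))"
      by (simp add: bdry_norm_sq_def sum_distrib_left)
    also have "\<dots> \<le> ennreal (2 * pi) * hardy_norm_sq \<beta> F"
      by (intro mult_left_mono bdry_norm_sq_le_hardy ts) simp
    finally show ?thesis .
  qed
  have "sum (energy \<beta> g) J \<le> ennreal (2 * pi) * hardy_norm_sq \<beta> F" if J: "finite J" for J
  proof -
    have "sum (energy \<beta> g) J \<le> (\<integral>\<^sup>+\<xi>. (\<Sum>l=1..4. \<Sum>j\<in>J. ennreal ((cmod (M l j \<xi>))\<^sup>2)) \<partial>lborel)"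
    proof -
      have "sum (energy \<beta> g) J = (\<integral>\<^sup>+\<xi>. (\<Sum>j\<in>J. ennreal ((cmod (g j \<xi>))\<^sup>2 * cosh (pi * \<xi>) * cosh ((2 * \<beta> - pi) * (\<xi> - of_int j / 2)))) \<partial>lborel)"
        unfolding energy_def by (subst nn_integral_sum) auto
      also have "\<dots> \<le> (\<integral>\<^sup>+\<xi>. (\<Sum>j\<in>J. \<Sum>l=1..4. ennreal ((cmod (M l j \<xi>))\<^sup>2)) \<partial>lborel)"
      proof (intro nn_integral_mono sum_mono)
        fix \<xi> j
        have "(\<Sum>l=1..4. (cmod (M l j \<xi>))\<^sup>2) = (\<Sum>l=1..4. (exp (sigma l * (\<beta> - pi / 2) * of_int j / 2 - eta \<beta> l * \<xi>))\<^sup>2 * (cmod (g j \<xi>))\<^sup>2)"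
          by (simp add: M_def mode_def norm_mult power_mult_distrib)
        also have "\<dots> = 4 * (cosh (pi * \<xi>) * cosh ((2 * \<beta> - pi) * (\<xi> - of_int j / 2))) * (cmod (g j \<xi>))\<^sup>2"
          unfolding sum_distrib_right[symmetric] energy_weight_sum ..
        finally have eq: "(\<Sum>l=1..4. (cmod (M l j \<xi>))\<^sup>2) = 4 * ((cmod (g j \<xi>))\<^sup>2 * cosh (pi * \<xi>) * cosh ((2 * \<beta> - pi) * (\<xi> - of_int j / 2)))"
          by (simp add: mult_ac)
        have "0 \<le> (cmod (g j \<xi>))\<^sup>2 * cosh (pi * \<xi>) * cosh ((2 * \<beta> - pi) * (\<xi> - of_int j / 2))" by simp
        then have "(cmod (g j \<xi>))\<^sup>2 * cosh (pi * \<xi>) * cosh ((2 * \<beta> - pi) * (\<xi> - of_int j / 2)) \<le> (\<Sum>l=1..4. (cmod (M l j \<xi>))\<^sup>2)"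
          unfolding eq by linarith
        then have "ennreal ((cmod (g j \<xi>))\<^sup>2 * cosh (pi * \<xi>) * cosh ((2 * \<beta> - pi) * (\<xi> - of_int j / 2))) \<le> ennreal (\<Sum>l=1..4. (cmod (M l j \<xi>))\<^sup>2)"
          by (rule ennreal_leI)
        also have "\<dots> = (\<Sum>l=1..4. ennreal ((cmod (M l j \<xi>))\<^sup>2))" by (rule sum_ennreal[symmetric]) simp
        finally show "ennreal ((cmod (g j \<xi>))\<^sup>2 * cosh (pi * \<xi>) * cosh ((2 * \<beta> - pi) * (\<xi> - of_int j / 2))) \<le> (\<Sum>l=1..4. ennreal ((cmod (M l j \<xi>))\<^sup>2))" .
      qed
      also have "\<dots> = (\<integral>\<^sup>+\<xi>. (\<Sum>l=1..4. \<Sum>j\<in>J. ennreal ((cmod (M l j \<xi>))\<^sup>2)) \<partial>lborel)"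
        by (subst sum.swap) (rule refl)
      finally show ?thesis .
    qed
    also have "\<dots> = (\<integral>\<^sup>+\<xi>. liminf (\<lambda>n. \<Sum>l=1..4. \<Sum>j\<in>J. ennreal ((cmod (m n l j \<xi>))\<^sup>2)) \<partial>lborel)"
    proof (intro nn_integral_cong)
      fix \<xi>
      have "(\<lambda>n. \<Sum>l=1..4. \<Sum>j\<in>J. ennreal ((cmod (m n l j \<xi>))\<^sup>2)) \<longlonglongrightarrow> (\<Sum>l=1..4. \<Sum>j\<in>J. ennreal ((cmod (M l j \<xi>))\<^sup>2))"
        by (intro tendsto_sum tendsto_ennrealI tendsto_power tendsto_norm lim)
      from lim_imp_Liminf[OF sequentially_bot this]
      show "(\<Sum>l=1..4. \<Sum>j\<in>J. ennreal ((cmod (M l j \<xi>))\<^sup>2)) = liminf (\<lambda>n. \<Sum>l=1..4. \<Sum>j\<in>J. ennreal ((cmod (m n l j \<xi>))\<^sup>2))" by simp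
    qed
    also have "\<dots> \<le> liminf (\<lambda>n. \<integral>\<^sup>+\<xi>. (\<Sum>l=1..4. \<Sum>j\<in>J. ennreal ((cmod (m n l j \<xi>))\<^sup>2)) \<partial>lborel)"
      by (rule nn_integral_liminf) measurable
    also have "\<dots> = liminf (\<lambda>n. \<Sum>l=1..4. \<Sum>j\<in>J. L2_norm_sq lborel (m n l j))"
      unfolding L2_norm_sq_def by (simp add: nn_integral_sum del: sum_ennreal)
    also have "\<dots> \<le> ennreal (2 * pi) * hardy_norm_sq \<beta> F"
      by (intro Liminf_le always_eventually allI slice_sum J) auto
    finally show ?thesis .
  qed
  then have "infsum (energy \<beta> g) UNIV \<le> ennreal (2 * pi) * hardy_norm_sq \<beta> F"
    by (subst nonneg_infsum_complete) (auto intro!: SUP_least)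
  also have "\<dots> < \<infinity>" using fin by (simp add: ennreal_mult_less_top)
  finally show ?thesis using g by (simp add: finite_energy_alt)
qed

section \<open>Integrals over frequencies and modes\<close>

text \<open>Treating the sum over \<open>j\<close> and the integral over \<open>\<xi>\<close> as one integral gives Fubini's theorem and dominated
  convergence for both at once.\<close>

definition freq_measure :: "(int \<times> real) measure" where
  "freq_measure = count_space UNIV \<Otimes>\<^sub>M lborel"

interpretation Q: pair_sigma_finite "count_space (UNIV :: int set)" "lborel :: real measure"
  by (intro pair_sigma_finite.intro sigma_finite_measure_count_space) (rule lborel.sigma_finite_measure_axioms)

lemma freq_measurableI:
  "(\<And>j. (\<lambda>\<xi>. f (j, \<xi>)) \<in> borel_measurable borel) \<Longrightarrow> f \<in> borel_measurable freq_measure"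
  unfolding freq_measure_def by (rule measurable_pair_measure_countable1) auto

lemma nn_integral_freq:
  assumes "f \<in> borel_measurable freq_measure"
  shows "(\<integral>\<^sup>+p. f p \<partial>freq_measure) = (\<Sum>\<^sub>\<infinity>j. \<integral>\<^sup>+\<xi>. f (j, \<xi>) \<partial>lborel)"
  using assms unfolding freq_measure_def
  by (simp add: lborel.nn_integral_fst[symmetric] infsum_ennreal_eq_nn_integral)

lemma count_space_has_sum:
  fixes H :: "int \<Rightarrow> complex"
  assumes "integrable (count_space UNIV) H"
  shows "(H has_sum (\<integral>j. H j \<partial>count_space UNIV)) UNIV" and "(\<lambda>j. cmod (H j)) summable_on UNIV"
proof -
  have a: "Infinite_Set_Sum.abs_summable_on H UNIV" using assms by (simp add: abs_summable_on_def)
  then show "(\<lambda>j. cmod (H j)) summable_on UNIV" by (simp add: abs_summable_equivalent)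
  then have "H summable_on UNIV" by (rule abs_summable_summable)
  moreover have "infsum H UNIV = (\<integral>j. H j \<partial>count_space UNIV)"
    using infsetsum_infsum[OF a] by (simp add: infsetsum_def)
  ultimately show "(H has_sum (\<integral>j. H j \<partial>count_space UNIV)) UNIV" by (metis has_sum_infsum)
qed

lemma freq_has_sum:
  fixes f :: "int \<times> real \<Rightarrow> complex"
  assumes f: "integrable freq_measure f"
  shows "((\<lambda>j. LBINT \<xi>. f (j, \<xi>)) has_sum (\<integral>p. f p \<partial>freq_measure)) UNIV"
    and "(\<lambda>j. cmod (LBINT \<xi>. f (j, \<xi>))) summable_on UNIV"
    and "integrable lborel (\<lambda>\<xi>. f (j, \<xi>))"
proof -
  have f': "integrable (count_space UNIV \<Otimes>\<^sub>M lborel) f" using f by (simp add: freq_measure_def)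
  show "((\<lambda>j. LBINT \<xi>. f (j, \<xi>)) has_sum (\<integral>p. f p \<partial>freq_measure)) UNIV" "(\<lambda>j. cmod (LBINT \<xi>. f (j, \<xi>))) summable_on UNIV"
    using count_space_has_sum[OF Q.integrable_fst'[OF f']] Q.integral_fst'[OF f'] by (simp_all add: freq_measure_def)
  show "integrable lborel (\<lambda>\<xi>. f (j, \<xi>))" using Q.AE_integrable_fst'[OF f'] by (simp add: AE_count_space)
qed

lemma infsum_exp_neg_abs_int:
  assumes c: "c > 0"
  shows "(\<Sum>\<^sub>\<infinity>j::int. ennreal (exp (- c * \<bar>of_int j\<bar>))) < \<infinity>"
proof -
  define f where "f = (\<lambda>j::int. ennreal (exp (- c * \<bar>of_int j\<bar>)))"
  have nat: "(\<Sum>\<^sub>\<infinity>n::nat. ennreal (exp (- c * real n))) < \<infinity>"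
  proof -
    have "(\<Sum>\<^sub>\<infinity>n::nat. ennreal (exp (- c * real n))) = (\<Sum>n. ennreal (exp (- c) ^ n))"
      by (simp add: infsum_ennreal_eq_nn_integral nn_integral_count_space_nat exp_of_nat_mult[symmetric] mult.commute)
    also have "\<dots> = ennreal (\<Sum>n. exp (- c) ^ n)"
      by (rule suminf_ennreal2) (use c in \<open>auto intro!: summable_geometric\<close>)
    finally show ?thesis by simp
  qed
  have "infsum f (range int) = (\<Sum>\<^sub>\<infinity>n::nat. ennreal (exp (- c * real n)))"
    by (subst infsum_reindex) (auto simp: f_def o_def)
  moreover have "infsum f (range (\<lambda>n. - int n)) = (\<Sum>\<^sub>\<infinity>n::nat. ennreal (exp (- c * real n)))"
    by (subst infsum_reindex) (auto simp: f_def o_def inj_on_def)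
  moreover have "infsum f UNIV \<le> infsum f (range int) + infsum f (range (\<lambda>n. - int n))"
  proof -
    have U: "(UNIV :: int set) = range int \<union> range (\<lambda>n. - int n)"
      by (auto simp: image_iff) (metis int_cases2)
    have "infsum f UNIV = infsum f (range int \<union> (range (\<lambda>n. - int n) - range int))" by (subst U) (simp add: Un_Diff_cancel)
    also have "\<dots> = infsum f (range int) + infsum f (range (\<lambda>n. - int n) - range int)"
      by (rule infsum_Un_disjoint) (auto intro!: nonneg_summable_on_complete)
    also have "\<dots> \<le> infsum f (range int) + infsum f (range (\<lambda>n. - int n))"
      by (intro add_left_mono infsum_ennreal_mono_set) auto
    finally show ?thesis .
  qed
  ultimately show ?thesis using nat unfolding f_def[symmetric] by (auto intro: order.strict_trans1)
qed

definition freq_size :: "int \<times> real \<Rightarrow> real" where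
  "freq_size p = \<bar>snd p\<bar> + \<bar>of_int (fst p)\<bar>"

lemma freq_size_nonneg [simp]: "0 \<le> freq_size p" by (simp add: freq_size_def)

lemma freq_size_exp_integrable:
  assumes c: "c > 0"
  shows "(\<integral>\<^sup>+p. ennreal (exp (- c * freq_size p)) \<partial>freq_measure) < \<infinity>"
proof -
  have "(\<integral>\<^sup>+p. ennreal (exp (- c * freq_size p)) \<partial>freq_measure) = (\<Sum>\<^sub>\<infinity>j. \<integral>\<^sup>+\<xi>. ennreal (exp (- c * freq_size (j, \<xi>))) \<partial>lborel)"
    by (rule nn_integral_freq, rule freq_measurableI) (simp add: freq_size_def)
  also have "\<dots> = (\<Sum>\<^sub>\<infinity>j. (\<integral>\<^sup>+\<xi>. ennreal (exp (- c * \<bar>\<xi>\<bar>)) \<partial>lborel) * ennreal (exp (- c * \<bar>of_int j\<bar>)))"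
  proof (rule infsum_cong)
    fix j :: int
    have "exp (- c * freq_size (j, \<xi>)) = exp (- c * \<bar>\<xi>\<bar>) * exp (- c * \<bar>of_int j\<bar>)" for \<xi>
      by (simp add: freq_size_def algebra_simps flip: exp_add)
    then show "(\<integral>\<^sup>+\<xi>. ennreal (exp (- c * freq_size (j, \<xi>))) \<partial>lborel) = (\<integral>\<^sup>+\<xi>. ennreal (exp (- c * \<bar>\<xi>\<bar>)) \<partial>lborel) * ennreal (exp (- c * \<bar>of_int j\<bar>))"
      by (simp add: ennreal_mult nn_integral_multc)
  qed
  also have "\<dots> = (\<integral>\<^sup>+\<xi>. ennreal (exp (- c * \<bar>\<xi>\<bar>)) \<partial>lborel) * (\<Sum>\<^sub>\<infinity>j::int. ennreal (exp (- c * \<bar>of_int j\<bar>)))"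
    by (rule infsum_ennreal_cmult)
  also have "\<dots> < \<infinity>" using exp_neg_abs_integrable[OF c] infsum_exp_neg_abs_int[OF c] by (simp add: ennreal_mult_less_top)
  finally show ?thesis .
qed

text \<open>Inside the tube there is room to move \<open>(y, s)\<close> in all directions, which the weight converts into
  exponential decay in both frequency variables.\<close>

lemma weight_margin:
  assumes ys: "(y, s) \<in> tube \<beta>"
  obtains d where "d > 0" "\<And>j \<xi>. exp (s * of_int j / 2 - y * \<xi>) * exp (2 * d * freq_size (j, \<xi>))
     \<le> 2 * sqrt (cosh (pi * \<xi>) * cosh ((2 * \<beta> - pi) * (\<xi> - of_int j / 2)))"
proof -
  define d where "d = min (pi / 2 - \<bar>y - s\<bar>) (\<beta> - pi / 2 - \<bar>s\<bar>) / 8"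
  have d: "d > 0" using ys by (auto simp: d_def tube_def)
  have d8: "8 * d \<le> pi / 2 - \<bar>y - s\<bar>" "8 * d \<le> \<beta> - pi / 2 - \<bar>s\<bar>" by (auto simp: d_def)
  show ?thesis
  proof (rule that[OF d])
    fix j :: int and \<xi> :: real
    define \<tau> \<sigma> where "\<tau> = (if \<xi> \<ge> 0 then - 1 else 1 :: real)" and "\<sigma> = (if j \<ge> 0 then 1 else - 1 :: real)"
    \<comment> \<open>Moving \<open>(y, s)\<close> so as to increase the exponent stays inside: \<open>\<bar>y - s\<bar>\<close> grows by at most \<open>6d\<close>, \<open>\<bar>s\<bar>\<close> by \<open>4d\<close>.\<close>
    define y' s' where "y' = y + 2 * d * \<tau>" and "s' = s + 4 * d * \<sigma>"
    have t: "\<bar>\<tau>\<bar> = 1" "\<bar>\<sigma>\<bar> = 1" by (auto simp: \<tau>_def \<sigma>_def)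
    have "\<bar>y' - s'\<bar> \<le> \<bar>y - s\<bar> + \<bar>2 * d * \<tau> - 4 * d * \<sigma>\<bar>" unfolding y'_def s'_def by linarith
    also have "\<bar>2 * d * \<tau> - 4 * d * \<sigma>\<bar> \<le> 6 * d" using d by (auto simp: \<tau>_def \<sigma>_def)
    finally have 1: "\<bar>y' - s'\<bar> \<le> pi / 2" using d8(1) d by linarith
    have "\<bar>s'\<bar> \<le> \<bar>s\<bar> + 4 * d" unfolding s'_def using d by (auto simp: \<sigma>_def)
    then have 2: "\<bar>s'\<bar> \<le> \<beta> - pi / 2" using d8(2) d by linarith
    have "2 * d * freq_size (j, \<xi>) = 4 * d * \<sigma> * of_int j / 2 - 2 * d * \<tau> * \<xi>"
      by (auto simp: freq_size_def \<tau>_def \<sigma>_def algebra_simps)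
    then have "exp (s * of_int j / 2 - y * \<xi>) * exp (2 * d * freq_size (j, \<xi>)) = exp (s' * of_int j / 2 - y' * \<xi>)"
      by (simp add: s'_def y'_def field_simps flip: exp_add)
    also have "\<dots> = sqrt ((exp (s' * of_int j / 2 - y' * \<xi>))\<^sup>2)" by simp
    also have "\<dots> \<le> sqrt (4 * (cosh (pi * \<xi>) * cosh ((2 * \<beta> - pi) * (\<xi> - of_int j / 2))))"
      using 1 2 by (intro real_sqrt_le_mono mode_weight_le) (auto simp: closed_tube_def)
    also have "\<dots> = 2 * sqrt (cosh (pi * \<xi>) * cosh ((2 * \<beta> - pi) * (\<xi> - of_int j / 2)))"
      by (simp only: real_sqrt_mult[of 4]) simp
    finally show "exp (s * of_int j / 2 - y * \<xi>) * exp (2 * d * freq_size (j, \<xi>))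
       \<le> 2 * sqrt (cosh (pi * \<xi>) * cosh ((2 * \<beta> - pi) * (\<xi> - of_int j / 2)))" .
  qed
qed

text \<open>The estimate \<open>2ab \<le> a\<^sup>2 + b\<^sup>2\<close> separates the energy density from a decaying exponential.\<close>

lemma mode_exp_integrable:
  assumes fe: "finite_energy \<beta> g" and ys: "(y, s) \<in> tube \<beta>"
  obtains d where "d > 0" "integrable freq_measure (\<lambda>p. complex_of_real (exp (d * freq_size p)) * mode g y s (fst p) (snd p))"
proof -
  note [measurable] = finite_energyD(1)[OF fe]
  obtain d where d: "d > 0" and le: "\<And>j \<xi>. exp (s * of_int j / 2 - y * \<xi>) * exp (2 * d * freq_size (j, \<xi>))
     \<le> 2 * sqrt (cosh (pi * \<xi>) * cosh ((2 * \<beta> - pi) * (\<xi> - of_int j / 2)))"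
    using weight_margin[OF ys] by blast
  define W where "W = (\<lambda>p. (cmod (g (fst p) (snd p)))\<^sup>2 * cosh (pi * snd p) * cosh ((2 * \<beta> - pi) * (snd p - of_int (fst p) / 2)))"
  have Wm: "(\<lambda>p. ennreal (W p)) \<in> borel_measurable freq_measure"
    by (rule freq_measurableI) (simp add: W_def)
  have em: "(\<lambda>p. ennreal (exp (- (2 * d) * freq_size p))) \<in> borel_measurable freq_measure"
    by (rule freq_measurableI) (simp add: freq_size_def)
  have bound: "cmod (complex_of_real (exp (d * freq_size p)) * mode g y s (fst p) (snd p)) \<le> W p + exp (- (2 * d) * freq_size p)" for p
  proof -
    obtain j \<xi> where p: "p = (j, \<xi>)" by (cases p)
    define a where "a = cmod (g j \<xi>) * sqrt (cosh (pi * \<xi>) * cosh ((2 * \<beta> - pi) * (\<xi> - of_int j / 2)))"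
    have a2: "a\<^sup>2 = W p" by (simp add: a_def W_def p power_mult_distrib)
    have "exp (d * freq_size p) = exp (2 * d * freq_size p) * exp (- d * freq_size p)" by (simp flip: exp_add)
    then have "cmod (complex_of_real (exp (d * freq_size p)) * mode g y s (fst p) (snd p))
       = (exp (s * of_int j / 2 - y * \<xi>) * exp (2 * d * freq_size (j, \<xi>))) * cmod (g j \<xi>) * exp (- d * freq_size p)"
      by (simp add: mode_def norm_mult p)
    also have "\<dots> \<le> (2 * sqrt (cosh (pi * \<xi>) * cosh ((2 * \<beta> - pi) * (\<xi> - of_int j / 2)))) * cmod (g j \<xi>) * exp (- d * freq_size p)"
      by (intro mult_right_mono le) auto
    also have "\<dots> = 2 * a * exp (- d * freq_size p)" by (simp add: a_def)
    also have "\<dots> \<le> a\<^sup>2 + (exp (- d * freq_size p))\<^sup>2" using sum_squares_bound[of a "exp (- d * freq_size p)"] by simp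
    also have "(exp (- d * freq_size p))\<^sup>2 = exp (- (2 * d) * freq_size p)" by (simp add: power2_eq_square flip: exp_add)
    finally show ?thesis by (simp add: a2)
  qed
  have "integrable freq_measure (\<lambda>p. complex_of_real (exp (d * freq_size p)) * mode g y s (fst p) (snd p))"
  proof (rule integrableI_bounded)
    show "(\<lambda>p. complex_of_real (exp (d * freq_size p)) * mode g y s (fst p) (snd p)) \<in> borel_measurable freq_measure"
      by (rule freq_measurableI) (simp add: freq_size_def mode_def)
    have "(\<integral>\<^sup>+p. ennreal (cmod (complex_of_real (exp (d * freq_size p)) * mode g y s (fst p) (snd p))) \<partial>freq_measure)
       \<le> (\<integral>\<^sup>+p. ennreal (W p) + ennreal (exp (- (2 * d) * freq_size p)) \<partial>freq_measure)"
    proof (intro nn_integral_mono)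
      fix p
      have "0 \<le> W p" by (simp add: W_def)
      then show "ennreal (cmod (complex_of_real (exp (d * freq_size p)) * mode g y s (fst p) (snd p))) \<le> ennreal (W p) + ennreal (exp (- (2 * d) * freq_size p))"
        using bound[of p] by (simp add: ennreal_leI flip: ennreal_plus)
    qed
    also have "\<dots> = (\<integral>\<^sup>+p. ennreal (W p) \<partial>freq_measure) + (\<integral>\<^sup>+p. ennreal (exp (- (2 * d) * freq_size p)) \<partial>freq_measure)"
      by (rule nn_integral_add[OF Wm em])
    also have "(\<integral>\<^sup>+p. ennreal (W p) \<partial>freq_measure) = infsum (energy \<beta> g) UNIV"
      unfolding nn_integral_freq[OF Wm] by (simp add: W_def energy_def[abs_def])
    also have "infsum (energy \<beta> g) UNIV + (\<integral>\<^sup>+p. ennreal (exp (- (2 * d) * freq_size p)) \<partial>freq_measure) < \<infinity>"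
      using finite_energyD(3)[OF fe] freq_size_exp_integrable[of "2 * d"] d by simp
    finally show "(\<integral>\<^sup>+p. ennreal (cmod (complex_of_real (exp (d * freq_size p)) * mode g y s (fst p) (snd p))) \<partial>freq_measure) < \<infinity>" .
  qed
  then show ?thesis by (rule that[OF d])
qed

section \<open>Series of transforms\<close>

text \<open>For \<open>\<bar>z\<bar> = 1\<close> this is the sum over \<open>j\<close> of \<open>z\<^sup>j\<close> times the inverse Fourier transform of \<open>k\<^sub>j\<close>. Both the
  functions synthesised from their modes and the kernel have this form over a point \<open>(y, s)\<close>.\<close>

definition psi :: "(int \<Rightarrow> real \<Rightarrow> complex) \<Rightarrow> real \<Rightarrow> complex \<Rightarrow> complex" where
  "psi k x z = 1 / (2 * pi) * (\<integral>p. k (fst p) (snd p) * cis (x * snd p) * z powi fst p \<partial>freq_measure)"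

text \<open>Orthogonality, with the sum and the integral interchanged by absolute convergence.\<close>

lemma circle_series_coefficient:
  assumes a: "(\<lambda>j. cmod (a j)) summable_on UNIV" and \<Phi>: "\<And>\<theta>. ((\<lambda>j. a j * circ j \<theta>) has_sum \<Phi> \<theta>) UNIV"
  shows "(\<integral>\<theta>. \<Phi> \<theta> * cnj (circ m \<theta>) \<partial>circle_measure) = a m"
proof -
  interpret CC: pair_sigma_finite "count_space (UNIV :: int set)" circle_measure
    by (intro pair_sigma_finite.intro sigma_finite_measure_count_space) (rule circle.sigma_finite_measure_axioms)
  have ia: "integrable (count_space UNIV) a"
    using a by (simp add: abs_summable_equivalent abs_summable_on_def)
  define f where "f = (\<lambda>j \<theta>. a j * circ j \<theta> * cnj (circ m \<theta>))"
  have fm: "case_prod f \<in> borel_measurable (count_space UNIV \<Otimes>\<^sub>M circle_measure)"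
    by (rule measurable_pair_measure_countable1) (auto simp: f_def)
  have nf: "cmod (f j \<theta>) = cmod (a j)" for j \<theta> by (simp add: f_def norm_mult)
  have int: "integrable (count_space UNIV \<Otimes>\<^sub>M circle_measure) (case_prod f)"
  proof (rule integrableI_bounded[OF fm])
    have "(\<integral>\<^sup>+p. ennreal (cmod (case_prod f p)) \<partial>(count_space UNIV \<Otimes>\<^sub>M circle_measure)) = (\<integral>\<^sup>+j. ennreal (cmod (a j)) \<partial>count_space UNIV)"
      using fm by (subst circle.nn_integral_fst[symmetric]) (auto simp: nf)
    then show "(\<integral>\<^sup>+p. ennreal (cmod (case_prod f p)) \<partial>(count_space UNIV \<Otimes>\<^sub>M circle_measure)) < \<infinity>"
      using ia by (simp add: integrable_iff_bounded)
  qed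
  have "(\<integral>\<theta>. \<Phi> \<theta> * cnj (circ m \<theta>) \<partial>circle_measure) = (\<integral>\<theta>. (\<integral>j. f j \<theta> \<partial>count_space UNIV) \<partial>circle_measure)"
  proof (rule Bochner_Integration.integral_cong[OF refl])
    fix \<theta>
    have "integrable (count_space UNIV) (\<lambda>j. f j \<theta>)"
      using ia by (rule Bochner_Integration.integrable_bound) (auto simp: nf)
    from count_space_has_sum(1)[OF this] has_sum_cmult_left[OF \<Phi>[of \<theta>], of "cnj (circ m \<theta>)"]
    show "\<Phi> \<theta> * cnj (circ m \<theta>) = (\<integral>j. f j \<theta> \<partial>count_space UNIV)"
      unfolding f_def by (rule has_sum_unique[rotated])
  qed
  also have "\<dots> = (\<integral>j. (\<integral>\<theta>. f j \<theta> \<partial>circle_measure) \<partial>count_space UNIV)"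
    by (rule CC.Fubini_integral[OF int])
  also have "\<dots> = (\<integral>j. (if j = m then a m else 0) \<partial>count_space UNIV)"
    by (rule Bochner_Integration.integral_cong[OF refl]) (auto simp: f_def mult.assoc circ_orthonormal)
  also have "\<dots> = a m"
  proof -
    have "((\<lambda>j. if j = m then a m else 0) has_sum a m) {m}" by (rule has_sum_finiteI) auto
    then have "((\<lambda>j. if j = m then a m else 0) has_sum a m) UNIV"
      by (subst has_sum_cong_neutral[where T = "{m}" and g = "\<lambda>j. if j = m then a m else 0"]) auto
    moreover have "integrable (count_space UNIV) (\<lambda>j. if j = m then a m else 0)"
      using ia by (rule Bochner_Integration.integrable_bound) auto
    ultimately show ?thesis using count_space_has_sum(1) has_sum_unique by blast
  qed
  finally show ?thesis .
qed

context
  fixes k :: "int \<Rightarrow> real \<Rightarrow> complex"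
  assumes k: "integrable freq_measure (\<lambda>p. k (fst p) (snd p))"
begin

lemma psi_integrand_measurable: "(\<lambda>p. k (fst p) (snd p) * cis (x * snd p) * z powi fst p) \<in> borel_measurable freq_measure"
proof -
  have "(\<lambda>p. cis (x * snd p) * z powi fst p) \<in> borel_measurable freq_measure" by (rule freq_measurableI) simp
  then have "(\<lambda>p. k (fst p) (snd p) * (cis (x * snd p) * z powi fst p)) \<in> borel_measurable freq_measure"
    using borel_measurable_integrable[OF k] by measurable
  then show ?thesis by (simp add: mult.assoc)
qed

lemma psi_integrand_integrable:
  assumes "cmod z = 1"
  shows "integrable freq_measure (\<lambda>p. k (fst p) (snd p) * cis (x * snd p) * z powi fst p)"
  by (rule Bochner_Integration.integrable_bound[OF k psi_integrand_measurable])
     (use assms in \<open>auto simp: norm_mult norm_power_int\<close>)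

lemma psi_coefficient_integrable: "integrable lborel (k j)"
  using freq_has_sum(3)[OF k, of j] by simp

lemma psi_has_sum:
  assumes z: "cmod z = 1"
  shows "((\<lambda>j. z powi j * inv_fourier (k j) x) has_sum psi k x z) UNIV"
    and "(\<lambda>j. cmod (inv_fourier (k j) x)) summable_on UNIV"
proof -
  have eq: "1 / (2 * pi) * (LBINT \<xi>. k j \<xi> * cis (x * \<xi>) * z powi j) = z powi j * inv_fourier (k j) x" for j z
    by (simp add: inv_fourier_def)
  show "((\<lambda>j. z powi j * inv_fourier (k j) x) has_sum psi k x z) UNIV"
    using has_sum_cmult_right[OF freq_has_sum(1)[OF psi_integrand_integrable[OF z]], of "1 / (2 * pi)" x]
    unfolding fst_conv snd_conv eq psi_def .
  have "(\<lambda>j. cmod (LBINT \<xi>. k j \<xi> * cis (x * \<xi>) * 1 powi j)) summable_on UNIV"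
    using freq_has_sum(2)[OF psi_integrand_integrable[of 1 x]] by simp
  from summable_on_cmult_right[OF this, of "1 / (2 * pi)"]
  show "(\<lambda>j. cmod (inv_fourier (k j) x)) summable_on UNIV"
    by (simp add: inv_fourier_def norm_mult norm_divide)
qed

lemma psi_continuous: "continuous_on (UNIV \<times> sphere 0 1) (\<lambda>(x, z). psi k x z)"
  unfolding continuous_on_sequentially
proof (intro allI ballI impI)
  fix X and a :: "real \<times> complex" assume a: "a \<in> UNIV \<times> sphere 0 1" and X: "(\<forall>n. X n \<in> UNIV \<times> sphere 0 1) \<and> X \<longlonglongrightarrow> a"
  have l: "(\<lambda>n. fst (X n)) \<longlonglongrightarrow> fst a" "(\<lambda>n. snd (X n)) \<longlonglongrightarrow> snd a" using X by (auto intro: tendsto_fst tendsto_snd)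
  have n: "cmod (snd (X n)) = 1" "cmod (snd a) = 1" for n
  proof -
    have "snd (X n) \<in> sphere 0 1" "snd a \<in> sphere 0 1" using X a by (metis mem_Times_iff)+
    then show "cmod (snd (X n)) = 1" "cmod (snd a) = 1" by auto
  qed
  have "(\<lambda>n. \<integral>p. k (fst p) (snd p) * cis (fst (X n) * snd p) * snd (X n) powi fst p \<partial>freq_measure)
     \<longlonglongrightarrow> (\<integral>p. k (fst p) (snd p) * cis (fst a * snd p) * snd a powi fst p \<partial>freq_measure)"
  proof (rule integral_dominated_convergence[where w = "\<lambda>p. cmod (k (fst p) (snd p))"])
    show "AE p in freq_measure. (\<lambda>n. k (fst p) (snd p) * cis (fst (X n) * snd p) * snd (X n) powi fst p)
       \<longlonglongrightarrow> k (fst p) (snd p) * cis (fst a * snd p) * snd a powi fst p"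
      unfolding cis_conv_exp using n(2) by (intro AE_I2 tendsto_intros l) auto
    show "AE p in freq_measure. cmod (k (fst p) (snd p) * cis (fst (X n) * snd p) * snd (X n) powi fst p) \<le> cmod (k (fst p) (snd p))" for n
      using n(1) by (simp add: norm_mult norm_power_int)
  qed (use k psi_integrand_measurable in auto)
  then show "((\<lambda>(x, z). psi k x z) \<circ> X) \<longlonglongrightarrow> (case a of (x, z) \<Rightarrow> psi k x z)"
    unfolding psi_def split_beta' o_def by (intro tendsto_mult tendsto_const)
qed

lemma psi_coefficient: "(\<integral>\<theta>. psi k x (cis (2 * pi * \<theta>)) * cnj (circ m \<theta>) \<partial>circle_measure) = inv_fourier (k m) x"
proof (rule circle_series_coefficient)
  show "(\<lambda>j. cmod (inv_fourier (k j) x)) summable_on UNIV" by (rule psi_has_sum(2)[of 1]) simp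
  show "((\<lambda>j. inv_fourier (k j) x * circ j \<theta>) has_sum psi k x (cis (2 * pi * \<theta>))) UNIV" for \<theta>
    using psi_has_sum(1)[of "cis (2 * pi * \<theta>)" x] unfolding circ_powi by (simp add: mult.commute[of "inv_fourier _ _"])
qed

lemma psi_RT_measurable: "(\<lambda>(x, \<theta>). psi k x (cis (2 * pi * \<theta>))) \<in> borel_measurable RT"
  unfolding split_beta'
  by (intro RT_measurableI borel_measurable_continuous_onI
        continuous_on_compose2[OF psi_continuous, of _ "\<lambda>p. (fst p, cis (2 * pi * snd p))", simplified] continuous_intros) auto

lemma psi_norm:
  assumes k2: "\<And>j. k j \<in> L2 lborel"
  shows "L2_norm_sq RT (\<lambda>(x, \<theta>). psi k x (cis (2 * pi * \<theta>))) = ennreal (1 / (2 * pi)) * (\<Sum>\<^sub>\<infinity>j. L2_norm_sq lborel (k j))"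
proof -
  have "L2_norm_sq RT (\<lambda>(x, \<theta>). (case (x, \<theta>) of (x, \<theta>) \<Rightarrow> psi k x (cis (2 * pi * \<theta>))) - (\<Sum>j\<in>{}. inv_fourier (k j) x * circ j \<theta>))
      = (\<Sum>\<^sub>\<infinity>j\<in>-{}. L2_norm_sq lborel (inv_fourier (k j)))"
  proof (rule L2_norm_sq_RT_expansion[OF psi_RT_measurable])
    show "inv_fourier (k j) \<in> borel_measurable borel" for j by (rule measurable_inv_fourier[OF psi_coefficient_integrable])
    show "\<exists>h. continuous_on (sphere 0 1) h \<and> (\<forall>\<theta>. (case (x, \<theta>) of (x, \<theta>) \<Rightarrow> psi k x (cis (2 * pi * \<theta>))) = h (cis (2 * pi * \<theta>)))" for x
      by (intro exI[of _ "psi k x"] conjI continuous_on_compose2[OF psi_continuous, of _ "\<lambda>z. (x, z)", simplified] continuous_intros) auto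
    show "(\<integral>\<theta>. (case (x, \<theta>) of (x, \<theta>) \<Rightarrow> psi k x (cis (2 * pi * \<theta>))) * cnj (circ j \<theta>) \<partial>circle_measure) = inv_fourier (k j) x" for x j
      using psi_coefficient by simp
  qed simp
  then show ?thesis
    by (simp add: plancherel[OF psi_coefficient_integrable k2] infsum_ennreal_cmult)
qed

end

section \<open>Synthesis\<close>

text \<open>The integrand of the synthesis in the logarithmic coordinate: \<open>z = (z\<^sub>1, w)\<close> with \<open>z\<^sub>2 = e\<^sup>w\<close>.\<close>

definition freq_exp :: "(int \<Rightarrow> real \<Rightarrow> complex) \<Rightarrow> complex \<times> complex \<Rightarrow> int \<times> real \<Rightarrow> complex" where
  "freq_exp g z p = exp (\<i> * fst z * complex_of_real (snd p) + of_int (fst p) * snd z) * g (fst p) (snd p)"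

lemma norm_freq_exp: "cmod (freq_exp g (z, w) p) = cmod (mode g (Im z) (2 * Re w) (fst p) (snd p))"
  by (simp add: freq_exp_def mode_def norm_mult mult.commute)

lemma freq_exp_measurable: "(\<And>j. g j \<in> borel_measurable borel) \<Longrightarrow> freq_exp g z \<in> borel_measurable freq_measure"
  by (rule freq_measurableI) (simp add: freq_exp_def)

text \<open>Differentiation under the integral sign, by the bound \<open>\<bar>e\<^sup>w - 1 - w\<bar> \<le> \<bar>w\<bar>\<^sup>2 e\<^bsup>\<bar>w\<bar>\<^esup>\<close> for the remainder.\<close>

lemma freq_integral_has_derivative:
  assumes g: "\<And>j. g j \<in> borel_measurable borel" and d: "d > 0"
    and int: "integrable freq_measure (\<lambda>p. complex_of_real (exp (d * freq_size p)) * freq_exp g z p)"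
  obtains a b where "((\<lambda>z. \<integral>p. freq_exp g z p \<partial>freq_measure) has_derivative (\<lambda>(h1, h2). a * h1 + b * h2)) (at z)"
proof -
  note m = freq_exp_measurable[OF g]
  define M where "M = (\<integral>p. cmod (complex_of_real (exp (d * freq_size p)) * freq_exp g z p) \<partial>freq_measure)"
  have dom: "integrable freq_measure f" if "f \<in> borel_measurable freq_measure"
     "\<And>p. cmod (f p) \<le> c * (exp (d * freq_size p) * cmod (freq_exp g z p))" for f :: "int \<times> real \<Rightarrow> complex" and c
  proof (rule Bochner_Integration.integrable_bound[OF integrable_mult_right[OF int, of "complex_of_real c"] that(1)])
    show "AE p in freq_measure. cmod (f p) \<le> cmod (complex_of_real c * (complex_of_real (exp (d * freq_size p)) * freq_exp g z p))"
    proof (intro AE_I2)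
      fix p
      have "cmod (f p) \<le> c * (exp (d * freq_size p) * cmod (freq_exp g z p))" by (rule that(2))
      also have "\<dots> \<le> \<bar>c\<bar> * (exp (d * freq_size p) * cmod (freq_exp g z p))" by (intro mult_right_mono) auto
      finally show "cmod (f p) \<le> cmod (complex_of_real c * (complex_of_real (exp (d * freq_size p)) * freq_exp g z p))"
        by (simp add: norm_mult)
    qed
  qed
  have mm: "(\<lambda>p. complex_of_real (snd p)) \<in> borel_measurable freq_measure" "(\<lambda>p. complex_of_int (fst p)) \<in> borel_measurable freq_measure"
    by (rule freq_measurableI; simp)+
  have size_le: "freq_size p \<le> 1 / d * exp (d * freq_size p)" for p
  proof -
    have "d * freq_size p \<le> exp (d * freq_size p)" using exp_ge_add_one_self[of "d * freq_size p"] by linarith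
    then show ?thesis using d by (simp add: pos_le_divide_eq mult.commute)
  qed
  have i1: "integrable freq_measure (\<lambda>p. \<i> * complex_of_real (snd p) * freq_exp g z p)"
  proof (rule dom)
    show "(\<lambda>p. \<i> * complex_of_real (snd p) * freq_exp g z p) \<in> borel_measurable freq_measure" using m mm by measurable
    show "cmod (\<i> * complex_of_real (snd p) * freq_exp g z p) \<le> 1 / d * (exp (d * freq_size p) * cmod (freq_exp g z p))" for p
    proof -
      have "\<bar>snd p\<bar> \<le> freq_size p" by (simp add: freq_size_def)
      also note size_le[of p]
      finally show ?thesis using mult_right_mono[of "\<bar>snd p\<bar>" "1 / d * exp (d * freq_size p)" "cmod (freq_exp g z p)"] by (simp add: norm_mult)
    qed
  qed
  have i2: "integrable freq_measure (\<lambda>p. of_int (fst p) * freq_exp g z p)"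
  proof (rule dom)
    show "(\<lambda>p. of_int (fst p) * freq_exp g z p) \<in> borel_measurable freq_measure" using m mm by measurable
    show "cmod (of_int (fst p) * freq_exp g z p) \<le> 1 / d * (exp (d * freq_size p) * cmod (freq_exp g z p))" for p
    proof -
      have "\<bar>of_int (fst p)\<bar> \<le> freq_size p" by (simp add: freq_size_def)
      also note size_le[of p]
      finally show ?thesis using mult_right_mono[of "\<bar>of_int (fst p)\<bar>" "1 / d * exp (d * freq_size p)" "cmod (freq_exp g z p)"] by (simp add: norm_mult)
    qed
  qed
  define a where "a = (\<integral>p. \<i> * complex_of_real (snd p) * freq_exp g z p \<partial>freq_measure)"
  define b where "b = (\<integral>p. of_int (fst p) * freq_exp g z p \<partial>freq_measure)"
  have i0: "integrable freq_measure (freq_exp g z)"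
    by (rule dom[where c = 1]) (use m d in \<open>auto simp: mult_le_cancel_right1\<close>)
  show ?thesis
  proof (rule that, rule has_derivativeI_sandwich[where e = "d / 2" and H = "\<lambda>z'. 8 / d\<^sup>2 * M * norm (z' - z)"])
    show "0 < d / 2" using d by simp
    show "bounded_linear (\<lambda>(h1, h2). a * h1 + b * h2)"
      unfolding split_beta' by (intro bounded_linear_add bounded_linear_const_mult bounded_linear_fst bounded_linear_snd)
    show "((\<lambda>z'. 8 / d\<^sup>2 * M * norm (z' - z)) \<longlongrightarrow> 0) (at z)"
      by (rule tendsto_eq_intros refl)+ auto
    fix z' assume z': "z' \<noteq> z" "dist z' z < d / 2"
    define h where "h = z' - z"
    have h: "norm h < d / 2" "norm h > 0" using z' by (auto simp: h_def dist_norm)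
    define w where "w = (\<lambda>p. \<i> * complex_of_real (snd p) * fst h + of_int (fst p) * snd h)"
    have E': "freq_exp g z' p = exp (w p) * freq_exp g z p" for p
    proof -
      have "z' = z + h" by (simp add: h_def)
      then show ?thesis by (simp add: freq_exp_def w_def algebra_simps flip: exp_add)
    qed
    have w: "cmod (w p) \<le> freq_size p * norm h" for p
    proof -
      have "cmod (w p) \<le> \<bar>snd p\<bar> * cmod (fst h) + \<bar>of_int (fst p)\<bar> * cmod (snd h)"
        unfolding w_def by (rule order_trans[OF norm_triangle_ineq]) (simp add: norm_mult)
      also have "\<dots> \<le> \<bar>snd p\<bar> * norm h + \<bar>of_int (fst p)\<bar> * norm h"
        using norm_fst_le[of "fst h" "snd h"] norm_snd_le[of "snd h" "fst h"] by (intro add_mono mult_left_mono) auto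
      finally show ?thesis by (simp add: freq_size_def algebra_simps)
    qed
    have w': "cmod (w p) \<le> d / 2 * freq_size p" for p
      using w[of p] mult_left_mono[of "norm h" "d / 2" "freq_size p"] h by (simp add: mult.commute)
    \<comment> \<open>One half of the margin \<open>d\<close> absorbs \<open>e\<^bsup>\<bar>w\<bar>\<^esup>\<close>, the other half the factor \<open>\<bar>w\<bar>\<^sup>2\<close>.\<close>
    have rem: "cmod (exp (w p) - 1 - w p) \<le> 8 / d\<^sup>2 * (norm h)\<^sup>2 * exp (d * freq_size p)" for p
    proof -
      have "cmod (exp (w p) - (\<Sum>k\<le>1. w p ^ k / fact k)) \<le> exp \<bar>Re (w p)\<bar> * cmod (w p) ^ Suc 1 / fact 1"
        by (rule Taylor_exp)
      then have "cmod (exp (w p) - 1 - w p) \<le> exp \<bar>Re (w p)\<bar> * (cmod (w p))\<^sup>2"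
        by (simp add: numeral_2_eq_2 algebra_simps)
      also have "\<dots> \<le> exp (d / 2 * freq_size p) * (freq_size p * norm h)\<^sup>2"
        using w[of p] w'[of p] abs_Re_le_cmod[of "w p"] by (intro mult_mono power_mono) auto
      also have "\<dots> = exp (d / 2 * freq_size p) * (freq_size p)\<^sup>2 * (norm h)\<^sup>2" by (simp add: power_mult_distrib)
      also have "\<dots> \<le> exp (d / 2 * freq_size p) * (8 / d\<^sup>2 * exp (d / 2 * freq_size p)) * (norm h)\<^sup>2"
      proof (intro mult_right_mono mult_left_mono)
        have "(d / 2 * freq_size p)\<^sup>2 / 2 \<le> exp (d / 2 * freq_size p)"
        proof -
          have "0 \<le> d / 2 * freq_size p" using d by simp
          from exp_lower_Taylor_quadratic[OF this] this show ?thesis by linarith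
        qed
        then show "(freq_size p)\<^sup>2 \<le> 8 / d\<^sup>2 * exp (d / 2 * freq_size p)" using d by (simp add: field_simps power2_eq_square)
      qed auto
      also have "\<dots> = 8 / d\<^sup>2 * (norm h)\<^sup>2 * (exp (d / 2 * freq_size p) * exp (d / 2 * freq_size p))" by simp
      also have "exp (d / 2 * freq_size p) * exp (d / 2 * freq_size p) = exp (d * freq_size p)" by (simp flip: exp_add)
      finally show ?thesis .
    qed
    have i3: "integrable freq_measure (freq_exp g z')"
    proof (rule dom[where c = 1])
      show "freq_exp g z' \<in> borel_measurable freq_measure" by (rule m)
      fix p
      have "cmod (exp (w p)) \<le> exp (cmod (w p))" by (rule norm_exp)
      also have "\<dots> \<le> exp (d * freq_size p)" using w'[of p] d by (simp add: order_trans[OF w'[of p]])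
      finally show "cmod (freq_exp g z' p) \<le> 1 * (exp (d * freq_size p) * cmod (freq_exp g z p))"
        unfolding E' norm_mult by (simp add: mult_right_mono)
    qed
    have "(\<integral>p. freq_exp g z' p \<partial>freq_measure) - (\<integral>p. freq_exp g z p \<partial>freq_measure) - (a * fst h + b * snd h)
       = (\<integral>p. freq_exp g z' p - freq_exp g z p - (\<i> * complex_of_real (snd p) * freq_exp g z p * fst h + of_int (fst p) * freq_exp g z p * snd h) \<partial>freq_measure)"
      unfolding a_def b_def using i0 i1 i2 i3 by simp
    also have "\<dots> = (\<integral>p. (exp (w p) - 1 - w p) * freq_exp g z p \<partial>freq_measure)"
      by (rule Bochner_Integration.integral_cong[OF refl]) (simp add: E' w_def algebra_simps)
    finally have eq: "(\<integral>p. freq_exp g z' p \<partial>freq_measure) - (\<integral>p. freq_exp g z p \<partial>freq_measure) - (a * fst h + b * snd h)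
      = (\<integral>p. (exp (w p) - 1 - w p) * freq_exp g z p \<partial>freq_measure)" .
    have "cmod (\<integral>p. (exp (w p) - 1 - w p) * freq_exp g z p \<partial>freq_measure)
       \<le> (\<integral>p. 8 / d\<^sup>2 * (norm h)\<^sup>2 * cmod (complex_of_real (exp (d * freq_size p)) * freq_exp g z p) \<partial>freq_measure)"
    proof (rule order_trans[OF integral_norm_bound integral_mono])
      show "integrable freq_measure (\<lambda>p. 8 / d\<^sup>2 * (norm h)\<^sup>2 * cmod (complex_of_real (exp (d * freq_size p)) * freq_exp g z p))"
        using int by auto
      show "cmod ((exp (w p) - 1 - w p) * freq_exp g z p) \<le> 8 / d\<^sup>2 * (norm h)\<^sup>2 * cmod (complex_of_real (exp (d * freq_size p)) * freq_exp g z p)" for p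
        using mult_right_mono[OF rem[of p], of "cmod (freq_exp g z p)"] by (simp add: norm_mult mult.assoc)
      have e: "(exp (w p) - 1 - w p) * freq_exp g z p = freq_exp g z' p - freq_exp g z p - (\<i> * complex_of_real (snd p) * freq_exp g z p * fst h + of_int (fst p) * freq_exp g z p * snd h)" for p
        by (simp add: E' w_def algebra_simps)
      show "integrable freq_measure (\<lambda>p. cmod ((exp (w p) - 1 - w p) * freq_exp g z p))"
        unfolding e using i0 i1 i2 i3 by auto
    qed
    also have "\<dots> = 8 / d\<^sup>2 * (norm h)\<^sup>2 * M" by (simp add: M_def)
    finally have "norm ((\<integral>p. freq_exp g z' p \<partial>freq_measure) - (\<integral>p. freq_exp g z p \<partial>freq_measure) - (a * fst h + b * snd h)) \<le> 8 / d\<^sup>2 * (norm h)\<^sup>2 * M"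
      unfolding eq .
    then show "norm ((\<integral>p. freq_exp g z' p \<partial>freq_measure) - (\<integral>p. freq_exp g z p \<partial>freq_measure) - (case z' - z of (h1, h2) \<Rightarrow> a * h1 + b * h2)) / norm (z' - z)
       \<le> 8 / d\<^sup>2 * M * norm (z' - z)"
      unfolding h_def[symmetric] split_beta' using h(2) by (simp add: pos_divide_le_eq power2_eq_square mult_ac)
  qed
qed

definition synthesis :: "(int \<Rightarrow> real \<Rightarrow> complex) \<Rightarrow> complex \<times> complex \<Rightarrow> complex" where
  "synthesis g z = 1 / (2 * pi) * (\<integral>p. exp (\<i> * fst z * complex_of_real (snd p)) * snd z powi fst p * g (fst p) (snd p) \<partial>freq_measure)"

lemma synthesis_exp: "synthesis g (z, exp w) = 1 / (2 * pi) * (\<integral>p. freq_exp g (z, w) p \<partial>freq_measure)"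
proof -
  have "exp w powi j = exp (of_int j * w)" for j by (simp add: exp_power_int)
  then show ?thesis by (simp add: synthesis_def freq_exp_def exp_add)
qed

lemma D'_tube: "(z1, z2) \<in> D' \<beta> \<Longrightarrow> z2 \<noteq> 0 \<and> (Im z1, 2 * ln (cmod z2)) \<in> tube \<beta>"
  by (auto simp: D'_def tube_def ln_realpow)

text \<open>Near a point with \<open>z\<^sub>2 \<noteq> 0\<close> the function is the integral of \<open>freq_exp\<close> composed with a branch of the
  logarithm of \<open>z\<^sub>2\<close>, namely \<open>w0 + Ln (\<sqdot> / z2)\<close>.\<close>

lemma synthesis_holomorphic:
  assumes fe: "finite_energy \<beta> g"
  shows "holomorphic2_on (synthesis g) (D' \<beta>)"
  unfolding holomorphic2_on_def
proof
  fix z assume z: "z \<in> D' \<beta>"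
  obtain z1 z2 where zz: "z = (z1, z2)" by (cases z)
  have z2: "z2 \<noteq> 0" and t: "(Im z1, 2 * ln (cmod z2)) \<in> tube \<beta>" using D'_tube z zz by auto
  define w0 where "w0 = Ln z2"
  have w0: "exp w0 = z2" "Re w0 = ln (cmod z2)" using z2 by (auto simp: w0_def)
  obtain d where d: "d > 0" and int: "integrable freq_measure (\<lambda>p. complex_of_real (exp (d * freq_size p)) * mode g (Im z1) (2 * ln (cmod z2)) (fst p) (snd p))"
    using mode_exp_integrable[OF fe t] by blast
  note gm = finite_energyD(1)[OF fe]
  have em: "(\<lambda>p. complex_of_real (exp (d * freq_size p))) \<in> borel_measurable freq_measure"
    by (rule freq_measurableI) (simp add: freq_size_def)
  have int': "integrable freq_measure (\<lambda>p. complex_of_real (exp (d * freq_size p)) * freq_exp g (z1, w0) p)"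
  proof (rule Bochner_Integration.integrable_bound[OF int])
    show "(\<lambda>p. complex_of_real (exp (d * freq_size p)) * freq_exp g (z1, w0) p) \<in> borel_measurable freq_measure"
      using em freq_exp_measurable[OF gm] by measurable
  qed (auto simp: norm_mult norm_freq_exp w0)
  obtain a b where G: "((\<lambda>z. \<integral>p. freq_exp g z p \<partial>freq_measure) has_derivative (\<lambda>(h1, h2). a * h1 + b * h2)) (at (z1, w0))"
    using freq_integral_has_derivative[OF gm d int'] by blast
  define L :: "complex \<times> complex \<Rightarrow> complex \<times> complex" where "L = (\<lambda>u. (fst u, w0 + Ln (snd u / z2)))"
  have Ln: "((\<lambda>v. Ln (v / z2)) has_field_derivative 1 / z2) (at z2)"
    by (rule derivative_eq_intros refl | simp add: z2)+
  have "((\<lambda>u. Ln (snd u / z2)) has_derivative (\<lambda>h. 1 / z2 * snd h)) (at (z1, z2))"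
    using has_derivative_compose[OF has_derivative_snd[OF has_derivative_ident], of "\<lambda>v. Ln (v / z2)" "(*) (1 / z2)" "(z1, z2)" UNIV] Ln
    by (simp add: has_field_derivative_def)
  then have dL: "(L has_derivative (\<lambda>h. (fst h, 1 / z2 * snd h))) (at (z1, z2))"
    unfolding L_def by (intro derivative_eq_intros) auto
  have Lz: "L (z1, z2) = (z1, w0)" using z2 by (simp add: L_def)
  have "((\<lambda>u. \<integral>p. freq_exp g (L u) p \<partial>freq_measure) has_derivative (\<lambda>h. a * fst h + b * (1 / z2 * snd h))) (at (z1, z2))"
    using has_derivative_compose[OF dL, of "\<lambda>z. \<integral>p. freq_exp g z p \<partial>freq_measure" "\<lambda>(h1, h2). a * h1 + b * h2"] G by (simp add: Lz split_beta')
  then have "((\<lambda>u. 1 / (2 * pi) * (\<integral>p. freq_exp g (L u) p \<partial>freq_measure)) has_derivative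
      (\<lambda>h. 1 / (2 * pi) * (a * fst h + b * (1 / z2 * snd h)))) (at (z1, z2))"
    by (rule has_derivative_mult_right)
  then have "(synthesis g has_derivative (\<lambda>h. 1 / (2 * pi) * (a * fst h + b * (1 / z2 * snd h)))) (at (z1, z2))"
  proof (rule has_derivative_transform_within_open)
    show "open (UNIV \<times> (- {0 :: complex}))" by (intro open_Times) auto
    fix u :: "complex \<times> complex" assume "u \<in> UNIV \<times> (- {0})"
    then have "snd u \<noteq> 0" by auto
    then have "exp (w0 + Ln (snd u / z2)) = snd u" using z2 by (simp add: exp_add w0)
    then show "1 / (2 * pi) * (\<integral>p. freq_exp g (L u) p \<partial>freq_measure) = synthesis g u"
      using synthesis_exp[of g "fst u" "w0 + Ln (snd u / z2)"] by (simp add: L_def)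
  qed (use z2 in auto)
  moreover have "(\<lambda>h. 1 / (2 * pi) * (a * fst h + b * (1 / z2 * snd h))) = (\<lambda>(h1, h2). (a / (2 * pi)) * h1 + (b / (2 * pi * z2)) * h2)"
    by (auto simp: fun_eq_iff field_simps z2)
  ultimately show "\<exists>a b. (synthesis g has_derivative (\<lambda>(h1, h2). a * h1 + b * h2)) (at z)"
    unfolding zz by metis
qed

lemma mode_freq_integrable:
  assumes fe: "finite_energy \<beta> g" and ys: "(y, s) \<in> tube \<beta>"
  shows "integrable freq_measure (\<lambda>p. mode g y s (fst p) (snd p))"
proof -
  note [measurable] = finite_energyD(1)[OF fe]
  obtain d where d: "d > 0" and int: "integrable freq_measure (\<lambda>p. complex_of_real (exp (d * freq_size p)) * mode g y s (fst p) (snd p))"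
    using mode_exp_integrable[OF fe ys] by blast
  show ?thesis
  proof (rule Bochner_Integration.integrable_bound[OF int])
    show "(\<lambda>p. mode g y s (fst p) (snd p)) \<in> borel_measurable freq_measure"
      by (rule freq_measurableI) (simp add: mode_def)
    show "AE p in freq_measure. cmod (mode g y s (fst p) (snd p)) \<le> cmod (complex_of_real (exp (d * freq_size p)) * mode g y s (fst p) (snd p))"
      using d by (simp add: norm_mult mult_le_cancel_right1)
  qed
qed

lemma synthesis_psi: "synthesis g (Complex x y, complex_of_real (exp (s / 2)) * z) = psi (mode g y s) x z"
proof -
  have "exp (\<i> * Complex x y * complex_of_real \<xi>) * (complex_of_real (exp (s / 2)) * z) powi j * g j \<xi> = mode g y s j \<xi> * cis (x * \<xi>) * z powi j" for j \<xi>
  proof -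
    have "\<i> * Complex x y * complex_of_real \<xi> = complex_of_real (- y * \<xi>) + \<i> * complex_of_real (x * \<xi>)"
      by (simp add: complex_eq_iff)
    then have e: "exp (\<i> * Complex x y * complex_of_real \<xi>) = complex_of_real (exp (- y * \<xi>)) * cis (x * \<xi>)"
      by (simp only: exp_add exp_of_real cis_conv_exp)
    have "complex_of_real (exp (s / 2)) powi j = complex_of_real (exp (s * of_int j / 2))"
      by (simp add: exp_power_int mult.commute flip: of_real_power_int)
    then show ?thesis unfolding e mode_eq power_int_mult_distrib by simp
  qed
  then show ?thesis unfolding synthesis_def psi_def by (simp only: fst_conv snd_conv)
qed

theorem synthesis_spectral:
  assumes fe: "finite_energy \<beta> g" and b: "\<beta> > pi / 2"
  shows "spectral \<beta> (synthesis g) g"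
  unfolding spectral_def
proof (intro conjI allI impI)
  show "continuous_on (D' \<beta>) (synthesis g)" by (rule holomorphic2_continuous[OF synthesis_holomorphic[OF fe]])
  show "g j \<in> borel_measurable borel" for j by (rule finite_energyD(1)[OF fe])
  show "(\<lambda>\<xi>. complex_of_real (exp (- y * \<xi>)) * g j \<xi>) \<in> L2 lborel" if "\<bar>y\<bar> < \<beta>" for j y
    by (rule exp_weight_L2[OF finite_energyD(1)[OF fe] finite_energyD(2)[OF fe] that b])
  fix y s x j assume "(y, s) \<in> tube \<beta>"
  from psi_coefficient[OF mode_freq_integrable[OF fe this], of x j]
  show "(\<integral>\<theta>. fiber (synthesis g) y s (x, \<theta>) * cnj (circ j \<theta>) \<partial>circle_measure) = inv_fourier (mode g y s j) x"
    by (simp add: fiber_def synthesis_psi)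
qed

section \<open>The reproducing kernel\<close>

definition weight :: "real \<Rightarrow> int \<Rightarrow> real \<Rightarrow> real" where
  "weight \<beta> j \<xi> = cosh (pi * \<xi>) * cosh ((2 * \<beta> - pi) * (\<xi> - of_int j / 2))"

lemma weight_pos: "weight \<beta> j \<xi> > 0"
  by (simp add: weight_def)

text \<open>The frequency-side coefficients of \<open>4K(\<sqdot>, z)\<close> on the component with parameters \<open>(y, s')\<close>, where
  \<open>z = (u + iv, e\<^bsup>s/2\<^esup> \<omega>)\<close>.\<close>

definition kern :: "real \<Rightarrow> real \<Rightarrow> real \<Rightarrow> real \<Rightarrow> real \<Rightarrow> real \<Rightarrow> complex \<Rightarrow> int \<Rightarrow> real \<Rightarrow> complex" where
  "kern \<beta> y s' u v s \<omega> j \<xi> = complex_of_real (exp (s' * of_int j / 2 - y * \<xi>) * exp (s * of_int j / 2 - v * \<xi>) / weight \<beta> j \<xi>)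
     * cis (- u * \<xi>) * cnj \<omega> powi j"

lemma kern_measurable: "kern \<beta> y s' u v s \<omega> j \<in> borel_measurable borel"
  unfolding kern_def weight_def by measurable

text \<open>One factor is compared with the weight on the closed tube, the other with room to spare inside the tube.\<close>

lemma kern_bound:
  assumes "(y, s') \<in> closed_tube \<beta>" "(v, s) \<in> tube \<beta>"
  obtains d where "d > 0" "\<And>\<omega> j \<xi> u. cmod \<omega> = 1 \<Longrightarrow> cmod (kern \<beta> y s' u v s \<omega> j \<xi>) \<le> 4 * exp (- (2 * d) * freq_size (j, \<xi>))"
proof -
  obtain d where d: "d > 0" and le: "\<And>j \<xi>. exp (s * of_int j / 2 - v * \<xi>) * exp (2 * d * freq_size (j, \<xi>))
     \<le> 2 * sqrt (cosh (pi * \<xi>) * cosh ((2 * \<beta> - pi) * (\<xi> - of_int j / 2)))"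
    using weight_margin[OF assms(2)] by blast
  show ?thesis
  proof (rule that[OF d])
    fix \<omega> :: complex and j \<xi> u assume \<omega>: "cmod \<omega> = 1"
    define A where "A = exp (s' * of_int j / 2 - y * \<xi>)"
    define B where "B = exp (s * of_int j / 2 - v * \<xi>)"
    define W where "W = weight \<beta> j \<xi>"
    have W: "W > 0" unfolding W_def by (rule weight_pos)
    have "A = sqrt (A\<^sup>2)" by (simp add: A_def)
    also have "\<dots> \<le> sqrt (4 * W)" unfolding A_def W_def weight_def by (intro real_sqrt_le_mono mode_weight_le assms)
    finally have A: "A \<le> 2 * sqrt W" by (simp only: real_sqrt_mult[of 4]) simp
    have "B * exp (2 * d * freq_size (j, \<xi>)) \<le> 2 * sqrt W" using le[of j \<xi>] by (simp add: B_def W_def weight_def)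
    then have B: "B \<le> 2 * sqrt W * exp (- (2 * d) * freq_size (j, \<xi>))"
      by (simp add: exp_minus pos_le_divide_eq flip: divide_inverse)
    have "A * B \<le> (2 * sqrt W) * (2 * sqrt W * exp (- (2 * d) * freq_size (j, \<xi>)))"
      using W by (intro mult_mono A B) (auto simp: B_def)
    also have "\<dots> = 4 * W * exp (- (2 * d) * freq_size (j, \<xi>))" using W by simp
    finally have "A * B / W \<le> 4 * exp (- (2 * d) * freq_size (j, \<xi>))" using W by (simp add: divide_le_eq mult_ac)
    moreover have "cmod (kern \<beta> y s' u v s \<omega> j \<xi>) = A * B / W"
      unfolding kern_def A_def[symmetric] B_def[symmetric] W_def[symmetric]
      using W \<omega> by (simp add: norm_mult norm_divide norm_power_int A_def B_def)
    ultimately show "cmod (kern \<beta> y s' u v s \<omega> j \<xi>) \<le> 4 * exp (- (2 * d) * freq_size (j, \<xi>))" by simp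
  qed
qed

lemma kern_integrable:
  assumes "(y, s') \<in> closed_tube \<beta>" "(v, s) \<in> tube \<beta>" "cmod \<omega> = 1"
  shows "integrable freq_measure (\<lambda>p. kern \<beta> y s' u v s \<omega> (fst p) (snd p))"
    and "kern \<beta> y s' u v s \<omega> j \<in> L2 lborel"
    and "(\<Sum>\<^sub>\<infinity>j. L2_norm_sq lborel (kern \<beta> y s' u v s \<omega> j)) < \<infinity>"
proof -
  obtain d where d: "d > 0" and le': "\<And>\<omega> j \<xi> u. cmod \<omega> = 1 \<Longrightarrow> cmod (kern \<beta> y s' u v s \<omega> j \<xi>) \<le> 4 * exp (- (2 * d) * freq_size (j, \<xi>))"
    using kern_bound[OF assms(1,2)] by blast
  define k where "k = kern \<beta> y s' u v s \<omega>"
  have le: "cmod (k (fst p) (snd p)) \<le> 4 * exp (- (2 * d) * freq_size p)" for p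
    using le'[OF assms(3), of u "fst p" "snd p"] by (simp add: k_def)
  have km [measurable]: "k j \<in> borel_measurable borel" for j unfolding k_def by (rule kern_measurable)
  have e: "(\<integral>\<^sup>+p. ennreal (C * exp (- c * freq_size p)) \<partial>freq_measure) < \<infinity>" if "c > 0" "C \<ge> 0" for c C
  proof -
    have "(\<lambda>p. ennreal (exp (- c * freq_size p))) \<in> borel_measurable freq_measure"
      by (rule freq_measurableI) (simp add: freq_size_def)
    then show ?thesis using freq_size_exp_integrable[OF that(1)] that(2)
      by (simp add: ennreal_mult nn_integral_cmult ennreal_mult_less_top)
  qed
  have "integrable freq_measure (\<lambda>p. k (fst p) (snd p))"
  proof (rule integrableI_bounded)
    show "(\<lambda>p. k (fst p) (snd p)) \<in> borel_measurable freq_measure" by (rule freq_measurableI) simp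
    have "(\<integral>\<^sup>+p. ennreal (cmod (k (fst p) (snd p))) \<partial>freq_measure) \<le> (\<integral>\<^sup>+p. ennreal (4 * exp (- (2 * d) * freq_size p)) \<partial>freq_measure)"
      by (intro nn_integral_mono ennreal_leI le)
    also have "\<dots> < \<infinity>" using d by (intro e) auto
    finally show "(\<integral>\<^sup>+p. ennreal (cmod (k (fst p) (snd p))) \<partial>freq_measure) < \<infinity>" .
  qed
  then show "integrable freq_measure (\<lambda>p. kern \<beta> y s' u v s \<omega> (fst p) (snd p))" by (simp add: k_def)
  have "(\<Sum>\<^sub>\<infinity>j. L2_norm_sq lborel (k j)) = (\<integral>\<^sup>+p. ennreal ((cmod (k (fst p) (snd p)))\<^sup>2) \<partial>freq_measure)"
    unfolding L2_norm_sq_def by (subst nn_integral_freq) (auto intro!: freq_measurableI)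
  also have "\<dots> \<le> (\<integral>\<^sup>+p. ennreal (16 * exp (- (4 * d) * freq_size p)) \<partial>freq_measure)"
  proof (intro nn_integral_mono ennreal_leI)
    fix p
    have "(cmod (k (fst p) (snd p)))\<^sup>2 \<le> (4 * exp (- (2 * d) * freq_size p))\<^sup>2" by (intro power_mono le) simp
    then show "(cmod (k (fst p) (snd p)))\<^sup>2 \<le> 16 * exp (- (4 * d) * freq_size p)"
      by (simp add: power_mult_distrib power2_eq_square mult.assoc flip: exp_add)
  qed
  also have "\<dots> < \<infinity>" using d by (intro e) auto
  finally have fin: "(\<Sum>\<^sub>\<infinity>j. L2_norm_sq lborel (k j)) < \<infinity>" .
  then show "(\<Sum>\<^sub>\<infinity>j. L2_norm_sq lborel (kern \<beta> y s' u v s \<omega> j)) < \<infinity>" by (simp add: k_def)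
  have "L2_norm_sq lborel (k j) = infsum (\<lambda>j. L2_norm_sq lborel (k j)) {j}" by simp
  also have "\<dots> \<le> (\<Sum>\<^sub>\<infinity>j. L2_norm_sq lborel (k j))" by (rule infsum_ennreal_mono_set) simp
  finally show "kern \<beta> y s' u v s \<omega> j \<in> L2 lborel" using fin km[of j] by (auto simp: L2_def k_def intro: order.strict_trans1)
qed

lemma K_eq_psi:
  assumes "(y, s') \<in> closed_tube \<beta>" "(v, s) \<in> tube \<beta>" "cmod \<omega> = 1" "cmod \<zeta> = 1"
  shows "K \<beta> (Complex x y, complex_of_real (exp (s' / 2)) * \<zeta>) (Complex u v, complex_of_real (exp (s / 2)) * \<omega>)
     = 1 / 4 * psi (kern \<beta> y s' u v s \<omega>) x \<zeta>"
proof -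
  have p: "complex_of_real (exp (c / 2)) powi j = complex_of_real (exp (c * of_int j / 2))" for c j
    by (simp add: exp_power_int mult.commute flip: of_real_power_int)
  have "(complex_of_real (exp (s' / 2)) * \<zeta>) powi j * cnj (complex_of_real (exp (s / 2)) * \<omega>) powi j / (8 * complex_of_real pi) *
     (LBINT \<xi>. exp (\<i> * (Complex x y - cnj (Complex u v)) * complex_of_real \<xi>)
        / complex_of_real (cosh (pi * \<xi>) * cosh ((2 * \<beta> - pi) * (\<xi> - of_int j / 2))))
     = 1 / 4 * (\<zeta> powi j * inv_fourier (kern \<beta> y s' u v s \<omega> j) x)" for j
  proof -
    have e: "kern \<beta> y s' u v s \<omega> j \<xi> * cis (x * \<xi>) = complex_of_real (exp (s' * of_int j / 2)) * complex_of_real (exp (s * of_int j / 2)) * cnj \<omega> powi j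
        * (exp (\<i> * (Complex x y - cnj (Complex u v)) * complex_of_real \<xi>)
        / complex_of_real (cosh (pi * \<xi>) * cosh ((2 * \<beta> - pi) * (\<xi> - of_int j / 2))))" for \<xi>
    proof -
      have "\<i> * (Complex x y - cnj (Complex u v)) * complex_of_real \<xi> = complex_of_real (- y * \<xi>) + complex_of_real (- v * \<xi>) + \<i> * complex_of_real (- u * \<xi>) + \<i> * complex_of_real (x * \<xi>)"
        by (simp add: complex_eq_iff algebra_simps)
      then have 1: "exp (\<i> * (Complex x y - cnj (Complex u v)) * complex_of_real \<xi>)
         = complex_of_real (exp (- y * \<xi>)) * complex_of_real (exp (- v * \<xi>)) * cis (- u * \<xi>) * cis (x * \<xi>)"
        by (simp only: exp_add exp_of_real cis_conv_exp)
      have 2: "exp (c * of_int j / 2 - t * \<xi>) = exp (c * of_int j / 2) * exp (- t * \<xi>)" for c t by (simp flip: exp_add)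
      have calc: "complex_of_real (a * a' * (b * b') / W) * e * w * e' = of_real a * of_real b * w * (of_real a' * of_real b' * e * e' / of_real W)"
        for a a' b b' W e e' w by simp
      show ?thesis unfolding 1 kern_def weight_def 2 calc ..
    qed
    have "inv_fourier (kern \<beta> y s' u v s \<omega> j) x = 1 / (2 * complex_of_real pi) * (complex_of_real (exp (s' * of_int j / 2)) * complex_of_real (exp (s * of_int j / 2)) * cnj \<omega> powi j
        * (LBINT \<xi>. exp (\<i> * (Complex x y - cnj (Complex u v)) * complex_of_real \<xi>)
        / complex_of_real (cosh (pi * \<xi>) * cosh ((2 * \<beta> - pi) * (\<xi> - of_int j / 2)))))"
      unfolding inv_fourier_def e integral_mult_right_zero ..
    moreover have "A * z * (B * w) / (8 * c) * I = 1 / 4 * (z * (1 / (2 * c) * (A * B * w * I)))" for A B w z c I :: complex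
      by simp
    ultimately show ?thesis
      by (simp only: power_int_mult_distrib complex_cnj_mult complex_cnj_complex_of_real complex_cnj_power_int p)
  qed
  then show ?thesis
    unfolding K_def prod.case
    by (intro infsumI) (simp only:, intro has_sum_cmult_right psi_has_sum(1) kern_integrable(1) assms)
qed

section \<open>The operator S\<close>

lemma has_sum_finite_sum:
  fixes f :: "'i \<Rightarrow> 'a \<Rightarrow> complex"
  assumes "finite L" "\<And>l. l \<in> L \<Longrightarrow> (f l has_sum s l) A"
  shows "((\<lambda>j. \<Sum>l\<in>L. f l j) has_sum (\<Sum>l\<in>L. s l)) A"
  using assms by (induction L rule: finite_induct) (auto intro: has_sum_add)

text \<open>Termwise pairing: in the mean limit of the partial sums each angular mode of \<open>\<phi>\<close> meets only the same mode
  of the kernel.\<close>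

lemma bdry_pairing_has_sum:
  assumes \<phi>: "\<phi> \<in> L2 RT" and h: "\<And>j. h j \<in> L2 lborel"
    and lim: "((\<lambda>J. L2_norm_sq RT (\<lambda>(x, \<theta>). \<phi> (x, \<theta>) - (\<Sum>j\<in>J. h j x * circ j \<theta>))) \<longlongrightarrow> 0) (finite_subsets_at_top UNIV)"
    and k: "integrable freq_measure (\<lambda>p. k (fst p) (snd p))" "\<And>j. k j \<in> L2 lborel" "(\<Sum>\<^sub>\<infinity>j. L2_norm_sq lborel (k j)) < \<infinity>"
  shows "((\<lambda>j. LBINT x. h j x * cnj (inv_fourier (k j) x)) has_sum (\<integral>p. \<phi> p * cnj (case p of (x, \<theta>) \<Rightarrow> psi k x (cis (2 * pi * \<theta>))) \<partial>RT)) UNIV"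
proof -
  define \<kappa> where "\<kappa> = (\<lambda>(x, \<theta>). psi k x (cis (2 * pi * \<theta>)))"
  have \<kappa>: "\<kappa> \<in> L2 RT"
    using psi_norm[OF k(1,2)] psi_RT_measurable[OF k(1)] k(3) by (simp add: \<kappa>_def L2_def ennreal_mult_less_top)
  define m where "m = (\<lambda>j (x, \<theta>). h j x * circ j \<theta>)"
  have m: "m j \<in> L2 RT" for j
    using h[of j] measurable_RT_mode[of "h j" j] L2_norm_sq_RT_mode[of "h j" j] by (auto simp: m_def L2_def)
  have "((\<lambda>J. \<integral>p. (\<Sum>j\<in>J. m j p) * cnj (\<kappa> p) \<partial>RT) \<longlongrightarrow> (\<integral>p. \<phi> p * cnj (\<kappa> p) \<partial>RT)) (finite_subsets_at_top UNIV)"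
  proof (rule L2_inner_tendsto[OF _ _ \<phi> \<kappa>])
    show "((\<lambda>J. L2_norm_sq RT (\<lambda>p. (\<Sum>j\<in>J. m j p) - \<phi> p)) \<longlongrightarrow> 0) (finite_subsets_at_top UNIV)"
      using lim unfolding L2_norm_sq_diff_commute[of RT _ \<phi>] by (simp add: m_def split_beta')
    show "(\<lambda>p. \<Sum>j\<in>J. m j p) \<in> L2 RT" for J
    proof (cases "finite J")
      case True
      then show ?thesis by (intro L2_sum m)
    qed (simp add: L2_def L2_norm_sq_def)
  qed
  moreover have "(\<integral>p. (\<Sum>j\<in>J. m j p) * cnj (\<kappa> p) \<partial>RT) = (\<Sum>j\<in>J. LBINT x. h j x * cnj (inv_fourier (k j) x))" for J
  proof (cases "finite J")
    case True
    have "(\<integral>p. (\<Sum>j\<in>J. m j p) * cnj (\<kappa> p) \<partial>RT) = (\<Sum>j\<in>J. \<integral>p. m j p * cnj (\<kappa> p) \<partial>RT)"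
      unfolding sum_distrib_right by (rule Bochner_Integration.integral_sum) (rule L2_Cauchy_Schwarz(1)[OF m \<kappa>])
    also have "\<dots> = (\<Sum>j\<in>J. LBINT x. h j x * cnj (inv_fourier (k j) x))"
    proof (rule sum.cong[OF refl])
      fix j
      have "integrable (lborel \<Otimes>\<^sub>M circle_measure) (\<lambda>p. m j p * cnj (\<kappa> p))"
        using L2_Cauchy_Schwarz(1)[OF m[of j] \<kappa>] by (simp add: RT_def)
      from RT.integral_fst'[OF this]
      have "(\<integral>p. m j p * cnj (\<kappa> p) \<partial>RT) = (LBINT x. (\<integral>\<theta>. m j (x, \<theta>) * cnj (\<kappa> (x, \<theta>)) \<partial>circle_measure))"
        by (simp add: RT_def)
      also have "\<dots> = (LBINT x. h j x * cnj (inv_fourier (k j) x))"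
      proof (rule Bochner_Integration.integral_cong[OF refl])
        fix x
        have "(\<integral>\<theta>. m j (x, \<theta>) * cnj (\<kappa> (x, \<theta>)) \<partial>circle_measure) = (\<integral>\<theta>. h j x * cnj (psi k x (cis (2 * pi * \<theta>)) * cnj (circ j \<theta>)) \<partial>circle_measure)"
          by (rule Bochner_Integration.integral_cong[OF refl]) (simp add: m_def \<kappa>_def mult_ac)
        also have "\<dots> = h j x * cnj (\<integral>\<theta>. psi k x (cis (2 * pi * \<theta>)) * cnj (circ j \<theta>) \<partial>circle_measure)"
          by (simp only: integral_mult_right_zero Bochner_Integration.integral_cnj)
        finally show "(\<integral>\<theta>. m j (x, \<theta>) * cnj (\<kappa> (x, \<theta>)) \<partial>circle_measure) = h j x * cnj (inv_fourier (k j) x)"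
          by (simp add: psi_coefficient[OF k(1)])
      qed
      finally show "(\<integral>p. m j p * cnj (\<kappa> p) \<partial>RT) = (LBINT x. h j x * cnj (inv_fourier (k j) x))" .
    qed
    finally show ?thesis .
  qed simp
  ultimately show ?thesis by (simp add: has_sum_def \<kappa>_def)
qed

text \<open>Pairing with the kernel: by Plancherel each mode contributes an integral over the frequencies, and
  the four boundary weights add up to the weight in the denominator of the kernel.\<close>

theorem S_has_sum:
  assumes b: "\<beta> > pi / 2" and \<phi>: "\<phi> \<in> L2_bdry" and fe: "finite_energy \<beta> g" and bs: "bdry_series \<beta> g \<phi>"
    and vs: "(v, s) \<in> tube \<beta>" and \<omega>: "cmod \<omega> = 1"
  shows "((\<lambda>j. \<omega> powi j * inv_fourier (mode g v s j) u) has_sum S \<beta> \<phi> (Complex u v, complex_of_real (exp (s / 2)) * \<omega>)) UNIV"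
proof -
  define z where "z = (Complex u v, complex_of_real (exp (s / 2)) * \<omega>)"
  obtain h where h: "\<And>l j. l \<in> {1..4} \<Longrightarrow> is_bdry_mode \<beta> g l j (h l j)"
    and lim: "\<And>l. l \<in> {1..4} \<Longrightarrow> ((\<lambda>J. L2_norm_sq RT (\<lambda>(x, \<theta>). \<phi> l (x, \<theta>) - (\<Sum>j\<in>J. h l j x * circ j \<theta>))) \<longlongrightarrow> 0) (finite_subsets_at_top UNIV)"
    using bs unfolding bdry_series_iff by blast
  define k where "k = (\<lambda>l. kern \<beta> (eta \<beta> l) (sigma l * (\<beta> - pi / 2)) u v s \<omega>)"
  define m where "m = (\<lambda>l. mode g (eta \<beta> l) (sigma l * (\<beta> - pi / 2)))"
  have \<phi>2: "\<phi> l \<in> L2 RT" if "l \<in> {1..4}" for l using \<phi> that by (auto simp: L2_bdry_def)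
  have K_eq: "K \<beta> (bdry_point \<beta> l p) z = 1 / 4 * (case p of (x, \<theta>) \<Rightarrow> psi (k l) x (cis (2 * pi * \<theta>)))" if l: "l \<in> {1..4}" for l p
  proof -
    obtain x \<theta> where p: "p = (x, \<theta>)" by (cases p)
    have "sigma l / 2 * (\<beta> - pi / 2) = sigma l * (\<beta> - pi / 2) / 2" by simp
    then show ?thesis
      unfolding z_def p bdry_point_def k_def
      using K_eq_psi[OF eta_closed_tube[OF b l] vs \<omega>, of "cis (2 * pi * \<theta>)" x u] by simp
  qed
  have S: "((\<lambda>j. \<Sum>l=1..4. 1 / 4 * (LBINT x. h l j x * cnj (inv_fourier (k l j) x))) has_sum S \<beta> \<phi> z) UNIV"
    unfolding S_def
  proof (rule has_sum_finite_sum)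
    fix l :: nat assume l: "l \<in> {1..4}"
    have "((\<lambda>j. LBINT x. h l j x * cnj (inv_fourier (k l j) x)) has_sum (\<integral>p. \<phi> l p * cnj (case p of (x, \<theta>) \<Rightarrow> psi (k l) x (cis (2 * pi * \<theta>))) \<partial>RT)) UNIV"
    proof (rule bdry_pairing_has_sum[OF \<phi>2[OF l] _ lim[OF l]])
      show "h l j \<in> L2 lborel" for j using h[OF l, of j] by (simp add: is_bdry_mode_def is_inv_fourier_L2_def)
    qed (unfold k_def, (rule kern_integrable[OF eta_closed_tube[OF b l] vs \<omega>])+)
    from has_sum_cmult_right[OF this, of "1 / 4"]
    have "((\<lambda>j. 1 / 4 * (LBINT x. h l j x * cnj (inv_fourier (k l j) x))) has_sum
        (\<integral>p. 1 / 4 * (\<phi> l p * cnj (case p of (x, \<theta>) \<Rightarrow> psi (k l) x (cis (2 * pi * \<theta>)))) \<partial>RT)) UNIV"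
      by (simp only: integral_mult_right_zero)
    moreover have "\<phi> l p * cnj (K \<beta> (bdry_point \<beta> l p) z) = 1 / 4 * (\<phi> l p * cnj (case p of (x, \<theta>) \<Rightarrow> psi (k l) x (cis (2 * pi * \<theta>))))" for p
      unfolding K_eq[OF l] by (simp only: complex_cnj_mult) simp
    ultimately show "((\<lambda>j. 1 / 4 * (LBINT x. h l j x * cnj (inv_fourier (k l j) x))) has_sum
        (\<integral>p. \<phi> l p * cnj (K \<beta> (bdry_point \<beta> l p) z) \<partial>RT)) UNIV"
      by (simp only:)
  qed simp
  have "(\<Sum>l=1..4. 1 / 4 * (LBINT x. h l j x * cnj (inv_fourier (k l j) x))) = \<omega> powi j * inv_fourier (mode g v s j) u" for j
  proof -
    have gm: "g j \<in> borel_measurable borel" and ge: "energy \<beta> g j < \<infinity>" using finite_energyD[OF fe] by auto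
    have kj: "integrable lborel (k l j)" "k l j \<in> L2 lborel" if l: "l \<in> {1..4}" for l
      using freq_has_sum(3)[OF kern_integrable(1)[OF eta_closed_tube[OF b l] vs \<omega>], of u j]
        kern_integrable(2)[OF eta_closed_tube[OF b l] vs \<omega>, of u j] by (simp_all add: k_def)
    have mj: "m l j \<in> L2 lborel" if l: "l \<in> {1..4}" for l
      unfolding m_def by (rule mode_L2[where g = g and j = j, OF gm ge eta_closed_tube[OF b l]])
    have "(\<Sum>l=1..4. 1 / 4 * (LBINT x. h l j x * cnj (inv_fourier (k l j) x)))
        = (\<Sum>l=1..4. 1 / 4 * (1 / (2 * pi) * (LBINT \<xi>. m l j \<xi> * cnj (k l j \<xi>))))"
      using is_inv_fourier_L2_inner[OF h[unfolded is_bdry_mode_def] kj] by (intro sum.cong) (auto simp: m_def)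
    also have "\<dots> = 1 / 4 * (1 / (2 * pi)) * (\<Sum>l=1..4. LBINT \<xi>. m l j \<xi> * cnj (k l j \<xi>))"
      by (simp add: sum_distrib_left)
    also have "(\<Sum>l=1..4. LBINT \<xi>. m l j \<xi> * cnj (k l j \<xi>)) = (LBINT \<xi>. \<Sum>l=1..4. m l j \<xi> * cnj (k l j \<xi>))"
      by (rule Bochner_Integration.integral_sum[symmetric]) (rule L2_Cauchy_Schwarz(1)[OF mj kj(2)])
    also have "\<dots> = (LBINT \<xi>. 4 * \<omega> powi j * (mode g v s j \<xi> * cis (u * \<xi>)))"
    proof (rule Bochner_Integration.integral_cong[OF refl])
      fix \<xi>
      define c where "c = complex_of_real (exp (s * of_int j / 2 - v * \<xi>) / weight \<beta> j \<xi>) * cis (u * \<xi>) * \<omega> powi j * g j \<xi>"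
      have "m l j \<xi> * cnj (k l j \<xi>) = complex_of_real ((exp (sigma l * (\<beta> - pi / 2) * of_int j / 2 - eta \<beta> l * \<xi>))\<^sup>2) * c" for l
      proof -
        have cis: "cnj (cis (- u * \<xi>)) = cis (u * \<xi>)" by (simp add: complex_eq_iff)
        have calc: "of_real A * x * cnj (of_real (A * B / W) * e * cnj \<omega> powi j) = of_real (A\<^sup>2) * (of_real (B / W) * cnj e * \<omega> powi j * x)"
          for A B W :: real and x e
          by (simp add: power2_eq_square)
        show ?thesis
          unfolding m_def k_def mode_def kern_def c_def calc cis ..
      qed
      then have "(\<Sum>l=1..4. m l j \<xi> * cnj (k l j \<xi>)) = complex_of_real (\<Sum>l=1..4. (exp (sigma l * (\<beta> - pi / 2) * of_int j / 2 - eta \<beta> l * \<xi>))\<^sup>2) * c"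
        by (simp only: sum_distrib_right[symmetric] of_real_sum[symmetric])
      also have "\<dots> = complex_of_real (4 * weight \<beta> j \<xi>) * c" unfolding energy_weight_sum weight_def ..
      also have "\<dots> = 4 * \<omega> powi j * (mode g v s j \<xi> * cis (u * \<xi>))"
      proof -
        have calc: "complex_of_real (4 * W) * (of_real (B / W) * e * w * x) = 4 * w * (of_real B * x * e)" if "W > 0" for B W e w x
          using that by simp
        show ?thesis unfolding c_def mode_def calc[OF weight_pos] ..
      qed
      finally show "(\<Sum>l=1..4. m l j \<xi> * cnj (k l j \<xi>)) = 4 * \<omega> powi j * (mode g v s j \<xi> * cis (u * \<xi>))" .
    qed
    also have "\<dots> = 4 * \<omega> powi j * (LBINT \<xi>. mode g v s j \<xi> * cis (u * \<xi>))" by (rule integral_mult_right_zero)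
    finally show ?thesis by (simp add: inv_fourier_def)
  qed
  with S show ?thesis by (simp add: z_def)
qed

section \<open>The characterisation\<close>

theorem theorem3p14:
  fixes \<beta> :: real and \<phi> :: bdry_fun
  assumes "\<beta> > pi / 2" and "\<phi> \<in> L2_bdry"
  shows "(\<phi> \<in> H2_bdry \<beta> \<longleftrightarrow> (\<exists>g. finite_energy \<beta> g \<and> bdry_series \<beta> g \<phi>)) \<and>
    (\<forall>g. finite_energy \<beta> g \<and> bdry_series \<beta> g \<phi> \<longrightarrow>
      (\<forall>u v r \<gamma> :: real. r > 0 \<longrightarrow> (Complex u v, complex_of_real r * cis (2 * pi * \<gamma>)) \<in> D' \<beta> \<longrightarrow>
        ((\<lambda>j. complex_of_real (r powi j) * cis (2 * pi * of_int j * \<gamma>)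
            * inv_fourier (\<lambda>\<xi>. complex_of_real (exp (- v * \<xi>)) * g j \<xi>) u)
          has_sum S \<beta> \<phi> (Complex u v, complex_of_real r * cis (2 * pi * \<gamma>))) UNIV))"
proof (intro conjI allI impI)
  show "\<phi> \<in> H2_bdry \<beta> \<longleftrightarrow> (\<exists>g. finite_energy \<beta> g \<and> bdry_series \<beta> g \<phi>)"
  proof
    assume "\<phi> \<in> H2_bdry \<beta>"
    then obtain F where F: "holomorphic2_on F (D' \<beta>)" "hardy_norm_sq \<beta> F < \<infinity>" and bv: "is_bdry_value \<beta> F \<phi>"
      by (auto simp: H2_bdry_def H2_def hardy_norm_sq_def)
    obtain g where sp: "spectral \<beta> F g" using hardy_spectral[OF assms(1) F] by blast
    have fe: "finite_energy \<beta> g" by (rule spectral_finite_energy[OF assms(1) sp F(2)])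
    with is_bdry_value_iff_bdry_series[OF sp fe assms] bv show "\<exists>g. finite_energy \<beta> g \<and> bdry_series \<beta> g \<phi>" by blast
  next
    assume "\<exists>g. finite_energy \<beta> g \<and> bdry_series \<beta> g \<phi>"
    then obtain g where fe: "finite_energy \<beta> g" and bs: "bdry_series \<beta> g \<phi>" by blast
    have sp: "spectral \<beta> (synthesis g) g" by (rule synthesis_spectral[OF fe assms(1)])
    have "synthesis g \<in> H2 \<beta>"
      unfolding H2_def using synthesis_holomorphic[OF fe] spectral_norm_bounded[OF sp finite_energyD(3)[OF fe]] by simp
    with is_bdry_value_iff_bdry_series[OF sp fe assms] bs show "\<phi> \<in> H2_bdry \<beta>" by (auto simp: H2_bdry_def)
  qed
next
  fix g u v r \<gamma>
  assume g: "finite_energy \<beta> g \<and> bdry_series \<beta> g \<phi>" and r: "r > 0"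
    and D: "(Complex u v, complex_of_real r * cis (2 * pi * \<gamma>)) \<in> D' \<beta>"
  have vs: "(v, 2 * ln r) \<in> tube \<beta>" using D'_tube[OF D] r by (simp add: norm_mult)
  have e: "exp (2 * ln r / 2) = r" using r by simp
  have "cis (2 * pi * \<gamma>) powi j * inv_fourier (mode g v (2 * ln r) j) u
      = complex_of_real (r powi j) * cis (2 * pi * of_int j * \<gamma>) * inv_fourier (\<lambda>\<xi>. complex_of_real (exp (- v * \<xi>)) * g j \<xi>) u" for j
  proof -
    have "exp (2 * ln r * of_int j / 2) = exp (ln r) powi j" by (simp add: exp_power_int mult.commute)
    then show ?thesis using r unfolding circ_powi by (simp add: inv_fourier_mode circ_def mult_ac)
  qed
  then show "((\<lambda>j. complex_of_real (r powi j) * cis (2 * pi * of_int j * \<gamma>)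
            * inv_fourier (\<lambda>\<xi>. complex_of_real (exp (- v * \<xi>)) * g j \<xi>) u)
          has_sum S \<beta> \<phi> (Complex u v, complex_of_real r * cis (2 * pi * \<gamma>))) UNIV"
    using S_has_sum[OF assms conjunct1[OF g] conjunct2[OF g] vs, of "cis (2 * pi * \<gamma>)" u] unfolding e by simp
qed

end
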